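(* There is an algorithm which, given an $(s,t)$-layered graph $G_L=(V(G_L),E(G_L),w)$ and the vertices $s,t$, either outputs an $s\to t$ next-to-shortest path in $G_L$ (if one exists) or correctly reports that none exists, in time $O\big(|V_B(G_L)|^2\,|E_{FP}(G_L)|\,(|E(G_L)|+|V(G_L)|\log|V(G_L)|)\big)$.
   Context: Graphs are finite simple directed graphs with positive real edge weights; paths have no repeated vertices; $d_G$ is shortest-path distance. An $s\to t$ path $P$ is not-shortest if $w(P)>d_G(s,t)$; a next-to-shortest path is a not-shortest $s\to t$ path of minimum length among such. An edge $(u,v)$ is a back-edge if $d_G(s,u)+w(u,v)>d_G(s,v)$ and a forward-edge if $d_G(s,u)+w(u,v)=d_G(s,v)$. $V_B(G)$ is the set of vertices incident to a back-edge; $E_{FP}(G)$ is the set of ordered pairs $((u_1,v_1),(u_2,v_2))$ of forward-edges with $d_G(s,u_1)=d_G(s,u_2)$. $G$ is $(s,t)$-layered if (1) $d_G(s,u)+d_G(u,t)=d_G(s,t)$ (finite) for all $u$; (2) $d_G(s,u)\ne d_G(s,v)$ for every edge $(u,v)$; (3) for every edge $(u,v)$ with $d_G(s,u)<d_G(s,v)$ and every $x$, $d_G(s,x)\le d_G(s,u)$ or $d_G(s,x)\ge d_G(s,u)+w(u,v)$.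
   Formalization: When $V_B(G_L)$ is empty the stated product is $0$, which no algorithm's running time can meet; in exactly that case the time bound is taken to be $O(|V(G_L)|+|E(G_L)|)$ instead; otherwise the bound is as stated. *)

theory Defs
  imports "Graph_Theory.Shortest_Path"
begin

section \<open>Layered graphs and next-to-shortest paths\<close>

text \<open>
  Graphs are those of the \<^locale>\<open>digraph\<close> locale (finite, loopfree, no parallel arcs); paths are
  \<^emph>\<open>apath\<close>s, i.e. arc lists whose vertex sequence is repetition-free; \<^emph>\<open>\<mu> w u v\<close> is the distance
  (infinite if there is no walk from \<^emph>\<open>u\<close> to \<^emph>\<open>v\<close>).
\<close>

context wf_digraph
begin

definition not_shortest :: "'b weight_fun \<Rightarrow> 'a \<Rightarrow> 'a \<Rightarrow> 'b awalk \<Rightarrow> bool" where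
  "not_shortest w s t p \<longleftrightarrow> apath s p t \<and> ereal (awalk_cost w p) > \<mu> w s t"

definition next_to_shortest :: "'b weight_fun \<Rightarrow> 'a \<Rightarrow> 'a \<Rightarrow> 'b awalk \<Rightarrow> bool" where
  "next_to_shortest w s t p \<longleftrightarrow>
     not_shortest w s t p \<and> (\<forall>q. not_shortest w s t q \<longrightarrow> awalk_cost w p \<le> awalk_cost w q)"

definition back_edge :: "'b weight_fun \<Rightarrow> 'a \<Rightarrow> 'b \<Rightarrow> bool" where
  "back_edge w s e \<longleftrightarrow> e \<in> arcs G \<and> \<mu> w s (tail G e) + ereal (w e) > \<mu> w s (head G e)"

definition forward_edge :: "'b weight_fun \<Rightarrow> 'a \<Rightarrow> 'b \<Rightarrow> bool" where
  "forward_edge w s e \<longleftrightarrow> e \<in> arcs G \<and> \<mu> w s (tail G e) + ereal (w e) = \<mu> w s (head G e)"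

definition V_B :: "'b weight_fun \<Rightarrow> 'a \<Rightarrow> 'a set" where
  "V_B w s = {v \<in> verts G. \<exists>e. back_edge w s e \<and> (tail G e = v \<or> head G e = v)}"

definition E_FP :: "'b weight_fun \<Rightarrow> 'a \<Rightarrow> ('b \<times> 'b) set" where
  "E_FP w s = {(e1, e2). forward_edge w s e1 \<and> forward_edge w s e2 \<and>
     \<mu> w s (tail G e1) = \<mu> w s (tail G e2)}"

end

locale st_layered = digraph G
  for G :: "('a, 'b) pre_digraph" (structure) +
  fixes w :: "'b weight_fun" and s t :: 'a
  assumes weight_pos: "e \<in> arcs G \<Longrightarrow> w e > 0"
    and s_in_verts: "s \<in> verts G"
    and t_in_verts: "t \<in> verts G"
    and dist_finite: "\<mu> w s t < \<infinity>"
    and on_shortest_path: "u \<in> verts G \<Longrightarrow> \<mu> w s u + \<mu> w u t = \<mu> w s t"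
    and dist_ends_neq: "e \<in> arcs G \<Longrightarrow> \<mu> w s (tail G e) \<noteq> \<mu> w s (head G e)"
    and no_vertex_between:
      "\<lbrakk> e \<in> arcs G; \<mu> w s (tail G e) < \<mu> w s (head G e); x \<in> verts G \<rbrakk> \<Longrightarrow>
         \<mu> w s x \<le> \<mu> w s (tail G e) \<or> \<mu> w s x \<ge> \<mu> w s (tail G e) + ereal (w e)"


section \<open>Random access machine\<close>

text \<open>
  A unit-cost random access machine with two kinds of memory cells, one for natural numbers (also
  used as addresses) and one for real numbers. Both memories are split into arrays of unbounded
  length; a program mentions only finitely many of them, each by a fixed name, so this amounts to a
  single linear memory with interleaved arrays. The first argument of \<^emph>\<open>nmem\<close> and \<^emph>\<open>rmem\<close> is the
  array, the second one the index.

  There is no multiplication, and real numbers can only be added, subtracted and compared, in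
  particular neither rounded nor converted to natural numbers. Subtraction of natural numbers is
  truncated. A program is a finite syntax tree and hence independent of the input.
\<close>

record ram_state =
  nmem :: "nat \<Rightarrow> nat \<Rightarrow> nat"
  rmem :: "nat \<Rightarrow> nat \<Rightarrow> real"

datatype nexp = NConst nat | NCell nat nexp | NAdd nexp nexp | NSub nexp nexp

datatype rexp = RZero | RCell nat nexp | RAdd rexp rexp | RSub rexp rexp

datatype bexp = NLess nexp nexp | RLess rexp rexp | BNot bexp | BAnd bexp bexp

datatype com =
    Skip
  | NStore nat nexp nexp  \<comment> \<open>array, index, value\<close>
  | RStore nat nexp rexp  \<comment> \<open>array, index, value\<close>
  | Seq com com
  | IfThenElse bexp com com
  | While bexp com

primrec nval :: "nexp \<Rightarrow> ram_state \<Rightarrow> nat" where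
  "nval (NConst k) \<sigma> = k"
| "nval (NCell a i) \<sigma> = nmem \<sigma> a (nval i \<sigma>)"
| "nval (NAdd x y) \<sigma> = nval x \<sigma> + nval y \<sigma>"
| "nval (NSub x y) \<sigma> = nval x \<sigma> - nval y \<sigma>"

primrec rval :: "rexp \<Rightarrow> ram_state \<Rightarrow> real" where
  "rval RZero \<sigma> = 0"
| "rval (RCell a i) \<sigma> = rmem \<sigma> a (nval i \<sigma>)"
| "rval (RAdd x y) \<sigma> = rval x \<sigma> + rval y \<sigma>"
| "rval (RSub x y) \<sigma> = rval x \<sigma> - rval y \<sigma>"

primrec bval :: "bexp \<Rightarrow> ram_state \<Rightarrow> bool" where
  "bval (NLess x y) \<sigma> \<longleftrightarrow> nval x \<sigma> < nval y \<sigma>"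
| "bval (RLess x y) \<sigma> \<longleftrightarrow> rval x \<sigma> < rval y \<sigma>"
| "bval (BNot b) \<sigma> \<longleftrightarrow> \<not> bval b \<sigma>"
| "bval (BAnd b c) \<sigma> \<longleftrightarrow> bval b \<sigma> \<and> bval c \<sigma>"

text \<open>Evaluating an expression takes one step per node of its syntax tree.\<close>

primrec ncost :: "nexp \<Rightarrow> nat" where
  "ncost (NConst k) = 1"
| "ncost (NCell a i) = 1 + ncost i"
| "ncost (NAdd x y) = 1 + ncost x + ncost y"
| "ncost (NSub x y) = 1 + ncost x + ncost y"

primrec rcost :: "rexp \<Rightarrow> nat" where
  "rcost RZero = 1"
| "rcost (RCell a i) = 1 + ncost i"
| "rcost (RAdd x y) = 1 + rcost x + rcost y"
| "rcost (RSub x y) = 1 + rcost x + rcost y"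

primrec bcost :: "bexp \<Rightarrow> nat" where
  "bcost (NLess x y) = 1 + ncost x + ncost y"
| "bcost (RLess x y) = 1 + rcost x + rcost y"
| "bcost (BNot b) = 1 + bcost b"
| "bcost (BAnd b c) = 1 + bcost b + bcost c"

text \<open>\<^emph>\<open>exec c \<sigma> k \<sigma>'\<close>: started in \<^emph>\<open>\<sigma>\<close>, the program \<^emph>\<open>c\<close> halts in \<^emph>\<open>\<sigma>'\<close> after \<^emph>\<open>k\<close> steps.\<close>

inductive exec :: "com \<Rightarrow> ram_state \<Rightarrow> nat \<Rightarrow> ram_state \<Rightarrow> bool" where
  Skip: "exec Skip \<sigma> 1 \<sigma>"
| NStore: "exec (NStore a i x) \<sigma> (1 + ncost i + ncost x)
    (\<sigma>\<lparr>nmem := (nmem \<sigma>)(a := (nmem \<sigma> a)(nval i \<sigma> := nval x \<sigma>))\<rparr>)"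
| RStore: "exec (RStore a i x) \<sigma> (1 + ncost i + rcost x)
    (\<sigma>\<lparr>rmem := (rmem \<sigma>)(a := (rmem \<sigma> a)(nval i \<sigma> := rval x \<sigma>))\<rparr>)"
| Seq: "\<lbrakk> exec c1 \<sigma> k1 \<sigma>1; exec c2 \<sigma>1 k2 \<sigma>2 \<rbrakk> \<Longrightarrow> exec (Seq c1 c2) \<sigma> (k1 + k2) \<sigma>2"
| IfTrue: "\<lbrakk> bval b \<sigma>; exec c1 \<sigma> k \<sigma>' \<rbrakk> \<Longrightarrow>
    exec (IfThenElse b c1 c2) \<sigma> (1 + bcost b + k) \<sigma>'"
| IfFalse: "\<lbrakk> \<not> bval b \<sigma>; exec c2 \<sigma> k \<sigma>' \<rbrakk> \<Longrightarrow>
    exec (IfThenElse b c1 c2) \<sigma> (1 + bcost b + k) \<sigma>'"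
| WhileFalse: "\<not> bval b \<sigma> \<Longrightarrow> exec (While b c) \<sigma> (1 + bcost b) \<sigma>"
| WhileTrue: "\<lbrakk> bval b \<sigma>; exec c \<sigma> k1 \<sigma>1; exec (While b c) \<sigma>1 k2 \<sigma>2 \<rbrakk> \<Longrightarrow>
    exec (While b c) \<sigma> (1 + bcost b + k1 + k2) \<sigma>2"

inductive_cases exec_elims:
  "exec Skip \<sigma> k \<sigma>'"
  "exec (NStore a i x) \<sigma> k \<sigma>'"
  "exec (RStore a i y) \<sigma> k \<sigma>'"
  "exec (Seq c1 c2) \<sigma> k \<sigma>'"
  "exec (IfThenElse b c1 c2) \<sigma> k \<sigma>'"
inductive_cases exec_WhileE: "exec (While b c) \<sigma> k \<sigma>'"

lemma exec_deterministic:
  "exec c \<sigma> k \<sigma>' \<Longrightarrow> exec c \<sigma> l \<sigma>'' \<Longrightarrow> k = l \<and> \<sigma>' = \<sigma>''"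
proof (induction arbitrary: l \<sigma>'' rule: exec.induct)
  case (WhileFalse b \<sigma> c)
  from WhileFalse.prems WhileFalse.hyps show ?case by (auto elim: exec_WhileE)
next
  case (WhileTrue b \<sigma> c k1 \<sigma>1 k2 \<sigma>2)
  from WhileTrue.prems WhileTrue.hyps(1) obtain l1 \<tau> l2
    where "exec c \<sigma> l1 \<tau>" "exec (While b c) \<tau> l2 \<sigma>''" "l = 1 + bcost b + l1 + l2"
    by (auto elim: exec_WhileE)
  with WhileTrue.IH show ?case by blast
next
  case (Seq c1 \<sigma> k1 \<sigma>1 c2 k2 \<sigma>2)
  from Seq.prems obtain l1 \<tau> l2
    where "exec c1 \<sigma> l1 \<tau>" "exec c2 \<tau> l2 \<sigma>''" "l = l1 + l2"
    by (auto elim: exec_elims(4))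
  with Seq.IH show ?case by blast
next
  case (IfTrue b \<sigma> c1 k \<sigma>' c2)
  from IfTrue.prems IfTrue.hyps(1) obtain l1
    where "exec c1 \<sigma> l1 \<sigma>''" "l = 1 + bcost b + l1"
    by (auto elim: exec_elims(5))
  with IfTrue.IH show ?case by blast
next
  case (IfFalse b \<sigma> c2 k \<sigma>' c1)
  from IfFalse.prems IfFalse.hyps(1) obtain l1
    where "exec c2 \<sigma> l1 \<sigma>''" "l = 1 + bcost b + l1"
    by (auto elim: exec_elims(5))
  with IfFalse.IH show ?case by blast
qed (auto elim: exec_elims(1-3))


section \<open>Input and output\<close>

text \<open>
  An input graph has vertices \<^emph>\<open>0, \<dots>, n - 1\<close> and arcs \<^emph>\<open>0, \<dots>, m - 1\<close>. It is passed as the list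
  of its arcs, in arbitrary order: array 0 contains \<^emph>\<open>n, m, s, t\<close>, arrays 1 and 2 contain the tails
  and heads of the arcs, real array 0 contains their weights. All other cells are 0.
\<close>

definition numbered :: "(nat, nat) pre_digraph \<Rightarrow> bool" where
  "numbered G \<longleftrightarrow> verts G = {..<card (verts G)} \<and> arcs G = {..<card (arcs G)}"

definition input_state ::
  "(nat, nat) pre_digraph \<Rightarrow> nat weight_fun \<Rightarrow> nat \<Rightarrow> nat \<Rightarrow> ram_state" where
  "input_state G w s t = \<lparr>
     nmem = (\<lambda>_ _. 0)(
       0 := (\<lambda>_. 0)(0 := card (verts G), 1 := card (arcs G), 2 := s, 3 := t),
       1 := (\<lambda>e. if e < card (arcs G) then tail G e else 0),
       2 := (\<lambda>e. if e < card (arcs G) then head G e else 0)),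
     rmem = (\<lambda>_ _. 0)(
       0 := (\<lambda>e. if e < card (arcs G) then w e else 0)) \<rparr>"

text \<open>
  Cell 0 of array 3 tells whether a path is output (nonzero) or none is reported to exist (zero).
  In the former case cell 1 of array 3 is the number of arcs of the path, and array 4 lists these
  arcs from the first to the last.
\<close>

definition ram_output :: "ram_state \<Rightarrow> nat awalk option" where
  "ram_output \<sigma> = (if nmem \<sigma> 3 0 = 0 then None else Some (map (nmem \<sigma> 4) [0..<nmem \<sigma> 3 1]))"

definition correct_output ::
  "(nat, nat) pre_digraph \<Rightarrow> nat weight_fun \<Rightarrow> nat \<Rightarrow> nat \<Rightarrow> nat awalk option \<Rightarrow> bool" where
  "correct_output G w s t r \<longleftrightarrow> (case r of
      None \<Rightarrow> \<not> (\<exists>p. wf_digraph.next_to_shortest G w s t p)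
    | Some p \<Rightarrow> wf_digraph.next_to_shortest G w s t p)"

text \<open>
  The function inside the O. If there is no back-edge, the product is 0, which cannot bound the
  running time of any program; in this degenerate case it is replaced by the size of the input.
\<close>

definition time_bound ::
  "(nat, nat) pre_digraph \<Rightarrow> nat weight_fun \<Rightarrow> nat \<Rightarrow> real" where
  "time_bound G w s =
     (let n = real (card (verts G)); m = real (card (arcs G)) in
      if wf_digraph.V_B G w s = {} then n + m
      else real (card (wf_digraph.V_B G w s)) ^ 2 * real (card (wf_digraph.E_FP G w s))
           * (m + n * log 2 n))"

end

theory Submission
  imports Defs
begin

text \<open>
  Let \<open>d v\<close> be the distance from \<open>s\<close>. The excess \<open>w e + d (tail e) - d (head e)\<close> of an arc is 0 on forward
  arcs and positive on back arcs, and a next-to-shortest path is a simple path from \<open>s\<close> to \<open>t\<close> of least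
  positive excess. Split an optimal path into a forward path \<open>A\<close> from \<open>s\<close> to the tail \<open>x\<close> of the first back
  arc, a middle part \<open>M\<close> from \<open>x\<close> to the head \<open>y\<close> of the last back arc, and a forward path \<open>B\<close> from \<open>y\<close> to \<open>t\<close>.
  Let \<open>p\<close> be the lowest vertex of \<open>A\<close> reachable by forward arcs from the interior of \<open>M\<close> (or \<open>x\<close>), and let \<open>e1\<close>
  and \<open>e2\<close> be the arcs of \<open>A\<close> and \<open>B\<close> entering the level of \<open>p\<close>. An exchange argument shows that \<open>M\<close> avoids
  the ancestors of the tail of \<open>e1\<close>, the vertex \<open>p\<close>, and \<open>Bh\<close> for \<^emph>\<open>every\<close> choice of disjoint forward paths \<open>Ah\<close> from
  \<open>p\<close> to \<open>x\<close> and \<open>Bh\<close> from the head of \<open>e2\<close> to \<open>t\<close>.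

  So for all \<open>x\<close>, \<open>e1\<close>, \<open>e2\<close> it suffices to fix one such pair, to remove these vertices, and to compute
  shortest paths from \<open>x\<close> to the back arcs whose head \<open>y\<close> can be completed by disjoint forward paths from \<open>s\<close>
  to the tail of \<open>e1\<close> and from \<open>y\<close> to the tail of \<open>e2\<close>. Conversely, a candidate that is not a simple path
  can be shortcut to a cheaper path, so the cheapest candidate is a next-to-shortest path. When the arcs
  are relaxed in the order of the levels of their tails, one round more than there are heads of back arcs
  suffices for the shortest paths.
\<close>

section \<open>Paths of least positive excess\<close>

text \<open>A forward arc joins consecutive levels, so a forward path has exactly one vertex on each
  level that it spans. Hence paths can be cut and rejoined by comparing levels. The obstacle is that
  the algorithm does not know the upper forward paths of an optimal solution, and an arbitrary
  disjoint pair might run through its middle part. \<open>upper_free\<close> excludes this for the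
  path to \<open>t\<close>; meeting the path to \<open>x\<close> is harmless, since such vertices
  are not removed and a candidate that meets them can only be shortcut. Running time: with
  \<open>V\<close> vertices at back arcs there are at most \<open>V\<close> choices of
  \<open>x\<close>, at most \<open>npairs\<close> pairs of arcs for each of them, and at most
  \<open>V + 1\<close> rounds over \<open>m\<close> arcs, hence the order of
  \<open>V * V * npairs * m\<close>. Rounds in level order replace a priority queue, so the
  logarithmic term of the bound is never spent. The preparation is quadratic in \<open>m\<close> and
  the tables cost about \<open>V * m * m\<close>; both fit because \<open>m\<close> is at most
  \<open>2 * V * npairs\<close>. That inequality presupposes a back arc. Without one the bound is
  linear in the input, which forces a separate linear test at the start.\<close>

locale layered_arcs =
  fixes n m :: nat and ta he :: "nat \<Rightarrow> nat" and w :: "nat \<Rightarrow> real"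
    and s t :: nat and d :: "nat \<Rightarrow> real"
  assumes ta_less: "e < m \<Longrightarrow> ta e < n" and he_less: "e < m \<Longrightarrow> he e < n"
    and w_pos: "e < m \<Longrightarrow> 0 < w e"
    and s_less: "s < n" and t_less: "t < n"
    and d_neq: "e < m \<Longrightarrow> d (ta e) \<noteq> d (he e)"
    and tight: "e < m \<Longrightarrow> d (ta e) < d (he e) \<Longrightarrow> d (he e) = d (ta e) + w e"
    and between: "e < m \<Longrightarrow> d (ta e) < d (he e) \<Longrightarrow> x < n \<Longrightarrow> d x \<le> d (ta e) \<or> d (he e) \<le> d x"
    and from_s: "v < n \<Longrightarrow> (s, v) \<in> {(ta e, he e) | e. e < m \<and> d (ta e) < d (he e)}\<^sup>*"
    and to_t: "v < n \<Longrightarrow> (v, t) \<in> {(ta e, he e) | e. e < m \<and> d (ta e) < d (he e)}\<^sup>*"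
begin

section \<open>Forward arcs, excess and levels\<close>

definition fwd :: "nat \<Rightarrow> bool" where
  "fwd e \<longleftrightarrow> e < m \<and> d (ta e) < d (he e)"

definition exc :: "nat \<Rightarrow> real" where
  "exc e = w e + d (ta e) - d (he e)"

lemma exc_fwd: "fwd e \<Longrightarrow> exc e = 0"
  using tight[of e] by (auto simp: fwd_def exc_def)

lemma exc_back: "e < m \<Longrightarrow> \<not> fwd e \<Longrightarrow> 0 < exc e"
  using w_pos[of e] d_neq[of e] by (auto simp: fwd_def exc_def)

lemma exc_nonneg: "e < m \<Longrightarrow> 0 \<le> exc e"
  using exc_fwd exc_back by fastforce

lemma back_less: "e < m \<Longrightarrow> \<not> fwd e \<Longrightarrow> d (he e) < d (ta e)"
  using d_neq[of e] by (auto simp: fwd_def)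

lemma fwd_between: "fwd e \<Longrightarrow> x < n \<Longrightarrow> d x \<le> d (ta e) \<or> d (he e) \<le> d x"
  using between by (auto simp: fwd_def)

text \<open>Neither head may lie strictly between the ends of the other arc, so the next level above
  a given one is unique.\<close>

lemma fwd_level: "fwd e \<Longrightarrow> fwd f \<Longrightarrow> d (ta e) = d (ta f) \<Longrightarrow> d (he e) = d (he f)"
  using fwd_between[of e "he f"] fwd_between[of f "he e"] he_less[of e] he_less[of f]
  by (auto simp: fwd_def)

text \<open>
  Paths are represented by their vertex sets, which is all that matters for splicing: \<open>FP a S b\<close> is a
  forward path and \<open>WP a S b k\<close> a simple path with total excess \<open>k\<close>. The weight of a path from \<open>a\<close> to \<open>b\<close>
  is its excess plus \<open>d b - d a\<close>.
\<close>

inductive FP :: "nat \<Rightarrow> nat set \<Rightarrow> nat \<Rightarrow> bool" where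
  FP_refl: "a < n \<Longrightarrow> FP a {a} a"
| FP_step: "fwd e \<Longrightarrow> FP (he e) S b \<Longrightarrow> FP (ta e) (insert (ta e) S) b"

inductive WP :: "nat \<Rightarrow> nat set \<Rightarrow> nat \<Rightarrow> real \<Rightarrow> bool" where
  WP_refl: "a < n \<Longrightarrow> WP a {a} a 0"
| WP_step: "e < m \<Longrightarrow> WP (he e) S b k \<Longrightarrow> ta e \<notin> S \<Longrightarrow> WP (ta e) (insert (ta e) S) b (exc e + k)"

section \<open>Forward paths and their levels\<close>

lemma FP_V: "FP a S b \<Longrightarrow> a < n \<and> b < n \<and> S \<subseteq> {..<n} \<and> a \<in> S \<and> b \<in> S \<and> finite S"
  by (induction rule: FP.induct) (auto simp: fwd_def ta_less)

lemma FP_bounds: "FP a S b \<Longrightarrow> x \<in> S \<Longrightarrow> d a \<le> d x \<and> d x \<le> d b"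
proof (induction rule: FP.induct)
  case (FP_step e S b)
  have "d (he e) \<le> d b" using FP_step.hyps(2) by (induction rule: FP.induct) (auto simp: fwd_def)
  then show ?case using FP_step.prems FP_step.IH FP_step.hyps(1)
    by (cases "x = ta e") (fastforce simp: fwd_def)+
qed auto

text \<open>Levels strictly increase along a forward path. So \<open>d\<close> identifies and orders
  its vertices, and the vertex set alone determines the path; cutting becomes a filter by level in
  \<open>FP_upper\<close>, \<open>FP_lower\<close> and \<open>FP_segment\<close>.\<close>

lemma FP_inj: "FP a S b \<Longrightarrow> x \<in> S \<Longrightarrow> y \<in> S \<Longrightarrow> d x = d y \<Longrightarrow> x = y"
proof (induction rule: FP.induct)
  case (FP_step e S b)
  then show ?case using FP_bounds[OF FP_step.hyps(2)] by (force simp: fwd_def)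
qed auto

lemma FP_trans: "FP a S b \<Longrightarrow> FP b T c \<Longrightarrow> FP a (S \<union> T) c"
proof (induction rule: FP.induct)
  case (FP_refl a)
  then show ?case using FP_V[of a T c] by (simp add: insert_absorb)
qed (auto intro: FP_step)

lemma FP_upper: "FP a S b \<Longrightarrow> z \<in> S \<Longrightarrow> FP z {v \<in> S. d z \<le> d v} b"
proof (induction rule: FP.induct)
  case (FP_refl a)
  then show ?case by (auto intro: FP.FP_refl simp: Collect_conv_if)
next
  case (FP_step e S b)
  show ?case
  proof (cases "z = ta e")
    case True
    then have "{v \<in> insert (ta e) S. d z \<le> d v} = insert (ta e) S"
      using FP_bounds[OF FP_step.hyps(2)] FP_step.hyps(1) by (force simp: fwd_def)
    then show ?thesis using FP_step True FP.FP_step by simp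
  next
    case False
    then have "{v \<in> insert (ta e) S. d z \<le> d v} = {v \<in> S. d z \<le> d v}"
      using FP_bounds[OF FP_step.hyps(2)] FP_step.hyps(1) FP_step.prems by (force simp: fwd_def)
    then show ?thesis using FP_step False by simp
  qed
qed

lemma FP_lower: "FP a S b \<Longrightarrow> z \<in> S \<Longrightarrow> FP a {v \<in> S. d v \<le> d z} z"
proof (induction rule: FP.induct)
  case (FP_refl a)
  then show ?case by (auto intro: FP.FP_refl simp: Collect_conv_if)
next
  case (FP_step e S b)
  have lt: "\<And>v. v \<in> S \<Longrightarrow> d (ta e) < d v"
    using FP_bounds[OF FP_step.hyps(2)] FP_step.hyps(1) by (force simp: fwd_def)
  show ?case
  proof (cases "z = ta e")
    case True
    then have "{v \<in> insert (ta e) S. d v \<le> d z} = {ta e}"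
      using lt by force
    then show ?thesis using FP_step True FP.FP_refl ta_less by (simp add: fwd_def)
  next
    case False
    then have "{v \<in> insert (ta e) S. d v \<le> d z} = insert (ta e) {v \<in> S. d v \<le> d z}"
      using lt FP_step.prems by force
    then show ?thesis using FP_step False FP.FP_step by simp
  qed
qed

text \<open>A forward arc cannot jump over a level that contains a vertex.\<close>

lemma FP_level: "FP a S b \<Longrightarrow> v < n \<Longrightarrow> d a \<le> d v \<Longrightarrow> d v \<le> d b \<Longrightarrow> \<exists>u\<in>S. d u = d v"
proof (induction rule: FP.induct)
  case (FP_step e S b)
  show ?case
  proof (cases "d v = d (ta e)")
    case False
    then have "d (he e) \<le> d v" using fwd_between[OF FP_step.hyps(1) FP_step.prems(1)] FP_step.prems by auto
    then show ?thesis using FP_step by auto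
  qed auto
qed auto

lemma FP_segment: 
  assumes "FP a S b" "x \<in> S" "y \<in> S" "d x \<le> d y"
  shows "FP x {v \<in> S. d x \<le> d v \<and> d v \<le> d y} y"
proof -
  have "FP x {v \<in> {v \<in> S. d x \<le> d v}. d v \<le> d y} y"
    by (rule FP_lower[OF FP_upper[OF assms(1,2)]]) (use assms in auto)
  then show ?thesis by simp
qed

lemma FP_same: assumes "FP a S b" "d a = d b" shows "a = b \<and> S = {a}"
proof -
  have "x = a" if "x \<in> S" for x
    using FP_bounds[OF assms(1) that] FP_inj[OF assms(1) that, of a] FP_V[OF assms(1)] assms(2) by auto
  then show ?thesis using FP_V[OF assms(1)] by auto
qed

lemma FP_join: "FP a S (ta e) \<Longrightarrow> fwd e \<Longrightarrow> FP (he e) T b \<Longrightarrow> FP a (S \<union> T) b"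
  using FP_trans[of a S "ta e" "insert (ta e) T" b] FP_step[of e T b] FP_V[of a S "ta e"]
  by (simp add: insert_absorb)

lemma FP_pred:
  "FP a S b \<Longrightarrow> z \<in> S \<Longrightarrow> z \<noteq> a \<Longrightarrow> \<exists>e. fwd e \<and> ta e \<in> S \<and> he e = z"
proof (induction rule: FP.induct)
  case (FP_step e S b)
  then show ?case using FP_V[OF FP_step.hyps(2)] by (cases "z = he e") auto
qed auto

lemma rtrancl_FP:
  "(a, b) \<in> {(ta e, he e) | e. e < m \<and> d (ta e) < d (he e)}\<^sup>* \<Longrightarrow> b < n \<Longrightarrow> \<exists>S. FP a S b"
proof (induction rule: converse_rtrancl_induct)
  case base
  then show ?case using FP_refl by blast
next
  case (step y z)
  then obtain e S where "y = ta e" "z = he e" "fwd e" "FP z S b" by (auto simp: fwd_def)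
  then show ?case using FP_step by blast
qed

lemma ex_FP_s: "v < n \<Longrightarrow> \<exists>S. FP s S v"
  using rtrancl_FP from_s by blast

lemma ex_FP_t: "v < n \<Longrightarrow> \<exists>S. FP v S t"
  using rtrancl_FP to_t t_less by blast

lemma d_s_le: "v < n \<Longrightarrow> d s \<le> d v"
  using ex_FP_s[of v] FP_bounds[of s _ v v] FP_V[of s _ v] by blast

lemma d_t_ge: "v < n \<Longrightarrow> d v \<le> d t"
  using ex_FP_t[of v] FP_bounds[of v _ t v] FP_V[of v _ t] by blast

section \<open>Simple paths with excess\<close>

lemma WP_V: "WP a S b k \<Longrightarrow> a < n \<and> b < n \<and> S \<subseteq> {..<n} \<and> a \<in> S \<and> b \<in> S \<and> finite S \<and> 0 \<le> k"
  by (induction rule: WP.induct) (auto simp: ta_less exc_nonneg)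

lemma FP_WP: "FP a S b \<Longrightarrow> WP a S b 0"
proof (induction rule: FP.induct)
  case (FP_step e S b)
  moreover have "ta e \<notin> S" using FP_bounds[OF FP_step.hyps(2)] FP_step.hyps(1) by (force simp: fwd_def)
  ultimately show ?case using WP_step[of e S b 0] exc_fwd by (simp add: fwd_def)
qed (auto intro: WP_refl)

text \<open>Excesses are nonnegative and vanish only on forward arcs, so a sum of 0 leaves no room
  for a back arc.\<close>

lemma WP_zero: "WP a S b k \<Longrightarrow> k = 0 \<Longrightarrow> FP a S b"
proof (induction rule: WP.induct)
  case (WP_step e S b k)
  have "exc e = 0" "k = 0"
    using WP_step.prems exc_nonneg[OF WP_step.hyps(1)] WP_V[OF WP_step.hyps(2)] by linarith+
  moreover have "fwd e" using \<open>exc e = 0\<close> exc_back[OF WP_step.hyps(1)] by force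
  ultimately show ?case using FP_step WP_step.IH by blast
qed (auto intro: FP_refl)

text \<open>With excess 0 the path would be forward, and a forward path between different vertices
  ascends. This is the source of every strict inequality between excesses below.\<close>

lemma WP_drop: "WP a S b k \<Longrightarrow> d b \<le> d a \<Longrightarrow> a \<noteq> b \<Longrightarrow> 0 < k"
proof -
  assume a: "WP a S b k" "d b \<le> d a" "a \<noteq> b"
  have "k \<noteq> 0"
  proof
    assume "k = 0"
    then have "FP a S b" using a(1) WP_zero by blast
    moreover from this have "d a \<le> d b" using FP_bounds FP_V by blast
    ultimately show False using FP_same a by force
  qed
  then show ?thesis using WP_V[OF a(1)] by linarith
qed

lemma WP_loop: "WP a S a k \<Longrightarrow> S = {a} \<and> k = 0"
  by (erule WP.cases) (use WP_V in auto)

lemma WP_trans: "WP a S b k \<Longrightarrow> WP b T c l \<Longrightarrow> S \<inter> T \<subseteq> {b} \<Longrightarrow> WP a (S \<union> T) c (k + l)"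
proof (induction rule: WP.induct)
  case (WP_refl a)
  then show ?case using WP_V[of a T c l] by (simp add: insert_absorb)
next
  case (WP_step e S b k)
  then have "WP (ta e) (insert (ta e) (S \<union> T)) c (exc e + (k + l))"
    using WP_V[OF WP_step.hyps(2)] by (intro WP.WP_step) auto
  then show ?case by (simp add: add.assoc)
qed

lemma WP_first:
  "WP a S b k \<Longrightarrow> S \<inter> X \<noteq> {} \<Longrightarrow>
   \<exists>z S1 S2 k1 k2. WP a S1 z k1 \<and> WP z S2 b k2 \<and> S = S1 \<union> S2 \<and> S1 \<inter> S2 = {z} \<and>
     S1 \<inter> X = {z} \<and> k = k1 + k2"
proof (induction rule: WP.induct)
  case (WP_refl a)
  then show ?case by (intro exI[of _ a] exI[of _ "{a}"] exI[of _ 0]) (auto intro: WP.WP_refl)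
next
  case (WP_step e S b k)
  show ?case
  proof (cases "ta e \<in> X")
    case True
    then show ?thesis using WP_step.hyps
      by (intro exI[of _ "ta e"] exI[of _ "{ta e}"] exI[of _ "insert (ta e) S"] exI[of _ 0] exI[of _ "exc e + k"])
        (auto intro: WP.WP_refl WP.WP_step ta_less)
  next
    case False
    with WP_step.prems have "S \<inter> X \<noteq> {}" by auto
    then obtain z S1 S2 k1 k2 where z: "WP (he e) S1 z k1" "WP z S2 b k2" "S = S1 \<union> S2"
      "S1 \<inter> S2 = {z}" "S1 \<inter> X = {z}" "k = k1 + k2" using WP_step.IH by blast
    have "WP (ta e) (insert (ta e) S1) z (exc e + k1)" "ta e \<notin> S2"
      using z WP_step.hyps by (auto intro: WP.WP_step)
    moreover have "insert (ta e) S = insert (ta e) S1 \<union> S2" "insert (ta e) S1 \<inter> S2 = {z}"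
      "insert (ta e) S1 \<inter> X = {z}" "exc e + k = exc e + k1 + k2"
      using z(3-6) \<open>ta e \<notin> S2\<close> False by auto
    ultimately show ?thesis using z(2) by blast
  qed
qed

lemma WP_last:
  "WP a S b k \<Longrightarrow> S \<inter> X \<noteq> {} \<Longrightarrow>
   \<exists>z S1 S2 k1 k2. WP a S1 z k1 \<and> WP z S2 b k2 \<and> S = S1 \<union> S2 \<and> S1 \<inter> S2 = {z} \<and>
     S2 \<inter> X = {z} \<and> k = k1 + k2"
proof (induction rule: WP.induct)
  case (WP_refl a)
  then show ?case by (intro exI[of _ a] exI[of _ "{a}"] exI[of _ 0]) (auto intro: WP.WP_refl)
next
  case (WP_step e S b k)
  show ?case
  proof (cases "S \<inter> X = {}")
    case True
    then show ?thesis using WP_step.hyps WP_step.prems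
      by (intro exI[of _ "ta e"] exI[of _ "{ta e}"] exI[of _ "insert (ta e) S"] exI[of _ 0] exI[of _ "exc e + k"])
        (auto intro: WP.WP_refl WP.WP_step ta_less)
  next
    case False
    then obtain z S1 S2 k1 k2 where z: "WP (he e) S1 z k1" "WP z S2 b k2" "S = S1 \<union> S2"
      "S1 \<inter> S2 = {z}" "S2 \<inter> X = {z}" "k = k1 + k2" using WP_step.IH by blast
    have "WP (ta e) (insert (ta e) S1) z (exc e + k1)" "ta e \<notin> S2"
      using z WP_step.hyps by (auto intro: WP.WP_step)
    moreover have "insert (ta e) S = insert (ta e) S1 \<union> S2" "insert (ta e) S1 \<inter> S2 = {z}"
      "S2 \<inter> X = {z}" "exc e + k = exc e + k1 + k2"
      using z(3-6) \<open>ta e \<notin> S2\<close> by auto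
    ultimately show ?thesis using z(2) by blast
  qed
qed

lemma WP_split: "WP a S b k \<Longrightarrow> z \<in> S \<Longrightarrow>
   \<exists>S1 S2 k1 k2. WP a S1 z k1 \<and> WP z S2 b k2 \<and> S = S1 \<union> S2 \<and> S1 \<inter> S2 = {z} \<and> k = k1 + k2"
proof -
  assume a: "WP a S b k" "z \<in> S"
  then obtain y S1 S2 k1 k2 where "WP a S1 y k1" "WP y S2 b k2" "S = S1 \<union> S2" "S1 \<inter> S2 = {y}"
    "S1 \<inter> {z} = {y}" "k = k1 + k2" using WP_first[OF a(1), of "{z}"] by blast
  moreover from this have "y = z" by blast
  ultimately show ?thesis by blast
qed

definition nsp :: "nat set \<Rightarrow> real \<Rightarrow> bool" where
  "nsp S k \<longleftrightarrow> WP s S t k \<and> 0 < k"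

text \<open>
  If the middle part \<open>M\<close> meets the forward parts, shortcutting at the first vertex of the second part, or
  at the last vertex of the first part, leaves a back arc in place and strictly lowers the excess. Hence
  a cheapest candidate is automatically simple.
\<close>

theorem sound:
  assumes Al: "FP s Al p'" and Ah: "FP p Ah x" and Bl: "FP y Bl q'" and Bh: "FP q Bh t"
    and f1: "fwd f1" "ta f1 = p'" "he f1 = p" and f2: "fwd f2" "ta f2 = q'" "he f2 = q"
    and lev: "d p' = d q'" and dl: "Al \<inter> Bl = {}" and dh: "Ah \<inter> Bh = {}"
    and M: "WP x M y k" and av: "(M - {x, y}) \<inter> (Al \<union> {p} \<union> Bh) = {}"
  shows "(\<exists>S k'. nsp S k' \<and> k' < k) \<or> 
    M \<inter> (Al \<union> Ah) = {x} \<and> M \<inter> (Bl \<union> Bh) = {y} \<and> (Al \<union> Ah) \<inter> (Bl \<union> Bh) = {}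
     \<and> nsp (Al \<union> Ah \<union> M \<union> (Bl \<union> Bh)) k"
proof -
  have pq: "d p = d q"
    using fwd_level f1 f2 lev by blast
  have lv: "d p' < d p" "d q' < d q" using f1 f2 by (auto simp: fwd_def)
  have A: "FP s (Al \<union> Ah) x"
    using FP_join Al Ah f1 by blast
  have B: "FP y (Bl \<union> Bh) t"
    using FP_join Bl Bh f2 by blast
  have ll: "\<And>v. v \<in> Al \<Longrightarrow> d v \<le> d p'" "\<And>v. v \<in> Bl \<Longrightarrow> d v \<le> d p' \<and> d y \<le> d v"
    "\<And>v. v \<in> Ah \<Longrightarrow> d p \<le> d v" "\<And>v. v \<in> Bh \<Longrightarrow> d p \<le> d v"
    using FP_bounds[OF Al] FP_bounds[OF Bl] FP_bounds[OF Ah] FP_bounds[OF Bh] lev pq by auto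
  \<comment> \<open>\<open>Al\<close> and \<open>Bl\<close> end on the level below that of
    \<open>p\<close>, while \<open>Ah\<close> and \<open>Bh\<close> start on the level of
    \<open>p\<close>, so a lower and an upper part never meet.\<close>
  have AB: "(Al \<union> Ah) \<inter> (Bl \<union> Bh) = {}"
    using dl dh ll lv by force
  have VM: "x \<in> M" "y \<in> M" "x \<in> Ah" "y \<in> Bl" "p \<in> Ah" "t \<in> Bh"
    using FP_V[OF Ah] FP_V[OF Bl] FP_V[OF Bh] WP_V[OF M] by auto
  have xy: "d y < d x" "x \<noteq> y" using ll VM lv by force+
  show ?thesis
  proof (cases "M \<inter> (Bl \<union> Bh) = {y}")
    case False
    have ne: "M \<inter> (Bl \<union> Bh) \<noteq> {}" using VM by auto
    obtain z M1 M2 k1 k2 where z: "WP x M1 z k1" "WP z M2 y k2" "M = M1 \<union> M2"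
      "M1 \<inter> M2 = {z}" "M1 \<inter> (Bl \<union> Bh) = {z}" "k = k1 + k2"
      using WP_first[OF M ne] by blast
    \<comment> \<open>If the first vertex of \<open>M\<close> on the second part were its end
      \<open>y\<close>, the intersection would be \<open>{y}\<close>, contrary to the case.\<close>
    have zy: "z \<noteq> y"
    proof
      assume "z = y"
      then have "M2 = {y}" using z(2) WP_loop by blast
      then have "M = M1" using z(3,4) \<open>z = y\<close> by blast
      then show False using z(5) False \<open>z = y\<close> by simp
    qed
    have zx: "z \<noteq> x" using z(5) AB VM by blast
    have zM: "z \<in> M" "z \<in> Bl \<union> Bh" using z(3,5) by blast+
    have zB: "z \<in> Bl" using zM av zx zy by blast
    have "d y \<le> d z" using ll zB by blast
    then have k2: "0 < k2" using WP_drop[OF z(2)] zy by auto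
    \<comment> \<open>Let \<open>v\<close> be the last vertex before \<open>z\<close> on the first
      part. The piece from \<open>v\<close> to \<open>z\<close> then touches the forward parts only
      at its ends. It descends from \<open>Ah\<close> to \<open>Bl\<close>, so it keeps a positive
      excess, while the piece from \<open>z\<close> down to \<open>y\<close> is saved.\<close>
    have "M1 \<inter> (Al \<union> Ah) \<noteq> {}" using VM WP_V[OF z(1)] by auto
    then obtain v N1 N2 l1 l2 where v: "WP x N1 v l1" "WP v N2 z l2" "M1 = N1 \<union> N2"
      "N1 \<inter> N2 = {v}" "N2 \<inter> (Al \<union> Ah) = {v}" "k1 = l1 + l2"
      using WP_last[OF z(1), of "Al \<union> Ah"] by blast
    have vM: "v \<in> M" "v \<in> Al \<union> Ah" using v(3,5) z(3) by blast+
    have "v \<noteq> y" using vM AB VM by auto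
    then have vA: "v \<in> Ah" using vM av VM by blast
    have dz: "d z < d v" using ll(2)[OF zB] ll(3)[OF vA] lv by linarith
    then have l2: "0 < l2" using WP_drop[OF v(2)] by auto
    have P1: "WP s {u \<in> Al \<union> Ah. d u \<le> d v} v 0" using FP_WP[OF FP_lower[OF A]] vM by blast
    have P3: "WP z {u \<in> Bl \<union> Bh. d z \<le> d u} t 0" using FP_WP[OF FP_upper[OF B]] zM by blast
    have N2M: "N2 \<subseteq> M1" using v(3) by blast
    have P12: "WP s ({u \<in> Al \<union> Ah. d u \<le> d v} \<union> N2) z (0 + l2)"
      by (rule WP_trans[OF P1 v(2)]) (use v(5) in blast)
    have "WP s ({u \<in> Al \<union> Ah. d u \<le> d v} \<union> N2 \<union> {u \<in> Bl \<union> Bh. d z \<le> d u}) t (0 + l2 + 0)"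
      by (rule WP_trans[OF P12 P3]) (use z(5) N2M AB in blast)
    moreover have "l2 < k" using v(6) z(6) k2 WP_V[OF v(1)] by linarith
    ultimately show ?thesis unfolding nsp_def using l2 by auto
  next
    case True
    show ?thesis
    proof (cases "M \<inter> (Al \<union> Ah) = {x}")
      case A1: True
      have P12: "WP s (Al \<union> Ah \<union> M) y (0 + k)"
        by (rule WP_trans[OF FP_WP[OF A] M]) (use A1 in blast)
      have "WP s (Al \<union> Ah \<union> M \<union> (Bl \<union> Bh)) t (0 + k + 0)"
        by (rule WP_trans[OF P12 FP_WP[OF B]]) (use True AB in blast)
      moreover have "0 < k" using WP_drop[OF M] xy by auto
      ultimately show ?thesis using A1 True AB unfolding nsp_def by auto
    next
      \<comment> \<open>Now \<open>M\<close> returns to the first part; \<open>z\<close> is the last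
        such vertex and lies on \<open>Ah\<close> below \<open>x\<close>. Going straight to
        \<open>z\<close> saves the piece from \<open>x\<close> to \<open>z\<close>, and the
        remaining descent to \<open>y\<close> keeps a positive excess.\<close>
      case A2: False
      have ne: "M \<inter> (Al \<union> Ah) \<noteq> {}" using VM by auto
      obtain z M1 M2 k1 k2 where z: "WP x M1 z k1" "WP z M2 y k2" "M = M1 \<union> M2"
        "M1 \<inter> M2 = {z}" "M2 \<inter> (Al \<union> Ah) = {z}" "k = k1 + k2"
        using WP_last[OF M ne] by blast
      have zx: "z \<noteq> x"
      proof
        assume "z = x"
        then have "M1 = {x}" using z(1) WP_loop by blast
        then have "M = M2" using z(3,4) \<open>z = x\<close> by blast
        then show False using z(5) A2 \<open>z = x\<close> by simp
      qed
      have zM: "z \<in> M" "z \<in> Al \<union> Ah" using z(3,5) by blast+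
      have "z \<noteq> y" using zM AB VM by auto
      then have zA: "z \<in> Ah" using zM av zx by blast
      have "d z \<le> d x" using FP_bounds[OF Ah zA] by auto
      then have k1: "0 < k1" using WP_drop[OF z(1)] zx by auto
      have "d y < d z" using ll(2)[of y] VM ll(3)[OF zA] lv by linarith
      then have k2: "0 < k2" using WP_drop[OF z(2)] by auto
      have P1: "WP s {u \<in> Al \<union> Ah. d u \<le> d z} z 0" using FP_WP[OF FP_lower[OF A]] zM by blast
      have P12: "WP s ({u \<in> Al \<union> Ah. d u \<le> d z} \<union> M2) y (0 + k2)"
        by (rule WP_trans[OF P1 z(2)]) (use z(5) in blast)
      have "WP s ({u \<in> Al \<union> Ah. d u \<le> d z} \<union> M2 \<union> (Bl \<union> Bh)) t (0 + k2 + 0)"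
        by (rule WP_trans[OF P12 FP_WP[OF B]]) (use z(3) True AB in blast)
      then have "nsp ({u \<in> Al \<union> Ah. d u \<le> d z} \<union> M2 \<union> (Bl \<union> Bh)) k2"
        unfolding nsp_def using k2 by simp
      moreover have "k2 < k" using k1 z(6) by simp
      ultimately show ?thesis by blast
    qed
  qed
qed

end

context layered_arcs begin

section \<open>Extremal vertices of forward paths, first and last back arcs\<close>

lemma fwd_level_ta: "fwd e \<Longrightarrow> fwd f \<Longrightarrow> d (he e) = d (he f) \<Longrightarrow> d (ta e) = d (ta f)"
  using fwd_between[of e "ta f"] fwd_between[of f "ta e"] ta_less[of e] ta_less[of f]
  by (auto simp: fwd_def)

lemma FP_highest:
  assumes "FP a J b" "u \<in> J" "u \<in> X"
  shows "\<exists>z \<in> J \<inter> X. \<forall>v \<in> J \<inter> X. d v \<le> d z"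
proof -
  have "finite (J \<inter> X)" "J \<inter> X \<noteq> {}" using FP_V[OF assms(1)] assms(2,3) by auto
  then show ?thesis
    using arg_min_if_finite(1)[of "J \<inter> X" "\<lambda>v. - d v"] arg_min_if_finite(2)[of "J \<inter> X" "\<lambda>v. - d v"]
    by (meson not_le neg_less_iff_less)
qed

lemma FP_lowest:
  assumes "FP a J b" "u \<in> J" "u \<in> X"
  shows "\<exists>z \<in> J \<inter> X. \<forall>v \<in> J \<inter> X. d z \<le> d v"
proof -
  have "finite (J \<inter> X)" "J \<inter> X \<noteq> {}" using FP_V[OF assms(1)] assms(2,3) by auto
  then show ?thesis
    using arg_min_if_finite(1)[of "J \<inter> X" d] arg_min_if_finite(2)[of "J \<inter> X" d]
    by (meson not_le)
qed

lemma last_back: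
  "WP a S b k \<Longrightarrow> 0 < k \<Longrightarrow>
   \<exists>N e B l. WP a N (ta e) l \<and> e < m \<and> \<not> fwd e \<and> FP (he e) B b \<and> N \<inter> B = {} \<and> S = N \<union> B \<and> k = l + exc e"
proof (induction rule: WP.induct)
  case (WP_step e S b k)
  show ?case
  proof (cases "k = 0")
    case True
    then have "FP (he e) S b" "\<not> fwd e" using WP_zero WP_step exc_fwd by force+
    then show ?thesis using True WP_step.hyps
      by (intro exI[of _ "{ta e}"] exI[of _ e] exI[of _ S] exI[of _ 0])
        (auto intro: WP.WP_refl ta_less)
  next
    case False
    then have "0 < k" using WP_V[OF WP_step.hyps(2)] by simp
    then obtain N f B l where f: "WP (he e) N (ta f) l" "f < m" "\<not> fwd f" "FP (he f) B b"
      "N \<inter> B = {}" "S = N \<union> B" "k = l + exc f" using WP_step.IH by blast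
    have "WP (ta e) (insert (ta e) N) (ta f) (exc e + l)"
      using WP.WP_step f WP_step.hyps by blast
    moreover have "insert (ta e) N \<inter> B = {}" "insert (ta e) S = insert (ta e) N \<union> B"
      using f(5,6) WP_step.hyps(3) by blast+
    moreover have "exc e + k = exc e + l + exc f" using f(7) by simp
    ultimately show ?thesis using f(2-4) by blast
  qed
qed auto

lemma first_back:
  "WP a S b k \<Longrightarrow> 0 < k \<Longrightarrow>
   \<exists>A e N l. FP a A (ta e) \<and> e < m \<and> \<not> fwd e \<and> WP (he e) N b l \<and> A \<inter> N = {} \<and> S = A \<union> N \<and> k = exc e + l"
proof (induction rule: WP.induct)
  case (WP_step e S b k)
  show ?case
  proof (cases "fwd e")
    case False
    then show ?thesis using WP_step.hyps
      by (intro exI[of _ "{ta e}"] exI[of _ e] exI[of _ S] exI[of _ k])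
        (auto intro: FP.FP_refl ta_less)
  next
    case True
    then have "0 < k" using WP_step.prems exc_fwd by simp
    then obtain A f N l where f: "FP (he e) A (ta f)" "f < m" "\<not> fwd f" "WP (he f) N b l"
      "A \<inter> N = {}" "S = A \<union> N" "k = exc f + l" using WP_step.IH by blast
    have "FP (ta e) (insert (ta e) A) (ta f)"
      using FP.FP_step f(1) True by blast
    moreover have "insert (ta e) A \<inter> N = {}" "insert (ta e) S = insert (ta e) A \<union> N"
      using f(5,6) WP_step.hyps(3) by blast+
    moreover have "exc e + k = exc f + l" using f(7) exc_fwd[OF True] by simp
    ultimately show ?thesis using f(2-4) by blast
  qed
qed auto

end

text \<open>
  The middle part of an optimal path: from the tail \<open>x\<close> of its first back arc to the tail \<open>v\<close> of its last
  back arc \<open>el\<close>. Forward paths \<open>A\<close> and \<open>B\<close> with \<open>dec A B\<close> complete it to an optimal path.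
\<close>

locale optimal_middle = layered_arcs +
  fixes x v y :: nat and N :: "nat set" and el :: nat and k C :: real
  assumes N: "WP x N v k" and el: "el < m" "\<not> fwd el" "ta el = v" "he el = y"
    and C: "C = k + exc el" and opt: "nsp S l \<Longrightarrow> C \<le> l"
    and split_pos: "N \<inter> X \<noteq> {} \<Longrightarrow> x \<notin> X \<Longrightarrow> \<exists>z N1 N2 k1 k2. WP x N1 z k1 \<and> WP z N2 v k2 \<and>
      N = N1 \<union> N2 \<and> N1 \<inter> N2 = {z} \<and> N1 \<inter> X = {z} \<and> 0 < k1 \<and> k = k1 + k2"
begin

definition M0 where "M0 = N - {x}"

text \<open>\<open>N\<close> ends at the tail of \<open>el\<close> and \<open>B\<close> starts at
  its head; therefore \<open>N\<close> and \<open>B\<close> are disjoint, whereas \<open>A\<close>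
  and \<open>N\<close> share \<open>x\<close>.\<close>

definition dec :: "nat set \<Rightarrow> nat set \<Rightarrow> bool" where
  "dec A B \<longleftrightarrow> FP s A x \<and> FP y B t \<and> A \<inter> N = {x} \<and> N \<inter> B = {} \<and> A \<inter> B = {}"

lemma xN: "x \<in> N" "v \<in> N" "0 \<le> k" "0 < exc el"
  using WP_V[OF N] exc_back el by auto

text \<open>The first arc of a nontrivial middle is a back arc, so every initial piece that leaves
  \<open>x\<close> has positive excess; \<open>split_pos\<close> records this, and here it is used
  with a single vertex.\<close>

lemma split_at:
  assumes "z \<in> M0"
  shows "\<exists>N1 N2 k1 k2. WP x N1 z k1 \<and> WP z N2 v k2 \<and>
      N = N1 \<union> N2 \<and> N1 \<inter> N2 = {z} \<and> x \<notin> N2 \<and> 0 < k1 \<and> k = k1 + k2"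
proof -
  have "N \<inter> {z} \<noteq> {}" "x \<notin> {z}" using assms by (auto simp: M0_def)
  then obtain z' N1 N2 k1 k2 where z: "WP x N1 z' k1" "WP z' N2 v k2"
      "N = N1 \<union> N2" "N1 \<inter> N2 = {z'}" "N1 \<inter> {z} = {z'}" "0 < k1" "k = k1 + k2"
    using split_pos[of "{z}"] by blast
  then have "z' = z" by blast
  moreover have "x \<notin> N2" using z(4) WP_V[OF z(1)] \<open>z' = z\<close> assms by (auto simp: M0_def)
  ultimately show ?thesis using z by blast
qed

text \<open>Appending \<open>el\<close> and \<open>B\<close> gives a competitor of excess
  \<open>l + exc el\<close>, to be compared with \<open>C = k + exc el\<close>. So no path from
  \<open>s\<close> to \<open>v\<close> that avoids \<open>B\<close> has less excess than the
  middle.\<close>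

lemma finish:
  assumes "WP s S v l" "FP y B t" "S \<inter> B = {}" "v \<in> N" "N \<inter> B = {}"
  shows "k \<le> l"
proof -
  have 1: "WP v (insert v B) t (exc el + 0)"
    using WP_step[of el B t 0] FP_WP[OF assms(2)] el assms(4,5) by blast
  have "WP s (S \<union> insert v B) t (l + (exc el + 0))"
    by (rule WP_trans[OF assms(1) 1]) (use assms(3) in blast)
  moreover have "0 < l + (exc el + 0)" using WP_V[OF assms(1)] xN by simp
  ultimately show ?thesis using opt[of _ "l + (exc el + 0)"] C unfolding nsp_def by fastforce
qed

text \<open>Leaving \<open>A\<close> at \<open>a\<close>, ascending along \<open>J\<close> and
  joining the middle at \<open>z\<close> saves the piece from \<open>x\<close> to \<open>z\<close>,
  which has positive excess.\<close>

lemma fact1: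
  assumes "dec A B" "FP a J z" "a \<in> A" "z \<in> M0" "J \<inter> A = {a}" "J \<inter> M0 = {z}" "J \<inter> B = {}"
  shows False
proof -
  note D = assms(1)[unfolded dec_def]
  obtain N1 N2 k1 k2 where z: "WP x N1 z k1" "WP z N2 v k2"
      "N = N1 \<union> N2" "N1 \<inter> N2 = {z}" "x \<notin> N2" "0 < k1" "k = k1 + k2"
    using split_at[OF assms(4)] by blast
  have A: "WP s {u \<in> A. d u \<le> d a} a 0" using FP_WP[OF FP_lower] D assms(3) by blast
  have 1: "WP s ({u \<in> A. d u \<le> d a} \<union> J) z (0 + 0)"
    by (rule WP_trans[OF A FP_WP[OF assms(2)]]) (use assms(5) in blast)
  have N2N: "N2 \<subseteq> N" using z(3) by blast
  have N2M: "N2 \<subseteq> M0" using z(3,5) unfolding M0_def by blast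
  have 2: "WP s ({u \<in> A. d u \<le> d a} \<union> J \<union> N2) v (0 + 0 + k2)"
  proof (rule WP_trans[OF 1 z(2)])
    have "A \<inter> N = {x}" using D by simp
    then have "A \<inter> N2 \<subseteq> {x}" using N2N by auto
    then have "A \<inter> N2 = {}" using z(5) by auto
    then show "({u \<in> A. d u \<le> d a} \<union> J) \<inter> N2 \<subseteq> {z}" using assms(6) N2M by blast
  qed
  have "A \<inter> B = {}" "N \<inter> B = {}" "FP y B t" using D by simp_all
  then have "N2 \<inter> B = {}" using N2N by auto
  then have "({u \<in> A. d u \<le> d a} \<union> J \<union> N2) \<inter> B = {}" using assms(7) \<open>A \<inter> B = {}\<close> by auto
  then have "k \<le> 0 + 0 + k2"
    using finish[OF 2 \<open>FP y B t\<close>] xN \<open>N \<inter> B = {}\<close> by simp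
  then show False using z by simp
qed

text \<open>The dual exchange: leaving the middle at \<open>z\<close> and ascending along
  \<open>J\<close> to \<open>B\<close> saves at least the back arc \<open>el\<close>, and the piece
  from \<open>x\<close> to \<open>z\<close> keeps the excess positive.\<close>

lemma fact2:
  assumes "dec A B" "FP z J b" "b \<in> B" "z \<in> M0" "J \<inter> B = {b}" "J \<inter> M0 = {z}" "J \<inter> A = {}"
  shows False
proof -
  note D = assms(1)[unfolded dec_def]
  obtain N1 N2 k1 k2 where z: "WP x N1 z k1" "WP z N2 v k2"
      "N = N1 \<union> N2" "N1 \<inter> N2 = {z}" "x \<notin> N2" "0 < k1" "k = k1 + k2"
    using split_at[OF assms(4)] by blast
  have B: "WP b {u \<in> B. d b \<le> d u} t 0" using FP_WP[OF FP_upper] D assms(3) by blast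
  have 1: "WP s (A \<union> N1) z (0 + k1)"
    by (rule WP_trans[OF FP_WP z(1)]) (use D z(3) in blast)+
  have N1M: "N1 \<subseteq> insert x M0" using z(3) unfolding M0_def by blast
  have xJ: "x \<notin> J" using assms(7) FP_V[of s A x] D by blast
  have 2: "WP s (A \<union> N1 \<union> J) b (0 + k1 + 0)"
    by (rule WP_trans[OF 1 FP_WP[OF assms(2)]]) (use assms(6,7) N1M xJ in blast)
  have 3: "WP s (A \<union> N1 \<union> J \<union> {u \<in> B. d b \<le> d u}) t (0 + k1 + 0 + 0)"
    by (rule WP_trans[OF 2 B]) (use D assms(5) z(3) in blast)
  then have "C \<le> k1" using opt[of _ k1] z(6) by (auto simp: nsp_def)
  then show False using z(7) WP_V[OF z(2)] C xN by simp
qed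

text \<open>\<open>fact1\<close> without the minimality conditions: cut \<open>J\<close> to the
  segment from its highest vertex on \<open>A\<close> to the next vertex of
  \<open>M0\<close>.\<close>

lemma fact1':
  assumes "dec A B" "FP a J z" "a \<in> A" "z \<in> M0"
  shows "J \<inter> B \<noteq> {}"
proof
  assume JB: "J \<inter> B = {}"
  have aJ: "a \<in> J" "z \<in> J" using FP_V[OF assms(2)] by auto
  have AM: "A \<inter> M0 = {}" using assms(1) by (auto simp: dec_def M0_def)
  obtain a' where a': "a' \<in> J" "a' \<in> A" "\<And>u. u \<in> J \<Longrightarrow> u \<in> A \<Longrightarrow> d u \<le> d a'"
    using FP_highest[OF assms(2) aJ(1) assms(3)] by blast
  have J1: "FP a' {u \<in> J. d a' \<le> d u} z" using FP_upper[OF assms(2) a'(1)] .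
  have zJ1: "z \<in> {u \<in> J. d a' \<le> d u}" using aJ FP_bounds[OF assms(2) a'(1)] by blast
  obtain z' where z': "z' \<in> J" "d a' \<le> d z'" "z' \<in> M0"
      "\<And>u. u \<in> J \<Longrightarrow> d a' \<le> d u \<Longrightarrow> u \<in> M0 \<Longrightarrow> d z' \<le> d u"
    using FP_lowest[OF J1 zJ1 assms(4)] by blast
  define K where "K = {u \<in> J. d a' \<le> d u \<and> d u \<le> d z'}"
  have K: "FP a' K z'" using FP_segment[OF assms(2) a'(1) z'(1,2)] by (simp add: K_def)
  have "K \<inter> A = {a'}"
    using a' FP_inj[OF assms(2)] z'(2) by (auto simp: K_def intro: order_antisym)
  moreover have "K \<inter> M0 = {z'}"
    using z' FP_inj[OF assms(2)] by (auto simp: K_def intro: order_antisym)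
  moreover have "K \<inter> B = {}" using JB by (auto simp: K_def)
  ultimately show False using fact1[OF assms(1) K a'(2) z'(3)] by blast
qed

text \<open>Between the highest vertex of \<open>J\<close> in \<open>M0\<close> and the next one on
  \<open>B\<close>, the path must meet \<open>A\<close>, since otherwise \<open>fact2\<close>
  applies to that segment.\<close>

lemma fact2':
  assumes "dec A B" "FP z J b" "b \<in> B" "z \<in> M0"
  shows "\<exists>a \<in> J \<inter> A. \<forall>u \<in> J \<inter> M0. d u < d a"
proof -
  have aJ: "z \<in> J" "b \<in> J" using FP_V[OF assms(2)] by auto
  have AM: "A \<inter> M0 = {}" using assms(1) by (auto simp: dec_def M0_def)
  obtain z' where z': "z' \<in> J" "z' \<in> M0" "\<And>u. u \<in> J \<Longrightarrow> u \<in> M0 \<Longrightarrow> d u \<le> d z'"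
    using FP_highest[OF assms(2) aJ(1) assms(4)] by blast
  have J1: "FP z' {u \<in> J. d z' \<le> d u} b" using FP_upper[OF assms(2) z'(1)] .
  have bJ1: "b \<in> {u \<in> J. d z' \<le> d u}" using aJ FP_bounds[OF assms(2) z'(1)] by blast
  obtain b' where b': "b' \<in> J" "d z' \<le> d b'" "b' \<in> B"
      "\<And>u. u \<in> J \<Longrightarrow> d z' \<le> d u \<Longrightarrow> u \<in> B \<Longrightarrow> d b' \<le> d u"
    using FP_lowest[OF J1 bJ1 assms(3)] by blast
  define K where "K = {u \<in> J. d z' \<le> d u \<and> d u \<le> d b'}"
  have K: "FP z' K b'" using FP_segment[OF assms(2) z'(1) b'(1,2)] by (simp add: K_def)
  have "K \<inter> M0 = {z'}"
    using z' FP_inj[OF assms(2)] b'(2) by (auto simp: K_def intro: order_antisym)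
  moreover have "K \<inter> B = {b'}"
    using b' FP_inj[OF assms(2)] by (auto simp: K_def intro: order_antisym)
  ultimately have "K \<inter> A \<noteq> {}" using fact2[OF assms(1) K b'(3) z'(2)] by blast
  then obtain a where a: "a \<in> J" "a \<in> A" "d z' \<le> d a" by (auto simp: K_def)
  have "d u < d a" if "u \<in> J \<inter> M0" for u
  proof -
    have "a \<noteq> z'" using AM a(2) z'(2) by blast
    then have "d z' \<noteq> d a" using FP_inj[OF assms(2) z'(1) a(1)] by blast
    then show ?thesis using a(3) z'(3)[of u] that by auto
  qed
  then show ?thesis using a by blast
qed

text \<open>If \<open>z\<close> were not above \<open>y\<close>, a forward path from
  \<open>s\<close> to \<open>z\<close> would stay at or below the level of \<open>y\<close> and so
  avoid \<open>B\<close>. Following it up to its first vertex on the rest of the middle would save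
  the piece from \<open>x\<close> to \<open>z\<close>, against \<open>finish\<close>.\<close>

lemma M0_above:
  assumes "dec A B" "z \<in> M0" shows "d y < d z"
proof (rule ccontr)
  assume "\<not> d y < d z"
  then have le: "d z \<le> d y" by simp
  note D = assms(1)[unfolded dec_def]
  obtain N1 N2 k1 k2 where z: "WP x N1 z k1" "WP z N2 v k2"
      "N = N1 \<union> N2" "N1 \<inter> N2 = {z}" "x \<notin> N2" "0 < k1" "k = k1 + k2"
    using split_at[OF assms(2)] by blast
  have zN2: "z \<in> N2" using z(4) by blast
  obtain S where S: "FP s S z" using ex_FP_s WP_V[OF z(2)] by blast
  have zS: "z \<in> S" using FP_V[OF S] by blast
  obtain u where u: "u \<in> S" "u \<in> N2" "\<And>u'. u' \<in> S \<Longrightarrow> u' \<in> N2 \<Longrightarrow> d u \<le> d u'"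
    using FP_lowest[OF S zS zN2] by blast
  obtain N3 N4 k3 k4 where N4: "WP z N3 u k3" "WP u N4 v k4" "N2 = N3 \<union> N4" "k2 = k3 + k4"
    using WP_split[OF z(2) u(2)] by blast
  have 1: "WP s {v \<in> S. d v \<le> d u} u 0" using FP_WP[OF FP_lower[OF S u(1)]] .
  have "{v \<in> S. d v \<le> d u} \<inter> N4 \<subseteq> {u}"
  proof
    fix a assume a: "a \<in> {v \<in> S. d v \<le> d u} \<inter> N4"
    then have "d u \<le> d a" using u(3) N4(3) by blast
    then have "d a = d u" using a by simp
    then show "a \<in> {u}" using FP_inj[OF S] a u(1) by blast
  qed
  then have 2: "WP s ({v \<in> S. d v \<le> d u} \<union> N4) v (0 + k4)" by (rule WP_trans[OF 1 N4(2)])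
  have SB: "S \<inter> B = {}"
  proof (rule ccontr)
    assume "S \<inter> B \<noteq> {}"
    then obtain a where a: "a \<in> S" "a \<in> B" by blast
    have dd: "d a \<le> d z" "d y \<le> d a" using FP_bounds[OF S a(1)] FP_bounds[of y B t a] D a(2) by blast+
    have "a = z" using FP_inj[OF S a(1) zS] dd le by linarith
    then show False using a(2) D zN2 z(3) by blast
  qed
  have "k \<le> 0 + k4"
    by (rule finish[OF 2]) (use D xN SB N4(3) z(3) in blast)+
  then show False using z(6,7) N4(4) WP_V[OF N4(1)] by linarith
qed

end

context optimal_middle begin

text \<open>
  Suppose that \<open>Bh\<close> meets \<open>M0\<close>. Among all completions by \<open>Au\<close>, \<open>Bu\<close> avoiding \<open>M0\<close> take one that crosses
  \<open>Ah\<close>, \<open>Bh\<close> least often. Following \<open>Bu\<close> up to its last crossing and then \<open>Ah\<close> gives \<open>K\<close>, following \<open>Au\<close> up to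
  its last crossing and then \<open>Bh\<close> gives \<open>R\<close>. If they met, a detour would save a crossing. Now \<open>K\<close>, a
  proper part of the middle, and \<open>R\<close> can be joined to a cheaper path.
\<close>

lemma upper_free:
  assumes D0: "dec A0 B0" and f1: "fwd f1" "ta f1 \<in> A0" "he f1 \<in> A0"
    and f2: "fwd f2" "ta f2 \<in> B0" "he f2 \<in> B0" and lev: "d (he f1) = d (he f2)"
    and ylev: "d y \<le> d (ta f2)"
    and lowest: "\<And>a z S. a \<in> A0 \<Longrightarrow> z \<in> M0 \<Longrightarrow> FP z S a \<Longrightarrow> d (he f1) \<le> d a"
    and reach: "M0 \<noteq> {} \<Longrightarrow> \<exists>z\<in>M0. \<exists>S. FP z S (he f1)"
    and Ah: "FP (he f1) Ah x" and Bh: "FP (he f2) Bh t" and dh: "Ah \<inter> Bh = {}"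
  shows "Bh \<inter> M0 = {}"
proof (rule ccontr)
  assume BM: "Bh \<inter> M0 \<noteq> {}"
  define p q where "p = he f1" and "q = he f2"
  note Ah = Ah[folded p_def] and Bh = Bh[folded q_def] and lev = lev[folded p_def q_def]
  define Al Bl where "Al = {u \<in> A0. d u \<le> d (ta f1)}" and "Bl = {u \<in> B0. d u \<le> d (ta f2)}"
  have D: "FP s A0 x" "FP y B0 t" "A0 \<inter> N = {x}" "N \<inter> B0 = {}" "A0 \<inter> B0 = {}"
    using D0 by (auto simp: dec_def)
  have Al: "FP s Al (ta f1)" unfolding Al_def by (rule FP_lower[OF D(1) f1(2)])
  have Bl: "FP y Bl (ta f2)" unfolding Bl_def by (rule FP_lower[OF D(2) f2(2)])
  have lt: "d (ta f1) < d p" "d (ta f2) < d p"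
    using f1 f2 lev by (auto simp: fwd_def p_def q_def)
  have low: "d u < d p" if "u \<in> Al \<union> Bl" for u
    using that lt unfolding Al_def Bl_def by auto
  have ylow: "d y < d p" using lt ylev by linarith
  have dx: "d p \<le> d x" using FP_bounds[OF D(1) f1(3)] by (simp add: p_def)
  have xAl: "x \<notin> Al" using low[of x] dx by auto
  have sub: "Al \<subseteq> A0" "Bl \<subseteq> B0" unfolding Al_def Bl_def by auto
  have AlN: "Al \<inter> N = {}" using D(3) xAl sub by auto
  have BlN: "Bl \<inter> N = {}" using D(4) sub by auto
  have AlBl: "Al \<inter> Bl = {}" using D(5) sub by auto
  \<comment> \<open>Only the upper parts vary; the lower parts \<open>Al\<close> and
    \<open>Bl\<close> of the given completion are kept throughout.\<close>
  define adm where "adm Au Bu \<longleftrightarrow> FP p Au x \<and> FP q Bu t \<and> Au \<inter> Bu = {} \<and> Au \<inter> M0 = {} \<and> Bu \<inter> M0 = {}"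
    for Au Bu
  have up1: "d p \<le> d u" if "FP p S b" "u \<in> S" for S b u
    using FP_bounds[OF that] by simp
  have up2: "d p \<le> d u" if "FP q S b" "u \<in> S" for S b u
    using FP_bounds[OF that] lev by simp
  \<comment> \<open>Each admissible pair yields a completion, so \<open>fact1'\<close> and
    \<open>fact2'\<close> may be applied to any of them.\<close>
  have adm_dec: "dec (Al \<union> Au) (Bl \<union> Bu)" if "adm Au Bu" for Au Bu
  proof -
    have a: "FP p Au x" "FP q Bu t" "Au \<inter> Bu = {}" "Au \<inter> M0 = {}" "Bu \<inter> M0 = {}"
      using that by (auto simp: adm_def)
    have 1: "FP s (Al \<union> Au) x" using FP_join[OF Al f1(1)] a(1) by (simp add: p_def)
    have 2: "FP y (Bl \<union> Bu) t" using FP_join[OF Bl f2(1)] a(2) by (simp add: q_def)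
    have xA: "x \<in> Au" using FP_V[OF a(1)] by blast
    have 3: "(Al \<union> Au) \<inter> N = {x}" using AlN a(4) xA xN(1) unfolding M0_def by blast
    have 4: "N \<inter> (Bl \<union> Bu) = {}" using BlN a(3,5) xA unfolding M0_def by blast
    have "Al \<inter> Bu = {}" using low up2[OF a(2)] by (meson UnI1 disjoint_iff not_le)
    moreover have "Au \<inter> Bl = {}" using low up1[OF a(1)] by (meson UnI2 disjoint_iff not_le)
    ultimately have "(Al \<union> Au) \<inter> (Bl \<union> Bu) = {}" using AlBl a(3) by blast
    then show ?thesis using 1 2 3 4 unfolding dec_def by blast
  qed
  have "adm {u \<in> A0. d p \<le> d u} {u \<in> B0. d q \<le> d u}"
    unfolding adm_def M0_def p_def q_def
    using FP_upper[OF D(1) f1(3)] FP_upper[OF D(2) f2(3)] D(3-5) by blast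
  \<comment> \<open>A crossing is a meeting of \<open>Au\<close> with the wrong path
    \<open>Bh\<close>, or of \<open>Bu\<close> with the wrong path \<open>Ah\<close>.\<close>
  then obtain Au Bu where adm: "adm Au Bu"
    and min: "\<And>Au' Bu'. adm Au' Bu' \<Longrightarrow> card (Bh \<inter> Au) + card (Ah \<inter> Bu) \<le> card (Bh \<inter> Au') + card (Ah \<inter> Bu')"
    using ex_has_least_nat[of "\<lambda>P. adm (fst P) (snd P)" "({u \<in> A0. d p \<le> d u}, {u \<in> B0. d q \<le> d u})"
        "\<lambda>P. card (Bh \<inter> fst P) + card (Ah \<inter> snd P)"] by auto
  have a: "FP p Au x" "FP q Bu t" "Au \<inter> Bu = {}" "Au \<inter> M0 = {}" "Bu \<inter> M0 = {}"
    using adm by (auto simp: adm_def)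
  have dec: "dec (Al \<union> Au) (Bl \<union> Bu)" using adm_dec[OF adm] .
  have mem: "p \<in> Ah" "x \<in> Ah" "q \<in> Bh" "t \<in> Bh" "p \<in> Au" "x \<in> Au" "q \<in> Bu" "t \<in> Bu"
    using FP_V[OF Ah] FP_V[OF Bh] FP_V[OF a(1)] FP_V[OF a(2)] by auto
  have fin: "finite Ah" "finite Bh"
    using FP_V[OF Ah] FP_V[OF Bh] by auto

  \<comment> \<open>Otherwise one could follow \<open>Al\<close>, \<open>Ah\<close> and the middle
    up to its first vertex on \<open>Bh\<close>, and continue along \<open>Bh\<close> without ever
    using \<open>el\<close>.\<close>
  have AhM: "Ah \<inter> M0 \<noteq> {}"
  proof
    assume AhM: "Ah \<inter> M0 = {}"
    have "x \<notin> Bh" using dh mem by blast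
    moreover have "N \<inter> Bh \<noteq> {}" using BM unfolding M0_def by blast
    ultimately obtain z N1 N2 k1 k2 where z: "WP x N1 z k1" "WP z N2 v k2"
      "N = N1 \<union> N2" "N1 \<inter> N2 = {z}" "N1 \<inter> Bh = {z}" "0 < k1" "k = k1 + k2"
      using split_pos[of Bh] by blast
    have zB: "z \<in> Bh" using z(5) by blast
    have 1: "WP s (Al \<union> Ah) x 0" using FP_WP FP_join[OF Al f1(1)] Ah by (simp add: p_def)
    have N1N: "N1 \<subseteq> N" using z(3) by blast
    have 2: "WP s (Al \<union> Ah \<union> N1) z (0 + k1)"
      by (rule WP_trans[OF 1 z(1)]) (use AlN AhM N1N in \<open>auto simp: M0_def\<close>)
    have 3: "WP z {u \<in> Bh. d z \<le> d u} t 0" using FP_WP[OF FP_upper[OF Bh zB]] .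
    have AlBh: "Al \<inter> Bh = {}" using low up2[OF Bh] by (meson UnI1 disjoint_iff not_le)
    have "WP s (Al \<union> Ah \<union> N1 \<union> {u \<in> Bh. d z \<le> d u}) t (0 + k1 + 0)"
      by (rule WP_trans[OF 2 3]) (use z(5) dh AlBh in blast)
    then have "C \<le> k1" using opt[of _ k1] z(6) by (auto simp: nsp_def)
    then show False using z(7) WP_V[OF z(2)] C xN by simp
  qed

  \<comment> \<open>\<open>fact2'\<close> applies to the rest of \<open>Bh\<close> after
    \<open>u\<close>, since it ends at \<open>t\<close>; \<open>Al\<close> lies too low to be
    met.\<close>
  have above: "\<exists>a \<in> Bh \<inter> Au. d u < d a" if uu: "u \<in> Bh" "u \<in> M0" for u
  proof -
    have 1: "FP u {b \<in> Bh. d u \<le> d b} t" using FP_upper[OF Bh uu(1)] .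
    have "t \<in> Bl \<union> Bu" using mem by blast
    then obtain b where "b \<in> {b \<in> Bh. d u \<le> d b} \<inter> (Al \<union> Au)" "d u < d b"
      using fact2'[OF dec 1 _ uu(2)] FP_V[OF 1] uu(2) by blast
    moreover have "Al \<inter> Bh = {}" using low up2[OF Bh] by (meson UnI1 disjoint_iff not_le)
    ultimately show ?thesis by blast
  qed
  obtain u0 where u0: "u0 \<in> Bh \<inter> Au" using above BM by blast
  obtain al where al: "al \<in> Bh" "al \<in> Au" "\<And>u. u \<in> Bh \<Longrightarrow> u \<in> Au \<Longrightarrow> d u \<le> d al"
    using FP_highest[OF Bh, of u0 Au] u0 by blast
  have al_M0: "u \<notin> M0" if "u \<in> Bh" "d al \<le> d u" for u
    using above[OF that(1)] al(3) that(2) by (meson IntD1 IntD2 leD order_less_le_trans order_le_less_trans)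
  \<comment> \<open>This is \<open>fact1'\<close> for the current completion; \<open>Bl\<close> lies
    below everything reachable from \<open>Au\<close>, so the meeting is with \<open>Bu\<close>.
    Applied to \<open>Ah\<close>, which starts at \<open>p\<close> and meets \<open>M0\<close>, it
    provides the crossing \<open>be\<close>.\<close>
  have AlM: "\<And>u J z. u \<in> Au \<Longrightarrow> FP u J z \<Longrightarrow> z \<in> M0 \<Longrightarrow> \<exists>b \<in> J. b \<in> Bu"
  proof -
    fix u J z assume *: "u \<in> Au" "FP u J z" "z \<in> M0"
    then have "J \<inter> (Bl \<union> Bu) \<noteq> {}" using fact1'[OF dec *(2)] by blast
    moreover have "J \<inter> Bl = {}"
      using low FP_bounds[OF *(2)] up1[OF a(1) *(1)] by (meson UnI2 disjoint_iff not_le order_trans)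
    ultimately show "\<exists>b \<in> J. b \<in> Bu" by blast
  qed
  obtain m1 where m1: "m1 \<in> Ah" "m1 \<in> M0" using AhM by blast
  obtain b0 where b0: "b0 \<in> Ah" "b0 \<in> Bu"
    using AlM[OF mem(5) FP_lower[OF Ah m1(1)] m1(2)] by blast
  obtain be where be: "be \<in> Ah" "be \<in> Bu" "\<And>u. u \<in> Ah \<Longrightarrow> u \<in> Bu \<Longrightarrow> d u \<le> d be"
    using FP_highest[OF Ah b0] by blast

  \<comment> \<open>If \<open>Ah\<close> and \<open>Au\<close> met between \<open>be\<close> and
    \<open>al\<close>, then \<open>Au\<close> could bypass \<open>al\<close> along
    \<open>Ah\<close>: from the highest common vertex below \<open>al\<close> to the lowest one
    above it, which exists because both paths end at \<open>x\<close>.\<close>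
  have no_a: False if aa: "aa \<in> Ah" "aa \<in> Au" "d be \<le> d aa" "d aa \<le> d al" for aa
  proof -
    have "aa \<noteq> be" "aa \<noteq> al" "al \<noteq> x" using aa be(2) a(3) al(1) dh mem by blast+
    then have "d be \<noteq> d aa" "d aa \<noteq> d al"
      using FP_inj[OF Ah be(1) aa(1)] FP_inj[OF a(1) aa(2) al(2)] by blast+
    then have lts: "d be < d aa" "d aa < d al" using aa(3,4) by simp_all
    have alx: "d al < d x"
      using FP_bounds[OF a(1) al(2)] FP_inj[OF a(1) al(2) mem(6)] \<open>al \<noteq> x\<close> by linarith
    obtain a2 where a2: "a2 \<in> Ah" "a2 \<in> Au" "d a2 < d al" 
      and a2m: "\<And>u. u \<in> Ah \<Longrightarrow> u \<in> Au \<Longrightarrow> d u < d al \<Longrightarrow> d u \<le> d a2"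
      using FP_highest[OF Ah aa(1), of "{u \<in> Au. d u < d al}"] aa(2) lts by blast
    obtain a3 where a3: "a3 \<in> Ah" "a3 \<in> Au" "d al < d a3" 
      and a3m: "\<And>u. u \<in> Ah \<Longrightarrow> u \<in> Au \<Longrightarrow> d al < d u \<Longrightarrow> d a3 \<le> d u"
      using FP_lowest[OF Ah mem(2), of "{u \<in> Au. d al < d u}"] mem(6) alx by blast
    have be2: "d be < d a2" using a2m[OF aa(1,2)] lts by simp
    define K where "K = {u \<in> Ah. d a2 \<le> d u \<and> d u \<le> d a3}"
    have K: "FP a2 K a3" unfolding K_def using FP_segment[OF Ah a2(1) a3(1)] a2(3) a3(3) by simp
    have KAh: "K \<subseteq> Ah" unfolding K_def by blast
    have KB: "K \<inter> Bu = {}"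
    proof (rule ccontr)
      assume "K \<inter> Bu \<noteq> {}"
      then obtain u where "u \<in> Ah" "u \<in> Bu" "d a2 \<le> d u" unfolding K_def by blast
      then show False using be(3)[of u] be2 by linarith
    qed
    have KM: "K \<inter> M0 = {}"
    proof (rule ccontr)
      assume "K \<inter> M0 \<noteq> {}"
      then obtain z where z: "z \<in> K" "z \<in> M0" by blast
      obtain b where "b \<in> K" "b \<in> Bu" using AlM[OF a2(2) FP_lower[OF K z(1)] z(2)] by blast
      then show False using KB by blast
    qed
    \<comment> \<open>The detour \<open>K\<close> lies above \<open>be\<close>, hence avoids
      \<open>Bu\<close>, hence avoids \<open>M0\<close> by \<open>AlM\<close>. Being part of
      \<open>Ah\<close> it creates no crossing with \<open>Bh\<close>, and the crossing
      \<open>al\<close> disappears.\<close>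
    define Au' where "Au' = {u \<in> Au. d u \<le> d a2} \<union> K \<union> {u \<in> Au. d a3 \<le> d u}"
    have "FP p Au' x" unfolding Au'_def
      using FP_trans[OF FP_trans[OF FP_lower[OF a(1) a2(2)] K] FP_upper[OF a(1) a3(2)]] .
    moreover have "Au' \<inter> Bu = {}" "Au' \<inter> M0 = {}"
      using KB KM a(3,4) unfolding Au'_def by blast+
    ultimately have "adm Au' Bu" using a unfolding adm_def by blast
    then have "card (Bh \<inter> Au) \<le> card (Bh \<inter> Au')" using min[of Au' Bu] by simp
    moreover have "card (Bh \<inter> Au') \<le> card (Bh \<inter> Au - {al})"
    proof (rule card_mono)
      have "K \<inter> Bh = {}" using KAh dh by blast
      then show "Bh \<inter> Au' \<subseteq> Bh \<inter> Au - {al}" using a2(3) a3(3) unfolding Au'_def by auto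
    qed (use fin in simp)
    moreover have "card (Bh \<inter> Au - {al}) < card (Bh \<inter> Au)"
      using al(1,2) fin by (intro card_Diff1_less) auto
    ultimately show False by linarith
  qed

  \<comment> \<open>The same exchange for \<open>Bu\<close>, bypassing \<open>be\<close> along
    \<open>Bh\<close>. Here the detour lies above \<open>al\<close>, so it avoids \<open>Au\<close>
    by the choice of \<open>al\<close> and avoids \<open>M0\<close> by \<open>al_M0\<close>.\<close>
  have no_b: False if bb: "bb \<in> Bh" "bb \<in> Bu" "d al \<le> d bb" "d bb \<le> d be" for bb
  proof -
    have "bb \<noteq> be" "bb \<noteq> al" "be \<noteq> t" using bb al(2) a(3) be(1) dh mem by blast+
    then have "d al \<noteq> d bb" "d bb \<noteq> d be"
      using FP_inj[OF Bh al(1) bb(1)] FP_inj[OF a(2) bb(2) be(2)] by blast+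
    then have lts: "d al < d bb" "d bb < d be" using bb(3,4) by simp_all
    have bet: "d be < d t"
      using FP_bounds[OF a(2) be(2)] FP_inj[OF a(2) be(2) mem(8)] \<open>be \<noteq> t\<close> by linarith
    obtain b2 where b2: "b2 \<in> Bh" "b2 \<in> Bu" "d b2 < d be" 
      and b2m: "\<And>u. u \<in> Bh \<Longrightarrow> u \<in> Bu \<Longrightarrow> d u < d be \<Longrightarrow> d u \<le> d b2"
      using FP_highest[OF Bh bb(1), of "{u \<in> Bu. d u < d be}"] bb(2) lts by blast
    obtain b3 where b3: "b3 \<in> Bh" "b3 \<in> Bu" "d be < d b3" 
      and b3m: "\<And>u. u \<in> Bh \<Longrightarrow> u \<in> Bu \<Longrightarrow> d be < d u \<Longrightarrow> d b3 \<le> d u"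
      using FP_lowest[OF Bh mem(4), of "{u \<in> Bu. d be < d u}"] mem(8) bet by blast
    have al2: "d al < d b2" using b2m[OF bb(1,2)] lts by simp
    define K where "K = {u \<in> Bh. d b2 \<le> d u \<and> d u \<le> d b3}"
    have K: "FP b2 K b3" unfolding K_def using FP_segment[OF Bh b2(1) b3(1)] b2(3) b3(3) by simp
    have KBh: "K \<subseteq> Bh" unfolding K_def by blast
    have Kal: "d al \<le> d u" if "u \<in> K" for u using that al2 unfolding K_def by simp
    have KA: "K \<inter> Au = {}"
    proof (rule ccontr)
      assume "K \<inter> Au \<noteq> {}"
      then obtain u where "u \<in> Bh" "u \<in> Au" "d b2 \<le> d u" unfolding K_def by blast
      then show False using al(3)[of u] al2 by linarith
    qed
    have KM: "K \<inter> M0 = {}" using al_M0 Kal KBh by blast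
    define Bu' where "Bu' = {u \<in> Bu. d u \<le> d b2} \<union> K \<union> {u \<in> Bu. d b3 \<le> d u}"
    have "FP q Bu' t" unfolding Bu'_def
      using FP_trans[OF FP_trans[OF FP_lower[OF a(2) b2(2)] K] FP_upper[OF a(2) b3(2)]] .
    moreover have "Au \<inter> Bu' = {}" "Bu' \<inter> M0 = {}"
      using KA KM a(3,5) unfolding Bu'_def by blast+
    ultimately have "adm Au Bu'" using a unfolding adm_def by blast
    then have "card (Ah \<inter> Bu) \<le> card (Ah \<inter> Bu')" using min[of Au Bu'] by simp
    moreover have "card (Ah \<inter> Bu') \<le> card (Ah \<inter> Bu - {be})"
    proof (rule card_mono)
      have "K \<inter> Ah = {}" using KBh dh by blast
      then show "Ah \<inter> Bu' \<subseteq> Ah \<inter> Bu - {be}" using b2(3) b3(3) unfolding Bu'_def by auto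
    qed (use fin in simp)
    moreover have "card (Ah \<inter> Bu - {be}) < card (Ah \<inter> Bu)"
      using be(1,2) fin by (intro card_Diff1_less) auto
    ultimately show False by linarith
  qed

  \<comment> \<open>The switch at the last crossings exchanges the ends: \<open>K\<close> leads from
    \<open>q\<close> to \<open>x\<close> and \<open>R\<close> from \<open>p\<close> to
    \<open>t\<close>.\<close>
  define K R where "K = {u \<in> Bu. d u \<le> d be} \<union> {u \<in> Ah. d be \<le> d u}"
    and "R = {u \<in> Au. d u \<le> d al} \<union> {u \<in> Bh. d al \<le> d u}"
  have K: "FP q K x" unfolding K_def using FP_trans[OF FP_lower[OF a(2) be(2)] FP_upper[OF Ah be(1)]] .
  have R: "FP p R t" unfolding R_def using FP_trans[OF FP_lower[OF a(1) al(2)] FP_upper[OF Bh al(1)]] .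
  have KR: "K \<inter> R = {}" using no_a no_b a(3) dh unfolding K_def R_def by blast
  have RM: "R \<inter> M0 = {}" using al_M0 a(4) unfolding R_def by blast

  obtain z1 S1 where z1: "z1 \<in> M0" "FP z1 S1 p" using reach BM p_def by blast
  have z1S: "z1 \<in> S1" using FP_V[OF z1(2)] by blast
  obtain ms where ms: "ms \<in> S1" "ms \<in> M0" "\<And>u. u \<in> S1 \<Longrightarrow> u \<in> M0 \<Longrightarrow> d u \<le> d ms"
    using FP_highest[OF z1(2) z1S z1(1)] by blast
  define J where "J = {u \<in> S1. d ms \<le> d u}"
  have J: "FP ms J p" unfolding J_def using FP_upper[OF z1(2) ms(1)] .
  have Jb: "\<And>u. u \<in> J \<Longrightarrow> d ms \<le> d u \<and> d u \<le> d p" using FP_bounds[OF J] by blast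
  have mJ: "ms \<in> J" "p \<in> J" using FP_V[OF J] by auto
  have JM: "J \<inter> M0 = {ms}"
    using ms mJ(1) FP_inj[OF z1(2)] unfolding J_def by (auto intro: order_antisym)
  \<comment> \<open>The lower piece of \<open>J\<close> up to \<open>u\<close> is a forward path
    from the interior to \<open>A0\<close>, so \<open>u\<close> cannot lie below
    \<open>p\<close>.\<close>
  have JA: "J \<inter> A0 \<subseteq> {p}"
  proof
    fix u assume u: "u \<in> J \<inter> A0"
    then have "FP ms {v \<in> J. d v \<le> d u} u" using FP_lower[OF J] by blast
    then have "d p \<le> d u" using lowest[OF _ ms(2)] u p_def by blast
    then have "d u = d p" using Jb[of u] u by simp
    then show "u \<in> {p}" using FP_inj[OF J] u mJ by blast
  qed
  have pA0: "p \<in> A0" using f1 p_def by simp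
  \<comment> \<open>By \<open>fact2'\<close> a vertex of \<open>J\<close> on \<open>B0\<close> has a
    vertex of \<open>A0\<close> at or below it on \<open>J\<close>. That vertex can only be
    \<open>p\<close>, the top of \<open>J\<close>, so \<open>p\<close> itself would lie on
    \<open>B0\<close>.\<close>
  have JB: "J \<inter> B0 = {}"
  proof (rule ccontr)
    assume "J \<inter> B0 \<noteq> {}"
    then obtain b where b: "b \<in> J" "b \<in> B0" by blast
    have Jl: "FP ms {v \<in> J. d v \<le> d b} b" using FP_lower[OF J b(1)] .
    obtain u where u: "u \<in> J" "u \<in> A0" "d u \<le> d b" using fact2'[OF D0 Jl b(2) ms(2)] by blast
    then have "u = p" using JA by blast
    then have "d b = d p" using u Jb[OF b(1)] by simp
    then have "b = p" using FP_inj[OF J b(1) mJ(2)] by blast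
    then show False using b pA0 D(5) by blast
  qed
  have msp: "d ms < d p"
  proof -
    have "ms \<noteq> p" using ms(2) a(4) mem by blast
    then have "d ms \<noteq> d p" using FP_inj[OF J mJ] by blast
    then show ?thesis using Jb[OF mJ(1)] by simp
  qed

  obtain N1 N2 k1 k2 where z: "WP x N1 ms k1" "WP ms N2 v k2"
      "N = N1 \<union> N2" "N1 \<inter> N2 = {ms}" "x \<notin> N2" "0 < k1" "k = k1 + k2"
    using split_at[OF ms(2)] by blast
  have xK: "x \<in> K" "q \<in> K" using FP_V[OF K] by auto
  then have "N1 \<inter> K \<noteq> {}" using WP_V[OF z(1)] by blast
  \<comment> \<open>The last vertex of the middle on \<open>K\<close> before \<open>ms\<close>
    exists because the middle starts at \<open>x\<close>, the end of \<open>K\<close>.\<close>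
  then obtain u N3 N4 k3 k4 where u: "WP x N3 u k3" "WP u N4 ms k4"
      "N1 = N3 \<union> N4" "N3 \<inter> N4 = {u}" "N4 \<inter> K = {u}" "k1 = k3 + k4"
    using WP_last[OF z(1), of K] by blast
  have uK: "u \<in> K" using u(5) by blast
  have N4N: "N4 \<subseteq> insert x M0" using u(3) z(3) unfolding M0_def by blast
  have k4: "0 < k4"
  proof (rule WP_drop[OF u(2)])
    have "d p \<le> d u" using up2[OF K uK] .
    then show "d ms \<le> d u" "u \<noteq> ms" using msp by auto
  qed
  \<comment> \<open>The cheaper path goes up from \<open>s\<close> through \<open>y\<close> and
    \<open>Bl\<close>, along \<open>K\<close> to \<open>u\<close>, along the middle from
    \<open>u\<close> to \<open>ms\<close>, along \<open>J\<close> to \<open>p\<close>, and along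
    \<open>R\<close> to \<open>t\<close>. Its whole excess is \<open>k4\<close>: positive since
    \<open>ms\<close> lies below \<open>u\<close>, and less than \<open>C\<close> since
    \<open>el\<close> is avoided.\<close>
  obtain S where S: "FP s S y" using ex_FP_s[of y] FP_V[OF D(2)] by blast
  have Sb: "\<And>u. u \<in> S \<Longrightarrow> d u \<le> d y" using FP_bounds[OF S] by blast
  define S' where "S' = S \<union> Bl"
  have S': "FP s S' (ta f2)" unfolding S'_def using FP_trans[OF S Bl] .
  define T where "T = S' \<union> {v \<in> K. d v \<le> d u}"
  have T: "FP s T u" unfolding T_def
    using FP_join[OF S' f2(1)] FP_lower[OF K uK] by (simp add: q_def)
  have S'lt: "\<And>u. u \<in> S' \<Longrightarrow> d u < d p" using low ylow Sb unfolding S'_def by fastforce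
  have M0y: "\<And>u. u \<in> M0 \<Longrightarrow> d y < d u" using M0_above[OF D0] .
  have "S \<inter> M0 = {}" using M0y Sb by (meson disjoint_iff not_le)
  then have SM0: "S' \<inter> M0 = {}" using BlN unfolding S'_def M0_def by auto
  have xS': "x \<notin> S'" using S'lt[of x] dx by auto
  have SN4: "S' \<inter> N4 = {}" using SM0 xS' N4N by blast
  have 1: "WP s (T \<union> N4) ms (0 + k4)"
    by (rule WP_trans[OF FP_WP[OF T] u(2)]) (use SN4 u(5) in \<open>auto simp: T_def\<close>)
  have pR: "p \<in> R" using FP_V[OF R] by blast
  then have pK: "p \<notin> K" "p \<noteq> x" using KR xK by blast+
  have JK: "J \<inter> K = {}"
  proof (rule ccontr)
    assume "J \<inter> K \<noteq> {}"
    then obtain b where b: "b \<in> J" "b \<in> K" by blast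
    then have "d b = d p" using Jb[OF b(1)] up2[OF K b(2)] by simp
    then show False using FP_inj[OF J b(1) mJ(2)] b(2) pK by blast
  qed
  have JS': "J \<inter> S' = {}"
  proof -
    have "J \<inter> Bl = {}" using JB unfolding Bl_def by blast
    moreover have "J \<inter> S = {}"
      using Jb Sb M0y[OF ms(2)] by (meson disjoint_iff not_le order_less_le_trans)
    ultimately show ?thesis unfolding S'_def by blast
  qed
  have "J \<inter> N4 \<subseteq> {ms}" using JM N4N JK xK by blast
  then have "(T \<union> N4) \<inter> J \<subseteq> {ms}" using JK JS' unfolding T_def by auto
  then have 2: "WP s (T \<union> N4 \<union> J) p (0 + k4 + 0)" by (rule WP_trans[OF 1 FP_WP[OF J]])
  have JR: "J \<inter> R \<subseteq> {p}"
  proof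
    fix b assume b: "b \<in> J \<inter> R"
    then have "d b = d p" using Jb[of b] up1[OF R, of b] by simp
    then show "b \<in> {p}" using FP_inj[OF J] b mJ(2) by blast
  qed
  have "S' \<inter> R = {}" using S'lt up1[OF R] by (meson disjoint_iff not_le)
  moreover have "N4 \<inter> R = {}" using N4N RM KR xK by blast
  ultimately have "(T \<union> N4 \<union> J) \<inter> R \<subseteq> {p}" using JR KR unfolding T_def by auto
  then have "WP s (T \<union> N4 \<union> J \<union> R) t (0 + k4 + 0 + 0)" by (rule WP_trans[OF 2 FP_WP[OF R]])
  then have "C \<le> k4" using opt[of _ k4] k4 by (auto simp: nsp_def)
  then show False using C xN u(6) z(7) WP_V[OF u(1)] WP_V[OF z(2)] by linarith
qed

text \<open>Only \<open>x\<close>, \<open>f1\<close> and \<open>f2\<close> can be enumerated by the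
  program, so everything else is bound by quantifiers, and the last line ranges over all upper
  pairs. Since \<open>ta f1\<close> lies below \<open>p\<close>, the lowest vertex of
  \<open>A\<close> reachable from \<open>M0\<close>, no vertex of \<open>M0\<close> is an ancestor
  of it.\<close>

lemma complete_core:
  assumes D0: "dec A B"
  shows "\<exists>f1 f2 Al Bl. fwd f1 \<and> fwd f2 \<and> d (ta f1) = d (ta f2) \<and> FP s Al (ta f1) \<and> FP y Bl (ta f2) \<and>
    Al \<inter> Bl = {} \<and> (\<exists>Ah Bh. FP (he f1) Ah x \<and> FP (he f2) Bh t \<and> Ah \<inter> Bh = {}) \<and>
    (\<forall>u\<in>M0. \<forall>S. \<not> FP u S (ta f1)) \<and> he f1 \<notin> M0 \<and>
    (\<forall>Ah Bh. FP (he f1) Ah x \<longrightarrow> FP (he f2) Bh t \<longrightarrow> Ah \<inter> Bh = {} \<longrightarrow> Bh \<inter> M0 = {})"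
proof -
  have D: "FP s A x" "FP y B t" "A \<inter> N = {x}" "N \<inter> B = {}" "A \<inter> B = {}"
    using D0 by (auto simp: dec_def)
  have AM: "A \<inter> M0 = {}" "B \<inter> M0 = {}" using D(3,4) by (auto simp: M0_def)
  have "\<exists>p \<in> A. d y < d p \<and> (\<forall>a \<in> A. \<forall>z \<in> M0. \<forall>S. FP z S a \<longrightarrow> d p \<le> d a) \<and>
    (M0 \<noteq> {} \<longrightarrow> (\<exists>z\<in>M0. \<exists>S. FP z S p))"
  proof (cases "M0 = {}")
    \<comment> \<open>The only back arc is then \<open>el\<close>, whose tail is \<open>x\<close>;
      this makes \<open>x\<close> itself lie above \<open>y\<close>.\<close>
    case True
    then have "x = v" using xN unfolding M0_def by blast
    then have "d y < d x" using back_less el by blast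
    moreover have "x \<in> A" using D(3) by blast
    ultimately show ?thesis using True by blast
  next
    case False
    then obtain z where z: "z \<in> M0" by blast
    then have "z < n" using WP_V[OF N] unfolding M0_def by blast
    then obtain S where S: "FP z S t" using ex_FP_t by blast
    have "t \<in> B" using FP_V[OF D(2)] by blast
    \<comment> \<open>Some vertex of \<open>A\<close> is reachable from the interior:
      \<open>fact2'\<close> finds one on any forward path from \<open>z\<close> to
      \<open>t\<close>.\<close>
    then obtain a where a: "a \<in> S" "a \<in> A" using fact2'[OF D0 S _ z] by blast
    define X where "X = {a \<in> A. \<exists>z\<in>M0. \<exists>S. FP z S a}"
    have aX: "a \<in> X" using a z FP_lower[OF S a(1)] unfolding X_def by blast
    obtain p where p: "p \<in> X" "\<And>u. u \<in> A \<Longrightarrow> u \<in> X \<Longrightarrow> d p \<le> d u"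
      using FP_lowest[OF D(1) a(2) aX] by blast
    obtain z' S' where z': "z' \<in> M0" "FP z' S' p" using p(1) unfolding X_def by blast
    have "d y < d p" using M0_above[OF D0 z'(1)] FP_bounds[OF z'(2), of p] FP_V[OF z'(2)] by force
    then show ?thesis using p z' unfolding X_def by blast
  qed
  then obtain p where p: "p \<in> A" "d y < d p" "\<And>a z S. a \<in> A \<Longrightarrow> z \<in> M0 \<Longrightarrow> FP z S a \<Longrightarrow> d p \<le> d a"
    "M0 \<noteq> {} \<Longrightarrow> \<exists>z\<in>M0. \<exists>S. FP z S p" by blast
  have yn: "y < n" "p < n" using FP_V[OF D(1)] FP_V[OF D(2)] p(1) by auto
  have "p \<noteq> s" using d_s_le[OF yn(1)] p(2) by force
  then obtain f1 where f1: "fwd f1" "ta f1 \<in> A" "he f1 = p" using FP_pred[OF D(1) p(1)] by blast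
  obtain q where q: "q \<in> B" "d q = d p"
    using FP_level[OF D(2) yn(2)] p(2) d_t_ge[OF yn(2)] by force
  have "q \<noteq> y" using q p(2) by force
  then obtain f2 where f2: "fwd f2" "ta f2 \<in> B" "he f2 = q" using FP_pred[OF D(2) q(1)] by blast
  have lev: "d (ta f1) = d (ta f2)" using fwd_level_ta[OF f1(1) f2(1)] f1(3) f2(3) q(2) by simp
  have ylev: "d y \<le> d (ta f2)" using FP_bounds[OF D(2) f2(2)] by blast
  have 1: "FP s {u \<in> A. d u \<le> d (ta f1)} (ta f1)" using FP_lower[OF D(1) f1(2)] .
  have 2: "FP y {u \<in> B. d u \<le> d (ta f2)} (ta f2)" using FP_lower[OF D(2) f2(2)] .
  have 3: "FP (he f1) {u \<in> A. d p \<le> d u} x" using FP_upper[OF D(1) p(1)] f1(3) by simp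
  have 4: "FP (he f2) {u \<in> B. d q \<le> d u} t" using FP_upper[OF D(2) q(1)] f2(3) by simp
  have 5: "{u \<in> A. d u \<le> d (ta f1)} \<inter> {u \<in> B. d u \<le> d (ta f2)} = {}"
     "{u \<in> A. d p \<le> d u} \<inter> {u \<in> B. d q \<le> d u} = {}" using D(5) by blast+
  have 6: "\<forall>u\<in>M0. \<forall>S. \<not> FP u S (ta f1)"
    using p(3)[OF f1(2)] f1(1,3) unfolding fwd_def by (meson leD)
  have 7: "he f1 \<notin> M0" using AM p(1) f1(3) by blast
  have "Bh \<inter> M0 = {}" if "FP (he f1) Ah x" "FP (he f2) Bh t" "Ah \<inter> Bh = {}" for Ah Bh
    by (rule upper_free[OF D0 f1(1,2) _ f2(1,2) _ _ ylev _ _ that])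
      (use f1 f2 p q in auto)
  then show ?thesis using f1(1) f2(1) lev 1 2 3 4 5 6 7 by blast
qed

end

section \<open>Completeness of the candidates\<close>

context layered_arcs begin

text \<open>Cutting an optimal path at its last and its first back arc provides an instance of
  \<open>optimal_middle\<close>, to which \<open>complete_core\<close> applies.\<close>

theorem complete:
  assumes P: "nsp P C" and opt: "\<And>S l. nsp S l \<Longrightarrow> C \<le> l"
  obtains x N k el eb f1 f2 Al Bl where
    "eb < m" "\<not> fwd eb" "ta eb = x" "WP x N (ta el) k" "el < m" "\<not> fwd el" "C = k + exc el"
    "fwd f1" "fwd f2" "d (ta f1) = d (ta f2)" "FP s Al (ta f1)" "FP (he el) Bl (ta f2)" "Al \<inter> Bl = {}"
    "\<exists>Ah Bh. FP (he f1) Ah x \<and> FP (he f2) Bh t \<and> Ah \<inter> Bh = {}"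
    "\<And>u S. u \<in> N - {x} \<Longrightarrow> \<not> FP u S (ta f1)" "he f1 \<notin> N - {x}"
    "\<And>Ah Bh. FP (he f1) Ah x \<Longrightarrow> FP (he f2) Bh t \<Longrightarrow> Ah \<inter> Bh = {} \<Longrightarrow> Bh \<inter> (N - {x}) = {}"
proof -
  obtain N0 el B l where el: "WP s N0 (ta el) l" "el < m" "\<not> fwd el" "FP (he el) B t" "N0 \<inter> B = {}"
     "C = l + exc el" using last_back P unfolding nsp_def by blast
  obtain x A N eb where N: "eb < m" "\<not> fwd eb" "ta eb = x" "FP s A x" "WP x N (ta el) l" "A \<inter> N = {x}"
    "N0 = A \<union> N" and
    sp: "\<And>X. N \<inter> X \<noteq> {} \<Longrightarrow> x \<notin> X \<Longrightarrow> \<exists>z N1 N2 k1 k2. WP x N1 z k1 \<and> WP z N2 (ta el) k2 \<and>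
      N = N1 \<union> N2 \<and> N1 \<inter> N2 = {z} \<and> N1 \<inter> X = {z} \<and> 0 < k1 \<and> l = k1 + k2"
  proof (cases "l = 0")
    \<comment> \<open>There is a single back arc: it serves as first and as last one, and the middle
      shrinks to its tail.\<close>
    case True
    then have "FP s N0 (ta el)" using WP_zero el(1) by blast
    moreover have "N0 \<inter> {ta el} = {ta el}" "N0 = N0 \<union> {ta el}" using FP_V[OF calculation] by auto
    ultimately show ?thesis
      using that[of el "ta el" N0 "{ta el}"] el(2,3) True WP_refl[OF ta_less[OF el(2)]] by auto
  next
    case False
    then have "0 < l" using WP_V[OF el(1)] by simp
    then obtain A eb N' l' where f: "FP s A (ta eb)" "eb < m" "\<not> fwd eb" "WP (he eb) N' (ta el) l'"
      "A \<inter> N' = {}" "N0 = A \<union> N'" "l = exc eb + l'" using first_back[OF el(1)] by blast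
    have tA: "ta eb \<in> A" using FP_V[OF f(1)] by blast
    \<comment> \<open>A set that misses the tail of \<open>eb\<close> is first met after
      \<open>eb\<close> has been traversed, which accounts for the positive excess.\<close>
    have sp: "\<exists>z N1 N2 k1 k2. WP (ta eb) N1 z k1 \<and> WP z N2 (ta el) k2 \<and>
      insert (ta eb) N' = N1 \<union> N2 \<and> N1 \<inter> N2 = {z} \<and> N1 \<inter> X = {z} \<and> 0 < k1 \<and> l = k1 + k2"
      if X: "insert (ta eb) N' \<inter> X \<noteq> {}" "ta eb \<notin> X" for X
    proof -
      have "N' \<inter> X \<noteq> {}" using X by blast
      then obtain z S1 S2 k1 k2 where z: "WP (he eb) S1 z k1" "WP z S2 (ta el) k2" "N' = S1 \<union> S2" 
        "S1 \<inter> S2 = {z}" "S1 \<inter> X = {z}" "l' = k1 + k2" using WP_first[OF f(4), of X] by blast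
      have tS: "ta eb \<notin> S1" "ta eb \<notin> S2" using tA f(5) z(3) by blast+
      have "WP (ta eb) (insert (ta eb) S1) z (exc eb + k1)" using WP_step[OF f(2) z(1)] tS by blast
      moreover have "insert (ta eb) N' = insert (ta eb) S1 \<union> S2" "insert (ta eb) S1 \<inter> S2 = {z}"
        "insert (ta eb) S1 \<inter> X = {z}" using z(3-5) tS X(2) by blast+
      moreover have "0 < exc eb + k1" "l = exc eb + k1 + k2"
        using exc_back[OF f(2,3)] WP_V[OF z(1)] f(7) z(6) by auto
      ultimately show ?thesis using z(2) by blast
    qed
    have 1: "WP (ta eb) (insert (ta eb) N') (ta el) l" using WP_step[OF f(2) f(4)] tA f(5,7) by blast
    have 2: "A \<inter> insert (ta eb) N' = {ta eb}" "N0 = A \<union> insert (ta eb) N'" using tA f(5,6) by blast+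
    show ?thesis by (rule that[OF f(2,3) refl f(1) 1 2 sp])
  qed
  interpret O: optimal_middle n m ta he w s t d x "ta el" "he el" N el l C
    by unfold_locales (use N el opt sp in auto)
  have "A \<inter> B = {}" "N \<inter> B = {}" using el(5) N(7) by blast+
  then have D: "O.dec A B" unfolding O.dec_def using N el by blast
  obtain f1 f2 Al Bl where F: "fwd f1" "fwd f2" "d (ta f1) = d (ta f2)" "FP s Al (ta f1)" "FP (he el) Bl (ta f2)"
    "Al \<inter> Bl = {}" "\<exists>Ah Bh. FP (he f1) Ah x \<and> FP (he f2) Bh t \<and> Ah \<inter> Bh = {}"
    "\<forall>u\<in>O.M0. \<forall>S. \<not> FP u S (ta f1)" "he f1 \<notin> O.M0"
    "\<forall>Ah Bh. FP (he f1) Ah x \<longrightarrow> FP (he f2) Bh t \<longrightarrow> Ah \<inter> Bh = {} \<longrightarrow> Bh \<inter> O.M0 = {}"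
    using O.complete_core[OF D] by (elim exE) (rule that; elim conjE; assumption)
  show ?thesis
    by (rule that[OF N(1-3,5) el(2,3,6) F(1-7)]) (use F(8-10) in \<open>unfold O.M0_def, blast\<close>)+
qed

end

section \<open>The program\<close>

subsection \<open>Total correctness with time bounds\<close>

definition upn :: "ram_state \<Rightarrow> nat \<Rightarrow> nat \<Rightarrow> nat \<Rightarrow> ram_state" where
  "upn \<sigma> a i x = \<sigma>\<lparr>nmem := (nmem \<sigma>)(a := (nmem \<sigma> a)(i := x))\<rparr>"

definition upr :: "ram_state \<Rightarrow> nat \<Rightarrow> nat \<Rightarrow> real \<Rightarrow> ram_state" where
  "upr \<sigma> a i x = \<sigma>\<lparr>rmem := (rmem \<sigma>)(a := (rmem \<sigma> a)(i := x))\<rparr>"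

lemma mem_upd [simp]:
  "nmem (upn \<sigma> a i x) b = (if b = a then (nmem \<sigma> a)(i := x) else nmem \<sigma> b)"
  "rmem (upn \<sigma> a i x) = rmem \<sigma>"
  "nmem (upr \<sigma> a i y) = nmem \<sigma>"
  "rmem (upr \<sigma> a i y) b = (if b = a then (rmem \<sigma> a)(i := y) else rmem \<sigma> b)"
  by (auto simp: upn_def upr_def)

fun run :: "com \<Rightarrow> ram_state \<Rightarrow> ram_state" where
  "run Skip \<sigma> = \<sigma>"
| "run (NStore a i x) \<sigma> = upn \<sigma> a (nval i \<sigma>) (nval x \<sigma>)"
| "run (RStore a i x) \<sigma> = upr \<sigma> a (nval i \<sigma>) (rval x \<sigma>)"
| "run (Seq c1 c2) \<sigma> = run c2 (run c1 \<sigma>)"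
| "run (IfThenElse b c1 c2) \<sigma> = (if bval b \<sigma> then run c1 \<sigma> else run c2 \<sigma>)"
| "run (While b c) \<sigma> = \<sigma>"

fun loop_free :: "com \<Rightarrow> bool" where
  "loop_free (Seq c1 c2) \<longleftrightarrow> loop_free c1 \<and> loop_free c2"
| "loop_free (IfThenElse b c1 c2) \<longleftrightarrow> loop_free c1 \<and> loop_free c2"
| "loop_free (While b c) \<longleftrightarrow> False"
| "loop_free _ \<longleftrightarrow> True"

text \<open>The two branches are added instead of maximised: a cruder bound, but one that
  \<open>simp\<close> evaluates to a numeral.\<close>

fun max_cost :: "com \<Rightarrow> nat" where
  "max_cost Skip = 1"
| "max_cost (NStore a i x) = 1 + ncost i + ncost x"
| "max_cost (RStore a i x) = 1 + ncost i + rcost x"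
| "max_cost (Seq c1 c2) = max_cost c1 + max_cost c2"
| "max_cost (IfThenElse b c1 c2) = 1 + bcost b + (max_cost c1 + max_cost c2)"
| "max_cost (While b c) = 0"

fun nwr :: "com \<Rightarrow> nat set" where
  "nwr (NStore a i x) = {a}"
| "nwr (Seq c1 c2) = nwr c1 \<union> nwr c2"
| "nwr (IfThenElse b c1 c2) = nwr c1 \<union> nwr c2"
| "nwr (While b c) = nwr c"
| "nwr _ = {}"

fun rwr :: "com \<Rightarrow> nat set" where
  "rwr (RStore a i x) = {a}"
| "rwr (Seq c1 c2) = rwr c1 \<union> rwr c2"
| "rwr (IfThenElse b c1 c2) = rwr c1 \<union> rwr c2"
| "rwr (While b c) = rwr c"
| "rwr _ = {}"

primrec nrd :: "nexp \<Rightarrow> nat set" where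
  "nrd (NConst k) = {}"
| "nrd (NCell a i) = insert a (nrd i)"
| "nrd (NAdd x y) = nrd x \<union> nrd y"
| "nrd (NSub x y) = nrd x \<union> nrd y"

text \<open>The arrays that a program can write are read off its text. Every rule below supplies
  this fact, so specifications mention only what changes.\<close>

definition frame :: "com \<Rightarrow> ram_state \<Rightarrow> ram_state \<Rightarrow> bool" where
  "frame c \<sigma> \<tau> \<longleftrightarrow> (\<forall>a. a \<notin> nwr c \<longrightarrow> nmem \<tau> a = nmem \<sigma> a) \<and> (\<forall>a. a \<notin> rwr c \<longrightarrow> rmem \<tau> a = rmem \<sigma> a)"

lemma frame_n: "frame c \<sigma> \<tau> \<Longrightarrow> a \<notin> nwr c \<Longrightarrow> nmem \<tau> a = nmem \<sigma> a"
  and frame_r: "frame c \<sigma> \<tau> \<Longrightarrow> a \<notin> rwr c \<Longrightarrow> rmem \<tau> a = rmem \<sigma> a"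
  by (auto simp: frame_def)

lemma exec_frame: "exec c \<sigma> k \<tau> \<Longrightarrow> frame c \<sigma> \<tau>"
  by (induction rule: exec.induct) (auto simp: frame_def)

lemma nval_cong: "(\<And>a. a \<in> nrd x \<Longrightarrow> nmem \<tau> a = nmem \<sigma> a) \<Longrightarrow> nval x \<tau> = nval x \<sigma>"
  by (induction x) auto

lemma exec_run: "loop_free c \<Longrightarrow> \<exists>k \<le> max_cost c. exec c \<sigma> k (run c \<sigma>)"
proof (induction c arbitrary: \<sigma>)
  case (Seq c1 c2)
  then obtain k1 k2 where "k1 \<le> max_cost c1" "exec c1 \<sigma> k1 (run c1 \<sigma>)"
    "k2 \<le> max_cost c2" "exec c2 (run c1 \<sigma>) k2 (run c2 (run c1 \<sigma>))" by (meson loop_free.simps(1))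
  then show ?case by (intro exI[of _ "k1 + k2"]) (auto intro: exec.Seq)
next
  case (IfThenElse b c1 c2)
  then obtain k1 k2 where k: "k1 \<le> max_cost c1" "exec c1 \<sigma> k1 (run c1 \<sigma>)"
    "k2 \<le> max_cost c2" "exec c2 \<sigma> k2 (run c2 \<sigma>)" by (meson loop_free.simps(2))
  show ?case
  proof (cases "bval b \<sigma>")
    case True
    then show ?thesis using exec.IfTrue[OF True k(2), of c2] k
      by (intro exI[of _ "1 + bcost b + k1"]) auto
  next
    case False
    then show ?thesis using exec.IfFalse[OF False k(4), of c1] k
      by (intro exI[of _ "1 + bcost b + k2"]) auto
  qed
next
  case Skip
  show ?case using exec.Skip by auto
next
  case (NStore a i x)
  show ?case using exec.NStore[of a i x \<sigma>] by (auto simp: upn_def)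
next
  case (RStore a i x)
  show ?case using exec.RStore[of a i x \<sigma>] by (auto simp: upr_def)
qed auto

text \<open>One halting execution expresses total correctness because \<open>exec\<close> is
  deterministic.\<close>

definition runs :: "com \<Rightarrow> ram_state \<Rightarrow> (ram_state \<Rightarrow> bool) \<Rightarrow> nat \<Rightarrow> bool" where
  "runs c \<sigma> Q k \<longleftrightarrow> (\<exists>l \<tau>. exec c \<sigma> l \<tau> \<and> l \<le> k \<and> Q \<tau>)"

lemma runs_conseq: "runs c \<sigma> Q k \<Longrightarrow> (\<And>\<tau>. Q \<tau> \<Longrightarrow> frame c \<sigma> \<tau> \<Longrightarrow> R \<tau>) \<Longrightarrow> k \<le> l \<Longrightarrow> runs c \<sigma> R l"
  unfolding runs_def using exec_frame by (meson order_trans)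

lemma runs_Seq:
  "runs c1 \<sigma> Q k1 \<Longrightarrow> (\<And>\<tau>. Q \<tau> \<Longrightarrow> frame c1 \<sigma> \<tau> \<Longrightarrow> runs c2 \<tau> R k2) \<Longrightarrow> k1 + k2 \<le> k \<Longrightarrow>
   runs (Seq c1 c2) \<sigma> R k"
  unfolding runs_def using exec_frame exec.Seq by (meson add_mono order_trans)

lemma runs_If:
  assumes "bval b \<sigma> \<Longrightarrow> runs c1 \<sigma> Q k" "\<not> bval b \<sigma> \<Longrightarrow> runs c2 \<sigma> Q k" "1 + bcost b + k \<le> l"
  shows "runs (IfThenElse b c1 c2) \<sigma> Q l"
proof (cases "bval b \<sigma>")
  case True
  then obtain j \<tau> where "exec c1 \<sigma> j \<tau>" "j \<le> k" "Q \<tau>" using assms(1) by (auto simp: runs_def)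
  then show ?thesis unfolding runs_def
    using exec.IfTrue[OF True, of c1 j \<tau> c2] assms(3) by (meson add_left_mono order_trans)
next
  case False
  then obtain j \<tau> where "exec c2 \<sigma> j \<tau>" "j \<le> k" "Q \<tau>" using assms(2) by (auto simp: runs_def)
  then show ?thesis unfolding runs_def
    using exec.IfFalse[OF False, of c2 j \<tau> c1] assms(3) by (meson add_left_mono order_trans)
qed

lemma runs_run: "loop_free c \<Longrightarrow> Q (run c \<sigma>) \<Longrightarrow> max_cost c \<le> k \<Longrightarrow> runs c \<sigma> Q k"
  unfolding runs_def using exec_run by (meson order_trans)

lemma runs_Seq_run:
  "loop_free c1 \<Longrightarrow> (\<And>\<tau>. \<tau> = run c1 \<sigma> \<Longrightarrow> runs c2 \<tau> R k2) \<Longrightarrow> max_cost c1 + k2 \<le> k \<Longrightarrow> runs (Seq c1 c2) \<sigma> R k"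
  by (rule runs_Seq[where Q = "\<lambda>\<tau>. \<tau> = run c1 \<sigma>"]) (auto intro: runs_run)

definition For :: "nat \<Rightarrow> nexp \<Rightarrow> com \<Rightarrow> com" where
  "For a b c = Seq (NStore a (NConst 0) (NConst 0))
     (While (NLess (NCell a (NConst 0)) b)
        (Seq c (NStore a (NConst 0) (NAdd (NCell a (NConst 0)) (NConst 1)))))"

lemma nwr_For [simp]: "nwr (For a b c) = insert a (nwr c)" "rwr (For a b c) = rwr c"
  by (auto simp: For_def)

lemma frame_bound:
  "frame (For a b c) \<sigma> \<tau> \<Longrightarrow> a \<notin> nrd b \<Longrightarrow> nrd b \<inter> nwr c = {} \<Longrightarrow> nval b \<tau> = nval b \<sigma>"
  by (rule nval_cong) (auto simp: frame_def)

text \<open>The frame is that of the whole loop relative to its initial state, so a body may rely on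
  any array that the loop leaves alone. By \<open>stable\<close> the invariant does not read the
  counter cell; the round number is passed to it separately.\<close>

lemma runs_For:
  assumes b: "nval b \<sigma> = N" "a \<notin> nrd b" "nrd b \<inter> nwr c = {}" and a: "a \<notin> nwr c"
    and stable: "\<And>i \<tau> x. I i (upn \<tau> a 0 x) \<longleftrightarrow> I i \<tau>"
    and init: "I 0 \<sigma>"
    and step: "\<And>i \<tau>. i < N \<Longrightarrow> nmem \<tau> a 0 = i \<Longrightarrow> I i \<tau> \<Longrightarrow> frame (For a b c) \<sigma> \<tau> \<Longrightarrow>
      runs c \<tau> (I (Suc i)) (T i)"
    and fin: "\<And>\<tau>. I N \<tau> \<Longrightarrow> frame (For a b c) \<sigma> \<tau> \<Longrightarrow> Q \<tau>"
    and time: "(\<Sum>i<N. T i) + N * (ncost b + 10) + ncost b + 10 \<le> k"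
  shows "runs (For a b c) \<sigma> Q k"
proof -
  let ?W = "While (NLess (NCell a (NConst 0)) b)
        (Seq c (NStore a (NConst 0) (NAdd (NCell a (NConst 0)) (NConst 1))))"
  \<comment> \<open>A round costs the body, 4 + \<open>ncost b\<close> steps for the test and 6 for
    the increment; the failing test at the end costs 4 + \<open>ncost b\<close>.\<close>
  have loop: "\<exists>l \<tau>'. exec ?W \<tau> l \<tau>' \<and> l \<le> (\<Sum>j=i..<N. T j) + (N - i) * (ncost b + 10) + ncost b + 4 \<and> I N \<tau>'
      \<and> frame (For a b c) \<sigma> \<tau>'"
    if "i \<le> N" "nmem \<tau> a 0 = i" "I i \<tau>" "frame (For a b c) \<sigma> \<tau>" for i \<tau>
    using that
  proof (induction i arbitrary: \<tau> rule: inc_induct)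
    case base
    have "nval b \<tau> = N" using b frame_bound[OF base(3)] by simp
    then have "exec ?W \<tau> (1 + bcost (NLess (NCell a (NConst 0)) b)) \<tau>"
      using base by (intro exec.WhileFalse) auto
    moreover have "1 + bcost (NLess (NCell a (NConst 0)) b) \<le> (\<Sum>j=N..<N. T j) + (N - N) * (ncost b + 10) + ncost b + 4"
      by simp
    ultimately show ?case using base by blast
  next
    case (step i)
    have nb: "nval b \<tau> = N" using b frame_bound[OF step.prems(3)] by simp
    obtain l1 \<tau>1 where t1: "exec c \<tau> l1 \<tau>1" "l1 \<le> T i" "I (Suc i) \<tau>1"
      using assms(7)[OF _ step.prems] step.hyps by (auto simp: runs_def)
    have f1: "frame c \<tau> \<tau>1" using exec_frame[OF t1(1)] .
    let ?S = "NStore a (NConst 0) (NAdd (NCell a (NConst 0)) (NConst 1))"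
    have ai: "nmem \<tau>1 a 0 = i" using frame_n[OF f1 a] step.prems(1) by simp
    have e2: "exec ?S \<tau>1 6 (upn \<tau>1 a 0 (Suc i))"
      using exec.NStore[of a "NConst 0" "NAdd (NCell a (NConst 0)) (NConst 1)" \<tau>1] ai
      by (simp add: upn_def eval_nat_numeral)
    have f2: "frame (For a b c) \<sigma> (upn \<tau>1 a 0 (Suc i))"
      using f1 step.prems(3) by (auto simp: frame_def)
    obtain l3 \<tau>3 where t3: "exec ?W (upn \<tau>1 a 0 (Suc i)) l3 \<tau>3"
      "l3 \<le> (\<Sum>j=Suc i..<N. T j) + (N - Suc i) * (ncost b + 10) + ncost b + 4" "I N \<tau>3"
      "frame (For a b c) \<sigma> \<tau>3"
      using step.IH[of "upn \<tau>1 a 0 (Suc i)"] t1(3) stable f2 by auto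
    have "bval (NLess (NCell a (NConst 0)) b) \<tau>" using nb step.hyps step.prems by simp
    from exec.WhileTrue[OF this exec.Seq[OF t1(1) e2] t3(1)]
    have "exec ?W \<tau> (1 + (1 + 2 + ncost b) + (l1 + 6) + l3) \<tau>3" by (simp add: eval_nat_numeral)
    moreover have "(\<Sum>j=i..<N. T j) = T i + (\<Sum>j=Suc i..<N. T j)"
      using step.hyps by (simp add: sum.atLeast_Suc_lessThan)
    moreover have "(N - i) * (ncost b + 10) = (N - Suc i) * (ncost b + 10) + (ncost b + 10)"
      using step.hyps by (metis Suc_diff_Suc add.commute mult_Suc)
    ultimately have "exec ?W \<tau> (1 + (1 + 2 + ncost b) + (l1 + 6) + l3) \<tau>3"
      "1 + (1 + 2 + ncost b) + (l1 + 6) + l3 \<le> (\<Sum>j=i..<N. T j) + (N - i) * (ncost b + 10) + ncost b + 4"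
      using t1(2) t3(2) by linarith+
    then show ?case using t3(3,4) by blast
  qed
  have e0: "exec (NStore a (NConst 0) (NConst 0)) \<sigma> 3 (upn \<sigma> a 0 0)"
    using exec.NStore[of a "NConst 0" "NConst 0" \<sigma>] by (simp add: upn_def eval_nat_numeral)
  have f0: "frame (For a b c) \<sigma> (upn \<sigma> a 0 0)" by (auto simp: frame_def)
  obtain l \<tau> where "exec ?W (upn \<sigma> a 0 0) l \<tau>"
     "l \<le> (\<Sum>j=0..<N. T j) + (N - 0) * (ncost b + 10) + ncost b + 4" "I N \<tau>"
      "frame (For a b c) \<sigma> \<tau>"
    using loop[of 0 "upn \<sigma> a 0 0"] init stable f0 by auto
  note l = this
  have "exec (For a b c) \<sigma> (3 + l) \<tau>" unfolding For_def using exec.Seq[OF e0 l(1)] .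
  moreover have "3 + l \<le> k" using l(2) time by (simp add: atLeast0LessThan)
  ultimately show ?thesis using fin l(3,4) unfolding runs_def by blast
qed

lemma runs_For_const:
  assumes b: "nval b \<sigma> = N" "a \<notin> nrd b" "nrd b \<inter> nwr c = {}" and a: "a \<notin> nwr c"
    and stable: "\<And>i \<tau> x. I i (upn \<tau> a 0 x) \<longleftrightarrow> I i \<tau>"
    and init: "I 0 \<sigma>"
    and step: "\<And>i \<tau>. i < N \<Longrightarrow> nmem \<tau> a 0 = i \<Longrightarrow> I i \<tau> \<Longrightarrow> frame (For a b c) \<sigma> \<tau> \<Longrightarrow>
      runs c \<tau> (I (Suc i)) T"
    and fin: "\<And>\<tau>. I N \<tau> \<Longrightarrow> frame (For a b c) \<sigma> \<tau> \<Longrightarrow> Q \<tau>"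
    and time: "(N + 1) * (T + ncost b + 10) \<le> k"
  shows "runs (For a b c) \<sigma> Q k"
proof (rule runs_For[where I = I and T = "\<lambda>_. T", OF b a stable init step fin])
  show "(\<Sum>i<N. T) + N * (ncost b + 10) + ncost b + 10 \<le> k"
    using time by (simp add: algebra_simps)
qed

lemma runs_For_run:
  assumes b: "nval b \<sigma> = N" "a \<notin> nrd b" "nrd b \<inter> nwr c = {}" and a: "a \<notin> nwr c"
    and stable: "\<And>i \<tau> x. I i (upn \<tau> a 0 x) \<longleftrightarrow> I i \<tau>"
    and lf: "loop_free c"
    and init: "I 0 \<sigma>"
    and step: "\<And>i \<tau>. i < N \<Longrightarrow> nmem \<tau> a 0 = i \<Longrightarrow> I i \<tau> \<Longrightarrow> frame (For a b c) \<sigma> \<tau> \<Longrightarrow>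
      I (Suc i) (run c \<tau>)"
    and fin: "\<And>\<tau>. I N \<tau> \<Longrightarrow> frame (For a b c) \<sigma> \<tau> \<Longrightarrow> Q \<tau>"
    and time: "(N + 1) * (max_cost c + ncost b + 10) \<le> k"
  shows "runs (For a b c) \<sigma> Q k"
  by (rule runs_For_const[where I = I and T = "max_cost c", OF b a stable init _ fin time])
    (auto intro: runs_run lf step)

abbreviation nv :: "nat \<Rightarrow> nexp" where "nv a \<equiv> NCell a (NConst 0)"

abbreviation sto :: "nat \<Rightarrow> nexp \<Rightarrow> com" where "sto a x \<equiv> NStore a (NConst 0) x"

definition nEq :: "nexp \<Rightarrow> nexp \<Rightarrow> bexp" where
  "nEq x y = BAnd (BNot (NLess x y)) (BNot (NLess y x))"

definition nNz :: "nexp \<Rightarrow> bexp" where "nNz x = NLess (NConst 0) x"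

definition bOr :: "bexp \<Rightarrow> bexp \<Rightarrow> bexp" where
  "bOr b c = BNot (BAnd (BNot b) (BNot c))"

definition When :: "bexp \<Rightarrow> com \<Rightarrow> com" where "When b c = IfThenElse b c Skip"

lemma bexp_simps [simp]:
  "bval (nEq x y) \<sigma> \<longleftrightarrow> nval x \<sigma> = nval y \<sigma>"
  "bval (nNz x) \<sigma> \<longleftrightarrow> nval x \<sigma> \<noteq> 0"
  "bval (bOr b c) \<sigma> \<longleftrightarrow> bval b \<sigma> \<or> bval c \<sigma>"
  "bcost (nEq x y) = 2 * (ncost x + ncost y) + 5"
  "bcost (nNz x) = ncost x + 2"
  "bcost (bOr b c) = bcost b + bcost c + 4"
  by (auto simp: nEq_def nNz_def bOr_def)

lemma When_simps [simp]:
  "run (When b c) \<sigma> = (if bval b \<sigma> then run c \<sigma> else \<sigma>)"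
  "loop_free (When b c) \<longleftrightarrow> loop_free c"
  "max_cost (When b c) = bcost b + max_cost c + 2"
  "nwr (When b c) = nwr c" "rwr (When b c) = rwr c"
  by (auto simp: When_def)

lemma runs_When:
  assumes "bval b \<sigma> \<Longrightarrow> runs c \<sigma> Q k" "\<not> bval b \<sigma> \<Longrightarrow> Q \<sigma>" "2 + bcost b + k \<le> l"
  shows "runs (When b c) \<sigma> Q l"
  unfolding When_def
proof (rule runs_If[where k = "k + 1"])
  show "runs c \<sigma> Q (k + 1)" if "bval b \<sigma>" using runs_conseq[OF assms(1)[OF that], of Q "k + 1"] by simp
  show "runs Skip \<sigma> Q (k + 1)" if "\<not> bval b \<sigma>" using assms(2)[OF that] by (intro runs_run) auto
qed (use assms(3) in simp)

subsection \<open>Relaxing arcs in a given order\<close>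

text \<open>
  Arrays of the program. Scalars live in cell 0 of an array of their own.

  \<^item> 10--17, 60--62: loop counters and temporaries; 60, 61, 62 are the current \<open>x\<close>, \<open>e1\<close>, \<open>e2\<close>
  \<^item> 20, 21: adjacency lists; 22--26: search; 27: some arc is not tight; real 1: potential
  \<^item> 30: arcs ordered by the level of their tails; 38: the reverse order; 37: position of an arc
  \<^item> 31, 32, real 2: reached, parent arc and distance computed by \<open>spaths\<close>; 33: removed vertices;
    34: source; 35: number of rounds; real 3: distances from \<open>s\<close>
  \<^item> 36: forward arcs; 39, 40: some forward arc leaving and entering a vertex; 41, 42: tails and heads of
    back arcs
  \<^item> 43, 44: multiples of \<open>n\<close> and \<open>n * n\<close>, used to index three-dimensional tables
  \<^item> 45, 46 (ascending from \<open>y\<close>) and 47, 48 (descending from \<open>x\<close>): pairs of disjoint forward paths,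
    storing the last arcs of both paths plus 1
  \<^item> 50: successor arcs of the path being built; 51--54: walking; 56, 57: improvement found, and its last
    back arc; real 4: value of the best candidate
\<close>

definition relax :: com where
  "relax = Seq (sto 13 (NCell 30 (nv 12)))
    (When (BAnd (nNz (NCell 31 (NCell 1 (nv 13)))) (BAnd (BNot (nNz (NCell 33 (NCell 2 (nv 13)))))
        (bOr (BNot (nNz (NCell 31 (NCell 2 (nv 13)))))
          (RLess (RAdd (RCell 2 (NCell 1 (nv 13))) (RCell 0 (nv 13))) (RCell 2 (NCell 2 (nv 13)))))))
      (Seq (RStore 2 (NCell 2 (nv 13)) (RAdd (RCell 2 (NCell 1 (nv 13))) (RCell 0 (nv 13))))
      (Seq (NStore 31 (NCell 2 (nv 13)) (NConst 1)) (NStore 32 (NCell 2 (nv 13)) (nv 13)))))"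

definition spaths :: com where
  "spaths = Seq (For 10 (nv 0) (NStore 31 (nv 10) (NConst 0)))
    (Seq (NStore 31 (nv 34) (NConst 1)) (Seq (RStore 2 (nv 34) RZero)
    (For 11 (nv 35) (For 12 (NCell 0 (NConst 1)) relax))))"

lemma relax_simps [simp]:
  "loop_free relax" "nwr relax = {13, 31, 32}" "rwr relax = {2}"
  by (auto simp: relax_def)

lemma relax_cost: "max_cost relax \<le> 80"
  by (simp add: relax_def)

lemma spaths_wr [simp]: "nwr spaths = {10, 11, 12, 13, 31, 32}" "rwr spaths = {2}"
  by (auto simp: spaths_def)

context layered_arcs begin

definition inp :: "ram_state \<Rightarrow> bool" where
  "inp \<sigma> \<longleftrightarrow> nmem \<sigma> 0 0 = n \<and> nmem \<sigma> 0 (Suc 0) = m \<and> nmem \<sigma> 0 2 = s \<and> nmem \<sigma> 0 3 = t \<and>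
    (\<forall>e<m. nmem \<sigma> (Suc 0) e = ta e \<and> nmem \<sigma> 2 e = he e \<and> rmem \<sigma> 0 e = w e)"

lemma inpD: "inp \<sigma> \<Longrightarrow> nmem \<sigma> 0 0 = n" "inp \<sigma> \<Longrightarrow> nmem \<sigma> 0 (Suc 0) = m"
  "inp \<sigma> \<Longrightarrow> nmem \<sigma> 0 2 = s" "inp \<sigma> \<Longrightarrow> nmem \<sigma> 0 3 = t"
  "inp \<sigma> \<Longrightarrow> e < m \<Longrightarrow> nmem \<sigma> (Suc 0) e = ta e" "inp \<sigma> \<Longrightarrow> e < m \<Longrightarrow> nmem \<sigma> 2 e = he e"
  "inp \<sigma> \<Longrightarrow> e < m \<Longrightarrow> rmem \<sigma> 0 e = w e"
  by (auto simp: inp_def)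

lemma inp_frame: "inp \<sigma> \<Longrightarrow> frame c \<sigma> \<tau> \<Longrightarrow> 0 \<notin> nwr c \<Longrightarrow> 1 \<notin> nwr c \<Longrightarrow> 2 \<notin> nwr c \<Longrightarrow> 0 \<notin> rwr c \<Longrightarrow> inp \<tau>"
  by (auto simp: inp_def frame_def)

text \<open>
  \<open>W ord R x k i v c\<close>: a walk of weight \<open>c\<close> from \<open>x\<close> to \<open>v\<close> never entering \<open>R\<close> is found by \<open>k\<close> rounds of
  relaxing all arcs in the order \<open>ord\<close> followed by relaxing the first \<open>i\<close> arcs.
\<close>

inductive W :: "(nat \<Rightarrow> nat) \<Rightarrow> nat set \<Rightarrow> nat \<Rightarrow> nat \<Rightarrow> nat \<Rightarrow> nat \<Rightarrow> real \<Rightarrow> bool"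
  for ord :: "nat \<Rightarrow> nat" and R :: "nat set" and x :: nat where
  W_src: "W ord R x k i x 0"
| W_step: "W ord R x k j (ta (ord j)) c \<Longrightarrow> j < i \<Longrightarrow> i \<le> m \<Longrightarrow> he (ord j) \<notin> R \<Longrightarrow>
    W ord R x k i (he (ord j)) (c + w (ord j))"
| W_round: "W ord R x k m v c \<Longrightarrow> W ord R x (Suc k) i v c"

lemma W_Suc: "W ord R x k (Suc i) v c \<Longrightarrow> i < m \<Longrightarrow> W ord R x k i v c \<or>
   (v = he (ord i) \<and> he (ord i) \<notin> R \<and> (\<exists>c'. W ord R x k i (ta (ord i)) c' \<and> c = c' + w (ord i)))"
proof (erule W.cases)
  fix k' j c' i' assume *: "k = k'" "Suc i = i'" "v = he (ord j)" "c = c' + w (ord j)"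
    "W ord R x k' j (ta (ord j)) c'" "j < i'" "he (ord j) \<notin> R" "i' \<le> m"
  show ?thesis
  proof (cases "j = i")
    case False
    then have "j < i" "i \<le> m" using * by auto
    then show ?thesis using * W_step by blast
  qed (use * in auto)
qed (auto intro: W.intros)

lemma W_0: "W ord R x (Suc k) 0 v c \<Longrightarrow> v = x \<and> c = 0 \<or> W ord R x k m v c"
  "W ord R x 0 0 v c \<Longrightarrow> v = x \<and> c = 0"
  by (erule W.cases; auto)+

text \<open>The parent condition is an inequality, since the value of a parent may decrease after
  its child was set. As weights are positive, values strictly decrease along parents. The source is
  exempt from avoiding \<open>R\<close>.\<close>

definition sp_inv :: "(nat \<Rightarrow> nat) \<Rightarrow> nat set \<Rightarrow> nat \<Rightarrow> nat \<Rightarrow> nat \<Rightarrow>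
    (nat \<Rightarrow> nat) \<Rightarrow> (nat \<Rightarrow> real) \<Rightarrow> (nat \<Rightarrow> nat) \<Rightarrow> bool" where
  "sp_inv ord R x k i rc ds pr \<longleftrightarrow> rc x \<noteq> 0 \<and> ds x = 0 \<and>
    (\<forall>v<n. rc v \<noteq> 0 \<longrightarrow> 0 \<le> ds v \<and> (v \<noteq> x \<longrightarrow> pr v < m \<and> he (pr v) = v \<and> v \<notin> R \<and>
      rc (ta (pr v)) \<noteq> 0 \<and> ds (ta (pr v)) + w (pr v) \<le> ds v)) \<and>
    (\<forall>v c. W ord R x k i v c \<longrightarrow> rc v \<noteq> 0 \<and> ds v \<le> c)"

lemma sp_inv_step:
  assumes I: "sp_inv ord R x k i rc ds pr" and i: "i < m" "ord i < m" and x: "x < n"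
  shows "if rc (ta (ord i)) \<noteq> 0 \<and> he (ord i) \<notin> R \<and>
      (rc (he (ord i)) = 0 \<or> ds (ta (ord i)) + w (ord i) < ds (he (ord i)))
    then sp_inv ord R x k (Suc i) (rc(he (ord i) := Suc 0))
       (ds(he (ord i) := ds (ta (ord i)) + w (ord i))) (pr(he (ord i) := ord i))
    else sp_inv ord R x k (Suc i) rc ds pr"
proof -
  define e where "e = ord i"
  have e: "e < m" "ta e < n" "he e < n" "0 < w e" "ta e \<noteq> he e"
    using i ta_less he_less w_pos d_neq[of e] by (auto simp: e_def)
  have a: "rc x \<noteq> 0" "ds x = 0" using I by (auto simp: sp_inv_def)
  have b: "\<And>v. v < n \<Longrightarrow> rc v \<noteq> 0 \<Longrightarrow> 0 \<le> ds v"
    "\<And>v. v < n \<Longrightarrow> rc v \<noteq> 0 \<Longrightarrow> v \<noteq> x \<Longrightarrow> pr v < m \<and> he (pr v) = v \<and> v \<notin> R \<and>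
      rc (ta (pr v)) \<noteq> 0 \<and> ds (ta (pr v)) + w (pr v) \<le> ds v"
    using I by (auto simp: sp_inv_def)
  have c: "\<And>v c. W ord R x k i v c \<Longrightarrow> rc v \<noteq> 0 \<and> ds v \<le> c" using I by (auto simp: sp_inv_def)
  show ?thesis
  proof (cases "rc (ta e) \<noteq> 0 \<and> he e \<notin> R \<and> (rc (he e) = 0 \<or> ds (ta e) + w e < ds (he e))")
    case True
    \<comment> \<open>The source has value 0 and any relaxed value is positive, so its entry is
      never overwritten.\<close>
    have hx: "he e \<noteq> x" using True a b(1)[OF e(2)] e(4) by auto
    let ?rc = "rc(he e := Suc 0)" and ?ds = "ds(he e := ds (ta e) + w e)" and ?pr = "pr(he e := e)"
    have 1: "0 \<le> ?ds v \<and> (v \<noteq> x \<longrightarrow> ?pr v < m \<and> he (?pr v) = v \<and> v \<notin> R \<and>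
      ?rc (ta (?pr v)) \<noteq> 0 \<and> ?ds (ta (?pr v)) + w (?pr v) \<le> ?ds v)" if v: "v < n" "?rc v \<noteq> 0" for v
    proof (cases "v = he e")
      case True': True
      then show ?thesis using True e b(1)[OF e(2)] by auto
    next
      case False
      then have rv: "rc v \<noteq> 0" using v by auto
      \<comment> \<open>Decreasing the value of a parent can only help the inequality of its
        children.\<close>
      have "?ds (ta (pr v)) \<le> ds (ta (pr v))" if "v \<noteq> x" using True b(2)[OF v(1) rv that] by auto
      then show ?thesis using False b(1)[OF v(1) rv] b(2)[OF v(1) rv] by auto
    qed
    have dec: "rc v \<noteq> 0 \<Longrightarrow> ?rc v \<noteq> 0 \<and> ?ds v \<le> ds v" for v using True by auto
    have 2: "?rc v \<noteq> 0 \<and> ?ds v \<le> c" if "W ord R x k (Suc i) v c" for v c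
      using W_Suc[OF that i(1)]
    proof
      assume "W ord R x k i v c"
      then show ?thesis using c dec by (meson order_trans)
    next
      assume "v = he (ord i) \<and> he (ord i) \<notin> R \<and> (\<exists>c'. W ord R x k i (ta (ord i)) c' \<and> c = c' + w (ord i))"
      then obtain c' where "v = he e" "W ord R x k i (ta e) c'" "c = c' + w e" unfolding e_def by blast
      then show ?thesis using c[of "ta e" c'] by auto
    qed
    have "sp_inv ord R x k (Suc i) ?rc ?ds ?pr"
      unfolding sp_inv_def using 1 2 a hx by simp
    then show ?thesis using True unfolding e_def by simp
  next
    case False
    have 2: "rc v \<noteq> 0 \<and> ds v \<le> c" if "W ord R x k (Suc i) v c" for v c
      using W_Suc[OF that i(1)]
    proof
      assume "v = he (ord i) \<and> he (ord i) \<notin> R \<and> (\<exists>c'. W ord R x k i (ta (ord i)) c' \<and> c = c' + w (ord i))"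
      then obtain c' where "v = he e" "he e \<notin> R" "W ord R x k i (ta e) c'" "c = c' + w e"
        unfolding e_def by blast
      then show ?thesis using c[of "ta e" c'] False by auto
    qed (use c in blast)
    have "sp_inv ord R x k (Suc i) rc ds pr"
      unfolding sp_inv_def using 2 a b by blast
    then show ?thesis using False unfolding e_def by (simp only: if_False)
  qed
qed

lemma runs_spaths:
  assumes inp: "inp \<sigma>" and ord: "\<And>i. i < m \<Longrightarrow> nmem \<sigma> 30 i < m" and x: "nmem \<sigma> 34 0 = x" "x < n"
    and r: "nmem \<sigma> 35 0 = r" and R: "R = {v. nmem \<sigma> 33 v \<noteq> 0}"
    and Q: "\<And>\<tau>. sp_inv (nmem \<sigma> 30) R x r 0 (nmem \<tau> 31) (rmem \<tau> 2) (nmem \<tau> 32) \<Longrightarrow>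
      frame spaths \<sigma> \<tau> \<Longrightarrow> Q \<tau>"
    and k: "(n + 1) * 20 + 8 + (r + 1) * ((m + 1) * 100 + 20) \<le> k"
  shows "runs spaths \<sigma> Q k"
proof -
  have "runs spaths \<sigma> (\<lambda>\<tau>. sp_inv (nmem \<sigma> 30) R x r 0 (nmem \<tau> 31) (rmem \<tau> 2) (nmem \<tau> 32)) k"
    unfolding spaths_def
  proof (rule runs_Seq[where Q = "\<lambda>\<tau>. \<forall>v<n. nmem \<tau> 31 v = 0" and ?k1.0 = "(n + 1) * 20"])
    show "runs (For 10 (nv 0) (NStore 31 (nv 10) (NConst 0))) \<sigma> (\<lambda>\<tau>. \<forall>v<n. nmem \<tau> 31 v = 0) ((n + 1) * 20)"
      by (rule runs_For_run[where N = n and I = "\<lambda>i \<tau>. \<forall>v<i. nmem \<tau> 31 v = 0"])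
        (auto simp: inpD[OF inp] less_Suc_eq)
  next
    fix \<tau> assume z: "\<forall>v<n. nmem \<tau> 31 v = 0"
      and f: "frame (For 10 (nv 0) (NStore 31 (nv 10) (NConst 0))) \<sigma> \<tau>"
    have inp': "inp \<tau>" by (rule inp_frame[OF inp f]) auto
    have e: "nmem \<tau> 30 = nmem \<sigma> 30" "nmem \<tau> 33 = nmem \<sigma> 33" "nmem \<tau> 34 0 = x" "nmem \<tau> 35 0 = r"
      using frame_n[OF f] x r by auto
    show "runs (Seq (NStore 31 (nv 34) (NConst 1)) (Seq (RStore 2 (nv 34) RZero)
      (For 11 (nv 35) (For 12 (NCell 0 (NConst 1)) relax)))) \<tau>
      (\<lambda>\<tau>. sp_inv (nmem \<sigma> 30) R x r 0 (nmem \<tau> 31) (rmem \<tau> 2) (nmem \<tau> 32))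
      (8 + (r + 1) * ((m + 1) * 100 + 20))"
    proof (rule runs_Seq[OF runs_run[OF _ refl order_refl]], simp, rule runs_Seq[OF runs_run[OF _ refl order_refl]], simp)
      fix \<tau>1 \<tau>2 assume t1: "run (NStore 31 (nv 34) (NConst 1)) \<tau> = \<tau>1"
        and t2: "run (RStore 2 (nv 34) RZero) \<tau>1 = \<tau>2"
      have init: "sp_inv (nmem \<sigma> 30) R x 0 0 (nmem \<tau>2 31) (rmem \<tau>2 2) (nmem \<tau>2 32)"
        unfolding t2[symmetric] t1[symmetric] using z e x
        by (auto simp: sp_inv_def dest: W_0(2))
      have inp2: "inp \<tau>2" unfolding t2[symmetric] t1[symmetric] using inp' by (simp add: inp_def)
      have e2: "nmem \<tau>2 30 = nmem \<sigma> 30" "nmem \<tau>2 33 = nmem \<sigma> 33" "nmem \<tau>2 35 0 = r"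
        unfolding t2[symmetric] t1[symmetric] using e by simp_all
      show "runs (For 11 (nv 35) (For 12 (NCell 0 (NConst 1)) relax)) \<tau>2
        (\<lambda>\<tau>. sp_inv (nmem \<sigma> 30) R x r 0 (nmem \<tau> 31) (rmem \<tau> 2) (nmem \<tau> 32)) ((r + 1) * ((m + 1) * 100 + 20))"
      proof (rule runs_For_const[where N = r and I = "\<lambda>k \<tau>. sp_inv (nmem \<sigma> 30) R x k 0 (nmem \<tau> 31) (rmem \<tau> 2) (nmem \<tau> 32)"
            and T = "(m + 1) * 100", OF _ _ _ _ _ init])
        fix k \<tau> assume k: "k < r" and I: "sp_inv (nmem \<sigma> 30) R x k 0 (nmem \<tau> 31) (rmem \<tau> 2) (nmem \<tau> 32)"
          and f3: "frame (For 11 (nv 35) (For 12 (NCell 0 (NConst 1)) relax)) \<tau>2 \<tau>"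
        have inp3: "inp \<tau>" by (rule inp_frame[OF inp2 f3]) auto
        show "runs (For 12 (NCell 0 (NConst 1)) relax) \<tau>
          (\<lambda>\<tau>. sp_inv (nmem \<sigma> 30) R x (Suc k) 0 (nmem \<tau> 31) (rmem \<tau> 2) (nmem \<tau> 32)) ((m + 1) * 100)"
        proof (rule runs_For_run[where N = m and
              I = "\<lambda>i \<tau>. sp_inv (nmem \<sigma> 30) R x k i (nmem \<tau> 31) (rmem \<tau> 2) (nmem \<tau> 32)", OF _ _ _ _ _ _ I])
          fix i \<tau>' assume i: "i < m" "nmem \<tau>' 12 0 = i"
            and I': "sp_inv (nmem \<sigma> 30) R x k i (nmem \<tau>' 31) (rmem \<tau>' 2) (nmem \<tau>' 32)"
            and f4: "frame (For 12 (NCell 0 (NConst 1)) relax) \<tau> \<tau>'"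
          have inp4: "inp \<tau>'" by (rule inp_frame[OF inp3 f4]) auto
          have oi: "nmem \<sigma> 30 i < m" using ord i by blast
          have "nmem \<tau>' 30 = nmem \<sigma> 30" "nmem \<tau>' 33 = nmem \<sigma> 33"
            using frame_n[OF f4] frame_n[OF f3] e2 by auto
          then show "sp_inv (nmem \<sigma> 30) R x k (Suc i) (nmem (run relax \<tau>') 31) (rmem (run relax \<tau>') 2)
            (nmem (run relax \<tau>') 32)"
            using sp_inv_step[OF I' i(1) oi x(2)] i
            by (auto simp: relax_def inpD[OF inp4] oi R split: if_splits)
        next
          fix \<tau>' assume "sp_inv (nmem \<sigma> 30) R x k m (nmem \<tau>' 31) (rmem \<tau>' 2) (nmem \<tau>' 32)"
          then show "sp_inv (nmem \<sigma> 30) R x (Suc k) 0 (nmem \<tau>' 31) (rmem \<tau>' 2) (nmem \<tau>' 32)"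
            by (auto simp: sp_inv_def dest: W_0(1))
        next
          show "(m + 1) * (max_cost relax + ncost (NCell 0 (NConst 1)) + 10) \<le> (m + 1) * 100"
            using relax_cost by (intro mult_le_mono2) simp
        qed (auto simp: inpD[OF inp3])
      next
        show "(r + 1) * ((m + 1) * 100 + ncost (nv 35) + 10) \<le> (r + 1) * ((m + 1) * 100 + 20)"
          by (intro mult_le_mono2) simp
      qed (auto simp: e2)
    qed auto
  qed (use k in auto)
  then show ?thesis by (rule runs_conseq) (use Q in auto)
qed

end

subsection \<open>Detecting graphs without back arcs in linear time\<close>

definition adjacency :: com where
  "adjacency = For 14 (NCell 0 (NConst 1))
    (Seq (NStore 21 (nv 14) (NCell 20 (NCell 1 (nv 14))))
         (NStore 20 (NCell 1 (nv 14)) (NAdd (nv 14) (NConst 1))))"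

text \<open>A step treats one arc of the current adjacency list or, at the end of the list, takes
  the next vertex from the queue. With constant work per step, a single loop of
  \<open>n + m + 1\<close> rounds replaces two nested ones and the time is visibly linear.\<close>

definition search_step :: com where
  "search_step = IfThenElse (nNz (nv 26))
    (Seq (sto 15 (NSub (nv 26) (NConst 1)))
    (Seq (When (BNot (nNz (NCell 22 (NCell 2 (nv 15)))))
       (Seq (RStore 1 (NCell 2 (nv 15)) (RAdd (RCell 1 (NCell 1 (nv 15))) (RCell 0 (nv 15))))
       (Seq (NStore 22 (NCell 2 (nv 15)) (NConst 1))
       (Seq (NStore 23 (nv 25) (NCell 2 (nv 15)))
         (sto 25 (NAdd (nv 25) (NConst 1)))))))
      (sto 26 (NCell 21 (nv 15)))))
    (When (NLess (nv 24) (nv 25))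
      (Seq (sto 26 (NCell 20 (NCell 23 (nv 24)))) (sto 24 (NAdd (nv 24) (NConst 1)))))"

definition search :: com where
  "search = Seq (Seq (NStore 22 (NCell 0 (NConst 2)) (NConst 1))
      (Seq (NStore 23 (NConst 0) (NCell 0 (NConst 2))) (sto 25 (NConst 1))))
    (For 14 (NAdd (NAdd (nv 0) (NCell 0 (NConst 1))) (NConst 1)) search_step)"

definition tight_check :: com where
  "tight_check = For 14 (NCell 0 (NConst 1))
    (When (bOr (RLess (RAdd (RCell 1 (NCell 1 (nv 14))) (RCell 0 (nv 14))) (RCell 1 (NCell 2 (nv 14))))
         (RLess (RCell 1 (NCell 2 (nv 14))) (RAdd (RCell 1 (NCell 1 (nv 14))) (RCell 0 (nv 14)))))
      (sto 27 (NConst 1)))"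

definition precheck :: com where
  "precheck = Seq adjacency (Seq search tight_check)"

lemma precheck_wr [simp]:
  "nwr adjacency = {14, 20, 21}" "rwr adjacency = {}"
  "nwr search_step = {15, 22, 23, 24, 25, 26}" "rwr search_step = {1}" "loop_free search_step"
  "nwr search = {14, 15, 22, 23, 24, 25, 26}" "rwr search = {1}"
  "nwr tight_check = {14, 27}" "rwr tight_check = {}"
  "nwr precheck = {14, 15, 20, 21, 22, 23, 24, 25, 26, 27}" "rwr precheck = {1}"
  by (auto simp: adjacency_def search_step_def search_def tight_check_def precheck_def)

lemma search_step_cost: "max_cost search_step \<le> 80"
  by (simp add: search_step_def)

context layered_arcs begin

text \<open>Pointers to arcs are shifted by 1, and 0 ends a list.\<close>

definition ptr :: "nat \<Rightarrow> nat \<Rightarrow> nat \<Rightarrow> bool" where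
  "ptr u b p \<longleftrightarrow> p \<le> b \<and> (p = 0 \<or> ta (p - 1) = u) \<and> (\<forall>f. p \<le> f \<and> f < b \<longrightarrow> ta f \<noteq> u)"

lemma runs_adjacency:
  assumes inp: "inp \<sigma>" and z: "nmem \<sigma> 20 = (\<lambda>_. 0)"
  shows "runs adjacency \<sigma> (\<lambda>\<tau>. (\<forall>u. ptr u m (nmem \<tau> 20 u)) \<and> (\<forall>e<m. ptr (ta e) e (nmem \<tau> 21 e)))
    ((m + 1) * 40)"
  unfolding adjacency_def
proof (rule runs_For_run[where N = m and
      I = "\<lambda>i \<tau>. (\<forall>u. ptr u i (nmem \<tau> 20 u)) \<and> (\<forall>e<i. ptr (ta e) e (nmem \<tau> 21 e))"])
  fix i \<tau> assume i: "i < m" "nmem \<tau> 14 0 = i"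
    and I: "(\<forall>u. ptr u i (nmem \<tau> 20 u)) \<and> (\<forall>e<i. ptr (ta e) e (nmem \<tau> 21 e))"
    and f: "frame (For 14 (NCell 0 (NConst 1))
        (Seq (NStore 21 (nv 14) (NCell 20 (NCell 1 (nv 14))))
         (NStore 20 (NCell 1 (nv 14)) (NAdd (nv 14) (NConst 1))))) \<sigma> \<tau>"
  have inp': "inp \<tau>" by (rule inp_frame[OF inp f]) auto
  have "ptr u (Suc i) (if u = ta i then Suc i else nmem \<tau> 20 u)" for u
    using conjunct1[OF I, rule_format, of u] by (auto simp: ptr_def less_Suc_eq)
  moreover have "ptr (ta e) e (if e = i then nmem \<tau> 20 (ta i) else nmem \<tau> 21 e)" if "e < Suc i" for e
    using I that by (auto simp: less_Suc_eq)
  ultimately show "(\<forall>u. ptr u (Suc i) (nmem (run (Seq (NStore 21 (nv 14) (NCell 20 (NCell 1 (nv 14))))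
         (NStore 20 (NCell 1 (nv 14)) (NAdd (nv 14) (NConst 1)))) \<tau>) 20 u)) \<and>
      (\<forall>e<Suc i. ptr (ta e) e (nmem (run (Seq (NStore 21 (nv 14) (NCell 20 (NCell 1 (nv 14))))
         (NStore 20 (NCell 1 (nv 14)) (NAdd (nv 14) (NConst 1)))) \<tau>) 21 e))"
    using i by (simp add: inpD[OF inp'] fun_upd_def)
next
  show "(m + 1) * (max_cost (Seq (NStore 21 (nv 14) (NCell 20 (NCell 1 (nv 14))))
         (NStore 20 (NCell 1 (nv 14)) (NAdd (nv 14) (NConst 1)))) + ncost (NCell 0 (NConst 1)) + 10)
    \<le> (m + 1) * 40" by (intro mult_le_mono2) simp
qed (auto simp: inpD[OF inp] z ptr_def)

text \<open>The arcs treated so far. Adjacency lists descend in arc numbers and pointers are shifted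
  by 1, so \<open>cur\<close> points to the arc \<open>cur - 1\<close> and the treated arcs of the
  current vertex are those numbered \<open>cur\<close> or more.\<close>

definition seen :: "(nat \<Rightarrow> nat) \<Rightarrow> nat \<Rightarrow> nat \<Rightarrow> nat set" where
  "seen que qh cur = {f. f < m \<and> ((\<exists>j. Suc j < qh \<and> ta f = que j) \<or> (0 < qh \<and> ta f = que (qh - 1) \<and> cur \<le> f))}"

text \<open>Either the search is finished, or each of the \<open>i\<close> rounds has removed a
  vertex from the queue or treated a new arc. The potential is compared with \<open>d\<close> only
  if all arcs are forward, since otherwise the tree of the search need not consist of tight
  arcs.\<close>

definition search_inv :: "nat \<Rightarrow> (nat \<Rightarrow> nat) \<Rightarrow> (nat \<Rightarrow> nat) \<Rightarrow> nat \<Rightarrow> nat \<Rightarrow> nat \<Rightarrow> (nat \<Rightarrow> real) \<Rightarrow> bool" where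
  "search_inv i vis que qh qt cur pot \<longleftrightarrow>
    qh \<le> qt \<and> inj_on que {..<qt} \<and> que ` {..<qt} \<subseteq> {..<n} \<and> (\<forall>v. vis v \<noteq> 0 \<longleftrightarrow> v \<in> que ` {..<qt}) \<and>
    vis s \<noteq> 0 \<and> (qh = 0 \<longrightarrow> cur = 0) \<and> (cur \<noteq> 0 \<longrightarrow> cur \<le> m \<and> ta (cur - 1) = que (qh - 1)) \<and>
    (\<forall>f \<in> seen que qh cur. vis (he f) \<noteq> 0) \<and>
    ((qh = qt \<and> cur = 0) \<or> i \<le> qh + card (seen que qh cur)) \<and>
    ((\<forall>e<m. fwd e) \<and> d s = 0 \<longrightarrow> (\<forall>v. vis v \<noteq> 0 \<longrightarrow> pot v = d v))"

lemma search_invD: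
  assumes "search_inv i vis que qh qt cur pot"
  shows "qh \<le> qt" "inj_on que {..<qt}" "que ` {..<qt} \<subseteq> {..<n}" "vis v \<noteq> 0 \<longleftrightarrow> v \<in> que ` {..<qt}"
    "vis s \<noteq> 0" "qh = 0 \<Longrightarrow> cur = 0" "cur \<noteq> 0 \<Longrightarrow> cur \<le> m \<and> ta (cur - 1) = que (qh - 1)"
    "f \<in> seen que qh cur \<Longrightarrow> vis (he f) \<noteq> 0"
    "(qh = qt \<and> cur = 0) \<or> i \<le> qh + card (seen que qh cur)"
    "\<forall>e<m. fwd e \<Longrightarrow> d s = 0 \<Longrightarrow> vis v \<noteq> 0 \<Longrightarrow> pot v = d v"
  using assms unfolding search_inv_def by blast+

lemma search_invI:
  assumes "qh \<le> qt" "inj_on que {..<qt}" "que ` {..<qt} \<subseteq> {..<n}" "\<And>v. vis v \<noteq> 0 \<longleftrightarrow> v \<in> que ` {..<qt}"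
    "vis s \<noteq> 0" "qh = 0 \<Longrightarrow> cur = 0" "cur \<noteq> 0 \<Longrightarrow> cur \<le> m \<and> ta (cur - 1) = que (qh - 1)"
    "\<And>f. f \<in> seen que qh cur \<Longrightarrow> vis (he f) \<noteq> 0"
    "(qh = qt \<and> cur = 0) \<or> i \<le> qh + card (seen que qh cur)"
    "\<And>v. \<forall>e<m. fwd e \<Longrightarrow> d s = 0 \<Longrightarrow> vis v \<noteq> 0 \<Longrightarrow> pot v = d v"
  shows "search_inv i vis que qh qt cur pot"
  using assms unfolding search_inv_def by blast

lemma seen_cong:
  assumes "\<And>j. j < qh \<Longrightarrow> que j = que' j"
  shows "seen que qh cur = seen que' qh cur"
proof -
  have "(\<exists>j. Suc j < qh \<and> ta f = que j) \<longleftrightarrow> (\<exists>j. Suc j < qh \<and> ta f = que' j)" for f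
    using assms Suc_lessD by metis
  moreover have "0 < qh \<Longrightarrow> que (qh - 1) = que' (qh - 1)" using assms by simp
  ultimately show ?thesis unfolding seen_def by auto
qed

lemma search_inv_idle:
  assumes "search_inv i vis que qh qt 0 pot" "\<not> qh < qt"
  shows "search_inv (Suc i) vis que qh qt 0 pot"
  using assms unfolding search_inv_def by (elim conjE) (intro conjI; (assumption | simp))

lemma search_inv_visit:
  assumes I: "search_inv i vis que qh qt cur pot" and cur: "cur \<noteq> 0" and v: "v = he (cur - 1)" "vis v = 0"
  shows "search_inv i (vis(v := Suc 0)) (que(qt := v)) qh (Suc qt) cur (pot(v := pot (ta (cur - 1)) + w (cur - 1)))"
proof -
  note I' = search_invD[OF I]
  have q: "qh \<le> qt" "0 < qh" using I'(1,6) cur by auto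
  have c: "cur - 1 < m" "ta (cur - 1) = que (qh - 1)" using I'(7) cur by auto
  have vn: "v < n" using he_less c v by simp
  have vq: "v \<notin> que ` {..<qt}" using I'(4)[of v] v(2) by simp
  have im: "(que(qt := v)) ` {..<Suc qt} = insert v (que ` {..<qt})"
    by (auto simp: lessThan_Suc image_def)
  have "que (qh - 1) \<in> que ` {..<qt}" using q by auto
  then have vt: "vis (ta (cur - 1)) \<noteq> 0" using I'(4) c(2) by simp
  have sn: "seen (que(qt := v)) qh cur = seen que qh cur" by (rule seen_cong) (use q in simp)
  have pot: "d v = d (ta (cur - 1)) + w (cur - 1)" if "\<forall>e<m. fwd e"
    using that c v tight[of "cur - 1"] by (auto simp: fwd_def)
  have "inj_on (que(qt := v)) {..<Suc qt}" using I'(2) vq by (auto simp: lessThan_Suc inj_on_def)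
  then show ?thesis
  proof (rule search_invI[rotated], goal_cases)
    case (2 u)
    show ?case unfolding im using I'(4)[of u] by simp
  next
    case (8 u)
    then show ?case using I'(10)[OF 8(1,2)] vt pot[OF 8(1)] by auto
  qed (use im I' vn q c cur in \<open>auto simp: sn\<close>)
qed

lemma search_inv_next:
  assumes I: "search_inv i vis que qh qt cur pot" and cur: "cur \<noteq> 0" and v: "vis (he (cur - 1)) \<noteq> 0"
    and nx: "ptr (ta (cur - 1)) (cur - 1) nx"
  shows "search_inv (Suc i) vis que qh qt nx pot"
proof -
  note I' = search_invD[OF I]
  have c: "cur - 1 < m" "ta (cur - 1) = que (qh - 1)" "0 < qh" "qh \<le> qt" using I'(1,6,7) cur by auto
  \<comment> \<open>By \<open>ptr\<close> no arc of the same tail is numbered strictly between the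
    next list entry and \<open>cur - 1\<close>, so exactly one arc is added.\<close>
  have sn: "seen que qh nx = insert (cur - 1) (seen que qh cur)"
  proof -
    have "nx \<le> f \<longleftrightarrow> f = cur - 1 \<or> cur \<le> f" if "ta f = que (qh - 1)" for f
      using nx that c(2) cur unfolding ptr_def by (cases "f < cur - 1") auto
    then show ?thesis unfolding seen_def using c by blast
  qed
  have "que j \<noteq> que (qh - 1)" if "Suc j < qh" for j
  proof -
    have "j < qt" "qh - 1 < qt" "j \<noteq> qh - 1" using that c by auto
    then show ?thesis using inj_onD[OF I'(2), of j "qh - 1"] by auto
  qed
  then have "cur - 1 \<notin> seen que qh cur" using cur c(2) unfolding seen_def by force
  moreover have "finite (seen que qh cur)" unfolding seen_def by simp
  ultimately have cd: "card (seen que qh nx) = Suc (card (seen que qh cur))" unfolding sn by simp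
  have nxs: "nx \<le> m" "nx \<noteq> 0 \<longrightarrow> ta (nx - 1) = que (qh - 1)" using nx c by (auto simp: ptr_def)
  show ?thesis
  proof (rule search_invI, goal_cases)
    case (8 f)
    then show ?case using I'(8) v unfolding sn by auto
  next
    case 9
    then show ?case using I'(9) cur unfolding cd by auto
  qed (use I'(1-5,10) nxs c in auto)
qed

lemma search_inv_pop:
  assumes I: "search_inv i vis que qh qt 0 pot" and q: "qh < qt" and nx: "ptr (que qh) m nx"
  shows "search_inv (Suc i) vis que (Suc qh) qt nx pot"
proof -
  note I' = search_invD[OF I]
  have sn: "seen que (Suc qh) nx = seen que qh 0"
  proof -
    have "\<not> (f < m \<and> ta f = que qh \<and> nx \<le> f)" for f using nx by (auto simp: ptr_def)
    moreover have "(\<exists>j. j < qh \<and> ta f = que j) \<longleftrightarrow>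
      (\<exists>j. Suc j < qh \<and> ta f = que j) \<or> (0 < qh \<and> ta f = que (qh - 1))" for f
    proof
      assume "\<exists>j. j < qh \<and> ta f = que j"
      then obtain j where "j < qh" "ta f = que j" by blast
      then show "(\<exists>j. Suc j < qh \<and> ta f = que j) \<or> (0 < qh \<and> ta f = que (qh - 1))"
        by (metis Suc_lessI bot_nat_0.not_eq_extremum diff_Suc_1 not_less0)
    next
      assume "(\<exists>j. Suc j < qh \<and> ta f = que j) \<or> (0 < qh \<and> ta f = que (qh - 1))"
      then show "\<exists>j. j < qh \<and> ta f = que j" by (metis Suc_lessD diff_less zero_less_one)
    qed
    ultimately show ?thesis unfolding seen_def by auto
  qed
  have nxs: "nx \<le> m" "nx \<noteq> 0 \<longrightarrow> ta (nx - 1) = que qh" using nx by (auto simp: ptr_def)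
  show ?thesis
  proof (rule search_invI, goal_cases)
    case (8 f)
    then show ?case using I'(8) unfolding sn by auto
  next
    case 9
    then show ?case using I'(9) q unfolding sn by auto
  qed (use I'(1-5,10) nxs q in auto)
qed

text \<open>At most \<open>n\<close> vertices are taken and at most \<open>m\<close> arcs are
  treated, so after \<open>n + m + 1\<close> rounds the search is finished. The visited set is then
  closed under arcs and contains everything reachable from \<open>s\<close>.\<close>

lemma search_inv_done:
  assumes I: "search_inv (n + m + 1) vis que qh qt cur pot" and f: "\<forall>e<m. fwd e" "d s = 0" and v: "v < n"
  shows "pot v = d v"
proof -
  note I' = search_invD[OF I]
  have "qt \<le> n"
    using I'(2,3) card_mono[of "{..<n}" "que ` {..<qt}"] by (simp add: card_image)
  moreover have "card (seen que qh cur) \<le> m"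
    using card_mono[of "{..<m}" "seen que qh cur"] by (auto simp: seen_def)
  ultimately have q: "qh = qt" "cur = 0" using I'(1,9) by auto
  have cl: "vis (he e) \<noteq> 0" if te: "vis (ta e) \<noteq> 0" "e < m" for e
  proof -
    obtain j where j: "j < qt" "ta e = que j" using te I'(4)[of "ta e"] by auto
    then have "(Suc j < qh \<and> ta e = que j) \<or> (0 < qh \<and> ta e = que (qh - 1) \<and> cur \<le> e)"
      using q by (cases "Suc j = qh") auto
    then have "e \<in> seen que qh cur" using te(2) unfolding seen_def by blast
    then show ?thesis using I'(8) by blast
  qed
  have "vis v \<noteq> 0" using from_s[OF v]
  proof (induction rule: rtrancl_induct)
    case (step y z)
    then show ?case using cl by blast
  qed (use I'(5) in blast)
  then show ?thesis using I'(10) f by blast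
qed

lemma runs_search:
  assumes inp: "inp \<sigma>" and z: "\<And>a. a \<in> {22, 23, 24, 25, 26} \<Longrightarrow> nmem \<sigma> a = (\<lambda>_. 0)" "rmem \<sigma> 1 = (\<lambda>_. 0)"
    and adj: "\<forall>u. ptr u m (nmem \<sigma> 20 u)" "\<forall>e<m. ptr (ta e) e (nmem \<sigma> 21 e)"
  shows "runs search \<sigma> (\<lambda>\<tau>. (\<forall>e<m. fwd e) \<longrightarrow> d s = 0 \<longrightarrow> (\<forall>v<n. rmem \<tau> 1 v = d v)) ((n + m + 2) * 100 + 20)"
  unfolding search_def
proof (rule runs_Seq[OF runs_run[OF _ refl order_refl]], simp)
  fix \<tau>0 assume t0: "run (Seq (NStore 22 (NCell 0 (NConst 2)) (NConst 1))
      (Seq (NStore 23 (NConst 0) (NCell 0 (NConst 2))) (sto 25 (NConst 1)))) \<sigma> = \<tau>0"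
  have inp0: "inp \<tau>0" unfolding t0[symmetric] using inp by (simp add: inp_def)
  have init: "search_inv 0 (nmem \<tau>0 22) (nmem \<tau>0 23) (nmem \<tau>0 24 0) (nmem \<tau>0 25 0) (nmem \<tau>0 26 0) (rmem \<tau>0 1)"
    unfolding t0[symmetric] using z inpD(3)[OF inp] s_less by (auto simp: search_inv_def seen_def inj_on_def)
  have adj0: "\<forall>u. ptr u m (nmem \<tau>0 20 u)" "\<forall>e<m. ptr (ta e) e (nmem \<tau>0 21 e)"
    unfolding t0[symmetric] using adj by simp_all
  show "runs (For 14 (NAdd (NAdd (nv 0) (NCell 0 (NConst 1))) (NConst 1)) search_step) \<tau>0
     (\<lambda>\<tau>. (\<forall>e<m. fwd e) \<longrightarrow> d s = 0 \<longrightarrow> (\<forall>v<n. rmem \<tau> 1 v = d v)) ((n + m + 2) * 100)"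
  proof (rule runs_For_run[where N = "n + m + 1" and I = "\<lambda>i \<tau>.
      search_inv i (nmem \<tau> 22) (nmem \<tau> 23) (nmem \<tau> 24 0) (nmem \<tau> 25 0) (nmem \<tau> 26 0) (rmem \<tau> 1)", OF _ _ _ _ _ _ init])
    fix i \<tau> assume I: "search_inv i (nmem \<tau> 22) (nmem \<tau> 23) (nmem \<tau> 24 0) (nmem \<tau> 25 0) (nmem \<tau> 26 0) (rmem \<tau> 1)"
      and f: "frame (For 14 (NAdd (NAdd (nv 0) (NCell 0 (NConst 1))) (NConst 1)) search_step) \<tau>0 \<tau>"
    have inp1: "inp \<tau>" by (rule inp_frame[OF inp0 f]) auto
    have a: "\<And>u. ptr u m (nmem \<tau> 20 u)" "\<And>e. e < m \<Longrightarrow> ptr (ta e) e (nmem \<tau> 21 e)"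
      using adj0 frame_n[OF f] by auto
    let ?\<tau> = "run search_step \<tau>"
    show "search_inv (Suc i) (nmem ?\<tau> 22) (nmem ?\<tau> 23) (nmem ?\<tau> 24 0) (nmem ?\<tau> 25 0) (nmem ?\<tau> 26 0) (rmem ?\<tau> 1)"
    proof (cases "nmem \<tau> 26 0 = 0")
      case True
      show ?thesis
      proof (cases "nmem \<tau> 24 0 < nmem \<tau> 25 0")
        case q: True
        show ?thesis using search_inv_pop[OF I[unfolded True] q a(1)] True q by (simp add: search_step_def)
      next
        case False
        show ?thesis using search_inv_idle[OF I[unfolded True] False] True False by (simp add: search_step_def)
      qed
    next
      case False
      then have c: "nmem \<tau> 26 0 - 1 < m" using search_invD(7)[OF I] by arith
      then have c': "nmem \<tau> 26 0 - Suc 0 < m" by simp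
      show ?thesis
      proof (cases "nmem \<tau> 22 (he (nmem \<tau> 26 0 - 1)) = 0")
        case True
        show ?thesis
          using search_inv_next[OF search_inv_visit[OF I False refl True] False _ a(2)[OF c]] False True
          by (simp add: search_step_def inpD[OF inp1] c')
      next
        case v: False
        show ?thesis
          using search_inv_next[OF I False v a(2)[OF c]] False v
          by (simp add: search_step_def inpD[OF inp1] c')
      qed
    qed
  next
    show "(n + m + 1 + 1) * (max_cost search_step + ncost (NAdd (NAdd (nv 0) (NCell 0 (NConst 1))) (NConst 1)) + 10)
      \<le> (n + m + 2) * 100" using search_step_cost by (intro mult_le_mono) simp_all
  qed (use search_inv_done in \<open>auto simp: inpD[OF inp0]\<close>)
qed auto

text \<open>A flag of 0 comes with a potential for which every arc is tight, which by
  \<open>potential_no_nsp\<close> settles the instance; and the flag is 0 whenever there is no back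
  arc, so the expensive part is then skipped.\<close>

lemma runs_precheck:
  assumes inp: "inp \<sigma>" and z: "\<And>a. a \<in> {20..27} \<Longrightarrow> nmem \<sigma> a = (\<lambda>_. 0)" "rmem \<sigma> 1 = (\<lambda>_. 0)"
  shows "runs precheck \<sigma> (\<lambda>\<tau>. ((\<forall>e<m. fwd e) \<longrightarrow> d s = 0 \<longrightarrow> nmem \<tau> 27 0 = 0) \<and>
     (nmem \<tau> 27 0 = 0 \<longrightarrow> (\<forall>e<m. rmem \<tau> 1 (ta e) + w e = rmem \<tau> 1 (he e)))) ((n + m + 2) * 240)"
  unfolding precheck_def
proof (rule runs_Seq[OF runs_adjacency[OF inp]])
  fix \<tau> assume adj: "(\<forall>u. ptr u m (nmem \<tau> 20 u)) \<and> (\<forall>e<m. ptr (ta e) e (nmem \<tau> 21 e))"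
    and f: "frame adjacency \<sigma> \<tau>"
  have inp1: "inp \<tau>" by (rule inp_frame[OF inp f]) auto
  show "runs (Seq search tight_check) \<tau> (\<lambda>\<tau>. ((\<forall>e<m. fwd e) \<longrightarrow> d s = 0 \<longrightarrow> nmem \<tau> 27 0 = 0) \<and>
     (nmem \<tau> 27 0 = 0 \<longrightarrow> (\<forall>e<m. rmem \<tau> 1 (ta e) + w e = rmem \<tau> 1 (he e)))) ((n + m + 2) * 100 + 20 + (m + 1) * 60)"
  proof (rule runs_Seq[OF runs_search[OF inp1]])
    fix \<tau>1 assume p: "(\<forall>e<m. fwd e) \<longrightarrow> d s = 0 \<longrightarrow> (\<forall>v<n. rmem \<tau>1 1 v = d v)" and f1: "frame search \<tau> \<tau>1"
    have inp2: "inp \<tau>1" by (rule inp_frame[OF inp1 f1]) auto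
    have z27: "nmem \<tau>1 27 0 = 0" using frame_n[OF f1] frame_n[OF f] z(1)[of 27] by simp
    show "runs tight_check \<tau>1 (\<lambda>\<tau>. ((\<forall>e<m. fwd e) \<longrightarrow> d s = 0 \<longrightarrow> nmem \<tau> 27 0 = 0) \<and>
     (nmem \<tau> 27 0 = 0 \<longrightarrow> (\<forall>e<m. rmem \<tau> 1 (ta e) + w e = rmem \<tau> 1 (he e)))) ((m + 1) * 60)"
      unfolding tight_check_def
    proof (rule runs_For_run[where N = m and I = "\<lambda>i \<tau>. (nmem \<tau> 27 0 = 0 \<longleftrightarrow>
       (\<forall>e<i. rmem \<tau>1 1 (ta e) + w e = rmem \<tau>1 1 (he e)))"], goal_cases)
      case (8 i \<tau>)
      have inp3: "inp \<tau>" by (rule inp_frame[OF inp2 8(4)]) auto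
      have "rmem \<tau> 1 = rmem \<tau>1 1" using frame_r[OF 8(4)] by simp
      then show ?case using 8(1-3) by (auto simp: inpD[OF inp3] less_Suc_eq)
    next
      case (9 \<tau>)
      have e: "rmem \<tau> 1 = rmem \<tau>1 1" using frame_r[OF 9(2)] by simp
      have "d (ta e) + w e = d (he e)" if "\<forall>e<m. fwd e" "e < m" for e
        using that tight[of e] by (auto simp: fwd_def)
      then show ?case using 9(1) p ta_less he_less unfolding e by auto
    next
      case 10
      show ?case by (intro mult_le_mono2) simp
    qed (auto simp: inpD[OF inp2] z27)
  qed (use adj z frame_n[OF f] frame_r[OF f] in auto)
qed (use z in auto)

text \<open>The weight of a path telescopes to a difference of potentials, so all paths from
  \<open>s\<close> to \<open>t\<close> have the excess of a forward one, which is 0.\<close>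

lemma potential_no_nsp:
  assumes p: "\<forall>e<m. pot (ta e) + w e = (pot (he e) :: real)"
  shows "\<not> nsp S k"
proof
  have eq: "WP a S b k \<Longrightarrow> k = (pot b - pot a) - (d b - d a)" for a S b k
    by (induction rule: WP.induct) (use p in \<open>auto simp: exc_def\<close>)
  assume "nsp S k"
  then have "WP s S t k" "0 < k" by (auto simp: nsp_def)
  moreover obtain T where "FP s T t" using ex_FP_s t_less by blast
  ultimately show False using eq[of s S t k] eq[OF FP_WP] by fastforce
qed

end

subsection \<open>Distances, levels and orders\<close>

text \<open>The levels are still unknown, so the arcs are relaxed in their given order and
  \<open>n\<close> rounds are made.\<close>

definition distances :: com where
  "distances = Seq (For 14 (NCell 0 (NConst 1)) (NStore 30 (nv 14) (nv 14)))
    (Seq (Seq (sto 34 (NCell 0 (NConst 2))) (sto 35 (nv 0)))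
    (Seq spaths (For 14 (nv 0) (RStore 3 (nv 14) (RCell 2 (nv 14))))))"

definition classify :: com where
  "classify = For 14 (NCell 0 (NConst 1))
    (IfThenElse (RLess (RCell 3 (NCell 1 (nv 14))) (RCell 3 (NCell 2 (nv 14))))
      (Seq (NStore 36 (nv 14) (NConst 1)) (Seq (NStore 39 (NCell 1 (nv 14)) (nv 14)) (NStore 40 (NCell 2 (nv 14)) (nv 14))))
      (Seq (NStore 41 (NCell 1 (nv 14)) (NConst 1)) (NStore 42 (NCell 2 (nv 14)) (NConst 1))))"

definition rank_step :: com where
  "rank_step = When (bOr (RLess (RCell 3 (NCell 1 (nv 15))) (RCell 3 (NCell 1 (nv 14))))
      (BAnd (BNot (RLess (RCell 3 (NCell 1 (nv 14))) (RCell 3 (NCell 1 (nv 15))))) (NLess (nv 15) (nv 14))))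
    (NStore 37 (nv 14) (NAdd (NCell 37 (nv 14)) (NConst 1)))"

text \<open>Counting predecessors instead of sorting takes quadratic time in \<open>m\<close>, which
  the bound permits as soon as there is a back arc.\<close>

definition rank :: com where
  "rank = For 14 (NCell 0 (NConst 1)) (For 15 (NCell 0 (NConst 1)) rank_step)"

definition arrange :: com where
  "arrange = For 14 (NCell 0 (NConst 1))
    (Seq (NStore 30 (NCell 37 (nv 14)) (nv 14))
      (NStore 38 (NSub (NSub (NCell 0 (NConst 1)) (NConst 1)) (NCell 37 (nv 14))) (nv 14)))"

definition count_heads :: com where
  "count_heads = Seq (sto 35 (NConst 1))
     (For 14 (nv 0) (When (nNz (NCell 42 (nv 14))) (sto 35 (NAdd (nv 35) (NConst 1)))))"

text \<open>The machine cannot multiply, so the multiples are obtained by repeated addition. The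
  index \<open>n\<close> is included because cell \<open>n\<close> of array 43, which holds
  \<open>n * n\<close>, is the increment of the second table.\<close>

definition offsets :: com where
  "offsets = Seq (For 14 (nv 0) (NStore 43 (NAdd (nv 14) (NConst 1)) (NAdd (NCell 43 (nv 14)) (nv 0))))
     (For 14 (nv 0) (NStore 44 (NAdd (nv 14) (NConst 1)) (NAdd (NCell 44 (nv 14)) (NCell 43 (nv 0)))))"

definition prepare :: com where
  "prepare = Seq distances (Seq classify (Seq rank (Seq arrange (Seq count_heads offsets))))"

lemma prepare_wr [simp]:
  "nwr distances = {10, 11, 12, 13, 14, 30, 31, 32, 34, 35}" "rwr distances = {2, 3}"
  "nwr classify = {14, 36, 39, 40, 41, 42}" "rwr classify = {}"
  "nwr rank_step = {37}" "rwr rank_step = {}" "loop_free rank_step"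
  "nwr rank = {14, 15, 37}" "rwr rank = {}"
  "nwr arrange = {14, 30, 38}" "rwr arrange = {}"
  "nwr count_heads = {14, 35}" "rwr count_heads = {}"
  "nwr offsets = {14, 43, 44}" "rwr offsets = {}"
  "nwr prepare = {10, 11, 12, 13, 14, 15, 30, 31, 32, 34, 35, 36, 37, 38, 39, 40, 41, 42, 43, 44}" "rwr prepare = {2, 3}"
  by (auto simp: distances_def classify_def rank_step_def rank_def arrange_def count_heads_def offsets_def prepare_def)

section \<open>Correctness of the distances and of the preparation\<close>

context layered_arcs begin

text \<open>Follow parent arcs down to the source: values strictly decrease, which justifies the
  induction, and no arc gains more in \<open>d\<close> than its weight.\<close>

lemma sp_lower:
  assumes I: "sp_inv ord R x k i rc ds pr" and x: "x < n"
  shows "v < n \<Longrightarrow> rc v \<noteq> 0 \<Longrightarrow> d v - d x \<le> ds v"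
proof (induction v rule: measure_induct_rule[of "\<lambda>v. card {u. u < n \<and> rc u \<noteq> 0 \<and> ds u < ds v}"])
  case (less v)
  show ?case
  proof (cases "v = x")
    case True
    then show ?thesis using I by (simp add: sp_inv_def)
  next
    case False
    define e where "e = pr v"
    have e: "e < m" "he e = v" "rc (ta e) \<noteq> 0" "ds (ta e) + w e \<le> ds v"
      using I less.prems False unfolding sp_inv_def e_def by blast+
    have lt: "ds (ta e) < ds v" using e(4) w_pos[OF e(1)] by linarith
    have "{u. u < n \<and> rc u \<noteq> 0 \<and> ds u < ds (ta e)} \<subset> {u. u < n \<and> rc u \<noteq> 0 \<and> ds u < ds v}"
      using lt ta_less[OF e(1)] e(3) by force
    then have "card {u. u < n \<and> rc u \<noteq> 0 \<and> ds u < ds (ta e)} < card {u. u < n \<and> rc u \<noteq> 0 \<and> ds u < ds v}"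
      by (intro psubset_card_mono) auto
    then have "d (ta e) - d x \<le> ds (ta e)" using less.IH ta_less[OF e(1)] e(3) by blast
    moreover have "d v \<le> d (ta e) + w e" using exc_nonneg[OF e(1)] e(2) by (simp add: exc_def)
    ultimately show ?thesis using e(4) by linarith
  qed
qed

lemma W_mono: "W ord R x k i v c \<Longrightarrow> i \<le> j \<Longrightarrow> j \<le> m \<Longrightarrow> W ord R x k j v c"
  by (erule W.cases) (auto intro: W.intros)

lemma W_mono_round: "W ord R x k m v c \<Longrightarrow> k < l \<Longrightarrow> W ord R x l i v c"
proof (induction l arbitrary: i)
  case (Suc l)
  show ?case
  proof (cases "k = l")
    case True
    then show ?thesis using Suc.prems W_round by blast
  next
    case False
    then show ?thesis using Suc W_round by simp
  qed
qed auto

text \<open>Whatever the order of relaxation, each round finds at least one more arc of the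
  path.\<close>

lemma W_FP: "FP s S v \<Longrightarrow> W (\<lambda>e. e) {} s (card S) 0 v (d v - d s)"
proof (induction "card S" arbitrary: S v rule: less_induct)
  case less
  show ?case
  proof (cases "v = s")
    case True
    then show ?thesis using W_src[of _ _ s] by simp
  next
    case False
    have fin: "v \<in> S" "finite S" using FP_V[OF less.prems] by auto
    obtain e where e: "fwd e" "ta e \<in> S" "he e = v"
      using FP_pred[OF less.prems fin(1) False] by blast
    let ?S = "{u \<in> S. d u \<le> d (ta e)}"
    have "v \<notin> ?S" using e by (auto simp: fwd_def)
    then have "card ?S < card S" using fin by (intro psubset_card_mono) auto
    then have "W (\<lambda>e. e) {} s (card ?S) 0 (ta e) (d (ta e) - d s)"
      using less.hyps FP_lower[OF less.prems e(2)] by blast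
    then have "W (\<lambda>e. e) {} s (card ?S) e (ta e) (d (ta e) - d s)"
      using W_mono e(1) by (simp add: fwd_def)
    then have "W (\<lambda>e. e) {} s (card ?S) m (he e) (d (ta e) - d s + w e)"
      using W_step[of "\<lambda>e. e" "{}" s "card ?S" e _ m] e(1) by (simp add: fwd_def)
    moreover have "d (ta e) - d s + w e = d v - d s" using tight[of e] e by (auto simp: fwd_def)
    ultimately have "W (\<lambda>e. e) {} s (card ?S) m v (d v - d s)" using e(3) by simp
    then show ?thesis using W_mono_round \<open>card ?S < card S\<close> by blast
  qed
qed

lemma W_cong:
  "W ord R x k i v c \<Longrightarrow> (\<And>j. j < m \<Longrightarrow> ord j = ord' j) \<Longrightarrow> W ord' R x k i v c"
proof (induction rule: W.induct)
  case (W_step k j c i)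
  then have "ord j = ord' j" by simp
  then show ?case using W_step W.W_step[of ord' R x k j c i] by simp
qed (auto intro: W.W_src W.W_round)

lemma sp_distances:
  assumes I: "sp_inv ord {} s n 0 rc ds pr" and ord: "\<And>j. j < m \<Longrightarrow> ord j = j" and s: "d s = 0" and v: "v < n"
  shows "ds v = d v"
proof -
  obtain S where S: "FP s S v" using ex_FP_s[OF v] by blast
  have "card S \<le> n" using FP_V[OF S] card_mono[of "{..<n}" S] by simp
  then have "W (\<lambda>e. e) {} s n 0 v (d v - d s)"
    using W_FP[OF S] W_mono[of "\<lambda>e. e" "{}" s "card S" 0 v "d v - d s" m] W_mono_round
    by (cases "card S = n") auto
  then have "W ord {} s n 0 v (d v)" using W_cong ord s by fastforce
  then have "rc v \<noteq> 0 \<and> ds v \<le> d v" using I unfolding sp_inv_def by blast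
  then show ?thesis using sp_lower[OF I s_less v] s by simp
qed

lemma runs_distances:
  assumes inp: "inp \<sigma>" and z: "nmem \<sigma> 33 = (\<lambda>_. 0)" and s: "d s = 0"
  shows "runs distances \<sigma> (\<lambda>\<tau>. (\<forall>v<n. rmem \<tau> 3 v = d v) \<and> (\<forall>i<m. nmem \<tau> 30 i < m)) ((n + 1) * ((m + 1) * 300))"
  unfolding distances_def
proof (rule runs_Seq[where Q = "\<lambda>\<tau>. \<forall>i<m. nmem \<tau> 30 i = i" and ?k1.0 = "(m + 1) * 20"
    and ?k2.0 = "10 + ((n + 1) * 20 + 8 + (n + 1) * ((m + 1) * 100 + 20) + (n + 1) * 20)"], goal_cases)
  case 1
  show ?case
    by (rule runs_For_run[where N = m and I = "\<lambda>i \<tau>. \<forall>v<i. nmem \<tau> 30 v = v"])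
        (auto simp: inpD[OF inp] less_Suc_eq)
next
  case (2 \<tau>)
  have inp1: "inp \<tau>" by (rule inp_frame[OF inp 2(2)]) auto
  have z1: "nmem \<tau> 33 = (\<lambda>_. 0)" using frame_n[OF 2(2)] z by simp
  show ?case
  proof (rule runs_Seq_run[where ?k2.0 = "(n + 1) * 20 + 8 + (n + 1) * ((m + 1) * 100 + 20) + (n + 1) * 20"], simp, goal_cases)
    case (1 \<tau>1)
    have inp2: "inp \<tau>1" unfolding 1(1) using inp1 by (simp add: inp_def)
    have e: "nmem \<tau>1 33 = (\<lambda>_. 0)" "nmem \<tau>1 34 0 = s" "nmem \<tau>1 35 0 = n" "nmem \<tau>1 30 = nmem \<tau> 30"
      unfolding 1(1) using z1 inpD[OF inp1] by simp_all
    show ?case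
    proof (rule runs_Seq[where Q = "\<lambda>\<tau>. \<forall>v<n. rmem \<tau> 2 v = d v" and
        ?k1.0 = "(n + 1) * 20 + 8 + (n + 1) * ((m + 1) * 100 + 20)" and ?k2.0 = "(n + 1) * 20"], goal_cases)
      case 1
      show ?case
        by (rule runs_spaths[OF inp2 _ e(2) s_less e(3) refl _ order_refl])
          (use 2(1) e s sp_distances in auto)
    next
      case (2 \<tau>2)
      have inp3: "inp \<tau>2" by (rule inp_frame[OF inp2 2(2)]) auto
      have o: "\<forall>i<m. nmem \<tau>2 30 i < m" using frame_n[OF 2(2)] e(4) \<open>\<forall>i<m. nmem \<tau> 30 i = i\<close> by simp
      show ?case
      proof (rule runs_For_run[where N = n and I = "\<lambda>i \<tau>. \<forall>v<i. rmem \<tau> 3 v = d v" and k = "(n + 1) * 20"], goal_cases)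
        case (8 i \<tau>3)
        have "rmem \<tau>3 2 = rmem \<tau>2 2" using frame_r[OF 8(4)] by simp
        then show ?case using 8(1-3) 2(1) by (auto simp: less_Suc_eq)
      next
        case (9 \<tau>3)
        then show ?case using o frame_n[OF 9(2)] by simp
      qed (auto simp: inpD[OF inp3])
    qed auto
  qed auto
next
  case 3
  have "(m + 1) * 20 + ((10 :: nat) + ((n + 1) * 20 + 8 + (n + 1) * ((m + 1) * 100 + 20) + (n + 1) * 20)) \<le> (n + 1) * ((m + 1) * 300)"
    by (simp add: algebra_simps)
  then show ?case by simp
qed

section \<open>The order of the arcs by level\<close>

definition prec :: "nat \<Rightarrow> nat \<Rightarrow> bool" where
  "prec f e \<longleftrightarrow> d (ta f) < d (ta e) \<or> d (ta f) = d (ta e) \<and> f < e"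

text \<open>Ties within a level are broken by arc number, so the number of predecessors is a
  bijection onto the positions.\<close>

definition pos :: "nat \<Rightarrow> nat" where
  "pos e = card {f. f < m \<and> prec f e}"

lemma pos_less_iff: "e < m \<Longrightarrow> f < m \<Longrightarrow> prec f e \<Longrightarrow> pos f < pos e"
  unfolding pos_def by (intro psubset_card_mono psubsetI) (auto simp: prec_def)

lemma pos_less: "e < m \<Longrightarrow> pos e < m"
proof -
  assume "e < m"
  then have "{f. f < m \<and> prec f e} \<subset> {..<m}" by (auto simp: prec_def)
  then have "card {f. f < m \<and> prec f e} < card {..<m}" by (intro psubset_card_mono) auto
  then show ?thesis by (simp add: pos_def)
qed

lemma pos_mono: "e < m \<Longrightarrow> f < m \<Longrightarrow> d (ta f) < d (ta e) \<Longrightarrow> pos f < pos e"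
  using pos_less_iff by (simp add: prec_def)

lemma pos_inj: "e < m \<Longrightarrow> f < m \<Longrightarrow> pos e = pos f \<Longrightarrow> e = f"
  using pos_less_iff[of e f] pos_less_iff[of f e] unfolding prec_def
  by (metis less_irrefl linorder_neqE_nat linorder_neqE_linordered_idom)

definition classified :: "ram_state \<Rightarrow> bool" where
  "classified \<tau> \<longleftrightarrow> (\<forall>e<m. nmem \<tau> 36 e \<noteq> 0 \<longleftrightarrow> fwd e) \<and>
    (\<forall>e. fwd e \<longrightarrow> fwd (nmem \<tau> 39 (ta e)) \<and> ta (nmem \<tau> 39 (ta e)) = ta e) \<and>
    (\<forall>e. fwd e \<longrightarrow> fwd (nmem \<tau> 40 (he e)) \<and> he (nmem \<tau> 40 (he e)) = he e) \<and>
    (\<forall>v. nmem \<tau> 41 v \<noteq> 0 \<longleftrightarrow> (\<exists>e<m. \<not> fwd e \<and> ta e = v)) \<and>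
    (\<forall>v. nmem \<tau> 42 v \<noteq> 0 \<longleftrightarrow> (\<exists>e<m. \<not> fwd e \<and> he e = v))"

lemma runs_classify:
  assumes inp: "inp \<sigma>" and D: "\<forall>v<n. rmem \<sigma> 3 v = d v"
    and z: "nmem \<sigma> 36 = (\<lambda>_. 0)" "nmem \<sigma> 41 = (\<lambda>_. 0)" "nmem \<sigma> 42 = (\<lambda>_. 0)"
  shows "runs classify \<sigma> classified ((m + 1) * 100)"
  unfolding classify_def
proof (rule runs_For_run[where N = m and I = "\<lambda>i \<tau>. (\<forall>e. nmem \<tau> 36 e \<noteq> 0 \<longleftrightarrow> e < i \<and> fwd e) \<and>
    (\<forall>e<i. fwd e \<longrightarrow> fwd (nmem \<tau> 39 (ta e)) \<and> ta (nmem \<tau> 39 (ta e)) = ta e) \<and>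
    (\<forall>e<i. fwd e \<longrightarrow> fwd (nmem \<tau> 40 (he e)) \<and> he (nmem \<tau> 40 (he e)) = he e) \<and>
    (\<forall>v. nmem \<tau> 41 v \<noteq> 0 \<longleftrightarrow> (\<exists>e<i. \<not> fwd e \<and> ta e = v)) \<and>
    (\<forall>v. nmem \<tau> 42 v \<noteq> 0 \<longleftrightarrow> (\<exists>e<i. \<not> fwd e \<and> he e = v))"], goal_cases)
  case (8 i \<tau>)
  have inp1: "inp \<tau>" by (rule inp_frame[OF inp 8(4)]) auto
  have D1: "rmem \<tau> 3 = rmem \<sigma> 3" using frame_r[OF 8(4)] by simp
  have f: "fwd i \<longleftrightarrow> rmem \<sigma> 3 (ta i) < rmem \<sigma> 3 (he i)"
    using D ta_less[OF 8(1)] he_less[OF 8(1)] 8(1) by (simp add: fwd_def)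
  note I = 8(3)[THEN conjunct1] 8(3)[THEN conjunct2, THEN conjunct1] 8(3)[THEN conjunct2, THEN conjunct2, THEN conjunct1]
    8(3)[THEN conjunct2, THEN conjunct2, THEN conjunct2, THEN conjunct1]
    8(3)[THEN conjunct2, THEN conjunct2, THEN conjunct2, THEN conjunct2]
  show ?case
  proof (cases "fwd i")
    case True
    show ?thesis using f True 8(1,2) I
      by (simp add: inpD[OF inp1] D1 less_Suc_eq) (safe, blast+)
  next
    case False
    show ?thesis using f False 8(1,2) I
      by (simp add: inpD[OF inp1] D1 less_Suc_eq) (safe, blast+)
  qed
next
  case (9 \<tau>)
  then show ?case unfolding classified_def using fwd_def by blast
next
  case 10
  show ?case by (intro mult_le_mono2) simp
qed (auto simp: inpD[OF inp] z)

lemma runs_rank: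
  assumes inp: "inp \<sigma>" and D: "\<forall>v<n. rmem \<sigma> 3 v = d v" and z: "nmem \<sigma> 37 = (\<lambda>_. 0)"
  shows "runs rank \<sigma> (\<lambda>\<tau>. \<forall>e<m. nmem \<tau> 37 e = pos e) ((m + 1) * ((m + 1) * 100))"
  unfolding rank_def
proof (rule runs_For_const[where N = m and T = "(m + 1) * 80" and I = "\<lambda>i \<tau>. nmem \<tau> 37 = (\<lambda>e. if e < i then pos e else 0)"], goal_cases)
  case (7 i \<tau>)
  have inp1: "inp \<tau>" by (rule inp_frame[OF inp 7(4)]) auto
  show ?case
  proof (rule runs_For_run[where N = m and I = "\<lambda>j \<tau>. nmem \<tau> 37 = (\<lambda>e. if e < i then pos e else
      if e = i then card {f. f < j \<and> prec f i} else 0)"], goal_cases)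
    case (8 j \<tau>1)
    have inp2: "inp \<tau>1" by (rule inp_frame[OF inp1 8(4)]) auto
    have D1: "rmem \<tau>1 3 = rmem \<sigma> 3" using frame_r[OF 8(4)] frame_r[OF 7(4)] by simp
    have i: "nmem \<tau>1 14 0 = i" using frame_n[OF 8(4)] 7(2) by simp
    have p: "prec j i \<longleftrightarrow> bval (bOr (RLess (RCell 3 (NCell 1 (nv 15))) (RCell 3 (NCell 1 (nv 14))))
      (BAnd (BNot (RLess (RCell 3 (NCell 1 (nv 14))) (RCell 3 (NCell 1 (nv 15))))) (NLess (nv 15) (nv 14)))) \<tau>1"
      using D ta_less[OF 8(1)] ta_less[OF 7(1)] 8(1,2) 7(1) i by (auto simp: prec_def D1 inpD[OF inp2])
    have "{f. f < Suc j \<and> prec f i} = (if prec j i then insert j {f. f < j \<and> prec f i} else {f. f < j \<and> prec f i})"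
      by (auto simp: less_Suc_eq)
    then have c: "card {f. f < Suc j \<and> prec f i} = (if prec j i then Suc (card {f. f < j \<and> prec f i}) else card {f. f < j \<and> prec f i})"
      by simp
    show ?case unfolding rank_step_def c p using 8(2,3) i by (auto simp del: bexp_simps simp: fun_eq_iff)
  next
    case (9 \<tau>1)
    then show ?case by (auto simp: pos_def fun_eq_iff less_Suc_eq)
  next
    case 10
    show ?case by (intro mult_le_mono2) (simp add: rank_step_def)
  qed (use 7(3) in \<open>auto simp: inpD[OF inp1]\<close>)
next
  case 9
  show ?case by (intro mult_le_mono2) simp
qed (auto simp: inpD[OF inp] z)

lemma runs_arrange:
  assumes inp: "inp \<sigma>" and p: "\<forall>e<m. nmem \<sigma> 37 e = pos e" and z: "nmem \<sigma> 38 = (\<lambda>_. 0)" "\<forall>i<m. nmem \<sigma> 30 i < m"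
  shows "runs arrange \<sigma> (\<lambda>\<tau>. (\<forall>i<m. nmem \<tau> 30 i < m \<and> nmem \<tau> 38 i < m) \<and>
    (\<forall>e<m. nmem \<tau> 30 (pos e) = e \<and> nmem \<tau> 38 (m - 1 - pos e) = e)) ((m + 1) * 40)"
  unfolding arrange_def
proof (rule runs_For_run[where N = m and I = "\<lambda>i \<tau>. (\<forall>i<m. nmem \<tau> 30 i < m \<and> nmem \<tau> 38 i < m) \<and>
    (\<forall>e<i. nmem \<tau> 30 (pos e) = e \<and> nmem \<tau> 38 (m - 1 - pos e) = e)"], goal_cases)
  case (8 i \<tau>)
  have inp1: "inp \<tau>" by (rule inp_frame[OF inp 8(4)]) auto
  have p1: "nmem \<tau> 37 i = pos i" using frame_n[OF 8(4)] p 8(1) by simp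
  have ne: "pos e \<noteq> pos i" "m - Suc 0 - pos e \<noteq> m - Suc 0 - pos i" if "e < i" for e
  proof -
    show "pos e \<noteq> pos i" using pos_inj[of e i] that 8(1) by auto
    then show "m - Suc 0 - pos e \<noteq> m - Suc 0 - pos i" using pos_less[of e] pos_less[of i] that 8(1) by simp
  qed
  show ?case using 8(1-3) ne by (auto simp: inpD[OF inp1] p1 less_Suc_eq)
next
  case 10
  show ?case by (intro mult_le_mono2) simp
qed (use z in \<open>auto simp: inpD[OF inp]\<close>)

lemma runs_count_heads:
  assumes inp: "inp \<sigma>"
  shows "runs count_heads \<sigma> (\<lambda>\<tau>. nmem \<tau> 35 0 = Suc (card {v. v < n \<and> nmem \<sigma> 42 v \<noteq> 0})) ((n + 1) * 40)"
  unfolding count_heads_def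
proof (rule runs_Seq_run[where ?k2.0 = "(n + 1) * 35"], simp, goal_cases)
  case (1 \<tau>)
  have inp1: "inp \<tau>" unfolding 1(1) using inp by (simp add: inp_def)
  have e: "nmem \<tau> 42 = nmem \<sigma> 42" "nmem \<tau> 35 0 = 1" unfolding 1(1) by simp_all
  show ?case
  proof (rule runs_For_run[where N = n and k = "(n + 1) * 35" and
      I = "\<lambda>i \<tau>. nmem \<tau> 35 0 = Suc (card {v. v < i \<and> nmem \<sigma> 42 v \<noteq> 0})"], goal_cases)
    case (8 i \<tau>1)
    have "nmem \<tau>1 42 = nmem \<sigma> 42" using frame_n[OF 8(4)] e by simp
    moreover have "{v. v < Suc i \<and> nmem \<sigma> 42 v \<noteq> 0} = (if nmem \<sigma> 42 i \<noteq> 0 then insert i {v. v < i \<and> nmem \<sigma> 42 v \<noteq> 0}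
      else {v. v < i \<and> nmem \<sigma> 42 v \<noteq> 0})" by (auto simp: less_Suc_eq)
    ultimately show ?case using 8(2,3) by simp
  qed (use e in \<open>auto simp: inpD[OF inp1]\<close>)
qed auto

lemma runs_offsets:
  assumes inp: "inp \<sigma>" and z: "nmem \<sigma> 43 = (\<lambda>_. 0)" "nmem \<sigma> 44 = (\<lambda>_. 0)"
  shows "runs offsets \<sigma> (\<lambda>\<tau>. \<forall>v\<le>n. nmem \<tau> 43 v = v * n \<and> nmem \<tau> 44 v = v * (n * n)) ((n + 1) * 60)"
  unfolding offsets_def
proof (rule runs_Seq[where Q = "\<lambda>\<tau>. \<forall>v\<le>n. nmem \<tau> 43 v = v * n" and ?k1.0 = "(n + 1) * 30" and ?k2.0 = "(n + 1) * 30"], goal_cases)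
  case 1
  show ?case
  proof (rule runs_For_run[where N = n and I = "\<lambda>i \<tau>. \<forall>v\<le>i. nmem \<tau> 43 v = v * n"], goal_cases)
    case (8 i \<tau>1)
    have inp1: "inp \<tau>1" by (rule inp_frame[OF inp 8(4)]) auto
    show ?case using 8(2,3) by (auto simp: inpD[OF inp1] le_Suc_eq)
  qed (auto simp: inpD[OF inp] z)
next
  case (2 \<tau>)
  have inp1: "inp \<tau>" by (rule inp_frame[OF inp 2(2)]) auto
  have z1: "nmem \<tau> 44 = (\<lambda>_. 0)" using frame_n[OF 2(2)] z by simp
  show ?case
  proof (rule runs_For_run[where N = n and I = "\<lambda>i \<tau>. \<forall>v\<le>i. nmem \<tau> 44 v = v * (n * n)"], goal_cases)
    case (8 i \<tau>1)
    have inp2: "inp \<tau>1" by (rule inp_frame[OF inp1 8(4)]) auto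
    have "nmem \<tau>1 43 n = n * n" using frame_n[OF 8(4)] 2(1) by simp
    then show ?case using 8(2,3) by (auto simp: inpD[OF inp2] le_Suc_eq)
  next
    case (9 \<tau>1)
    have "nmem \<tau>1 43 = nmem \<tau> 43" using frame_n[OF 9(2)] by simp
    then show ?case using 9(1) 2(1) by simp
  qed (auto simp: inpD[OF inp1] z1)
qed auto

definition prep :: "ram_state \<Rightarrow> bool" where
  "prep \<tau> \<longleftrightarrow> inp \<tau> \<and> (\<forall>v<n. rmem \<tau> 3 v = d v) \<and> classified \<tau> \<and>
    (\<forall>i<m. nmem \<tau> 30 i < m \<and> nmem \<tau> 38 i < m) \<and>
    (\<forall>e<m. nmem \<tau> 30 (pos e) = e \<and> nmem \<tau> 38 (m - 1 - pos e) = e) \<and>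
    nmem \<tau> 35 0 = Suc (card {v. v < n \<and> nmem \<tau> 42 v \<noteq> 0}) \<and>
    (\<forall>v\<le>n. nmem \<tau> 43 v = v * n \<and> nmem \<tau> 44 v = v * (n * n))"

lemma prep_frame:
  "prep \<sigma> \<Longrightarrow> frame c \<sigma> \<tau> \<Longrightarrow> nwr c \<inter> {0, 1, 2, 30, 35, 36, 38, 39, 40, 41, 42, 43, 44} = {} \<Longrightarrow>
   rwr c \<inter> {0, 3} = {} \<Longrightarrow> prep \<tau>"
  unfolding prep_def classified_def frame_def inp_def by simp

lemma runs_prepare:
  assumes inp: "inp \<sigma>" and z: "\<And>a. a \<in> {33..44} \<Longrightarrow> nmem \<sigma> a = (\<lambda>_. 0)" and s: "d s = 0"
  shows "runs prepare \<sigma> prep ((m + 1) * ((n + m + 1) * 1000))"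
  unfolding prepare_def
proof (rule runs_Seq[OF runs_distances[OF inp _ s], where ?k2.0 = "((m + 1) * 100 + ((m + 1) * ((m + 1) * 100) + ((m + 1) * 40 + ((n + 1) * 40 + (n + 1) * 60))))"], goal_cases)
  case (2 \<tau>1)
  note f1 = frame_n[OF 2(2)] and p1 = 2(1)
  have inp1: "inp \<tau>1" by (rule inp_frame[OF inp 2(2)]) auto
  show ?case
  proof (rule runs_Seq[OF runs_classify[OF inp1], where ?k2.0 = "((m + 1) * ((m + 1) * 100) + ((m + 1) * 40 + ((n + 1) * 40 + (n + 1) * 60)))"], goal_cases)
    case (5 \<tau>2)
    note f2 = frame_n[OF 5(2)] frame_r[OF 5(2)] and p2 = 5(1)
    have inp2: "inp \<tau>2" by (rule inp_frame[OF inp1 5(2)]) auto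
    show ?case
    proof (rule runs_Seq[OF runs_rank[OF inp2], where ?k2.0 = "((m + 1) * 40 + ((n + 1) * 40 + (n + 1) * 60))"], goal_cases)
      case (3 \<tau>3)
      note f3 = frame_n[OF 3(2)] frame_r[OF 3(2)] and p3 = 3(1)
      have inp3: "inp \<tau>3" by (rule inp_frame[OF inp2 3(2)]) auto
      show ?case
      proof (rule runs_Seq[OF runs_arrange[OF inp3 p3], where ?k2.0 = "((n + 1) * 40 + (n + 1) * 60)"], goal_cases)
        case (3 \<tau>4)
        note f4 = frame_n[OF 3(2)] frame_r[OF 3(2)] and p4 = 3(1)
        have inp4: "inp \<tau>4" by (rule inp_frame[OF inp3 3(2)]) auto
        show ?case
        proof (rule runs_Seq[OF runs_count_heads[OF inp4], where ?k2.0 = "(n + 1) * 60"], goal_cases)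
          case (1 \<tau>5)
          note f5 = frame_n[OF 1(2)] frame_r[OF 1(2)] and p5 = 1(1)
          have inp5: "inp \<tau>5" by (rule inp_frame[OF inp4 1(2)]) auto
          show ?case
          proof (rule runs_conseq[OF runs_offsets[OF inp5]], goal_cases)
            case (3 \<tau>6)
            note f6 = frame_n[OF 3(2)] frame_r[OF 3(2)] and p6 = 3(1)
            have "inp \<tau>6" by (rule inp_frame[OF inp5 3(2)]) auto
            moreover have "classified \<tau>6" using p2 unfolding classified_def by (simp add: f3 f4 f5 f6)
            moreover have "\<forall>v<n. rmem \<tau>6 3 v = d v" using p1 by (simp add: f2 f3 f4 f5 f6)
            ultimately show ?case using p4 p5 p6 unfolding prep_def by (simp add: f5 f6)
          qed (use z in \<open>auto simp: f1 f2 f3 f4 f5\<close>)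
        next
          case 2
          show ?case by (rule order_refl)
        qed
      next
        case 4
        show ?case by (rule order_refl)
      qed (use z p1 in \<open>auto simp: f1 f2 f3\<close>)
    next
      case 4
      show ?case by (rule order_refl)
    qed (use z p1 in \<open>auto simp: f1 f2\<close>)
  next
    case 6
    show ?case by (rule order_refl)
  qed (use z p1 in \<open>auto simp: f1\<close>)
next
  case 3
  show ?case by (simp add: algebra_simps)
qed (use z in auto)

end

subsection \<open>Tables of pairs of disjoint forward paths\<close>

abbreviation pix :: "nexp \<Rightarrow> nexp \<Rightarrow> nexp \<Rightarrow> nexp" where
  "pix z a b \<equiv> NAdd (NAdd (NCell 44 z) (NCell 43 a)) b"

text \<open>One path of the pair is to have its far end at \<open>z\<close>, the other one passes
  through some \<open>a\<close> on the same level. The rest of the latter lies beyond that level and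
  cannot meet the former, so every \<open>a\<close> other than \<open>z\<close> is a valid start.
  The entry 1 is a marker, not an arc: walks stop at \<open>z\<close>.\<close>

definition pair_base :: "nat \<Rightarrow> com" where
  "pair_base T1 = For 14 (nv 0) (When (BAnd (BNot (nEq (nv 14) (nv 16)))
      (BAnd (BNot (RLess (RCell 3 (nv 14)) (RCell 3 (nv 16)))) (BNot (RLess (RCell 3 (nv 16)) (RCell 3 (nv 14))))))
    (NStore T1 (pix (nv 16) (nv 14) (nv 16)) (NConst 1)))"

definition pair_step :: "nat \<Rightarrow> nat \<Rightarrow> nat \<Rightarrow> nat \<Rightarrow> com" where
  "pair_step t h T1 T2 = When (BAnd (nNz (NCell 36 (nv 17))) (BAnd (nNz (NCell 36 (nv 15)))
      (BAnd (BNot (nEq (NCell h (nv 17)) (NCell h (nv 15))))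
        (nNz (NCell T1 (pix (nv 16) (NCell t (nv 17)) (NCell t (nv 15))))))))
    (Seq (NStore T1 (pix (nv 16) (NCell h (nv 17)) (NCell h (nv 15))) (NAdd (nv 17) (NConst 1)))
      (NStore T2 (pix (nv 16) (NCell h (nv 17)) (NCell h (nv 15))) (NAdd (nv 15) (NConst 1))))"

text \<open>Exchanging the arrays of tails and heads and reversing the order turns ascending pairs
  into descending ones, so one program fills both tables.\<close>

definition pair_table :: "nat \<Rightarrow> nat \<Rightarrow> nat \<Rightarrow> nat \<Rightarrow> nat \<Rightarrow> nat \<Rightarrow> com" where
  "pair_table t h ord fl T1 T2 = For 16 (nv 0) (When (nNz (NCell fl (nv 16))) (Seq (pair_base T1)
    (For 14 (NCell 0 (NConst 1)) (Seq (sto 17 (NCell ord (nv 14)))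
      (For 15 (NCell 0 (NConst 1)) (pair_step t h T1 T2))))))"

lemma pair_wr [simp]:
  "nwr (pair_base T1) = {14, T1}" "rwr (pair_base T1) = {}"
  "nwr (pair_step t h T1 T2) = {T1, T2}" "rwr (pair_step t h T1 T2) = {}" "loop_free (pair_step t h T1 T2)"
  "nwr (pair_table t h ord fl T1 T2) = {14, 15, 16, 17, T1, T2}" "rwr (pair_table t h ord fl T1 T2) = {}"
  by (auto simp: pair_base_def pair_step_def pair_table_def)

lemma pair_step_cost: "max_cost (pair_step t h T1 T2) \<le> 130"
  by (simp add: pair_step_def)

lemma sum_if_le: "(\<Sum>i<n. if P i then K else (c::nat)) \<le> n * c + card {i. i < n \<and> P i} * K"
proof (induction n)
  case (Suc n)
  have "{i. i < Suc n \<and> P i} = (if P n then insert n {i. i < n \<and> P i} else {i. i < n \<and> P i})"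
    by (auto simp: less_Suc_eq)
  then have "card {i. i < Suc n \<and> P i} = card {i. i < n \<and> P i} + (if P n then 1 else 0)" by simp
  then show ?case using Suc.IH by auto
qed auto

section \<open>Encoding, validity and completeness of the pair tables\<close>

context layered_arcs begin

definition cell :: "nat \<Rightarrow> nat \<Rightarrow> nat \<Rightarrow> nat" where
  "cell z a b = z * (n * n) + a * n + b"

text \<open>A number in base \<open>n\<close> whose leading digit \<open>z\<close> may be
  arbitrarily large.\<close>

lemma cell_inj:
  assumes "a < n" "b < n" "a' < n" "b' < n" "cell z a b = cell z' a' b'"
  shows "z = z' \<and> a = a' \<and> b = b'"
proof -
  have eq: "(z * n + a) * n + b = (z' * n + a') * n + b'" using assms(5) by (simp add: cell_def algebra_simps)
  have b: "b = b'" using arg_cong[OF eq, of "\<lambda>k. k mod n"] assms by simp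
  then have eq2: "z * n + a = z' * n + a'" using eq assms(1) by simp
  have a: "a = a'" using arg_cong[OF eq2, of "\<lambda>k. k mod n"] assms by simp
  then show ?thesis using eq2 b assms(1) by simp
qed

text \<open>
  The two paths of a pair proceed level by level, so they are disjoint iff they differ on each level. The
  second one starts at \<open>z\<close>.
\<close>

definition tab_valid :: "(nat \<Rightarrow> nat) \<Rightarrow> (nat \<Rightarrow> nat) \<Rightarrow> (nat \<Rightarrow> nat) \<Rightarrow> (nat \<Rightarrow> nat) \<Rightarrow> nat \<Rightarrow> bool" where
  "tab_valid tt hh U1 U2 z \<longleftrightarrow> (\<forall>a<n. \<forall>b<n. U1 (cell z a b) \<noteq> 0 \<longrightarrow> a \<noteq> b \<and> d a = d b \<and>
    (b = z \<or> (\<exists>e f. fwd e \<and> fwd f \<and> U1 (cell z a b) = Suc e \<and> U2 (cell z a b) = Suc f \<and> hh e = a \<and> hh f = b \<and>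
      U1 (cell z (tt e) (tt f)) \<noteq> 0)))"

text \<open>The pairs that are certain to be found once the first \<open>i\<close> arcs have been
  treated. The index orders only the arcs of the first path, since the inner loop offers all arcs to
  the second one. An entry at the tails must be certain before arc number \<open>j\<close> is
  treated.\<close>

inductive PW :: "(nat \<Rightarrow> nat) \<Rightarrow> (nat \<Rightarrow> nat) \<Rightarrow> (nat \<Rightarrow> nat) \<Rightarrow> nat \<Rightarrow> nat \<Rightarrow> nat \<Rightarrow> nat \<Rightarrow> bool"
  for ord tt hh :: "nat \<Rightarrow> nat" and z :: nat where
  PW_base: "a < n \<Longrightarrow> a \<noteq> z \<Longrightarrow> d a = d z \<Longrightarrow> PW ord tt hh z i a z"
| PW_step: "PW ord tt hh z j (tt (ord j)) (tt f) \<Longrightarrow> j < i \<Longrightarrow> i \<le> m \<Longrightarrow> fwd (ord j) \<Longrightarrow> fwd f \<Longrightarrow>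
    hh (ord j) \<noteq> hh f \<Longrightarrow> PW ord tt hh z i (hh (ord j)) (hh f)"

lemma PW_Suc: "PW ord tt hh z (Suc i) a b \<Longrightarrow> PW ord tt hh z i a b \<or>
   (\<exists>f. a = hh (ord i) \<and> b = hh f \<and> fwd (ord i) \<and> fwd f \<and> hh (ord i) \<noteq> hh f \<and> PW ord tt hh z i (tt (ord i)) (tt f))"
proof (erule PW.cases)
  fix j f i' assume *: "Suc i = i'" "a = hh (ord j)" "b = hh f" "PW ord tt hh z j (tt (ord j)) (tt f)" "j < i'"
    "i' \<le> m" "fwd (ord j)" "fwd f" "hh (ord j) \<noteq> hh f"
  show ?thesis
  proof (cases "j = i")
    case False
    then have "j < i" "i \<le> m" using * by auto
    then show ?thesis using * PW_step by blast
  qed (use * in blast)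
qed (auto intro: PW_base)

definition tab_inv where
  "tab_inv ord tt hh z i j U1 U2 V1 V2 \<longleftrightarrow> tab_valid tt hh U1 U2 z \<and>
    (\<forall>a b. PW ord tt hh z i a b \<longrightarrow> U1 (cell z a b) \<noteq> 0) \<and>
    (\<forall>f<j. fwd (ord i) \<and> fwd f \<and> hh (ord i) \<noteq> hh f \<and> PW ord tt hh z i (tt (ord i)) (tt f) \<longrightarrow>
       U1 (cell z (hh (ord i)) (hh f)) \<noteq> 0) \<and>
    (\<forall>z' a b. z' \<noteq> z \<longrightarrow> a < n \<longrightarrow> b < n \<longrightarrow> U1 (cell z' a b) = V1 (cell z' a b) \<and> U2 (cell z' a b) = V2 (cell z' a b))"

lemma tab_inv_step:
  assumes I: "tab_inv ord tt hh z i j U1 U2 V1 V2" and b: "i < m" "j < m" "ord i < m" "z < n"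
    and bd: "\<And>e. e < m \<Longrightarrow> tt e < n \<and> hh e < n"
    and lev: "\<And>e f. fwd e \<Longrightarrow> fwd f \<Longrightarrow> d (tt e) = d (tt f) \<Longrightarrow> d (hh e) = d (hh f)"
  shows "if fwd (ord i) \<and> fwd j \<and> hh (ord i) \<noteq> hh j \<and> U1 (cell z (tt (ord i)) (tt j)) \<noteq> 0
    then tab_inv ord tt hh z i (Suc j) (U1(cell z (hh (ord i)) (hh j) := Suc (ord i)))
       (U2(cell z (hh (ord i)) (hh j) := Suc j)) V1 V2
    else tab_inv ord tt hh z i (Suc j) U1 U2 V1 V2"
proof -
  define e where "e = ord i"
  have e: "e < m" "tt e < n" "hh e < n" "tt j < n" "hh j < n" using b bd by (auto simp: e_def)
  have v: "tab_valid tt hh U1 U2 z" and pw: "\<And>a b. PW ord tt hh z i a b \<Longrightarrow> U1 (cell z a b) \<noteq> 0"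
    and fj: "\<And>f. f < j \<Longrightarrow> fwd e \<Longrightarrow> fwd f \<Longrightarrow> hh e \<noteq> hh f \<Longrightarrow> PW ord tt hh z i (tt e) (tt f) \<Longrightarrow>
      U1 (cell z (hh e) (hh f)) \<noteq> 0"
    and oth: "\<And>z' a b. z' \<noteq> z \<Longrightarrow> a < n \<Longrightarrow> b < n \<Longrightarrow> U1 (cell z' a b) = V1 (cell z' a b) \<and> U2 (cell z' a b) = V2 (cell z' a b)"
    using I unfolding tab_inv_def e_def by blast+
  show ?thesis
  proof (cases "fwd e \<and> fwd j \<and> hh e \<noteq> hh j \<and> U1 (cell z (tt e) (tt j)) \<noteq> 0")
    case True
    define c where "c = cell z (hh e) (hh j)"
    let ?U1 = "U1(c := Suc e)" and ?U2 = "U2(c := Suc j)"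
    \<comment> \<open>Entries may be overwritten by another last pair of arcs but never return to 0,
      so older links keep leading to valid entries.\<close>
    have nz: "U1 k \<noteq> 0 \<Longrightarrow> ?U1 k \<noteq> 0" for k by simp
    have "d (tt e) = d (tt j)" using v True e(2,4) unfolding tab_valid_def by blast
    then have dl: "d (hh e) = d (hh j)" using lev True by blast
    have 1: "tab_valid tt hh ?U1 ?U2 z"
      unfolding tab_valid_def
    proof (intro allI impI)
      fix a' b' assume ab: "a' < n" "b' < n" "?U1 (cell z a' b') \<noteq> 0"
      show "a' \<noteq> b' \<and> d a' = d b' \<and> (b' = z \<or> (\<exists>e f. fwd e \<and> fwd f \<and> ?U1 (cell z a' b') = Suc e \<and>
        ?U2 (cell z a' b') = Suc f \<and> hh e = a' \<and> hh f = b' \<and> ?U1 (cell z (tt e) (tt f)) \<noteq> 0))"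
      proof (cases "cell z a' b' = c")
        case c: True
        then have "a' = hh e" "b' = hh j" using cell_inj[OF ab(1,2) e(3,5)] by (auto simp: c_def)
        moreover have "?U1 (cell z (tt e) (tt j)) \<noteq> 0" using True nz by blast
        ultimately show ?thesis using True dl c by auto
      next
        case False
        then have "U1 (cell z a' b') \<noteq> 0" using ab(3) by simp
        then have "a' \<noteq> b' \<and> d a' = d b' \<and> (b' = z \<or> (\<exists>e f. fwd e \<and> fwd f \<and> U1 (cell z a' b') = Suc e \<and>
          U2 (cell z a' b') = Suc f \<and> hh e = a' \<and> hh f = b' \<and> U1 (cell z (tt e) (tt f)) \<noteq> 0))"
          using v ab(1,2) unfolding tab_valid_def by blast
        then show ?thesis using False nz by auto
      qed
    qed
    have 2: "?U1 (cell z (hh e) (hh f)) \<noteq> 0"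
      if "f < Suc j" "fwd e" "fwd f" "hh e \<noteq> hh f" "PW ord tt hh z i (tt e) (tt f)" for f
      using that fj nz by (cases "f = j") (auto simp: c_def)
    have 3: "?U1 (cell z' a b) = V1 (cell z' a b) \<and> ?U2 (cell z' a b) = V2 (cell z' a b)"
      if "z' \<noteq> z" "a < n" "b < n" for z' a b
    proof -
      have "cell z' a b \<noteq> c" using cell_inj[OF that(2,3) e(3,5)] that(1) by (auto simp: c_def)
      then show ?thesis using oth[OF that] by simp
    qed
    have "tab_inv ord tt hh z i (Suc j) ?U1 ?U2 V1 V2"
      unfolding tab_inv_def e_def[symmetric] using 1 2 3 pw nz by blast
    then show ?thesis using True unfolding e_def c_def by simp
  next
    case False
    have 2: "U1 (cell z (hh e) (hh f)) \<noteq> 0"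
      if "f < Suc j" "fwd e" "fwd f" "hh e \<noteq> hh f" "PW ord tt hh z i (tt e) (tt f)" for f
      using that fj pw False by (cases "f = j") auto
    have "tab_inv ord tt hh z i (Suc j) U1 U2 V1 V2"
      unfolding tab_inv_def e_def[symmetric] using v 2 oth pw by blast
    then show ?thesis using False unfolding e_def by (simp only: if_False)
  qed
qed

lemma tab_inv_round:
  assumes "tab_inv ord tt hh z i m U1 U2 V1 V2"
  shows "tab_inv ord tt hh z (Suc i) 0 U1 U2 V1 V2"
proof -
  have "U1 (cell z a b) \<noteq> 0" if "PW ord tt hh z (Suc i) a b" for a b
    using PW_Suc[OF that]
  proof
    assume "\<exists>f. a = hh (ord i) \<and> b = hh f \<and> fwd (ord i) \<and> fwd f \<and> hh (ord i) \<noteq> hh f \<and> PW ord tt hh z i (tt (ord i)) (tt f)"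
    then obtain f where f: "a = hh (ord i)" "b = hh f" "fwd (ord i)" "fwd f" "hh (ord i) \<noteq> hh f" "PW ord tt hh z i (tt (ord i)) (tt f)"
      by blast
    then have "f < m" by (simp add: fwd_def)
    then show ?thesis using assms f unfolding tab_inv_def by blast
  qed (use assms in \<open>unfold tab_inv_def, blast\<close>)
  then show ?thesis using assms unfolding tab_inv_def by blast
qed

definition tab :: "(nat \<Rightarrow> nat) \<Rightarrow> (nat \<Rightarrow> nat) \<Rightarrow> (nat \<Rightarrow> nat) \<Rightarrow> (nat \<Rightarrow> nat) \<Rightarrow> (nat \<Rightarrow> nat) \<Rightarrow> nat \<Rightarrow> bool" where
  "tab ord tt hh U1 U2 z \<longleftrightarrow> tab_valid tt hh U1 U2 z \<and> (\<forall>a b. PW ord tt hh z m a b \<longrightarrow> U1 (cell z a b) \<noteq> 0)"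

lemma tab_cong:
  assumes "tab ord tt hh U1 U2 z" "\<And>a b. a < n \<Longrightarrow> b < n \<Longrightarrow> U1 (cell z a b) = V1 (cell z a b) \<and> U2 (cell z a b) = V2 (cell z a b)"
    and bd: "\<And>e. e < m \<Longrightarrow> tt e < n \<and> hh e < n" and z: "z < n"
  shows "tab ord tt hh V1 V2 z"
proof -
  have "PW ord tt hh z i a b \<Longrightarrow> a < n \<and> b < n" for i a b
    by (erule PW.cases) (use bd z in \<open>auto simp: fwd_def\<close>)
  then have 1: "\<forall>a b. PW ord tt hh z m a b \<longrightarrow> V1 (cell z a b) \<noteq> 0"
    using assms(1,2) unfolding tab_def by metis
  have "tab_valid tt hh V1 V2 z"
    unfolding tab_valid_def
  proof (intro allI impI)
    fix a b assume ab: "a < n" "b < n" "V1 (cell z a b) \<noteq> 0"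
    then have "U1 (cell z a b) \<noteq> 0" using assms(2) by simp
    then have *: "a \<noteq> b \<and> d a = d b \<and> (b = z \<or> (\<exists>e f. fwd e \<and> fwd f \<and> U1 (cell z a b) = Suc e \<and> U2 (cell z a b) = Suc f \<and> hh e = a \<and> hh f = b \<and>
      U1 (cell z (tt e) (tt f)) \<noteq> 0))" using assms(1) ab unfolding tab_def tab_valid_def by blast
    show "a \<noteq> b \<and> d a = d b \<and> (b = z \<or> (\<exists>e f. fwd e \<and> fwd f \<and> V1 (cell z a b) = Suc e \<and> V2 (cell z a b) = Suc f \<and> hh e = a \<and> hh f = b \<and>
      V1 (cell z (tt e) (tt f)) \<noteq> 0))"
    proof (cases "b = z")
      case False
      then obtain e f where "fwd e" "fwd f" "U1 (cell z a b) = Suc e" "U2 (cell z a b) = Suc f" "hh e = a" "hh f = b"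
        "U1 (cell z (tt e) (tt f)) \<noteq> 0" using * by blast
      moreover from this have "V1 (cell z (tt e) (tt f)) \<noteq> 0"
        using assms(2)[of "tt e" "tt f"] bd by (auto simp: fwd_def)
      ultimately show ?thesis using * assms(2)[OF ab(1,2)] by auto
    qed (use * in blast)
  qed
  then show ?thesis using 1 unfolding tab_def by blast
qed

lemma prepD:
  assumes "prep \<tau>"
  shows "inp \<tau>" "v < n \<Longrightarrow> rmem \<tau> 3 v = d v" "classified \<tau>" "i < m \<Longrightarrow> nmem \<tau> 30 i < m" "i < m \<Longrightarrow> nmem \<tau> 38 i < m"
    "e < m \<Longrightarrow> nmem \<tau> 30 (pos e) = e" "e < m \<Longrightarrow> nmem \<tau> 38 (m - 1 - pos e) = e"
    "nmem \<tau> 35 0 = Suc (card {v. v < n \<and> nmem \<tau> 42 v \<noteq> 0})"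
    "v \<le> n \<Longrightarrow> nmem \<tau> 43 v = v * n" "v \<le> n \<Longrightarrow> nmem \<tau> 44 v = v * (n * n)" "e < m \<Longrightarrow> nmem \<tau> 36 e \<noteq> 0 \<longleftrightarrow> fwd e"
  using assms unfolding prep_def classified_def by auto

lemma runs_pair_table:
  assumes P: "prep \<sigma>" and ids: "ti < 3" "h < 3" "ord \<in> {30, 38}" "fl \<in> {41, 42}" "T1 > 44" "T2 > 44" "T1 \<noteq> T2"
    and th: "\<And>e. e < m \<Longrightarrow> nmem \<sigma> ti e = tt e" "\<And>e. e < m \<Longrightarrow> nmem \<sigma> h e = hh e"
    and bd: "\<And>e. e < m \<Longrightarrow> tt e < n \<and> hh e < n"
    and lev: "\<And>e f. fwd e \<Longrightarrow> fwd f \<Longrightarrow> d (tt e) = d (tt f) \<Longrightarrow> d (hh e) = d (hh f)"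
    and z: "nmem \<sigma> T1 = (\<lambda>_. 0)"
  shows "runs (pair_table ti h ord fl T1 T2) \<sigma>
    (\<lambda>\<tau>. \<forall>z<n. nmem \<sigma> fl z \<noteq> 0 \<longrightarrow> tab (nmem \<sigma> ord) tt hh (nmem \<tau> T1) (nmem \<tau> T2) z)
    ((n + 1) * 40 + card {z. z < n \<and> nmem \<sigma> fl z \<noteq> 0} * ((n + 1) * 60 + (m + 1) * ((m + 1) * 200)))"
proof -
  define ordf where "ordf = nmem \<sigma> ord"
  define K where "K = (n + 1) * 60 + (m + 1) * ((m + 1) * 200)"
  have ofl: "ordf i < m" if "i < m" for i using ids(3) prepD(4,5)[OF P that] by (auto simp: ordf_def)
  have idn: "fl \<noteq> T1" "fl \<noteq> T2" "fl \<noteq> 14" "fl \<noteq> 15" "fl \<noteq> 16" "fl \<noteq> 17" "ord \<noteq> T1" "ord \<noteq> T2" "ord \<noteq> 14" "ord \<noteq> 15" "ord \<noteq> 16" "ord \<noteq> 17"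
    "ti \<noteq> T1" "ti \<noteq> T2" "ti \<noteq> 14" "ti \<noteq> 15" "ti \<noteq> 16" "ti \<noteq> 17" "h \<noteq> T1" "h \<noteq> T2" "h \<noteq> 14" "h \<noteq> 15" "h \<noteq> 16" "h \<noteq> 17"
    "T1 \<noteq> 14" "T1 \<noteq> 15" "T1 \<noteq> 16" "T1 \<noteq> 17" "T2 \<noteq> 14" "T2 \<noteq> 15" "T2 \<noteq> 16" "T2 \<noteq> 17"
    "T1 \<notin> {0, 1, 2, 30, 35, 36, 38, 39, 40, 41, 42, 43, 44}" "T2 \<notin> {0, 1, 2, 30, 35, 36, 38, 39, 40, 41, 42, 43, 44}"
    using ids by auto
  let ?I = "\<lambda>z \<tau>. (\<forall>z'<z. nmem \<sigma> fl z' \<noteq> 0 \<longrightarrow> tab ordf tt hh (nmem \<tau> T1) (nmem \<tau> T2) z') \<and>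
     (\<forall>z' a b. z \<le> z' \<longrightarrow> a < n \<longrightarrow> b < n \<longrightarrow> nmem \<tau> T1 (cell z' a b) = 0)"
  show ?thesis
    unfolding pair_table_def ordf_def[symmetric]
  proof (rule runs_For[where N = n and I = ?I and T = "\<lambda>z. if nmem \<sigma> fl z \<noteq> 0 then K + 10 else 10"], goal_cases)
    case (7 zz \<tau>)
    note f7 = frame_n[OF 7(4)] frame_r[OF 7(4)]
    have P1: "prep \<tau>" by (rule prep_frame[OF P 7(4)]) (use idn in auto)
    have flz: "nmem \<tau> fl = nmem \<sigma> fl" using f7 idn by simp
    show ?case
    proof (rule runs_When[where k = "if nmem \<sigma> fl zz \<noteq> 0 then K else 0"], goal_cases)
      case 1
      then have fz: "nmem \<sigma> fl zz \<noteq> 0" using 7(2) flz by simp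
      have "runs (Seq (pair_base T1) (For 14 (NCell 0 (NConst 1)) (Seq (sto 17 (NCell ord (nv 14)))
          (For 15 (NCell 0 (NConst 1)) (pair_step ti h T1 T2))))) \<tau> (?I (Suc zz)) K"
      proof (rule runs_Seq[where Q = "\<lambda>\<tau>'. tab_inv ordf tt hh zz 0 0 (nmem \<tau>' T1) (nmem \<tau>' T2) (nmem \<tau> T1) (nmem \<tau> T2)"
            and ?k1.0 = "(n + 1) * 60" and ?k2.0 = "(m + 1) * ((m + 1) * 200)"], goal_cases)
        case 1
        let ?J = "\<lambda>i U. (\<forall>a<n. \<forall>b<n. U (cell zz a b) \<noteq> 0 \<longleftrightarrow> a < i \<and> b = zz \<and> a \<noteq> zz \<and> d a = d zz) \<and>
            (\<forall>z' a b. z' \<noteq> zz \<longrightarrow> a < n \<longrightarrow> b < n \<longrightarrow> U (cell z' a b) = nmem \<tau> T1 (cell z' a b))"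
        show ?case unfolding pair_base_def
        proof (rule runs_For_run[where N = n and I = "\<lambda>i \<tau>'. ?J i (nmem \<tau>' T1)"], goal_cases)
          case (8 i \<tau>1)
          note f8 = frame_n[OF 8(4)] frame_r[OF 8(4)]
          have P2: "prep \<tau>1" by (rule prep_frame[OF P1 8(4)]) (use idn in auto)
          have zz: "nmem \<tau>1 16 0 = zz" using f8 7(2) idn by simp
          have c: "nmem \<tau>1 44 zz + nmem \<tau>1 43 i + zz = cell zz i zz"
            using prepD(9,10)[OF P2] 7(1) 8(1) by (simp add: cell_def)
          have eqd: "(\<not> rmem \<tau>1 3 i < rmem \<tau>1 3 zz \<and> \<not> rmem \<tau>1 3 zz < rmem \<tau>1 3 i) \<longleftrightarrow> d i = d zz"
            using prepD(2)[OF P2] 7(1) 8(1) by auto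
          show ?case
          proof (cases "i \<noteq> zz \<and> d i = d zz")
            case True
            have "?J (Suc i) ((nmem \<tau>1 T1)(cell zz i zz := 1))"
            proof (intro conjI allI impI)
              fix a b assume ab: "a < n" "b < n"
              have "cell zz a b = cell zz i zz \<longleftrightarrow> a = i \<and> b = zz" using cell_inj[OF ab 8(1) 7(1)] by auto
              then show "((nmem \<tau>1 T1)(cell zz i zz := 1)) (cell zz a b) \<noteq> 0 \<longleftrightarrow> a < Suc i \<and> b = zz \<and> a \<noteq> zz \<and> d a = d zz"
                using 8(3) ab True by (auto simp: less_Suc_eq)
            next
              fix z' a b assume ab: "z' \<noteq> zz" "a < n" "b < n"
              have "cell z' a b \<noteq> cell zz i zz" using cell_inj[OF ab(2,3) 8(1) 7(1)] ab(1) by auto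
              then show "((nmem \<tau>1 T1)(cell zz i zz := 1)) (cell z' a b) = nmem \<tau> T1 (cell z' a b)"
                using 8(3) ab by simp
            qed
            then show ?thesis using True zz 8(2) c eqd by simp
          next
            case False
            have "?J (Suc i) (nmem \<tau>1 T1)" using 8(3) False by (auto simp: less_Suc_eq)
            then show ?thesis using False zz 8(2) c eqd by (simp del: not_less; blast)
          qed
        next
          case (9 \<tau>1)
          note f9 = frame_n[OF 9(2)]
          have u2: "nmem \<tau>1 T2 = nmem \<tau> T2" using f9 idn ids(7) by simp
          have v: "tab_valid tt hh (nmem \<tau>1 T1) (nmem \<tau>1 T2) zz"
            using 9(1) unfolding tab_valid_def by blast
          have "PW ordf tt hh zz 0 a b \<Longrightarrow> a < n \<and> b = zz \<and> a \<noteq> zz \<and> d a = d zz" for a b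
            by (erule PW.cases) auto
          then have "\<forall>a b. PW ordf tt hh zz 0 a b \<longrightarrow> nmem \<tau>1 T1 (cell zz a b) \<noteq> 0" using 9(1) 7(1) by blast
          then show ?case unfolding tab_inv_def u2 using v[unfolded u2] 9(1) by simp
        next
          case 10
          show ?case by (intro mult_le_mono2) simp
        qed (use 7(1,3) inpD(1)[OF prepD(1)[OF P1]] idn in auto)
      next
        case (2 \<tau>1)
        note f2 = frame_n[OF 2(2)] frame_r[OF 2(2)]
        have P2: "prep \<tau>1" by (rule prep_frame[OF P1 2(2)]) (use idn in auto)
        have e2: "nmem \<tau>1 ti = nmem \<sigma> ti" "nmem \<tau>1 h = nmem \<sigma> h" "nmem \<tau>1 ord = ordf" "nmem \<tau>1 16 0 = zz"
          using f2 f7 idn 7(2) by (auto simp: ordf_def)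
        show ?case
        proof (rule runs_For_const[where N = m and T = "(m + 1) * 150 + 5" and
            I = "\<lambda>i \<tau>'. tab_inv ordf tt hh zz i 0 (nmem \<tau>' T1) (nmem \<tau>' T2) (nmem \<tau> T1) (nmem \<tau> T2)"], goal_cases)
          case (7 i \<tau>2)
          note f3 = frame_n[OF 7(4)] frame_r[OF 7(4)]
          have P3: "prep \<tau>2" by (rule prep_frame[OF P2 7(4)]) (use idn in auto)
          show ?case
          proof (rule runs_Seq_run[where ?k2.0 = "(m + 1) * 150"], goal_cases)
            case (2 \<tau>3)
            have P4: "prep \<tau>3" using P3 unfolding 2 prep_def classified_def inp_def by simp
            have e4: "nmem \<tau>3 ti = nmem \<sigma> ti" "nmem \<tau>3 h = nmem \<sigma> h" "nmem \<tau>3 16 0 = zz" "nmem \<tau>3 17 0 = ordf i"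
              "nmem \<tau>3 T1 = nmem \<tau>2 T1" "nmem \<tau>3 T2 = nmem \<tau>2 T2"
              unfolding 2 using f3 e2 idn 7(2) by auto
            show ?case
            proof (rule runs_For_run[where N = m and 
                I = "\<lambda>j \<tau>'. tab_inv ordf tt hh zz i j (nmem \<tau>' T1) (nmem \<tau>' T2) (nmem \<tau> T1) (nmem \<tau> T2)"], goal_cases)
              case (8 j \<tau>4)
              note f8 = frame_n[OF 8(4)]
              have P5: "prep \<tau>4" by (rule prep_frame[OF P4 8(4)]) (use idn in auto)
              have e5: "nmem \<tau>4 ti = nmem \<sigma> ti" "nmem \<tau>4 h = nmem \<sigma> h" "nmem \<tau>4 16 0 = zz" "nmem \<tau>4 17 0 = ordf i"
                using f8 e4 idn by auto
              have oi: "ordf i < m" using ofl 7(1) .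
              have zn: "zz < n" using \<open>zz < n\<close> .
              have cc: "nmem \<tau>4 44 zz + nmem \<tau>4 43 a + b = cell zz a b" if "a < n" for a b
                using prepD(9,10)[OF P5] zn that by (simp add: cell_def)
              have st: "tt (ordf i) < n" "hh (ordf i) < n" using bd oi by auto
              let ?c = "fwd (ordf i) \<and> fwd j \<and> hh (ordf i) \<noteq> hh j \<and> nmem \<tau>4 T1 (cell zz (tt (ordf i)) (tt j)) \<noteq> 0"
              have rn: "run (pair_step ti h T1 T2) \<tau>4 = (if ?c
                then upn (upn \<tau>4 T1 (cell zz (hh (ordf i)) (hh j)) (Suc (ordf i))) T2 (cell zz (hh (ordf i)) (hh j)) (Suc j) else \<tau>4)"
                using idn prepD(11)[OF P5 oi] prepD(11)[OF P5 8(1)]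
                by (simp add: pair_step_def e5 8(2) th[OF oi] th[OF 8(1)] cc[OF st(1)] cc[OF st(2)] conj_commute)
              note S = tab_inv_step[OF 8(3) 7(1) 8(1) oi zn bd lev]
              show ?case
              proof (cases ?c)
                case True
                then show ?thesis using S ids(7) unfolding rn by (simp only: if_True mem_upd) simp
              next
                case False
                then show ?thesis using S unfolding rn by (simp only: if_False)
              qed
            next
              case (9 \<tau>4)
              then show ?case using tab_inv_round by blast
            next
              case 10
              show ?case using pair_step_cost[of ti h T1 T2] by (intro mult_le_mono2) simp
            qed (use 7(3) e4 inpD(2)[OF prepD(1)[OF P4]] idn in auto)
          qed auto
        next
          case (8 \<tau>2)
          have o: "\<And>z' a b. z' \<noteq> zz \<Longrightarrow> a < n \<Longrightarrow> b < n \<Longrightarrow> nmem \<tau>2 T1 (cell z' a b) = nmem \<tau> T1 (cell z' a b) \<and>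
            nmem \<tau>2 T2 (cell z' a b) = nmem \<tau> T2 (cell z' a b)"
            using 8(1) unfolding tab_inv_def by blast
          have tz: "tab ordf tt hh (nmem \<tau>2 T1) (nmem \<tau>2 T2) zz" using 8(1) unfolding tab_inv_def tab_def by blast
          have "tab ordf tt hh (nmem \<tau>2 T1) (nmem \<tau>2 T2) z'" if "z' < Suc zz" "nmem \<sigma> fl z' \<noteq> 0" for z'
          proof (cases "z' = zz")
            case False
            then have "tab ordf tt hh (nmem \<tau> T1) (nmem \<tau> T2) z'" using 7(3) that by (simp add: less_Suc_eq)
            then show ?thesis by (rule tab_cong) (use o False bd that 7(1) in auto)
          qed (use tz in simp)
          moreover have "nmem \<tau>2 T1 (cell z' a b) = 0" if "Suc zz \<le> z'" "a < n" "b < n" for z' a b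
            using o[of z' a b] 7(3) that by simp
          ultimately show ?case by blast
        next
          case 9
          show ?case by (intro mult_le_mono2) simp
        qed (use 2(1) inpD(2)[OF prepD(1)[OF P2]] idn in auto)
      qed (simp add: K_def)
      then show ?case using fz by simp
    next
      case 2
      then have "nmem \<sigma> fl zz = 0" using 7(2) flz by simp
      then show ?case using 7(3) by (auto simp: less_Suc_eq)
    qed auto
  next
    case 9
    have "(\<Sum>i<n. if nmem \<sigma> fl i \<noteq> 0 then K + 10 else 10) \<le> n * 10 + card {i. i < n \<and> nmem \<sigma> fl i \<noteq> 0} * (K + 10)"
      by (rule sum_if_le)
    moreover have "card {i. i < n \<and> nmem \<sigma> fl i \<noteq> 0} \<le> n"
      using card_mono[of "{..<n}" "{i. i < n \<and> nmem \<sigma> fl i \<noteq> 0}"] by auto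
    ultimately show ?case unfolding K_def by (simp add: algebra_simps)
  qed (use z inpD(1)[OF prepD(1)[OF P]] idn in auto)
qed

text \<open>A single pass suffices because an arc ending where another one begins is treated
  earlier. The condition on \<open>i\<close> says that all arcs into the first vertex have been
  treated. Keeping \<open>tt\<close>, \<open>hh\<close> and \<open>ps\<close> abstract serves both
  directions.\<close>

lemma PW_ordered:
  assumes ord: "\<And>e. e < m \<Longrightarrow> ord (ps e) = e \<and> ps e < m"
    and cons: "\<And>e f. fwd e \<Longrightarrow> fwd f \<Longrightarrow> hh e = tt f \<Longrightarrow> ps e < ps f"
    and st: "fwd e" "fwd f" "hh e \<noteq> hh f"
    and IH: "\<And>i. i \<le> m \<Longrightarrow> (\<And>g. fwd g \<Longrightarrow> hh g = tt e \<Longrightarrow> ps g < i) \<Longrightarrow> PW ord tt hh z i (tt e) (tt f)"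
    and i: "i \<le> m" "\<And>g. fwd g \<Longrightarrow> hh g = hh e \<Longrightarrow> ps g < i"
  shows "PW ord tt hh z i (hh e) (hh f)"
proof -
  have o: "ord (ps e) = e" "ps e < m" using ord st by (auto simp: fwd_def)
  have "PW ord tt hh z (ps e) (tt e) (tt f)" by (rule IH) (use o cons st in auto)
  then show ?thesis using PW_step[of ord tt hh z "ps e" f i] o st i by simp
qed

text \<open>Strip the last arcs of both paths until the second one is down to \<open>y\<close>. The
  first cannot end earlier, because no vertex lies below \<open>s\<close>.\<close>

lemma low_complete:
  assumes ord: "\<And>e. e < m \<Longrightarrow> ord (pos e) = e"
  shows "FP s A p \<Longrightarrow> FP y B q \<Longrightarrow> A \<inter> B = {} \<Longrightarrow> d p = d q \<Longrightarrow> i \<le> m \<Longrightarrow>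
    (\<And>g. fwd g \<Longrightarrow> he g = p \<Longrightarrow> pos g < i) \<Longrightarrow> PW ord ta he y i p q"
proof (induction "card B" arbitrary: A p B q i rule: less_induct)
  case less
  note V = FP_V[OF less.prems(1)] FP_V[OF less.prems(2)]
  show ?case
  proof (cases "q = y")
    case True
    then show ?thesis using V less.prems PW_base[of p y ord ta he i] by auto
  next
    case False
    have lt: "d y < d q" using FP_bounds[OF less.prems(2), of q] FP_same[OF less.prems(2)] V False by force
    have "p \<noteq> s" using d_s_le[of y] lt less.prems(4) V by force
    then obtain e where e: "fwd e" "ta e \<in> A" "he e = p" using FP_pred[OF less.prems(1)] V by blast
    obtain f where f: "fwd f" "ta f \<in> B" "he f = q" using FP_pred[OF less.prems(2)] V False by blast
    let ?B = "{u \<in> B. d u \<le> d (ta f)}"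
    have "q \<notin> ?B" using f by (auto simp: fwd_def)
    then have cB: "card ?B < card B" using V by (intro psubset_card_mono) auto
    have lv: "d (ta e) = d (ta f)" using fwd_level_ta[OF e(1) f(1)] e f less.prems(4) by simp
    have "p \<in> A" "q \<in> B" using V by auto
    then have pq: "he e \<noteq> he f" using e(3) f(3) less.prems(3) by auto
    have "PW ord ta he y i (he e) (he f)"
    proof (rule PW_ordered[where ps = pos])
      show "ord (pos e) = e \<and> pos e < m" if "e < m" for e using that ord pos_less by simp
      show "pos e < pos f" if "fwd e" "fwd f" "he e = ta f" for e f
        using that pos_mono[of f e] by (auto simp: fwd_def)
      show "PW ord ta he y i (ta e) (ta f)" if "i \<le> m" "\<And>g. fwd g \<Longrightarrow> he g = ta e \<Longrightarrow> pos g < i" for i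
        by (rule less.hyps[OF cB FP_lower[OF less.prems(1) e(2)] FP_lower[OF less.prems(2) f(2)]])
          (use less.prems(3) lv that in auto)
    qed (use e f pq less.prems in auto)
    then show ?thesis using e f by simp
  qed
qed

text \<open>The mirror image: first arcs are stripped until the path to \<open>x\<close> is
  exhausted, and that path is the second entry of the pair. The path to \<open>t\<close> cannot end
  earlier, because no vertex lies above \<open>t\<close>.\<close>

lemma high_complete:
  assumes ord: "\<And>e. e < m \<Longrightarrow> ord (m - 1 - pos e) = e"
  shows "FP p A x \<Longrightarrow> FP q B t \<Longrightarrow> A \<inter> B = {} \<Longrightarrow> d p = d q \<Longrightarrow> i \<le> m \<Longrightarrow>
    (\<And>g. fwd g \<Longrightarrow> ta g = q \<Longrightarrow> m - 1 - pos g < i) \<Longrightarrow> PW ord he ta x i q p"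
proof (induction "card A" arbitrary: A p B q i rule: less_induct)
  case less
  note V = FP_V[OF less.prems(1)] FP_V[OF less.prems(2)]
  show ?case
  proof (cases "p = x")
    case True
    then show ?thesis using V less.prems PW_base[of q x ord he ta i] by auto
  next
    case False
    have lt: "d p < d x" using FP_bounds[OF less.prems(1), of x] FP_same[OF less.prems(1)] V False by force
    have "q \<noteq> t" using d_t_ge[of x] lt less.prems(4) V by force
    obtain f S where f: "fwd f" "ta f = p" "FP (he f) S x" "A = insert p S"
      using less.prems(1) False by (cases rule: FP.cases) auto
    obtain e T where e: "fwd e" "ta e = q" "FP (he e) T t" "B = insert q T"
      using less.prems(2) \<open>q \<noteq> t\<close> by (cases rule: FP.cases) auto
    have "p \<notin> S" using FP_bounds[OF f(3)] f(1,2) by (force simp: fwd_def)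
    then have cS: "card S < card A" using f(4) FP_V[OF f(3)] by simp
    have lv: "d (he f) = d (he e)" using fwd_level[OF f(1) e(1)] e f less.prems(4) by simp
    have "p \<in> A" "q \<in> B" using V by auto
    then have pq: "ta e \<noteq> ta f" using e(2) f(2) less.prems(3) by auto
    have "PW ord he ta x i (ta e) (ta f)"
    proof (rule PW_ordered[where ps = "\<lambda>e. m - 1 - pos e"])
      show "ord (m - 1 - pos e) = e \<and> m - 1 - pos e < m" if "e < m" for e using that ord[OF that] by simp
      show "m - 1 - pos e < m - 1 - pos f" if "fwd e" "fwd f" "ta e = he f" for e f
        using that pos_mono[of e f] pos_less[of e] by (auto simp: fwd_def)
      show "PW ord he ta x i (he e) (he f)" if "i \<le> m" "\<And>g. fwd g \<Longrightarrow> ta g = he e \<Longrightarrow> m - 1 - pos g < i" for i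
        by (rule less.hyps[OF cS f(3) e(3)]) (use less.prems(3) e(4) f(4) lv that in auto)
    qed (use e f pq less.prems in auto)
    then show ?thesis using e f by simp
  qed
qed

end

subsection \<open>Removed vertices and candidates\<close>

definition clear_rem :: com where
  "clear_rem = For 14 (nv 0) (NStore 33 (nv 14) (NConst 0))"

definition anc_step :: com where
  "anc_step = Seq (sto 15 (NCell 38 (nv 14)))
    (When (BAnd (nNz (NCell 36 (nv 15))) (nNz (NCell 33 (NCell 2 (nv 15))))) (NStore 33 (NCell 1 (nv 15)) (NConst 1)))"

text \<open>The head of \<open>e1\<close> is marked only after the pass, so that its own ancestors
  are not removed along with it.\<close>

definition ancestors :: com where
  "ancestors = Seq (NStore 33 (NCell 1 (nv 61)) (NConst 1))
    (Seq (For 14 (NCell 0 (NConst 1)) anc_step) (NStore 33 (NCell 2 (nv 61)) (NConst 1)))"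

definition high_step :: com where
  "high_step = When (BNot (nEq (nv 51) (nv 60)))
    (Seq (NStore 33 (nv 52) (NConst 1))
    (Seq (sto 53 (NSub (NCell 47 (pix (nv 60) (nv 52) (nv 51))) (NConst 1)))
    (Seq (sto 54 (NSub (NCell 48 (pix (nv 60) (nv 52) (nv 51))) (NConst 1)))
    (Seq (NStore 50 (nv 52) (nv 53)) (Seq (NStore 50 (nv 51) (nv 54))
    (Seq (sto 52 (NCell 2 (nv 53))) (sto 51 (NCell 2 (nv 54)))))))))"

definition t_step :: com where
  "t_step = When (BNot (nEq (nv 52) (NCell 0 (NConst 3))))
    (Seq (NStore 50 (nv 52) (NCell 39 (nv 52)))
    (Seq (sto 52 (NCell 2 (NCell 39 (nv 52)))) (NStore 33 (nv 52) (NConst 1))))"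

definition high_walk :: com where
  "high_walk = Seq (Seq (sto 51 (NCell 2 (nv 61))) (sto 52 (NCell 2 (nv 62))))
    (Seq (For 14 (nv 0) high_step) (Seq (NStore 33 (nv 52) (NConst 1)) (For 14 (nv 0) t_step)))"

definition scan_step :: com where
  "scan_step = When (BAnd (BNot (nNz (NCell 36 (nv 14)))) (BAnd (nNz (NCell 31 (NCell 1 (nv 14))))
      (nNz (NCell 45 (pix (NCell 2 (nv 14)) (NCell 1 (nv 61)) (NCell 1 (nv 62)))))))
    (Seq (RStore 5 (NConst 0) (RAdd (RSub (RCell 3 (nv 60)) (RCell 3 (NCell 2 (nv 14))))
        (RAdd (RCell 2 (NCell 1 (nv 14))) (RCell 0 (nv 14)))))
      (When (bOr (BNot (nNz (nv 3))) (RLess (RCell 5 (NConst 0)) (RCell 4 (NConst 0))))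
        (Seq (RStore 4 (NConst 0) (RCell 5 (NConst 0)))
        (Seq (sto 3 (NConst 1)) (Seq (sto 56 (NConst 1)) (sto 57 (nv 14)))))))"

definition scan :: com where
  "scan = Seq (sto 56 (NConst 0)) (For 14 (NCell 0 (NConst 1)) scan_step)"

lemma walk_wr [simp]:
  "nwr clear_rem = {14, 33}" "rwr clear_rem = {}"
  "nwr anc_step = {15, 33}" "rwr anc_step = {}" "loop_free anc_step"
  "nwr ancestors = {14, 15, 33}" "rwr ancestors = {}"
  "nwr high_step = {33, 50, 51, 52, 53, 54}" "rwr high_step = {}" "loop_free high_step"
  "nwr t_step = {33, 50, 52}" "rwr t_step = {}" "loop_free t_step"
  "nwr high_walk = {14, 33, 50, 51, 52, 53, 54}" "rwr high_walk = {}"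
  "nwr scan_step = {3, 56, 57}" "rwr scan_step = {4, 5}" "loop_free scan_step"
  "nwr scan = {3, 14, 56, 57}" "rwr scan = {4, 5}"
  by (auto simp: clear_rem_def anc_step_def ancestors_def high_step_def t_step_def high_walk_def scan_step_def scan_def)

lemma walk_cost: "max_cost anc_step \<le> 40" "max_cost high_step \<le> 120" "max_cost t_step \<le> 50" "max_cost scan_step \<le> 130"
  by (simp_all add: anc_step_def high_step_def t_step_def scan_step_def)

context layered_arcs begin

text \<open>The simple path obtained by following the successor arcs \<open>f\<close>.\<close>

inductive FOL :: "(nat \<Rightarrow> nat) \<Rightarrow> nat \<Rightarrow> nat set \<Rightarrow> nat \<Rightarrow> real \<Rightarrow> bool" for f :: "nat \<Rightarrow> nat" where
  FOL_refl: "a < n \<Longrightarrow> FOL f a {a} a 0"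
| FOL_step: "f (ta e) = e \<Longrightarrow> e < m \<Longrightarrow> FOL f (he e) S b k \<Longrightarrow> ta e \<notin> S \<Longrightarrow> FOL f (ta e) (insert (ta e) S) b (exc e + k)"

lemma FOL_WP: "FOL f a S b k \<Longrightarrow> WP a S b k"
  by (induction rule: FOL.induct) (auto intro: WP_refl WP_step)

lemma FOL_FP: "FOL f a S b 0 \<Longrightarrow> FP a S b"
  using FOL_WP WP_zero by blast

lemmas FOL_V = WP_V[OF FOL_WP]

lemma FOL_cong: "FOL f a S b k \<Longrightarrow> (\<And>v. v \<in> S \<Longrightarrow> v \<noteq> b \<Longrightarrow> f v = g v) \<Longrightarrow> FOL g a S b k"
proof (induction rule: FOL.induct)
  case (FOL_step e S b k)
  have "b \<in> S" using FOL_V[OF FOL_step.hyps(3)] by blast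
  then have "ta e \<noteq> b" using FOL_step.hyps(4) by auto
  then have "g (ta e) = e" using FOL_step.prems[of "ta e"] FOL_step.hyps(1) by simp
  then show ?case using FOL_step FOL.FOL_step[of g e S b k] by auto
qed (auto intro: FOL_refl)

lemma FOL_trans: "FOL f a S b k \<Longrightarrow> FOL f b T c l \<Longrightarrow> S \<inter> T \<subseteq> {b} \<Longrightarrow> FOL f a (S \<union> T) c (k + l)"
proof (induction rule: FOL.induct)
  case (FOL_refl a)
  then show ?case using FOL_V[of f a T c l] by (simp add: insert_absorb)
next
  case (FOL_step e S b k)
  then have "FOL f (ta e) (insert (ta e) (S \<union> T)) c (exc e + (k + l))"
    using FOL_V[OF FOL_step.hyps(3)] by (intro FOL.FOL_step) auto
  then show ?case by (simp add: add.assoc)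
qed

lemma FOL_join:
  assumes "FOL f a S b k" "e < m" "f b = e" "ta e = b" "FOL f (he e) T c l" "S \<inter> T = {}"
  shows "FOL f a (S \<union> T) c (k + (exc e + l))"
proof -
  have b: "b \<in> S" using FOL_V[OF assms(1)] by blast
  then have "FOL f b (insert b T) c (exc e + l)" using FOL_step[of f e T c l] assms by auto
  then have "FOL f a (S \<union> insert b T) c (k + (exc e + l))" using FOL_trans[OF assms(1)] assms(6) by blast
  then show ?thesis using b by (simp add: insert_absorb)
qed

lemma FOL_snoc:
  assumes "FOL f a S b k" "e < m" "ta e = b" "he e \<notin> S"
  shows "FOL (f(b := e)) a (insert (he e) S) (he e) (k + exc e)"
proof -
  have "FOL (f(b := e)) a S b k" by (rule FOL_cong[OF assms(1)]) simp
  then show ?thesis using FOL_join[of "f(b := e)" a S b k e "{he e}" "he e" 0] assms he_less[OF assms(2)] FOL_refl by simp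
qed

lemma FOL_cons:
  assumes "FOL f a S b k" "e < m" "he e = a" "ta e \<notin> S"
  shows "FOL (f(ta e := e)) (ta e) (insert (ta e) S) b (exc e + k)"
proof -
  have "FOL (f(ta e := e)) a S b k" by (rule FOL_cong[OF assms(1)]) (use assms(4) in auto)
  then show ?thesis using FOL_step[of "f(ta e := e)" e S b k] assms by simp
qed

definition anc :: "nat \<Rightarrow> nat set" where "anc p = {v. \<exists>S. FP v S p}"

text \<open>The vertices certain to be marked after \<open>i\<close> arcs in descending order; an
  arc out of the head of another arc is treated before the latter, so one pass marks all
  ancestors.\<close>

inductive AW :: "(nat \<Rightarrow> nat) \<Rightarrow> nat \<Rightarrow> nat \<Rightarrow> nat \<Rightarrow> bool" for ord p where
  AW_base: "AW ord p i p"
| AW_step: "AW ord p j (he (ord j)) \<Longrightarrow> j < i \<Longrightarrow> i \<le> m \<Longrightarrow> fwd (ord j) \<Longrightarrow> AW ord p i (ta (ord j))"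

lemma AW_Suc: "AW ord p (Suc i) v \<Longrightarrow> AW ord p i v \<or> (v = ta (ord i) \<and> fwd (ord i) \<and> AW ord p i (he (ord i)))"
proof (erule AW.cases)
  fix j i' assume *: "Suc i = i'" "v = ta (ord j)" "AW ord p j (he (ord j))" "j < i'" "i' \<le> m" "fwd (ord j)"
  show ?thesis
  proof (cases "j = i")
    case False
    then have "j < i" "i \<le> m" using * by auto
    then show ?thesis using * AW_step by blast
  qed (use * in blast)
qed (auto intro: AW_base)

lemma AW_anc:
  assumes ord: "\<And>e. e < m \<Longrightarrow> ord (m - 1 - pos e) = e"
  shows "FP v S p \<Longrightarrow> i \<le> m \<Longrightarrow> (\<And>e. fwd e \<Longrightarrow> ta e = v \<Longrightarrow> m - 1 - pos e < i) \<Longrightarrow> AW ord p i v"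
proof (induction arbitrary: i rule: FP.induct)
  case (FP_step e S b)
  have e: "e < m" "d (ta e) < d (he e)" using FP_step.hyps by (auto simp: fwd_def)
  have "m - 1 - pos g < m - 1 - pos e" if "fwd g" "ta g = he e" for g
    using that pos_mono[of g e] pos_less[of g] e by (auto simp: fwd_def)
  then have "AW ord b (m - 1 - pos e) (he e)" using FP_step.IH[of "m - 1 - pos e"] by simp
  then show ?case using AW_step[of ord b "m - 1 - pos e" i] ord[OF e(1)] FP_step.hyps(1) FP_step.prems by simp
qed (auto intro: AW_base)

definition ready :: "ram_state \<Rightarrow> bool" where
  "ready \<tau> \<longleftrightarrow> prep \<tau> \<and> (\<forall>z<n. nmem \<tau> 42 z \<noteq> 0 \<longrightarrow> tab (nmem \<tau> 30) ta he (nmem \<tau> 45) (nmem \<tau> 46) z) \<and>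
     (\<forall>z<n. nmem \<tau> 41 z \<noteq> 0 \<longrightarrow> tab (nmem \<tau> 38) he ta (nmem \<tau> 47) (nmem \<tau> 48) z)"

lemma ready_frame:
  "ready \<sigma> \<Longrightarrow> frame c \<sigma> \<tau> \<Longrightarrow> nwr c \<inter> {0, 1, 2, 30, 35, 36, 38, 39, 40, 41, 42, 43, 44, 45, 46, 47, 48} = {} \<Longrightarrow>
   rwr c \<inter> {0, 3} = {} \<Longrightarrow> ready \<tau>"
  unfolding ready_def prep_def classified_def frame_def inp_def by simp

lemma ready_upn: "a \<notin> {0, 1, 2, 30, 35, 36, 38, 39, 40, 41, 42, 43, 44, 45, 46, 47, 48} \<Longrightarrow> ready \<tau> \<Longrightarrow> ready (upn \<tau> a i x)"
  by (erule ready_frame[where c = "NStore a (NConst i) (NConst x)"]) (auto simp: frame_def)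

lemma readyD: "ready \<tau> \<Longrightarrow> prep \<tau>" "ready \<tau> \<Longrightarrow> inp \<tau>"
  unfolding ready_def prep_def by auto

lemma runs_clear_rem: "inp \<sigma> \<Longrightarrow> runs clear_rem \<sigma> (\<lambda>\<tau>. \<forall>v<n. nmem \<tau> 33 v = 0) ((n + 1) * 20)"
  unfolding clear_rem_def
  by (rule runs_For_run[where N = n and I = "\<lambda>i \<tau>. \<forall>v<i. nmem \<tau> 33 v = 0"]) (auto simp: inpD less_Suc_eq)

lemma runs_ancestors:
  assumes R: "ready \<sigma>" and e1: "nmem \<sigma> 61 0 = e1" "e1 < m" and z: "\<forall>v<n. nmem \<sigma> 33 v = 0"
  shows "runs ancestors \<sigma> (\<lambda>\<tau>. \<forall>v<n. nmem \<tau> 33 v \<noteq> 0 \<longleftrightarrow> v \<in> anc (ta e1) \<union> {he e1}) ((m + 1) * 60 + 20)"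
  unfolding ancestors_def
proof (rule runs_Seq_run[where ?k2.0 = "(m + 1) * 60 + 5"], goal_cases)
  case (2 \<tau>)
  have R1: "ready \<tau>" unfolding 2 using R by (simp add: ready_upn)
  note P1 = readyD(1)[OF R1] and I1 = readyD(2)[OF R1]
  have e: "nmem \<tau> 61 0 = e1" unfolding 2 using e1 by simp
  have r: "\<forall>v<n. nmem \<tau> 33 v \<noteq> 0 \<longleftrightarrow> v = ta e1" unfolding 2 using e1 z inpD[OF readyD(2)[OF R]] by simp
  define ord where "ord = nmem \<tau> 38"
  show ?case
  proof (rule runs_Seq[where Q = "\<lambda>\<tau>. \<forall>v<n. nmem \<tau> 33 v \<noteq> 0 \<longleftrightarrow> v \<in> anc (ta e1)"
        and ?k1.0 = "(m + 1) * 60" and ?k2.0 = 5], goal_cases)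
    case 1
    show ?case
    proof (rule runs_For_run[where N = m and I = "\<lambda>i \<tau>. (\<forall>v<n. nmem \<tau> 33 v \<noteq> 0 \<longrightarrow> v \<in> anc (ta e1)) \<and>
        (\<forall>v<n. AW ord (ta e1) i v \<longrightarrow> nmem \<tau> 33 v \<noteq> 0)"], goal_cases)
      case 7
      have "AW ord (ta e1) 0 v \<Longrightarrow> v = ta e1" for v by (erule AW.cases) auto
      moreover have "ta e1 \<in> anc (ta e1)" using FP_refl[OF ta_less[OF e1(2)]] unfolding anc_def by blast
      ultimately show ?case using r by auto
    next
      case (8 i \<tau>1)
      have R2: "ready \<tau>1" by (rule ready_frame[OF R1 8(4)]) auto
      note P2 = readyD(1)[OF R2] and I2 = readyD(2)[OF R2]
      have o: "nmem \<tau>1 38 = ord" using frame_n[OF 8(4)] by (simp add: ord_def)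
      have oi: "ord i < m" using prepD(5)[OF P2 8(1)] o by simp
      note A = 8(3)[THEN conjunct1, rule_format] and B = 8(3)[THEN conjunct2, rule_format]
      show ?case
      proof (cases "fwd (ord i) \<and> nmem \<tau>1 33 (he (ord i)) \<noteq> 0")
        case True
        then obtain S where "FP (he (ord i)) S (ta e1)" using A he_less[OF oi] unfolding anc_def by blast
        then have "ta (ord i) \<in> anc (ta e1)" using FP_step True unfolding anc_def by blast
        moreover have "nmem \<tau>1 33 v \<noteq> 0 \<or> v = ta (ord i)" if "v < n" "AW ord (ta e1) (Suc i) v" for v
          using AW_Suc[OF that(2)] B that(1) by blast
        ultimately show ?thesis using True A 8(2) prepD(11)[OF P2 oi]
          by (auto simp: anc_step_def o inpD[OF I2] oi)
      next
        case False
        have "nmem \<tau>1 33 v \<noteq> 0" if "v < n" "AW ord (ta e1) (Suc i) v" for v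
          using AW_Suc[OF that(2)] B that(1) False he_less[OF oi] by blast
        then show ?thesis using False A 8(2) prepD(11)[OF P2 oi]
          by (auto simp: anc_step_def o inpD[OF I2] oi)
      qed
    next
      case (9 \<tau>1)
      have "AW ord (ta e1) m v" if "v \<in> anc (ta e1)" for v
      proof -
        obtain S where S: "FP v S (ta e1)" using \<open>v \<in> anc (ta e1)\<close> unfolding anc_def by blast
        show ?thesis by (rule AW_anc[OF _ S]) (use prepD(7)[OF P1] in \<open>auto simp: ord_def fwd_def\<close>)
      qed
      then show ?case using 9(1) by blast
    next
      case 10
      show ?case using walk_cost(1) by (intro mult_le_mono2) simp
    qed (auto simp: inpD[OF I1])
  next
    case (2 \<tau>1)
    have R2: "ready \<tau>1" by (rule ready_frame[OF R1 2(2)]) auto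
    have "nmem \<tau>1 61 0 = e1" using frame_n[OF 2(2)] e by simp
    then show ?case using 2(1) e1(2) by (intro runs_run) (auto simp: inpD[OF readyD(2)[OF R2]])
  qed auto
qed auto

lemma tab_next:
  assumes "tab ord tt hh U1 U2 z" "a < n" "b < n" "U1 (cell z a b) \<noteq> 0"
  shows "a \<noteq> b" "d a = d b"
    "b \<noteq> z \<Longrightarrow> \<exists>e f. fwd e \<and> fwd f \<and> U1 (cell z a b) = Suc e \<and> U2 (cell z a b) = Suc f \<and> hh e = a \<and> hh f = b \<and>
      U1 (cell z (tt e) (tt f)) \<noteq> 0"
  using assms unfolding tab_def tab_valid_def by blast+

definition walked :: "nat \<Rightarrow> nat \<Rightarrow> nat \<Rightarrow> (nat \<Rightarrow> nat) \<Rightarrow> nat set \<Rightarrow> nat set \<Rightarrow> (nat \<Rightarrow> nat) \<Rightarrow> bool" where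
  "walked p q x rem R0 B suc \<longleftrightarrow> (\<exists>A. FOL suc p A x 0 \<and> FOL suc q B t 0 \<and> A \<inter> B = {}) \<and>
    (\<forall>v<n. rem v \<noteq> 0 \<longleftrightarrow> v \<in> R0 \<union> B)"

lemma runs_high_walk:
  assumes R: "ready \<sigma>" and x: "nmem \<sigma> 60 0 = x" "x < n" "nmem \<sigma> 41 x \<noteq> 0"
    and e1: "nmem \<sigma> 61 0 = e1" "e1 < m" and e2: "nmem \<sigma> 62 0 = e2" "e2 < m"
    and tb: "nmem \<sigma> 47 (cell x (he e2) (he e1)) \<noteq> 0" and r: "\<forall>v<n. nmem \<sigma> 33 v \<noteq> 0 \<longleftrightarrow> v \<in> R0"
  shows "runs high_walk \<sigma> (\<lambda>\<tau>. \<exists>B. walked (he e1) (he e2) x (nmem \<tau> 33) R0 B (nmem \<tau> 50)) ((n + 1) * 240)"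
  unfolding high_walk_def
proof (rule runs_Seq_run[where ?k2.0 = "(n + 1) * 140 + (5 + (n + 1) * 70)"], goal_cases)
  case (2 \<tau>)
  define p q where "p = he e1" and "q = he e2"
  have pq: "p < n" "q < n" using he_less e1 e2 by (auto simp: p_def q_def)
  have R1: "ready \<tau>" unfolding 2 using R by (simp add: ready_upn)
  note I1 = readyD(2)[OF R1]
  have s1: "nmem \<tau> 60 0 = x" "nmem \<tau> 51 0 = p" "nmem \<tau> 52 0 = q" "nmem \<tau> 33 = nmem \<sigma> 33" "nmem \<tau> 47 = nmem \<sigma> 47" "nmem \<tau> 41 = nmem \<sigma> 41"
    unfolding 2 using x e1 e2 inpD[OF readyD(2)[OF R]] by (simp_all add: p_def q_def)
  define U1 U2 where "U1 = nmem \<tau> 47" and "U2 = nmem \<tau> 48"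
  have tab: "tab (nmem \<tau> 38) he ta U1 U2 x" using R1 x s1 unfolding ready_def U1_def U2_def by simp
  have U: "U1 (cell x q p) \<noteq> 0" using tb s1 unfolding U1_def p_def q_def by simp
  have ne: "q \<noteq> p" "d q = d p" using tab_next[OF tab pq(2,1) U] by auto
  \<comment> \<open>The vertex \<open>b\<close> is marked when it is left, hence the exception. The
    cardinality counts steps: after \<open>n\<close> of them without reaching \<open>x\<close>, the
    path would have more than \<open>n\<close> vertices.\<close>
  define J where "J i a b suc rem \<longleftrightarrow> (\<exists>A B. FOL suc p A a 0 \<and> FOL suc q B b 0 \<and> A \<inter> B = {} \<and>
      (\<forall>v<n. rem v \<noteq> 0 \<longleftrightarrow> v \<in> R0 \<union> (B - {b})) \<and> U1 (cell x b a) \<noteq> 0 \<and> (a \<noteq> x \<longrightarrow> card A = Suc i))"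
    for i :: nat and a b :: nat and suc rem :: "nat \<Rightarrow> nat"
  have Jstep: "J (Suc i) (he f) (he e) (suc(b := e, a := f)) (rem(b := Suc 0))"
    if J: "J i a b suc rem" and ef: "a \<noteq> x" "fwd e" "fwd f" "ta e = b" "ta f = a" "U1 (cell x (he e) (he f)) \<noteq> 0"
    for i a b suc rem e f
  proof -
    obtain A B where AB: "FOL suc p A a 0" "FOL suc q B b 0" "A \<inter> B = {}" "\<forall>v<n. rem v \<noteq> 0 \<longleftrightarrow> v \<in> R0 \<union> (B - {b})"
      "U1 (cell x b a) \<noteq> 0" "card A = Suc i" using J ef(1) unfolding J_def by blast
    note VA = FOL_V[OF AB(1)] and VB = FOL_V[OF AB(2)]
    have em: "e < m" "f < m" using ef by (auto simp: fwd_def)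
    have ab: "b \<noteq> a" "d b = d a" using tab_next[OF tab _ _ AB(5)] VA VB by auto
    have hh: "he e \<noteq> he f" "d (he e) = d (he f)" using tab_next[OF tab _ _ ef(6)] he_less em by auto
    have A1: "d v \<le> d a" if "v \<in> A" for v using FP_bounds[OF FOL_FP[OF AB(1)] that] by simp
    have B1: "d v \<le> d a" if "v \<in> B" for v using FP_bounds[OF FOL_FP[OF AB(2)] that] ab by simp
    have gt: "d a < d (he f)" "d a < d (he e)" using ef ab by (auto simp: fwd_def)
    have nA: "he f \<notin> A" "he f \<notin> B" "he e \<notin> A" "he e \<notin> B" using A1 B1 gt by force+
    have aA: "a \<in> A" "b \<in> B" using VA VB by auto
    have "FOL (suc(b := e)) p A a 0" by (rule FOL_cong[OF AB(1)]) (use aA AB(3) in auto)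
    then have 1: "FOL (suc(b := e, a := f)) p (insert (he f) A) (he f) 0"
      using FOL_snoc[of "suc(b := e)" p A a 0 f] em ef nA exc_fwd by simp
    have "FOL (suc(a := f)) q B b 0" by (rule FOL_cong[OF AB(2)]) (use aA AB(3) in auto)
    then have 2: "FOL (suc(b := e, a := f)) q (insert (he e) B) (he e) 0"
      using FOL_snoc[of "suc(a := f)" q B b 0 e] em ef nA exc_fwd ab by (simp add: fun_upd_twist)
    have 3: "\<forall>v<n. (rem(b := Suc 0)) v \<noteq> 0 \<longleftrightarrow> v \<in> R0 \<union> (insert (he e) B - {he e})"
      using AB(4) nA aA by auto
    have "insert (he f) A \<inter> insert (he e) B = {}" using nA AB(3) hh by auto
    moreover have "card (insert (he f) A) = Suc (Suc i)" using AB(6) nA VA by simp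
    ultimately show ?thesis unfolding J_def using 1 2 3 ef(6) by blast
  qed
  show ?case
  proof (rule runs_Seq[where Q = "\<lambda>\<tau>. nmem \<tau> 51 0 = x \<and> J n (nmem \<tau> 51 0) (nmem \<tau> 52 0) (nmem \<tau> 50) (nmem \<tau> 33)"
        and ?k1.0 = "(n + 1) * 140" and ?k2.0 = "5 + (n + 1) * 70"], goal_cases)
    case 1
    show ?case
    proof (rule runs_For_run[where N = n and I = "\<lambda>i \<tau>. J i (nmem \<tau> 51 0) (nmem \<tau> 52 0) (nmem \<tau> 50) (nmem \<tau> 33)"], goal_cases)
      case 7
      show ?case unfolding J_def s1
        by (intro exI[of _ "{p}"] exI[of _ "{q}"]) (use FOL_refl pq ne r U in auto)
    next
      case (8 i \<tau>1)
      have R2: "ready \<tau>1" by (rule ready_frame[OF R1 8(4)]) auto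
      note P2 = readyD(1)[OF R2] and I2 = readyD(2)[OF R2]
      have u: "nmem \<tau>1 47 = U1" "nmem \<tau>1 48 = U2" "nmem \<tau>1 60 0 = x"
        using frame_n[OF 8(4)] s1 by (simp_all add: U1_def U2_def)
      let ?a = "nmem \<tau>1 51 0" and ?b = "nmem \<tau>1 52 0"
      show ?case
      proof (cases "?a = x")
        case True
        then have "run high_step \<tau>1 = \<tau>1" using u by (simp add: high_step_def)
        then show ?thesis using 8(3) True unfolding J_def by auto
      next
        case False
        obtain A B where AB: "FOL (nmem \<tau>1 50) p A ?a 0" "FOL (nmem \<tau>1 50) q B ?b 0" "U1 (cell x ?b ?a) \<noteq> 0"
          using 8(3) unfolding J_def by blast
        have bn: "?a < n" "?b < n" using FOL_V[OF AB(1)] FOL_V[OF AB(2)] by auto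
        obtain e f where ef: "fwd e" "fwd f" "U1 (cell x ?b ?a) = Suc e" "U2 (cell x ?b ?a) = Suc f" "ta e = ?b" "ta f = ?a"
          "U1 (cell x (he e) (he f)) \<noteq> 0" using tab_next(3)[OF tab bn(2,1) AB(3)] False by blast
        have em: "e < m" "f < m" using ef by (auto simp: fwd_def)
        have c: "nmem \<tau>1 44 x + nmem \<tau>1 43 ?b + ?a = cell x ?b ?a"
          using prepD(9,10)[OF P2] x bn by (simp add: cell_def)
        have "nmem (run high_step \<tau>1) 51 0 = he f" "nmem (run high_step \<tau>1) 52 0 = he e"
          "nmem (run high_step \<tau>1) 50 = (nmem \<tau>1 50)(?b := e, ?a := f)" "nmem (run high_step \<tau>1) 33 = (nmem \<tau>1 33)(?b := Suc 0)"
          using False em by (simp_all add: high_step_def u c ef inpD[OF I2])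
        then show ?thesis using Jstep[OF 8(3) False ef(1,2,5,6,7)] by simp
      qed
    next
      case (9 \<tau>1)
      have "nmem \<tau>1 51 0 = x"
      proof (rule ccontr)
        assume "nmem \<tau>1 51 0 \<noteq> x"
        then obtain A where A: "FOL (nmem \<tau>1 50) p A (nmem \<tau>1 51 0) 0" "card A = Suc n" using 9(1) unfolding J_def by blast
        then show False using FOL_V[OF A(1)] card_mono[of "{..<n}" A] by simp
      qed
      then show ?case using 9(1) by simp
    next
      case 10
      show ?case using walk_cost(2) by (intro mult_le_mono2) simp
    qed (auto simp: inpD[OF I1])
  next
    case (2 \<tau>1)
    have R2: "ready \<tau>1" by (rule ready_frame[OF R1 2(2)]) auto
    let ?b0 = "nmem \<tau>1 52 0"
    obtain A B0 where AB: "FOL (nmem \<tau>1 50) p A x 0" "FOL (nmem \<tau>1 50) q B0 ?b0 0" "A \<inter> B0 = {}"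
      "\<forall>v<n. nmem \<tau>1 33 v \<noteq> 0 \<longleftrightarrow> v \<in> R0 \<union> (B0 - {?b0})" "U1 (cell x ?b0 x) \<noteq> 0" using 2(1) unfolding J_def by auto
    have b0: "?b0 < n" "?b0 \<in> B0" using FOL_V[OF AB(2)] by auto
    have db0: "d ?b0 = d x" using tab_next(2)[OF tab b0(1) x(2) AB(5)] .
    \<comment> \<open>In this phase a vertex is marked when it is entered, and
      \<open>d x <= d b\<close> guarantees that the next vertex lies above all of
      \<open>A\<close>.\<close>
    define L where "L i b suc rem \<longleftrightarrow> FOL suc p A x 0 \<and> (\<exists>B. FOL suc q B b 0 \<and> A \<inter> B = {} \<and> d x \<le> d b \<and>
      (\<forall>v<n. rem v \<noteq> 0 \<longleftrightarrow> v \<in> R0 \<union> B) \<and> (b \<noteq> t \<longrightarrow> i < card B))" for i :: nat and b :: nat and suc rem :: "nat \<Rightarrow> nat"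
    show ?case
    proof (rule runs_Seq_run[where ?k2.0 = "(n + 1) * 70"], goal_cases)
      case (2 \<tau>2)
      have R3: "ready \<tau>2" unfolding 2 using R2 by (simp add: ready_upn)
      have L0: "L 0 (nmem \<tau>2 52 0) (nmem \<tau>2 50) (nmem \<tau>2 33)"
        unfolding L_def 2
      proof (intro conjI exI[of _ B0])
        show "nmem (run (NStore 33 (nv 52) (NConst 1)) \<tau>1) 52 0 \<noteq> t \<longrightarrow> 0 < card B0"
          using FOL_V[OF AB(2)] by (auto simp: card_gt_0_iff)
      qed (use AB db0 b0 in auto)
      show ?case
      proof (rule runs_For_run[where N = n and I = "\<lambda>i \<tau>. L i (nmem \<tau> 52 0) (nmem \<tau> 50) (nmem \<tau> 33)"], goal_cases)
        case 7
        show ?case using L0 .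
      next
        case (8 i \<tau>3)
        have R4: "ready \<tau>3" by (rule ready_frame[OF R3 8(4)]) auto
        note P4 = readyD(1)[OF R4] and I4 = readyD(2)[OF R4]
        let ?b = "nmem \<tau>3 52 0"
        obtain B where B: "FOL (nmem \<tau>3 50) p A x 0" "FOL (nmem \<tau>3 50) q B ?b 0" "A \<inter> B = {}" "d x \<le> d ?b"
          "\<forall>v<n. nmem \<tau>3 33 v \<noteq> 0 \<longleftrightarrow> v \<in> R0 \<union> B" "?b \<noteq> t \<longrightarrow> i < card B" using 8(3) unfolding L_def by blast
        show ?case
        proof (cases "?b = t")
          case True
          then have "run t_step \<tau>3 = \<tau>3" by (simp add: t_step_def inpD[OF I4])
          then show ?thesis using B True unfolding L_def by auto
        next
          case False
          have bB: "?b < n" "?b \<in> B" "finite B" using FOL_V[OF B(2)] by auto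
          obtain S where "FP ?b S t" using ex_FP_t bB by blast
          then obtain g where g: "fwd g" "ta g = ?b" using False by (cases rule: FP.cases) auto
          define e where "e = nmem \<tau>3 39 ?b"
          have e: "fwd e" "ta e = ?b" using prepD(3)[OF P4] g unfolding classified_def e_def by metis+
          have em: "e < m" using e by (simp add: fwd_def)
          have gt: "d ?b < d (he e)" using e by (simp add: fwd_def)
          have nB: "he e \<notin> B" "he e \<notin> A"
            using FP_bounds[OF FOL_FP[OF B(2)], of "he e"] FP_bounds[OF FOL_FP[OF B(1)], of "he e"] gt B(4) by force+
          have rn: "nmem (run t_step \<tau>3) 52 0 = he e" "nmem (run t_step \<tau>3) 50 = (nmem \<tau>3 50)(?b := e)"
            "nmem (run t_step \<tau>3) 33 = (nmem \<tau>3 33)(he e := Suc 0)"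
            using False em by (simp_all add: t_step_def inpD[OF I4] e_def[symmetric])
          have 1: "FOL ((nmem \<tau>3 50)(?b := e)) p A x 0" by (rule FOL_cong[OF B(1)]) (use bB B(3) in auto)
          have 2: "FOL ((nmem \<tau>3 50)(?b := e)) q (insert (he e) B) (he e) 0"
            using FOL_snoc[OF B(2) em e(2) nB(1)] exc_fwd[OF e(1)] by simp
          have 3: "\<forall>v<n. ((nmem \<tau>3 33)(he e := Suc 0)) v \<noteq> 0 \<longleftrightarrow> v \<in> R0 \<union> insert (he e) B" using B(5) by auto
          have "A \<inter> insert (he e) B = {}" "d x \<le> d (he e)" "Suc i < card (insert (he e) B)"
            using B(3,4,6) nB gt False bB(3) by auto
          then show ?thesis unfolding L_def rn using 1 2 3 by blast
        qed
      next
        case (9 \<tau>3)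
        then obtain B where B: "FOL (nmem \<tau>3 50) p A x 0" "FOL (nmem \<tau>3 50) q B (nmem \<tau>3 52 0) 0" "A \<inter> B = {}"
          "\<forall>v<n. nmem \<tau>3 33 v \<noteq> 0 \<longleftrightarrow> v \<in> R0 \<union> B" "nmem \<tau>3 52 0 \<noteq> t \<longrightarrow> n < card B" unfolding L_def by blast
        have "nmem \<tau>3 52 0 = t" using FOL_V[OF B(2)] card_mono[of "{..<n}" B] B(5) by fastforce
        then show ?case unfolding walked_def p_def[symmetric] q_def[symmetric] using B by auto
      next
        case 10
        show ?case using walk_cost(3) by (intro mult_le_mono2) simp
      qed (auto simp: inpD[OF readyD(2)[OF R3]])
    qed auto
  qed auto
qed auto

section \<open>Candidates and their values\<close>

definition cand :: "nat \<Rightarrow> nat \<Rightarrow> (nat \<Rightarrow> nat) \<Rightarrow> (nat \<Rightarrow> nat) \<Rightarrow> nat \<Rightarrow> bool" where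
  "cand e1 e2 U rc el \<longleftrightarrow> el < m \<and> \<not> fwd el \<and> rc (ta el) \<noteq> 0 \<and> U (cell (he el) (ta e1) (ta e2)) \<noteq> 0"

text \<open>If \<open>ds\<close> is the weight of a path to the tail of \<open>el\<close>, this is
  the excess of that path followed by \<open>el\<close>. The forward parts add nothing, so it is the
  excess of the whole candidate.\<close>

definition cval :: "nat \<Rightarrow> (nat \<Rightarrow> real) \<Rightarrow> nat \<Rightarrow> real" where
  "cval x ds el = d x - d (he el) + (ds (ta el) + w el)"

text \<open>If \<open>imp\<close> is 0, the stored optimum is untouched and the path output earlier
  still belongs to it; otherwise \<open>el\<close> attains the new optimum and the output has to be
  rewritten.\<close>

definition scan_inv where
  "scan_inv C v f0 b0 i fl bs imp el \<longleftrightarrow> (\<forall>e<i. C e \<longrightarrow> fl \<noteq> 0 \<and> bs \<le> v e) \<and>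
    (imp = 0 \<longrightarrow> fl = f0 \<and> bs = b0) \<and> (imp \<noteq> 0 \<longrightarrow> fl \<noteq> 0 \<and> C el \<and> bs = v el) \<and> (f0 \<noteq> 0 \<longrightarrow> fl \<noteq> 0 \<and> bs \<le> b0)"
  for C :: "nat \<Rightarrow> bool" and v :: "nat \<Rightarrow> real" and f0 :: nat and b0 :: real and i fl :: nat and bs :: real and imp el :: nat

lemma runs_scan:
  assumes R: "ready \<sigma>" and x: "nmem \<sigma> 60 0 = x" "x < n" 
    and e1: "nmem \<sigma> 61 0 = e1" "e1 < m" and e2: "nmem \<sigma> 62 0 = e2" "e2 < m"
  shows "runs scan \<sigma> (\<lambda>\<tau>. scan_inv (cand e1 e2 (nmem \<sigma> 45) (nmem \<sigma> 31)) (cval x (rmem \<sigma> 2)) (nmem \<sigma> 3 0) (rmem \<sigma> 4 0) m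
    (nmem \<tau> 3 0) (rmem \<tau> 4 0) (nmem \<tau> 56 0) (nmem \<tau> 57 0) \<and> nmem \<tau> 3 1 = nmem \<sigma> 3 1) ((m + 1) * 160)"
  unfolding scan_def
proof (rule runs_Seq_run[where ?k2.0 = "(m + 1) * 150"], goal_cases)
  case (2 \<tau>)
  have R1: "ready \<tau>" unfolding 2 using R by (simp add: ready_upn)
  let ?C = "cand e1 e2 (nmem \<sigma> 45) (nmem \<sigma> 31)" and ?v = "cval x (rmem \<sigma> 2)"
  show ?case
  proof (rule runs_For_run[where N = m and I = "\<lambda>i \<tau>. scan_inv ?C ?v (nmem \<sigma> 3 0) (rmem \<sigma> 4 0) i
    (nmem \<tau> 3 0) (rmem \<tau> 4 0) (nmem \<tau> 56 0) (nmem \<tau> 57 0) \<and> nmem \<tau> 3 1 = nmem \<sigma> 3 1"], goal_cases)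
    case 7
    then show ?case unfolding 2 scan_inv_def by simp
  next
    case (8 i \<tau>1)
    have R2: "ready \<tau>1" by (rule ready_frame[OF R1 8(4)]) auto
    note P2 = readyD(1)[OF R2] and I2 = readyD(2)[OF R2]
    have f: "nmem \<tau>1 45 = nmem \<sigma> 45" "nmem \<tau>1 31 = nmem \<sigma> 31" "rmem \<tau>1 2 = rmem \<sigma> 2"
      "nmem \<tau>1 60 0 = x" "nmem \<tau>1 61 0 = e1" "nmem \<tau>1 62 0 = e2"
      using frame_n[OF 8(4)] frame_r[OF 8(4)] x e1 e2 unfolding 2 by simp_all
    have bn: "ta i < n" "he i < n" "ta e1 < n" using ta_less he_less 8(1) e1 by auto
    have c: "nmem \<tau>1 44 (he i) + nmem \<tau>1 43 (ta e1) + ta e2 = cell (he i) (ta e1) (ta e2)"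
      using prepD(9,10)[OF P2] bn by (simp add: cell_def)
    have C: "?C i \<longleftrightarrow> \<not> nmem \<tau>1 36 i \<noteq> 0 \<and> nmem \<sigma> 31 (ta i) \<noteq> 0 \<and> nmem \<sigma> 45 (cell (he i) (ta e1) (ta e2)) \<noteq> 0"
      using prepD(11)[OF P2 8(1)] 8(1) by (simp add: cand_def)
    have v: "?v i = rmem \<tau>1 3 x - rmem \<tau>1 3 (he i) + (rmem \<sigma> 2 (ta i) + w i)"
      using prepD(2)[OF P2] x bn by (simp add: cval_def)
    have rn: "run scan_step \<tau>1 = (if ?C i then (if nmem \<tau>1 3 0 = 0 \<or> ?v i < rmem \<tau>1 4 0 then
       upn (upn (upn (upr (upr \<tau>1 5 0 (?v i)) 4 0 (?v i)) 3 0 1) 56 0 1) 57 0 i else upr \<tau>1 5 0 (?v i)) else \<tau>1)"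
      unfolding C v scan_step_def using 8(1,2) e1 e2 by (simp add: f inpD[OF I2] c)
    show ?case
    proof (cases "?C i")
      case True
      then show ?thesis using 8(3) unfolding rn scan_inv_def by (auto simp: less_Suc_eq)
    next
      case False
      then show ?thesis using 8(3) unfolding rn scan_inv_def by (auto simp: less_Suc_eq)
    qed
  next
    case 10
    show ?case using walk_cost(4) by (intro mult_le_mono2) simp
  qed (auto simp: inpD[OF readyD(2)[OF R1]])
qed auto

lemma W_le: "W ord R x b i v c \<Longrightarrow> i \<le> m \<Longrightarrow> b \<le> b' \<Longrightarrow> W ord R x b' i v c"
  using W_mono[of ord R x b i v c m] W_mono_round[of ord R x b v c b' i] by (cases "b = b'") auto

text \<open>The reason for the number of rounds. The position of a forward arc is smaller than that
  of every arc leaving its head, so a run of forward arcs is found within one round. Only after a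
  back arc may a new round be needed, and a simple path enters each head of a back arc at most once.
  The premise on \<open>a\<close> says that it is reached in the current round before any arc
  leaving its level or a higher one.\<close>

lemma W_WP:
  assumes ord: "\<And>e. e < m \<Longrightarrow> ord (pos e) = e"
  shows "WP a S v k \<Longrightarrow> (S - {a}) \<inter> R = {} \<Longrightarrow>
    (\<And>i. i \<le> m \<Longrightarrow> (\<And>e. e < m \<Longrightarrow> d (ta e) < d a \<Longrightarrow> pos e < i) \<Longrightarrow> W ord R x b i a c) \<Longrightarrow>
    W ord R x (b + card ((S - {a}) \<inter> {v. v < n \<and> (\<exists>e<m. \<not> fwd e \<and> he e = v)})) m v (c + k + d v - d a)"
proof (induction arbitrary: b c rule: WP.induct)
  case (WP_refl a)
  then show ?case using pos_less by simp
next
  case (WP_step e S v k)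
  let ?H = "{v. v < n \<and> (\<exists>e<m. \<not> fwd e \<and> he e = v)}"
  note V = WP_V[OF WP_step.hyps(2)]
  have e: "ord (pos e) = e" "pos e < m" using ord pos_less WP_step.hyps(1) by auto
  have S: "insert (ta e) S - {ta e} = S" using WP_step.hyps(3) by auto
  have hR: "he e \<notin> R" using WP_step.prems(1) V unfolding S by blast
  have "W ord R x b (pos e) (ta e) c"
    by (rule WP_step.prems(2)) (use e pos_mono WP_step.hyps(1) in auto)
  then have W1: "W ord R x b i (he e) (c + w e)" if "pos e < i" "i \<le> m" for i
    using W.W_step[of ord R x b "pos e" c i] e that hR by simp
  have SR: "(S - {he e}) \<inter> R = {}" using WP_step.prems(1) unfolding S by blast
  have fin: "finite (S \<inter> ?H)" by simp
  have le: "b' + card ((S - {he e}) \<inter> ?H) \<le> b + card (S \<inter> ?H) \<Longrightarrow>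
      (\<And>i. i \<le> m \<Longrightarrow> (\<And>f. f < m \<Longrightarrow> d (ta f) < d (he e) \<Longrightarrow> pos f < i) \<Longrightarrow> W ord R x b' i (he e) (c + w e)) \<Longrightarrow>
      W ord R x (b + card (S \<inter> ?H)) m v (c + w e + k + d v - d (he e))" for b'
    using WP_step.IH[OF SR, of b' "c + w e"] W_le[OF _ order_refl] by blast
  have "W ord R x (b + card (S \<inter> ?H)) m v (c + w e + k + d v - d (he e))"
  proof (cases "fwd e")
    case True
    show ?thesis
    proof (rule le)
      show "b + card ((S - {he e}) \<inter> ?H) \<le> b + card (S \<inter> ?H)" using fin by (intro add_left_mono card_mono) auto
      show "W ord R x b i (he e) (c + w e)" if "i \<le> m" "\<And>f. f < m \<Longrightarrow> d (ta f) < d (he e) \<Longrightarrow> pos f < i" for i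
        using W1 that True by (simp add: fwd_def)
    qed
  next
    case False
    have "he e \<in> S \<inter> ?H" using V False WP_step.hyps(1) by auto
    moreover have "(S - {he e}) \<inter> ?H = S \<inter> ?H - {he e}" by blast
    ultimately have "Suc (card ((S - {he e}) \<inter> ?H)) = card (S \<inter> ?H)" using fin by (simp add: card_Suc_Diff1 del: card_Diff_insert)
    \<comment> \<open>The next round pays for the head of this back arc, which does not occur again
      on the path.\<close>
    then show ?thesis using le[of "Suc b"] W_round[OF W1[OF e(2)]] by simp
  qed
  then show ?case unfolding S by (simp add: exc_def algebra_simps)
qed

end

subsection \<open>Writing out a candidate\<close>

definition back_step :: com where
  "back_step = When (BNot (nEq (nv 51) (nv 60)))
    (Seq (sto 53 (NCell 32 (nv 51))) (Seq (sto 51 (NCell 1 (nv 53))) (NStore 50 (nv 51) (nv 53))))"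

definition back_walk :: com where
  "back_walk = Seq (Seq (sto 51 (NCell 1 (nv 57))) (NStore 50 (nv 51) (nv 57))) (For 14 (nv 0) back_step)"

definition low_step :: com where
  "low_step = When (BNot (nEq (nv 52) (NCell 2 (nv 57))))
    (Seq (sto 53 (NSub (NCell 45 (pix (NCell 2 (nv 57)) (nv 51) (nv 52))) (NConst 1)))
    (Seq (sto 54 (NSub (NCell 46 (pix (NCell 2 (nv 57)) (nv 51) (nv 52))) (NConst 1)))
    (Seq (sto 51 (NCell 1 (nv 53))) (Seq (sto 52 (NCell 1 (nv 54)))
    (Seq (NStore 50 (nv 51) (nv 53)) (NStore 50 (nv 52) (nv 54)))))))"

definition s_step :: com where
  "s_step = When (BNot (nEq (nv 51) (NCell 0 (NConst 2))))
    (Seq (sto 53 (NCell 40 (nv 51))) (Seq (sto 51 (NCell 1 (nv 53))) (NStore 50 (nv 51) (nv 53))))"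

definition low_walk :: com where
  "low_walk = Seq (Seq (sto 51 (NCell 1 (nv 61))) (Seq (sto 52 (NCell 1 (nv 62)))
      (Seq (NStore 50 (nv 51) (nv 61)) (NStore 50 (nv 52) (nv 62)))))
    (Seq (For 14 (nv 0) low_step) (For 14 (nv 0) s_step))"

definition out_step :: com where
  "out_step = When (BNot (nEq (nv 51) (NCell 0 (NConst 3))))
    (Seq (NStore 4 (NCell 3 (NConst 1)) (NCell 50 (nv 51)))
    (Seq (NStore 3 (NConst 1) (NAdd (NCell 3 (NConst 1)) (NConst 1))) (sto 51 (NCell 2 (NCell 50 (nv 51))))))"

definition write_out :: com where
  "write_out = Seq (Seq (sto 51 (NCell 0 (NConst 2))) (NStore 3 (NConst 1) (NConst 0))) (For 14 (nv 0) out_step)"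

definition finalize :: com where
  "finalize = Seq back_walk (Seq low_walk write_out)"

lemma finalize_wr [simp]:
  "nwr back_step = {50, 51, 53}" "rwr back_step = {}" "loop_free back_step"
  "nwr back_walk = {14, 50, 51, 53}" "rwr back_walk = {}"
  "nwr low_step = {50, 51, 52, 53, 54}" "rwr low_step = {}" "loop_free low_step"
  "nwr s_step = {50, 51, 53}" "rwr s_step = {}" "loop_free s_step"
  "nwr low_walk = {14, 50, 51, 52, 53, 54}" "rwr low_walk = {}"
  "nwr out_step = {3, 4, 51}" "rwr out_step = {}" "loop_free out_step"
  "nwr write_out = {3, 4, 14, 51}" "rwr write_out = {}"
  "nwr finalize = {3, 4, 14, 50, 51, 52, 53, 54}" "rwr finalize = {}"
  by (auto simp: back_step_def back_walk_def low_step_def s_step_def low_walk_def out_step_def write_out_def finalize_def)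

lemma finalize_cost: "max_cost back_step \<le> 40" "max_cost low_step \<le> 120" "max_cost s_step \<le> 45" "max_cost out_step \<le> 50"
  by (simp_all add: back_step_def low_step_def s_step_def out_step_def)

context layered_arcs begin

text \<open>Values strictly decrease along parents, so the path traced back never repeats a vertex
  and reaches \<open>x\<close> within \<open>n\<close> steps. Its excess is bounded rather than
  computed, since stored values may exceed true weights.\<close>

lemma runs_back_walk:
  assumes I0: "inp \<sigma>" and x: "nmem \<sigma> 60 0 = x" "x < n" and el: "nmem \<sigma> 57 0 = el" "el < m" 
    and sp: "sp_inv ord R x r 0 rc ds pr" and rc: "rc (ta el) \<noteq> 0" and pr: "nmem \<sigma> 32 = pr"
  shows "runs back_walk \<sigma> (\<lambda>\<tau>. \<exists>S k. FOL (nmem \<tau> 50) x S (ta el) k \<and> nmem \<tau> 50 (ta el) = el \<and>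
    (\<forall>u\<in>S. u = x \<or> u \<notin> R) \<and> k \<le> ds (ta el) + d x - d (ta el) \<and> (\<forall>u. u \<notin> S \<longrightarrow> nmem \<tau> 50 u = nmem \<sigma> 50 u)) ((n + 1) * 70)"
  unfolding back_walk_def
proof (rule runs_Seq_run[where ?k2.0 = "(n + 1) * 60"], goal_cases)
  case (2 \<tau>)
  define J where "J i v suc \<longleftrightarrow> (\<exists>S k. FOL suc v S (ta el) k \<and> suc (ta el) = el \<and> (\<forall>u\<in>S. (u = x \<or> u \<notin> R) \<and> ds v \<le> ds u) \<and>
      rc v \<noteq> 0 \<and> k \<le> ds (ta el) - ds v + d v - d (ta el) \<and> (\<forall>u. u \<notin> S \<longrightarrow> suc u = nmem \<sigma> 50 u) \<and> (v \<noteq> x \<longrightarrow> card S = Suc i))"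
    for i v :: nat and suc :: "nat \<Rightarrow> nat"
  have I1: "inp \<tau>" unfolding 2 using I0 by (simp add: inp_def)
  have s1: "nmem \<tau> 60 0 = x" "nmem \<tau> 51 0 = ta el" "nmem \<tau> 50 = (nmem \<sigma> 50)(ta el := el)" "nmem \<tau> 32 = pr"
    unfolding 2 using x el pr inpD[OF I0] by simp_all
  have spv: "v \<noteq> x \<longrightarrow> pr v < m \<and> he (pr v) = v \<and> v \<notin> R \<and> rc (ta (pr v)) \<noteq> 0 \<and> ds (ta (pr v)) + w (pr v) \<le> ds v"
    if "v < n" "rc v \<noteq> 0" for v using sp that unfolding sp_inv_def by blast
  have "ds x = 0" using sp by (simp add: sp_inv_def)
  show ?case
  proof (rule runs_For_run[where N = n and I = "\<lambda>i \<tau>. J i (nmem \<tau> 51 0) (nmem \<tau> 50)"], goal_cases)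
    case 7
    show ?case unfolding J_def s1
      by (intro exI[of _ "{ta el}"] exI[of _ 0]) (use FOL_refl ta_less[OF el(2)] rc spv in auto)
  next
    case (8 i \<tau>1)
    have I2: "inp \<tau>1" by (rule inp_frame[OF I1 8(4)]) auto
    have u: "nmem \<tau>1 32 = pr" "nmem \<tau>1 60 0 = x" using frame_n[OF 8(4)] s1 by simp_all
    let ?v = "nmem \<tau>1 51 0" and ?suc = "nmem \<tau>1 50"
    obtain S k where S: "FOL ?suc ?v S (ta el) k" "?suc (ta el) = el" "\<forall>u\<in>S. (u = x \<or> u \<notin> R) \<and> ds ?v \<le> ds u"
      "rc ?v \<noteq> 0" "k \<le> ds (ta el) - ds ?v + d ?v - d (ta el)" "\<forall>u. u \<notin> S \<longrightarrow> ?suc u = nmem \<sigma> 50 u" "?v \<noteq> x \<longrightarrow> card S = Suc i"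
      using 8(3) unfolding J_def by blast
    show ?case
    proof (cases "?v = x")
      case True
      then have "run back_step \<tau>1 = \<tau>1" using u by (simp add: back_step_def)
      then show ?thesis using 8(3) True unfolding J_def by auto
    next
      case False
      have V: "?v < n" "ta el \<in> S" "finite S" using FOL_V[OF S(1)] by auto
      define e where "e = pr ?v"
      have e: "e < m" "he e = ?v" "rc (ta e) \<noteq> 0" "ds (ta e) + w e \<le> ds ?v"
        using spv[OF V(1) S(4)] False unfolding e_def by auto
      have rn: "nmem (run back_step \<tau>1) 51 0 = ta e" "nmem (run back_step \<tau>1) 50 = ?suc(ta e := e)"
        using False e(1) by (simp_all add: back_step_def u inpD[OF I2] e_def[symmetric])
      have lt: "ds (ta e) < ds ?v" using e(4) w_pos[OF e(1)] by linarith
      \<comment> \<open>The current vertex has the least value on the path, and its parent has a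
        smaller one.\<close>
      have nS: "ta e \<notin> S" using S(3) lt by force
      have 1: "FOL (?suc(ta e := e)) (ta e) (insert (ta e) S) (ta el) (exc e + k)"
        using FOL_cons[OF S(1) e(1,2) nS] .
      have 2: "(?suc(ta e := e)) (ta el) = el" using S(2) V(2) nS by auto
      have 3: "\<forall>u\<in>insert (ta e) S. (u = x \<or> u \<notin> R) \<and> ds (ta e) \<le> ds u"
        using S(3) lt spv[OF ta_less[OF e(1)] e(3)] by force
      have 4: "exc e + k \<le> ds (ta el) - ds (ta e) + d (ta e) - d (ta el)"
        using S(5) e(2,4) by (simp add: exc_def)
      have 5: "\<forall>u. u \<notin> insert (ta e) S \<longrightarrow> (?suc(ta e := e)) u = nmem \<sigma> 50 u" using S(6) by auto
      have 6: "card (insert (ta e) S) = Suc (Suc i)" using S(7) False nS V(3) by simp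
      show ?thesis unfolding J_def rn using 1 2 3 e(3) 4 5 6 by blast
    qed
  next
    case (9 \<tau>1)
    then obtain S k where S: "FOL (nmem \<tau>1 50) (nmem \<tau>1 51 0) S (ta el) k" "nmem \<tau>1 50 (ta el) = el" "\<forall>u\<in>S. u = x \<or> u \<notin> R"
      "k \<le> ds (ta el) - ds (nmem \<tau>1 51 0) + d (nmem \<tau>1 51 0) - d (ta el)" "\<forall>u. u \<notin> S \<longrightarrow> nmem \<tau>1 50 u = nmem \<sigma> 50 u"
      "nmem \<tau>1 51 0 \<noteq> x \<longrightarrow> card S = Suc n"
      unfolding J_def by blast
    have "nmem \<tau>1 51 0 = x" using FOL_V[OF S(1)] card_mono[of "{..<n}" S] S(6) by fastforce
    then show ?case using S \<open>ds x = 0\<close> by (intro exI[of _ S] exI[of _ k]) auto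
  next
    case 10
    show ?case using finalize_cost(1) by (intro mult_le_mono2) simp
  qed (auto simp: inpD[OF I1])
qed auto

lemma runs_low_walk:
  assumes R: "ready \<sigma>" and el: "nmem \<sigma> 57 0 = el" "el < m" "nmem \<sigma> 42 (he el) \<noteq> 0"
    and e1: "nmem \<sigma> 61 0 = e1" "e1 < m" and e2: "nmem \<sigma> 62 0 = e2" "e2 < m"
    and tb: "nmem \<sigma> 45 (cell (he el) (ta e1) (ta e2)) \<noteq> 0"
  shows "runs low_walk \<sigma> (\<lambda>\<tau>. \<exists>A B. FOL (nmem \<tau> 50) s A (ta e1) 0 \<and> FOL (nmem \<tau> 50) (he el) B (ta e2) 0 \<and> A \<inter> B = {} \<and>
    nmem \<tau> 50 (ta e1) = e1 \<and> nmem \<tau> 50 (ta e2) = e2 \<and> (\<forall>u. u \<notin> A \<union> B \<longrightarrow> nmem \<tau> 50 u = nmem \<sigma> 50 u)) ((n + 1) * 260)"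
  unfolding low_walk_def
proof (rule runs_Seq_run[where ?k2.0 = "(n + 1) * 140 + (n + 1) * 70"], goal_cases)
  case (2 \<tau>)
  define p q y where "p = ta e1" and "q = ta e2" and "y = he el"
  have pq: "p < n" "q < n" "y < n" using ta_less he_less e1 e2 el by (auto simp: p_def q_def y_def)
  have R1: "ready \<tau>" unfolding 2 using R by (simp add: ready_upn)
  note I1 = readyD(2)[OF R1]
  define U1 U2 where "U1 = nmem \<tau> 45" and "U2 = nmem \<tau> 46"
  have s1: "nmem \<tau> 57 0 = el" "nmem \<tau> 51 0 = p" "nmem \<tau> 52 0 = q" "nmem \<tau> 50 = (nmem \<sigma> 50)(p := e1, q := e2)"
    "U1 = nmem \<sigma> 45" "nmem \<tau> 42 = nmem \<sigma> 42"
    unfolding U1_def 2 using el e1 e2 inpD[OF readyD(2)[OF R]] by (simp_all add: p_def q_def)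
  have tab: "tab (nmem \<tau> 30) ta he U1 U2 y" using R1 el(3) pq(3) s1(6) unfolding ready_def U1_def U2_def y_def by simp
  have U: "U1 (cell y p q) \<noteq> 0" using tb s1(5) unfolding p_def q_def y_def by simp
  have ne: "p \<noteq> q" "d p = d q" using tab_next[OF tab pq(1,2) U] by auto
  define J where "J i a b suc \<longleftrightarrow> (\<exists>A B. FOL suc a A p 0 \<and> FOL suc b B q 0 \<and> A \<inter> B = {} \<and> suc p = e1 \<and> suc q = e2 \<and>
      U1 (cell y a b) \<noteq> 0 \<and> (\<forall>u. u \<notin> A \<union> B \<longrightarrow> suc u = nmem \<sigma> 50 u) \<and> (b \<noteq> y \<longrightarrow> card B = Suc i))"
    for i a b :: nat and suc :: "nat \<Rightarrow> nat"
  have Jstep: "J (Suc i) (ta e) (ta f) (suc(ta e := e, ta f := f))"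
    if J: "J i a b suc" and ef: "b \<noteq> y" "fwd e" "fwd f" "he e = a" "he f = b" "U1 (cell y (ta e) (ta f)) \<noteq> 0"
    for i a b suc e f
  proof -
    obtain A B where AB: "FOL suc a A p 0" "FOL suc b B q 0" "A \<inter> B = {}" "suc p = e1" "suc q = e2"
      "U1 (cell y a b) \<noteq> 0" "\<forall>u. u \<notin> A \<union> B \<longrightarrow> suc u = nmem \<sigma> 50 u" "card B = Suc i" using J ef(1) unfolding J_def by blast
    note VA = FOL_V[OF AB(1)] and VB = FOL_V[OF AB(2)]
    have em: "e < m" "f < m" using ef by (auto simp: fwd_def)
    have ab: "a \<noteq> b" "d a = d b" using tab_next[OF tab _ _ AB(6)] VA VB by auto
    have tt: "ta e \<noteq> ta f" "d (ta e) = d (ta f)" using tab_next[OF tab _ _ ef(6)] ta_less em by auto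
    have A1: "d a \<le> d v" if "v \<in> A" for v using FP_bounds[OF FOL_FP[OF AB(1)] that] by simp
    have B1: "d a \<le> d v" if "v \<in> B" for v using FP_bounds[OF FOL_FP[OF AB(2)] that] ab by simp
    have lt: "d (ta e) < d a" "d (ta f) < d a" using ef ab by (auto simp: fwd_def)
    have nA: "ta e \<notin> A" "ta e \<notin> B" "ta f \<notin> A" "ta f \<notin> B" using A1 B1 lt by force+
    have mem: "p \<in> A" "q \<in> B" using VA VB by auto
    have "FOL (suc(ta f := f)) a A p 0" by (rule FOL_cong[OF AB(1)]) (use nA in auto)
    then have 1: "FOL (suc(ta e := e, ta f := f)) (ta e) (insert (ta e) A) p 0"
      using FOL_cons[of "suc(ta f := f)" a A p 0 e] em ef nA exc_fwd tt by (simp add: fun_upd_twist)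
    have "FOL (suc(ta e := e)) b B q 0" by (rule FOL_cong[OF AB(2)]) (use nA in auto)
    then have 2: "FOL (suc(ta e := e, ta f := f)) (ta f) (insert (ta f) B) q 0"
      using FOL_cons[of "suc(ta e := e)" b B q 0 f] em ef nA exc_fwd by simp
    have 3: "(suc(ta e := e, ta f := f)) p = e1" "(suc(ta e := e, ta f := f)) q = e2" using AB(4,5) mem nA by auto
    have "insert (ta e) A \<inter> insert (ta f) B = {}" using nA AB(3) tt by auto
    moreover have "card (insert (ta f) B) = Suc (Suc i)" using AB(8) nA VB by simp
    moreover have "\<forall>u. u \<notin> insert (ta e) A \<union> insert (ta f) B \<longrightarrow> (suc(ta e := e, ta f := f)) u = nmem \<sigma> 50 u" using AB(7) by auto
    ultimately show ?thesis unfolding J_def using 1 2 3 ef(6) by blast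
  qed
  show ?case
  proof (rule runs_Seq[where Q = "\<lambda>\<tau>. nmem \<tau> 52 0 = y \<and> J n (nmem \<tau> 51 0) (nmem \<tau> 52 0) (nmem \<tau> 50)"
        and ?k1.0 = "(n + 1) * 140" and ?k2.0 = "(n + 1) * 70"], goal_cases)
    case 1
    show ?case
    proof (rule runs_For_run[where N = n and I = "\<lambda>i \<tau>. J i (nmem \<tau> 51 0) (nmem \<tau> 52 0) (nmem \<tau> 50)"], goal_cases)
      case 7
      show ?case unfolding J_def s1(2-4)
        by (intro exI[of _ "{p}"] exI[of _ "{q}"]) (use FOL_refl pq ne U in auto)
    next
      case (8 i \<tau>1)
      have R2: "ready \<tau>1" by (rule ready_frame[OF R1 8(4)]) auto
      note P2 = readyD(1)[OF R2] and I2 = readyD(2)[OF R2]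
      have u: "nmem \<tau>1 45 = U1" "nmem \<tau>1 46 = U2" "nmem \<tau>1 57 0 = el"
        using frame_n[OF 8(4)] s1(1) by (simp_all add: U1_def U2_def)
      let ?a = "nmem \<tau>1 51 0" and ?b = "nmem \<tau>1 52 0"
      show ?case
      proof (cases "?b = y")
        case True
        then have "run low_step \<tau>1 = \<tau>1" using u el(2) by (simp add: low_step_def inpD[OF I2] y_def)
        then show ?thesis using 8(3) True unfolding J_def by auto
      next
        case False
        obtain A B where AB: "FOL (nmem \<tau>1 50) ?a A p 0" "FOL (nmem \<tau>1 50) ?b B q 0" "U1 (cell y ?a ?b) \<noteq> 0"
          using 8(3) unfolding J_def by blast
        have bn: "?a < n" "?b < n" using FOL_V[OF AB(1)] FOL_V[OF AB(2)] by auto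
        obtain e f where ef: "fwd e" "fwd f" "U1 (cell y ?a ?b) = Suc e" "U2 (cell y ?a ?b) = Suc f" "he e = ?a" "he f = ?b"
          "U1 (cell y (ta e) (ta f)) \<noteq> 0" using tab_next(3)[OF tab bn AB(3)] False by blast
        have em: "e < m" "f < m" using ef by (auto simp: fwd_def)
        have c: "nmem \<tau>1 44 y + nmem \<tau>1 43 ?a + ?b = cell y ?a ?b"
          using prepD(9,10)[OF P2] pq bn by (simp add: cell_def)
        have hy: "nmem \<tau>1 2 el = y" using inpD(6)[OF I2 el(2)] by (simp add: y_def)
        have "nmem (run low_step \<tau>1) 51 0 = ta e" "nmem (run low_step \<tau>1) 52 0 = ta f"
          "nmem (run low_step \<tau>1) 50 = (nmem \<tau>1 50)(ta e := e, ta f := f)"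
          using False em by (simp_all add: low_step_def u hy c ef inpD(5)[OF I2])
        then show ?thesis using Jstep[OF 8(3) False ef(1,2,5,6,7)] by simp
      qed
    next
      case (9 \<tau>1)
      have "nmem \<tau>1 52 0 = y"
      proof (rule ccontr)
        assume "nmem \<tau>1 52 0 \<noteq> y"
        then obtain B where B: "FOL (nmem \<tau>1 50) (nmem \<tau>1 52 0) B q 0" "card B = Suc n" using 9(1) unfolding J_def by blast
        then show False using FOL_V[OF B(1)] card_mono[of "{..<n}" B] by simp
      qed
      then show ?case using 9(1) by simp
    next
      case 10
      show ?case using finalize_cost(2) by (intro mult_le_mono2) simp
    qed (auto simp: inpD[OF I1])
  next
    case (2 \<tau>1)
    have R2: "ready \<tau>1" by (rule ready_frame[OF R1 2(2)]) auto
    let ?a0 = "nmem \<tau>1 51 0"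
    obtain A0 B where AB: "FOL (nmem \<tau>1 50) ?a0 A0 p 0" "FOL (nmem \<tau>1 50) y B q 0" "A0 \<inter> B = {}"
      "nmem \<tau>1 50 p = e1" "nmem \<tau>1 50 q = e2" "U1 (cell y ?a0 y) \<noteq> 0" "\<forall>u. u \<notin> A0 \<union> B \<longrightarrow> nmem \<tau>1 50 u = nmem \<sigma> 50 u"
      using 2(1) unfolding J_def by auto
    have a0: "?a0 < n" "?a0 \<in> A0" "finite A0" using FOL_V[OF AB(1)] by auto
    have da0: "d ?a0 = d y" using tab_next(2)[OF tab a0(1) pq(3) AB(6)] .
    \<comment> \<open>The second path is already back at \<open>y\<close>. From here on the first
      one descends below the level of \<open>y\<close>, where it cannot meet the second, so
      arbitrary entering forward arcs lead it to \<open>s\<close>.\<close>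
    define L where "L i a suc \<longleftrightarrow> FOL suc y B q 0 \<and> suc p = e1 \<and> suc q = e2 \<and> (\<exists>A. FOL suc a A p 0 \<and> A \<inter> B = {} \<and> d a \<le> d y \<and>
      (\<forall>u. u \<notin> A \<union> B \<longrightarrow> suc u = nmem \<sigma> 50 u) \<and> (a \<noteq> s \<longrightarrow> i < card A))" for i a :: nat and suc :: "nat \<Rightarrow> nat"
    show ?case
    proof (rule runs_For_run[where N = n and I = "\<lambda>i \<tau>. L i (nmem \<tau> 51 0) (nmem \<tau> 50)"], goal_cases)
      case 7
      have "0 < card A0" using a0 by (auto simp: card_gt_0_iff)
      then show ?case unfolding L_def using AB da0 by auto
    next
      case (8 i \<tau>3)
      have R4: "ready \<tau>3" by (rule ready_frame[OF R2 8(4)]) auto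
      note P4 = readyD(1)[OF R4] and I4 = readyD(2)[OF R4]
      let ?a = "nmem \<tau>3 51 0" and ?suc = "nmem \<tau>3 50"
      obtain A where A: "FOL ?suc y B q 0" "?suc p = e1" "?suc q = e2" "FOL ?suc ?a A p 0" "A \<inter> B = {}" "d ?a \<le> d y"
        "\<forall>u. u \<notin> A \<union> B \<longrightarrow> ?suc u = nmem \<sigma> 50 u" "?a \<noteq> s \<longrightarrow> i < card A" using 8(3) unfolding L_def by blast
      show ?case
      proof (cases "?a = s")
        case True
        then have "run s_step \<tau>3 = \<tau>3" by (simp add: s_step_def inpD[OF I4])
        then show ?thesis using A True unfolding L_def by auto
      next
        case False
        have aA: "?a < n" "?a \<in> A" "finite A" "p \<in> A" using FOL_V[OF A(4)] by auto
        have qB: "q \<in> B" using FOL_V[OF A(1)] by auto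
        obtain S where S: "FP s S ?a" using ex_FP_s aA by blast
        then obtain g where g: "fwd g" "he g = ?a" using FP_pred[OF S _ False] FP_V[OF S] by blast
        define e where "e = nmem \<tau>3 40 ?a"
        have e: "fwd e" "he e = ?a" using prepD(3)[OF P4] g unfolding classified_def e_def by metis+
        have em: "e < m" using e by (simp add: fwd_def)
        have lt: "d (ta e) < d ?a" using e by (simp add: fwd_def)
        have nB: "ta e \<notin> B" "ta e \<notin> A"
          using FP_bounds[OF FOL_FP[OF A(1)], of "ta e"] FP_bounds[OF FOL_FP[OF A(4)], of "ta e"] lt A(6) by force+
        have rn: "nmem (run s_step \<tau>3) 51 0 = ta e" "nmem (run s_step \<tau>3) 50 = ?suc(ta e := e)"
          using False em by (simp_all add: s_step_def inpD[OF I4] e_def[symmetric])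
        have 1: "FOL (?suc(ta e := e)) y B q 0" by (rule FOL_cong[OF A(1)]) (use nB in auto)
        have 2: "FOL (?suc(ta e := e)) (ta e) (insert (ta e) A) p 0"
          using FOL_cons[OF A(4) em e(2) nB(2)] exc_fwd[OF e(1)] by simp
        have 3: "(?suc(ta e := e)) p = e1" "(?suc(ta e := e)) q = e2" using A(2,3) aA(4) qB nB by auto
        have 4: "\<forall>u. u \<notin> insert (ta e) A \<union> B \<longrightarrow> (?suc(ta e := e)) u = nmem \<sigma> 50 u" using A(7) by auto
        have "insert (ta e) A \<inter> B = {}" "d (ta e) \<le> d y" "Suc i < card (insert (ta e) A)"
          using A(5,6,8) nB lt False aA(3) by auto
        then show ?thesis unfolding L_def rn using 1 2 3 4 by blast
      qed
    next
      case (9 \<tau>3)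
      then obtain A where A: "FOL (nmem \<tau>3 50) y B q 0" "nmem \<tau>3 50 p = e1" "nmem \<tau>3 50 q = e2" "FOL (nmem \<tau>3 50) (nmem \<tau>3 51 0) A p 0" "A \<inter> B = {}"
        "\<forall>u. u \<notin> A \<union> B \<longrightarrow> nmem \<tau>3 50 u = nmem \<sigma> 50 u" "nmem \<tau>3 51 0 \<noteq> s \<longrightarrow> n < card A" unfolding L_def by blast
      have "nmem \<tau>3 51 0 = s" using FOL_V[OF A(4)] card_mono[of "{..<n}" A] A(7) by fastforce
      then show ?case using A unfolding p_def q_def y_def by auto
    next
      case 10
      show ?case using finalize_cost(3) by (intro mult_le_mono2) simp
    qed (auto simp: inpD[OF readyD(2)[OF R2]])
  qed auto
qed auto

section \<open>Arc lists, output and assembly of a candidate\<close>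

fun chain :: "nat \<Rightarrow> nat list \<Rightarrow> nat \<Rightarrow> bool" where
  "chain a [] b \<longleftrightarrow> a = b"
| "chain a (e # es) b \<longleftrightarrow> e < m \<and> ta e = a \<and> chain (he e) es b"

lemma chain_snoc: "chain a (es @ [e]) b \<longleftrightarrow> chain a es (ta e) \<and> e < m \<and> he e = b"
  by (induction es arbitrary: a) auto

definition spath :: "nat list \<Rightarrow> real \<Rightarrow> bool" where
  "spath l k \<longleftrightarrow> chain s l t \<and> distinct (s # map he l) \<and> sum_list (map exc l) = k"

text \<open>The conclusion is conditional because a candidate need not be a simple path. The walk
  halts after \<open>n\<close> rounds in any case, possibly leaving a meaningless list
  behind.\<close>

lemma runs_write_out:
  assumes I0: "inp \<sigma>"
  shows "runs write_out \<sigma> (\<lambda>\<tau>. nmem \<tau> 3 0 = nmem \<sigma> 3 0 \<and>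
    (\<forall>S k. FOL (nmem \<sigma> 50) s S t k \<longrightarrow> spath (map (nmem \<tau> 4) [0..<nmem \<tau> 3 1]) k)) ((n + 1) * 80)"
  unfolding write_out_def
proof (rule runs_Seq_run[where ?k2.0 = "(n + 1) * 70"], goal_cases)
  case (2 \<tau>)
  define f where "f = nmem \<sigma> 50"
  define J where "J i v l \<longleftrightarrow> (\<forall>S k. FOL f s S t k \<longrightarrow> (\<exists>S' k'. FOL f v S' t k' \<and> chain s l v \<and> distinct (s # map he l) \<and>
      set (s # map he l) \<inter> S' = {v} \<and> set (s # map he l) \<subseteq> {..<n} \<and> sum_list (map exc l) + k' = k \<and> (v \<noteq> t \<longrightarrow> length l = i)))"
    for i v l
  have I1: "inp \<tau>" unfolding 2 using I0 by (simp add: inp_def)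
  have s1: "nmem \<tau> 51 0 = s" "nmem \<tau> 3 1 = 0" "nmem \<tau> 3 0 = nmem \<sigma> 3 0" "nmem \<tau> 50 = f"
    unfolding 2 f_def using inpD[OF I0] by simp_all
  show ?case
  proof (rule runs_For_run[where N = n and I = "\<lambda>i \<tau>. nmem \<tau> 3 0 = nmem \<sigma> 3 0 \<and>
        J i (nmem \<tau> 51 0) (map (nmem \<tau> 4) [0..<nmem \<tau> 3 1])"], goal_cases)
    case 7
    show ?case unfolding J_def s1 using s_less s1 FOL_V by auto
  next
    case (8 i \<tau>1)
    have I2: "inp \<tau>1" by (rule inp_frame[OF I1 8(4)]) auto
    have u: "nmem \<tau>1 50 = f" using frame_n[OF 8(4)] s1 by simp
    let ?v = "nmem \<tau>1 51 0" and ?l = "map (nmem \<tau>1 4) [0..<nmem \<tau>1 3 1]"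
    show ?case
    proof (cases "?v = t")
      case True
      then have "run out_step \<tau>1 = \<tau>1" by (simp add: out_step_def inpD[OF I2])
      then show ?thesis using 8(3) True unfolding J_def by auto
    next
      case False
      let ?\<tau> = "run out_step \<tau>1"
      have rn: "nmem ?\<tau> 3 0 = nmem \<tau>1 3 0" "map (nmem ?\<tau> 4) [0..<nmem ?\<tau> 3 1] = ?l @ [f ?v]"
        "nmem ?\<tau> 51 0 = nmem \<tau>1 2 (f ?v)"
        using False u by (simp_all add: out_step_def inpD[OF I2])
      have "J (Suc i) (nmem \<tau>1 2 (f ?v)) (?l @ [f ?v])"
        unfolding J_def
      proof (intro allI impI)
        fix S k assume "FOL f s S t k"
        then obtain S' k' where S: "FOL f ?v S' t k'" "chain s ?l ?v" "distinct (s # map he ?l)"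
          "set (s # map he ?l) \<inter> S' = {?v}" "set (s # map he ?l) \<subseteq> {..<n}" "sum_list (map exc ?l) + k' = k" "length ?l = i"
          using 8(3) False unfolding J_def by blast
        obtain e S'' k'' where e: "f ?v = e" "ta e = ?v" "e < m" "FOL f (he e) S'' t k''" "S' = insert ?v S''" "?v \<notin> S''" "k' = exc e + k''"
          using S(1) False by (cases rule: FOL.cases) auto
        have hS: "he e \<in> S''" "he e < n" using FOL_V[OF e(4)] by auto
        have vl: "set (s # map he ?l) \<inter> S'' = {}"
        proof (rule ccontr)
          assume "set (s # map he ?l) \<inter> S'' \<noteq> {}"
          then obtain u where u: "u \<in> set (s # map he ?l)" "u \<in> S''" by blast
          then have "u \<in> {?v}" unfolding S(4)[symmetric] e(5) by blast
          then show False using u(2) e(6) by simp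
        qed
        have hl: "he e \<notin> set (s # map he ?l)" using vl hS(1) by blast
        have 1: "chain s (?l @ [e]) (he e)" using S(2) e(2,3) by (simp add: chain_snoc del: map_append)
        have 2: "distinct (s # map he (?l @ [e]))" using S(3) hl by auto
        have 3: "set (s # map he (?l @ [e])) = insert (he e) (set (s # map he ?l))" by auto
        have 4: "set (s # map he (?l @ [e])) \<inter> S'' = {he e}" "set (s # map he (?l @ [e])) \<subseteq> {..<n}"
          unfolding 3 using vl hS S(5) by auto
        have 5: "sum_list (map exc (?l @ [e])) + k'' = k" using S(6) e(7) by simp
        have 6: "length (?l @ [e]) = Suc i" using S(7) by simp
        have h: "nmem \<tau>1 2 e = he e" using inpD(6)[OF I2 e(3)] .
        show "\<exists>S' k'. FOL f (nmem \<tau>1 2 (f ?v)) S' t k' \<and> chain s (?l @ [f ?v]) (nmem \<tau>1 2 (f ?v)) \<and> distinct (s # map he (?l @ [f ?v])) \<and>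
          set (s # map he (?l @ [f ?v])) \<inter> S' = {nmem \<tau>1 2 (f ?v)} \<and> set (s # map he (?l @ [f ?v])) \<subseteq> {..<n} \<and>
          sum_list (map exc (?l @ [f ?v])) + k' = k \<and> (nmem \<tau>1 2 (f ?v) \<noteq> t \<longrightarrow> length (?l @ [f ?v]) = Suc i)"
          unfolding e(1) h by (intro exI[of _ S''] exI[of _ k''] conjI impI) (rule e(4) 1 2 4 5 6)+
      qed
      then show ?thesis unfolding rn using 8(3) by blast
    qed
  next
    case (9 \<tau>1)
    let ?l = "map (nmem \<tau>1 4) [0..<nmem \<tau>1 3 1]" and ?v = "nmem \<tau>1 51 0"
    have "spath ?l k" if F: "FOL f s S t k" for S k
    proof -
      obtain S' k' where S: "FOL f ?v S' t k'" "chain s ?l ?v" "distinct (s # map he ?l)"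
          "set (s # map he ?l) \<subseteq> {..<n}" "sum_list (map exc ?l) + k' = k" "?v \<noteq> t \<longrightarrow> length ?l = n"
        using 9(1) F unfolding J_def by blast
      \<comment> \<open>A walk still short of \<open>t\<close> after \<open>n\<close> arcs would
        have visited \<open>n + 1\<close> distinct vertices.\<close>
      have "card (set (s # map he ?l)) = Suc (length ?l)" using distinct_card[OF S(3)] by simp
      then have "length ?l < n" using card_mono[OF _ S(4)] by simp
      then have v: "?v = t" using S(6) by auto
      then have "k' = 0" using WP_loop[OF FOL_WP, of f t S' k'] S(1) by simp
      then show ?thesis unfolding spath_def using S(2,3,5) v by simp
    qed
    then show ?case using 9(1) unfolding f_def by blast
  next
    case 10
    show ?case using finalize_cost(4) by (intro mult_le_mono2) simp
  qed (auto simp: inpD[OF I1])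
qed auto

text \<open>By \<open>sound\<close>, a candidate either yields a strictly cheaper competitor, and
  then its value is not a lower bound, or its pieces meet only where they are joined. In the latter
  case no successor written later overwrites one that is still needed.\<close>

lemma assemble:
  assumes e1: "fwd e1" and e2: "fwd e2" and lev: "d (ta e1) = d (ta e2)" and el: "el < m" "\<not> fwd el"
    and Ah: "FOL f0 (he e1) Ah x 0" and Bh: "FOL f0 (he e2) Bh t 0" and dh: "Ah \<inter> Bh = {}"
    and R: "\<And>v. v < n \<Longrightarrow> v \<in> R \<longleftrightarrow> v \<in> anc (ta e1) \<union> {he e1} \<union> Bh"
    and S: "FOL f1 x S (ta el) k1" "f1 (ta el) = el" "\<forall>u\<in>S. u = x \<or> u \<notin> R" "k1 \<le> ds (ta el) + d x - d (ta el)"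
    and fr1: "\<forall>u. u \<notin> S \<longrightarrow> f1 u = f0 u"
    and Al: "FOL f2 s Al (ta e1) 0" and Bl: "FOL f2 (he el) Bl (ta e2) 0" and dl: "Al \<inter> Bl = {}"
    and f2: "f2 (ta e1) = e1" "f2 (ta e2) = e2" and fr2: "\<forall>u. u \<notin> Al \<union> Bl \<longrightarrow> f2 u = f1 u"
  shows "(\<exists>P k. nsp P k \<and> k \<le> cval x ds el) \<and>
    ((\<forall>P k. nsp P k \<longrightarrow> cval x ds el \<le> k) \<longrightarrow> (\<exists>P k. FOL f2 s P t k \<and> 0 < k \<and> k \<le> cval x ds el))"
proof -
  note Ah' = FOL_FP[OF Ah] and Bh' = FOL_FP[OF Bh] and Al' = FOL_FP[OF Al] and Bl' = FOL_FP[OF Bl]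
  define y where "y = he el"
  note snd = sound[OF Al' Ah' Bl' Bh' e1 refl refl e2 refl refl lev dl dh]
  have k1: "k1 + exc el \<le> cval x ds el" using S(4) by (simp add: cval_def exc_def)
  have ex: "0 < exc el" using exc_back el by blast
  have Sn: "S \<subseteq> {..<n}" "x \<in> S" "ta el \<in> S" "0 \<le> k1" using FOL_V[OF S(1)] by auto
  have AlA: "Al \<subseteq> anc (ta e1)" using FP_upper[OF Al'] unfolding anc_def by blast
  have Rs: "v \<in> R" if "v \<in> Al \<union> {he e1} \<union> Bh" for v
    using R[of v] that AlA FP_V[OF Al'] FP_V[OF Bh'] FP_V[OF Ah'] by blast
  have av: "(S - {x}) \<inter> (Al \<union> {he e1} \<union> Bh) = {}" using S(3) Rs by blast
  show ?thesis
  proof (cases "y \<in> S")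
    \<comment> \<open>The path to the tail of \<open>el\<close> already passes through
      \<open>y\<close>; its piece up to \<open>y\<close> is a cheaper middle without
      \<open>el\<close>.\<close>
    case True
    obtain S1 S2 ka kb where sp: "WP x S1 y ka" "WP y S2 (ta el) kb" "S = S1 \<union> S2" "k1 = ka + kb"
      using WP_split[OF FOL_WP[OF S(1)] True] by blast
    have "(S1 - {x, y}) \<inter> (Al \<union> {he e1} \<union> Bh) = {}" using av sp(3) by blast
    then obtain P k where "nsp P k" "k \<le> ka" using snd[OF sp(1)[unfolded y_def]] unfolding y_def by (meson order_less_imp_le order_refl)
    moreover have "ka < cval x ds el" using sp(4) WP_V[OF sp(2)] ex k1 by linarith
    ultimately show ?thesis by (meson leD order_le_less_trans order_less_imp_le)
  next
    case False
    have "FOL f1 x (S \<union> {y}) y (k1 + (exc el + 0))"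
      using FOL_join[OF S(1) el(1) S(2) refl FOL_refl[OF he_less[OF el(1)]]] False unfolding y_def by blast
    then have M: "WP x (S \<union> {y}) y (k1 + exc el)" using FOL_WP by fastforce
    have "(S \<union> {y} - {x, y}) \<inter> (Al \<union> {he e1} \<union> Bh) = {}" using av by blast
    then consider (cheaper) "\<exists>P k'. nsp P k' \<and> k' < k1 + exc el" |
      (simple) "(S \<union> {y}) \<inter> (Al \<union> Ah) = {x}" "(S \<union> {y}) \<inter> (Bl \<union> Bh) = {y}" "(Al \<union> Ah) \<inter> (Bl \<union> Bh) = {}"
        "nsp (Al \<union> Ah \<union> (S \<union> {y}) \<union> (Bl \<union> Bh)) (k1 + exc el)"
      using snd[OF M[unfolded y_def]] unfolding y_def by blast
    then show ?thesis
    proof cases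
      case cheaper
      then obtain P k' where "nsp P k'" "k' < cval x ds el" using k1 by (meson order_less_le_trans)
      then show ?thesis by (meson leD order_less_imp_le)
    next
      case simple
      have lt: "d (ta e1) < d (he e1)" using e1 by (simp add: fwd_def)
      have AhAl: "Ah \<inter> (Al \<union> Bl) = {}"
      proof -
        have "d u \<le> d (ta e1)" if "u \<in> Al \<union> Bl" for u
          using FP_bounds[OF Al', of u] FP_bounds[OF Bl', of u] that lev by auto
        moreover have "d (he e1) \<le> d u" if "u \<in> Ah" for u using FP_bounds[OF Ah' that] by simp
        ultimately show ?thesis using lt by fastforce
      qed
      have yBl: "y \<in> Bl" using FP_V[OF Bl'] unfolding y_def by blast
      have he12: "d (he e1) = d (he e2)" using fwd_level[OF e1 e2 lev] .
      have BhAl: "Bh \<inter> (Al \<union> Bl) = {}"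
      proof -
        have "d u \<le> d (ta e1)" if "u \<in> Al \<union> Bl" for u
          using FP_bounds[OF Al', of u] FP_bounds[OF Bl', of u] that lev by auto
        moreover have "d (he e1) \<le> d u" if "u \<in> Bh" for u using FP_bounds[OF Bh' that] he12 by simp
        ultimately show ?thesis using lt by fastforce
      qed
      \<comment> \<open>From here on, each piece of the path is shown to be untouched by the writes
        of the later walks.\<close>
      have sA: "u = x" if "u \<in> S \<union> {y}" "u \<in> Al \<union> Ah" for u using IntI[OF that] unfolding simple(1) by simp
      have sB: "u = y" if "u \<in> S \<union> {y}" "u \<in> Bl \<union> Bh" for u using IntI[OF that] unfolding simple(2) by simp
      have SB: "S \<inter> (Bl \<union> Bh) = {}" using sB False by blast
      have xAh: "x \<in> Ah" using FP_V[OF Ah'] by blast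
      have SAl: "S \<inter> Al = {}" using sA AhAl xAh by blast
      have g1: "FOL f2 (he e1) Ah x 0"
      proof (rule FOL_cong[OF Ah])
        fix v assume v: "v \<in> Ah" "v \<noteq> x"
        then have "v \<notin> S" "v \<notin> Al \<union> Bl" using sA AhAl by blast+
        then show "f0 v = f2 v" using fr1 fr2 by simp
      qed
      have g2: "FOL f2 (he e2) Bh t 0"
      proof (rule FOL_cong[OF Bh])
        fix v assume v: "v \<in> Bh"
        then have "v \<notin> S" "v \<notin> Al \<union> Bl" using SB BhAl by blast+
        then show "f0 v = f2 v" using fr1 fr2 by simp
      qed
      have g3: "FOL f2 x S (ta el) k1"
        by (rule FOL_cong[OF S(1)]) (use fr2 SB SAl in auto)
      have f2el: "f2 (ta el) = el" using fr2 S(2) SB SAl Sn by auto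
      have e1m: "e1 < m" "e2 < m" using e1 e2 by (auto simp: fwd_def)
      have 1: "FOL f2 s (Al \<union> Ah) x (0 + (exc e1 + 0))"
        by (rule FOL_join[OF Al e1m(1) f2(1) refl g1]) (use AhAl in blast)
      have 2: "FOL f2 y (Bl \<union> Bh) t (0 + (exc e2 + 0))"
        using FOL_join[OF Bl e1m(2) f2(2) refl g2] BhAl unfolding y_def by blast
      have 3: "FOL f2 s (Al \<union> Ah \<union> S) (ta el) (0 + (exc e1 + 0) + k1)"
        by (rule FOL_trans[OF 1 g3]) (use sA in blast)
      have 4: "FOL f2 s (Al \<union> Ah \<union> S \<union> (Bl \<union> Bh)) t (0 + (exc e1 + 0) + k1 + (exc el + (0 + (exc e2 + 0))))"
        by (rule FOL_join[OF 3 el(1) f2el refl 2[unfolded y_def]]) (use simple(3) SB in blast)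
      then have "FOL f2 s (Al \<union> Ah \<union> S \<union> (Bl \<union> Bh)) t (k1 + exc el)" using exc_fwd e1 e2 by simp
      moreover have "0 < k1 + exc el" using Sn ex by simp
      ultimately show ?thesis using simple(4) k1 by blast
    qed
  qed
qed

text \<open>Whether the stored value is optimal is unknown while the loop runs. So a correct list is
  promised only in case the value turns out to be a lower bound, while some competitor that is no
  more expensive is promised always.\<close>

definition goodout :: "ram_state \<Rightarrow> bool" where
  "goodout \<tau> \<longleftrightarrow> nmem \<tau> 3 0 \<noteq> 0 \<longrightarrow> (\<exists>P k. nsp P k \<and> k \<le> rmem \<tau> 4 0) \<and>
    ((\<forall>P k. nsp P k \<longrightarrow> rmem \<tau> 4 0 \<le> k) \<longrightarrow>
      (\<exists>k. spath (map (nmem \<tau> 4) [0..<nmem \<tau> 3 1]) k \<and> 0 < k \<and> k \<le> rmem \<tau> 4 0))"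

lemma runs_finalize:
  assumes R: "ready \<sigma>" and x: "nmem \<sigma> 60 0 = x" "x < n" and e1: "nmem \<sigma> 61 0 = e1" "fwd e1" and e2: "nmem \<sigma> 62 0 = e2" "fwd e2"
    and lev: "d (ta e1) = d (ta e2)"
    and wk: "walked (he e1) (he e2) x rem (anc (ta e1) \<union> {he e1}) B (nmem \<sigma> 50)"
    and sp: "sp_inv ord {v. rem v \<noteq> 0} x r 0 rc ds (nmem \<sigma> 32)"
    and el: "nmem \<sigma> 57 0 = el" and cd: "cand e1 e2 (nmem \<sigma> 45) rc el" and best: "rmem \<sigma> 4 0 = cval x ds el"
  shows "runs finalize \<sigma> (\<lambda>\<tau>. goodout \<tau> \<and> nmem \<tau> 3 0 = nmem \<sigma> 3 0) ((n + 1) * 410)"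
  unfolding finalize_def
proof -
  have em: "e1 < m" "e2 < m" "el < m" "\<not> fwd el" "rc (ta el) \<noteq> 0" "nmem \<sigma> 45 (cell (he el) (ta e1) (ta e2)) \<noteq> 0"
    using e1 e2 cd by (auto simp: fwd_def cand_def)
  obtain Ah where Ah: "FOL (nmem \<sigma> 50) (he e1) Ah x 0" "FOL (nmem \<sigma> 50) (he e2) B t 0" "Ah \<inter> B = {}"
    "\<forall>v<n. rem v \<noteq> 0 \<longleftrightarrow> v \<in> anc (ta e1) \<union> {he e1} \<union> B" using wk unfolding walked_def by blast
  show "runs (Seq back_walk (Seq low_walk write_out)) \<sigma> (\<lambda>\<tau>. goodout \<tau> \<and> nmem \<tau> 3 0 = nmem \<sigma> 3 0) ((n + 1) * 410)"
  proof (rule runs_Seq[OF runs_back_walk[OF readyD(2)[OF R] x el em(3) sp em(5) refl],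
        where ?k2.0 = "(n + 1) * 260 + (n + 1) * 80"], goal_cases)
    case (1 \<tau>)
    then obtain S k1 where S: "FOL (nmem \<tau> 50) x S (ta el) k1" "nmem \<tau> 50 (ta el) = el" "\<forall>u\<in>S. u = x \<or> u \<notin> {v. rem v \<noteq> 0}"
      "k1 \<le> ds (ta el) + d x - d (ta el)" "\<forall>u. u \<notin> S \<longrightarrow> nmem \<tau> 50 u = nmem \<sigma> 50 u" by blast
    have R1: "ready \<tau>" by (rule ready_frame[OF R 1(2)]) auto
    note f1 = frame_n[OF 1(2)] frame_r[OF 1(2)]
    have fl: "nmem \<tau> 42 (he el) \<noteq> 0" using prepD(3)[OF readyD(1)[OF R1]] em unfolding classified_def by blast
    show ?case
    proof (rule runs_Seq[OF runs_low_walk[OF R1 _ em(3) fl _ em(1) _ em(2)], where ?k2.0 = "(n + 1) * 80"], goal_cases)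
      case (5 \<tau>1)
      then obtain Al Bl where A: "FOL (nmem \<tau>1 50) s Al (ta e1) 0" "FOL (nmem \<tau>1 50) (he el) Bl (ta e2) 0" "Al \<inter> Bl = {}"
        "nmem \<tau>1 50 (ta e1) = e1" "nmem \<tau>1 50 (ta e2) = e2" "\<forall>u. u \<notin> Al \<union> Bl \<longrightarrow> nmem \<tau>1 50 u = nmem \<tau> 50 u" by blast
      have R2: "ready \<tau>1" by (rule ready_frame[OF R1 5(2)]) auto
      note f2 = frame_n[OF 5(2)] frame_r[OF 5(2)]
      have as: "(\<exists>P k. nsp P k \<and> k \<le> cval x ds el) \<and>
        ((\<forall>P k. nsp P k \<longrightarrow> cval x ds el \<le> k) \<longrightarrow> (\<exists>P k. FOL (nmem \<tau>1 50) s P t k \<and> 0 < k \<and> k \<le> cval x ds el))"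
        by (rule assemble[where ds = ds and R = "{v. rem v \<noteq> 0}", OF e1(2) e2(2) lev em(3,4) Ah(1-3) _ S A]) (use Ah(4) in auto)
      show ?case
      proof (rule runs_conseq[OF runs_write_out[OF readyD(2)[OF R2]]], goal_cases)
        case (1 \<tau>2)
        have b: "rmem \<tau>2 4 0 = cval x ds el" using frame_r[OF 1(2)] f1 f2 best by simp
        have "nmem \<tau>2 3 0 = nmem \<sigma> 3 0" using 1(1) f1 f2 by simp
        moreover have "goodout \<tau>2" unfolding goodout_def b using as 1(1) by blast
        ultimately show ?case by blast
      qed auto
    qed (use f1 el e1 e2 em in auto)
  qed auto
qed

end

subsection \<open>Main loop\<close>

text \<open>The output is rewritten at each improvement, when the successor and parent arrays still
  belong to the current triple. This costs about \<open>n\<close> steps and is covered by the cost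
  of the relaxation.\<close>

definition process :: com where
  "process = Seq clear_rem (Seq ancestors (Seq high_walk (Seq (sto 34 (nv 60)) (Seq spaths (Seq scan (When (nNz (nv 56)) finalize))))))"

lemma process_wr [simp]: "nwr process = {3, 4, 10, 11, 12, 13, 14, 15, 31, 32, 33, 34, 50, 51, 52, 53, 54, 56, 57}" "rwr process = {2, 4, 5}"
  by (auto simp: process_def)

context layered_arcs begin

text \<open>What \<open>complete\<close> provides for a triple, closed over the unknown optimal path
  so that loop invariants can carry it.\<close>

definition completes :: "nat \<Rightarrow> nat \<Rightarrow> nat \<Rightarrow> real \<Rightarrow> bool" where
  "completes x e1 e2 C \<longleftrightarrow> (\<exists>N k el Al Bl. WP x N (ta el) k \<and> el < m \<and> \<not> fwd el \<and> C = k + exc el \<and>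
    FP s Al (ta e1) \<and> FP (he el) Bl (ta e2) \<and> Al \<inter> Bl = {} \<and> he e1 \<notin> N - {x} \<and>
    (\<forall>u S. u \<in> N - {x} \<longrightarrow> \<not> FP u S (ta e1)) \<and>
    (\<forall>Ah Bh. FP (he e1) Ah x \<longrightarrow> FP (he e2) Bh t \<longrightarrow> Ah \<inter> Bh = {} \<longrightarrow> Bh \<inter> (N - {x}) = {}))"

text \<open>None of the removed vertices lies on the middle, apart possibly from its source, so by
  \<open>W_WP\<close> the available rounds find a walk at most as heavy; \<open>low_complete\<close>
  makes the lower pair visible in the table.\<close>

lemma completes_cand:
  assumes R: "ready \<tau>" and wk: "walked (he e1) (he e2) x rem (anc (ta e1) \<union> {he e1}) B suc"
    and sp: "sp_inv (nmem \<tau> 30) {v. rem v \<noteq> 0} x (nmem \<tau> 35 0) 0 rc ds pr"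
    and lev: "d (ta e1) = d (ta e2)" and cc: "completes x e1 e2 C"
  shows "\<exists>el. cand e1 e2 (nmem \<tau> 45) rc el \<and> cval x ds el \<le> C"
proof -
  note P = readyD(1)[OF R]
  define H where "H = {v. v < n \<and> (\<exists>e<m. \<not> fwd e \<and> he e = v)}"
  obtain N k el Al Bl where c: "WP x N (ta el) k" "el < m" "\<not> fwd el" "C = k + exc el"
    "FP s Al (ta e1)" "FP (he el) Bl (ta e2)" "Al \<inter> Bl = {}" "he e1 \<notin> N - {x}"
    "\<forall>u S. u \<in> N - {x} \<longrightarrow> \<not> FP u S (ta e1)"
    "\<forall>Ah Bh. FP (he e1) Ah x \<longrightarrow> FP (he e2) Bh t \<longrightarrow> Ah \<inter> Bh = {} \<longrightarrow> Bh \<inter> (N - {x}) = {}"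
    using cc unfolding completes_def by (elim exE conjE) (rule that; assumption)
  obtain A where A: "FOL suc (he e1) A x 0" "FOL suc (he e2) B t 0" "A \<inter> B = {}"
    "\<forall>v<n. rem v \<noteq> 0 \<longleftrightarrow> v \<in> anc (ta e1) \<union> {he e1} \<union> B" using wk unfolding walked_def by blast
  have BN: "B \<inter> (N - {x}) = {}" using c(10) FOL_FP[OF A(1)] FOL_FP[OF A(2)] A(3) by simp
  have "u \<notin> {v. rem v \<noteq> 0}" if u: "u \<in> N - {x}" for u
  proof -
    have "u < n" using WP_V[OF c(1)] u by blast
    moreover have "u \<notin> anc (ta e1)" using c(9) u unfolding anc_def by blast
    ultimately show ?thesis using A(4) BN c(8) u by blast
  qed
  then have "(N - {x}) \<inter> {v. rem v \<noteq> 0} = {}" by blast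
  then have W1: "W (nmem \<tau> 30) {v. rem v \<noteq> 0} x (0 + card ((N - {x}) \<inter> H)) m (ta el) (0 + k + d (ta el) - d x)"
    unfolding H_def by (intro W_WP[OF prepD(6)[OF P] c(1)] W_src)
  have "nmem \<tau> 35 0 = Suc (card H)"
    using prepD(8)[OF P] prepD(3)[OF P] unfolding classified_def H_def by simp
  moreover have "card ((N - {x}) \<inter> H) \<le> card H" unfolding H_def by (intro card_mono) auto
  ultimately have "0 + card ((N - {x}) \<inter> H) < nmem \<tau> 35 0" by simp
  then have "W (nmem \<tau> 30) {v. rem v \<noteq> 0} x (nmem \<tau> 35 0) 0 (ta el) (0 + k + d (ta el) - d x)"
    by (rule W_mono_round[OF W1])
  then have "W (nmem \<tau> 30) {v. rem v \<noteq> 0} x (nmem \<tau> 35 0) 0 (ta el) (k + d (ta el) - d x)" by simp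
  then have rc: "rc (ta el) \<noteq> 0" "ds (ta el) \<le> k + d (ta el) - d x" using sp unfolding sp_inv_def by blast+
  have "nmem \<tau> 42 (he el) \<noteq> 0" using prepD(3)[OF P] c(2,3) unfolding classified_def by blast
  then have tb: "tab (nmem \<tau> 30) ta he (nmem \<tau> 45) (nmem \<tau> 46) (he el)"
    using R he_less[OF c(2)] unfolding ready_def by blast
  have "PW (nmem \<tau> 30) ta he (he el) m (ta e1) (ta e2)"
    by (rule low_complete[OF prepD(6)[OF P] c(5,6,7) lev]) (auto simp: fwd_def pos_less)
  then have "nmem \<tau> 45 (cell (he el) (ta e1) (ta e2)) \<noteq> 0" using tb unfolding tab_def by blast
  then have "cand e1 e2 (nmem \<tau> 45) rc el" using c(2,3) rc(1) unfolding cand_def by blast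
  moreover have "cval x ds el \<le> C" using rc(2) c(4) by (simp add: cval_def exc_def)
  ultimately show ?thesis by blast
qed

lemma runs_process:
  assumes R: "ready \<sigma>" and x: "nmem \<sigma> 60 0 = x" "x < n" "nmem \<sigma> 41 x \<noteq> 0"
    and e1: "nmem \<sigma> 61 0 = e1" "fwd e1" and e2: "nmem \<sigma> 62 0 = e2" "fwd e2"
    and tb: "nmem \<sigma> 47 (cell x (he e2) (he e1)) \<noteq> 0" and g: "goodout \<sigma>"
  shows "runs process \<sigma> (\<lambda>\<tau>. goodout \<tau> \<and> (nmem \<sigma> 3 0 \<noteq> 0 \<longrightarrow> nmem \<tau> 3 0 \<noteq> 0 \<and> rmem \<tau> 4 0 \<le> rmem \<sigma> 4 0) \<and>
     (\<forall>C. completes x e1 e2 C \<longrightarrow> nmem \<tau> 3 0 \<noteq> 0 \<and> rmem \<tau> 4 0 \<le> C))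
     ((n + 1) * 800 + (nmem \<sigma> 35 0 + 1) * ((m + 1) * 400))"
proof -
  have em: "e1 < m" "e2 < m" using e1 e2 by (auto simp: fwd_def)
  have "tab (nmem \<sigma> 38) he ta (nmem \<sigma> 47) (nmem \<sigma> 48) x" using R x unfolding ready_def by blast
  then have "d (he e2) = d (he e1)" using tab_next(2) tb he_less em by blast
  then have lev: "d (ta e1) = d (ta e2)" using fwd_level_ta[OF e1(2) e2(2)] by simp
  define X where "X = anc (ta e1) \<union> {he e1}"
  define r where "r = nmem \<sigma> 35 0"
  show ?thesis
    unfolding process_def r_def[symmetric]
  proof (rule runs_Seq[OF runs_clear_rem[OF readyD(2)[OF R]],
        where ?k2.0 = "((m + 1) * 60 + 20) + ((n + 1) * 240 + (4 + (((n + 1) * 20 + 8 + (r + 1) * ((m + 1) * 100 + 20)) + ((m + 1) * 160 + ((n + 1) * 410 + 10)))))"], goal_cases)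
    case (1 \<tau>1)
    have R1: "ready \<tau>1" by (rule ready_frame[OF R 1(2)]) auto
    note f1 = frame_n[OF 1(2)] frame_r[OF 1(2)]
    show ?case
    proof (rule runs_Seq[OF runs_ancestors[OF R1 _ em(1) 1(1)],
          where ?k2.0 = "((n + 1) * 240 + (4 + (((n + 1) * 20 + 8 + (r + 1) * ((m + 1) * 100 + 20)) + ((m + 1) * 160 + ((n + 1) * 410 + 10)))))"], goal_cases)
      case (2 \<tau>2)
      have R2: "ready \<tau>2" by (rule ready_frame[OF R1 2(2)]) auto
      note f2 = frame_n[OF 2(2)] frame_r[OF 2(2)]
      show ?case
      proof (rule runs_Seq[OF runs_high_walk[OF R2 _ x(2) _ _ em(1) _ em(2), where ?R0.0 = X],
            where ?k2.0 = "(4 + (((n + 1) * 20 + 8 + (r + 1) * ((m + 1) * 100 + 20)) + ((m + 1) * 160 + ((n + 1) * 410 + 10))))"], goal_cases)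
        case (7 \<tau>3)
        then obtain B where wk: "walked (he e1) (he e2) x (nmem \<tau>3 33) X B (nmem \<tau>3 50)" by blast
        have R3: "ready \<tau>3" by (rule ready_frame[OF R2 7(2)]) auto
        note f3 = frame_n[OF 7(2)] frame_r[OF 7(2)]
        show ?case
        proof (rule runs_Seq_run[where ?k2.0 = "(((n + 1) * 20 + 8 + (r + 1) * ((m + 1) * 100 + 20)) + ((m + 1) * 160 + ((n + 1) * 410 + 10)))"], goal_cases)
          case (2 \<tau>4)
          have R4: "ready \<tau>4" unfolding 2 using R3 by (simp add: ready_upn)
          note P4 = readyD(1)[OF R4]
          have v4: "nmem \<tau>4 34 0 = x" "nmem \<tau>4 35 0 = r" "nmem \<tau>4 60 0 = x" "nmem \<tau>4 61 0 = e1" "nmem \<tau>4 62 0 = e2"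
            "nmem \<tau>4 33 = nmem \<tau>3 33" "nmem \<tau>4 50 = nmem \<tau>3 50" "nmem \<tau>4 3 = nmem \<sigma> 3" "nmem \<tau>4 4 = nmem \<sigma> 4" "rmem \<tau>4 4 = rmem \<sigma> 4"
            unfolding 2 using f1 f2 f3 x e1 e2 by (simp_all add: r_def)
          define ord where "ord = nmem \<tau>4 30"
          show ?case
          proof (rule runs_Seq[where Q = "\<lambda>\<tau>. sp_inv ord {v. nmem \<tau>3 33 v \<noteq> 0} x r 0 (nmem \<tau> 31) (rmem \<tau> 2) (nmem \<tau> 32)" and
              ?k1.0 = "(n + 1) * 20 + 8 + (r + 1) * ((m + 1) * 100 + 20)" and ?k2.0 = "(m + 1) * 160 + ((n + 1) * 410 + 10)"], goal_cases)
            case 1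
            show ?case by (rule runs_spaths[OF readyD(2)[OF R4] prepD(4)[OF P4] v4(1) x(2) v4(2) _ _ order_refl])
                (use v4(6) in \<open>auto simp: ord_def\<close>)
          next
            case (2 \<tau>5)
            have R5: "ready \<tau>5" by (rule ready_frame[OF R4 2(2)]) auto
            note f5 = frame_n[OF 2(2)] frame_r[OF 2(2)]
            note sp = 2(1)
            let ?C = "cand e1 e2 (nmem \<tau>5 45) (nmem \<tau>5 31)" and ?v = "cval x (rmem \<tau>5 2)"
            have cmp: "\<exists>el. ?C el \<and> ?v el \<le> C" if cc: "completes x e1 e2 C" for C
              by (rule completes_cand[OF R5 wk[unfolded X_def] _ lev cc]) (use sp f5 v4(2) in \<open>simp add: ord_def\<close>)
            have v5: "nmem \<tau>5 60 0 = x" "nmem \<tau>5 61 0 = e1" "nmem \<tau>5 62 0 = e2" "nmem \<tau>5 50 = nmem \<tau>3 50"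
              "nmem \<tau>5 3 = nmem \<sigma> 3" "nmem \<tau>5 4 = nmem \<sigma> 4" "rmem \<tau>5 4 = rmem \<sigma> 4"
              using f5 v4 by simp_all
            show ?case
            proof (rule runs_Seq[OF runs_scan[OF R5 v5(1) x(2) v5(2) em(1) v5(3) em(2)], where ?k2.0 = "(n + 1) * 410 + 10"], goal_cases)
              case (1 \<tau>6)
              have R6: "ready \<tau>6" by (rule ready_frame[OF R5 1(2)]) auto
              note f6 = frame_n[OF 1(2)] frame_r[OF 1(2)]
              have sc: "scan_inv ?C ?v (nmem \<sigma> 3 0) (rmem \<sigma> 4 0) m (nmem \<tau>6 3 0) (rmem \<tau>6 4 0) (nmem \<tau>6 56 0) (nmem \<tau>6 57 0)"
                "nmem \<tau>6 3 1 = nmem \<sigma> 3 1" using 1(1) v5 by auto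
              have mono: "nmem \<sigma> 3 0 \<noteq> 0 \<longrightarrow> nmem \<tau>6 3 0 \<noteq> 0 \<and> rmem \<tau>6 4 0 \<le> rmem \<sigma> 4 0" using sc(1) unfolding scan_inv_def by blast
              have co: "nmem \<tau>6 3 0 \<noteq> 0 \<and> rmem \<tau>6 4 0 \<le> C" if "completes x e1 e2 C" for C
              proof -
                obtain el where el: "?C el" "?v el \<le> C" using cmp[OF \<open>completes x e1 e2 C\<close>] by blast
                moreover have "el < m" using el(1) by (simp add: cand_def)
                ultimately show ?thesis using sc(1) unfolding scan_inv_def by (meson order_trans)
              qed
              show ?case
              proof (rule runs_When[where k = "(n + 1) * 410"], goal_cases)
                case 1
                then have cd: "?C (nmem \<tau>6 57 0)" "rmem \<tau>6 4 0 = ?v (nmem \<tau>6 57 0)" using sc(1) unfolding scan_inv_def by simp_all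
                have v6: "nmem \<tau>6 60 0 = x" "nmem \<tau>6 61 0 = e1" "nmem \<tau>6 62 0 = e2" "nmem \<tau>6 50 = nmem \<tau>3 50"
                  "nmem \<tau>6 45 = nmem \<tau>5 45" "nmem \<tau>6 32 = nmem \<tau>5 32" using f6 v5 by simp_all
                have wk6: "walked (he e1) (he e2) x (nmem \<tau>3 33) (anc (ta e1) \<union> {he e1}) B (nmem \<tau>6 50)"
                  using wk v6(4) unfolding X_def by simp
                have sp6: "sp_inv ord {v. nmem \<tau>3 33 v \<noteq> 0} x r 0 (nmem \<tau>5 31) (rmem \<tau>5 2) (nmem \<tau>6 32)"
                  using sp v6(6) by simp
                have cd6: "cand e1 e2 (nmem \<tau>6 45) (nmem \<tau>5 31) (nmem \<tau>6 57 0)" using cd(1) v6(5) by simp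
                show ?case
                proof (rule runs_conseq[OF runs_finalize[OF R6 v6(1) x(2) v6(2) e1(2) v6(3) e2(2) lev wk6 sp6 refl cd6 cd(2)]], goal_cases)
                  case (1 \<tau>7)
                  have "rmem \<tau>7 4 = rmem \<tau>6 4" using frame_r[OF 1(2)] by simp
                  then show ?case using 1(1) mono co by simp
                qed auto
              next
                case 2
                then have "nmem \<tau>6 3 0 = nmem \<sigma> 3 0" "rmem \<tau>6 4 0 = rmem \<sigma> 4 0" using sc(1) unfolding scan_inv_def by simp_all
                moreover have "nmem \<tau>6 4 = nmem \<sigma> 4" using f6 v5 by simp
                ultimately have "goodout \<tau>6" using g sc(2) unfolding goodout_def by simp
                then show ?case using mono co by blast
              qed auto
            qed auto
          qed auto
        qed auto
      qed (use 2(1) f1 f2 x e1 e2 tb in \<open>auto simp: X_def\<close>)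
    qed (use f1 e1 in auto)
  next
    case 2
    show ?case by (simp add: algebra_simps)
  qed
qed

end

text \<open>A nonzero entry forces the two heads, and hence the two tails, onto a common level. The
  inner loop thus runs \<open>process\<close> only on pairs counted by \<open>npairs\<close>,
  although it looks at all pairs of arcs.\<close>

definition main_test :: bexp where
  "main_test = BAnd (nNz (NCell 36 (nv 62))) (nNz (NCell 47 (pix (nv 60) (NCell 2 (nv 62)) (NCell 2 (nv 61)))))"

definition main_inner :: com where
  "main_inner = For 62 (NCell 0 (NConst 1)) (When main_test process)"

definition main_mid :: com where
  "main_mid = For 61 (NCell 0 (NConst 1)) (When (nNz (NCell 36 (nv 61))) main_inner)"

definition main_loop :: com where
  "main_loop = For 60 (nv 0) (When (nNz (NCell 41 (nv 60))) main_mid)"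

definition nsp_prog :: com where
  "nsp_prog = Seq precheck (When (nNz (nv 27)) (Seq prepare
    (Seq (pair_table 1 2 30 42 45 46) (Seq (pair_table 2 1 38 41 47 48) main_loop))))"

lemma main_wr [simp]:
  "nwr main_inner = {3, 4, 10, 11, 12, 13, 14, 15, 31, 32, 33, 34, 50, 51, 52, 53, 54, 56, 57, 62}" "rwr main_inner = {2, 4, 5}"
  "nwr main_mid = {3, 4, 10, 11, 12, 13, 14, 15, 31, 32, 33, 34, 50, 51, 52, 53, 54, 56, 57, 61, 62}" "rwr main_mid = {2, 4, 5}"
  "nwr main_loop = {3, 4, 10, 11, 12, 13, 14, 15, 31, 32, 33, 34, 50, 51, 52, 53, 54, 56, 57, 60, 61, 62}" "rwr main_loop = {2, 4, 5}"
  by (auto simp: main_inner_def main_mid_def main_loop_def)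

lemma main_test_cost: "bcost main_test \<le> 24"
  by (simp add: main_test_def)

lemma sum_affine: "(\<Sum>e<m. K + c e * q + L) = m * (K + L) + (\<Sum>e<m. c e) * (q :: nat)"
  by (induction m) (simp_all add: algebra_simps)

context layered_arcs begin

lemma goodout_upn: "a \<notin> {3, 4} \<Longrightarrow> goodout (upn \<tau> a i x) = goodout \<tau>"
  unfolding goodout_def by simp

text \<open>\<open>D\<close> is the set of triples treated so far; none of them could still improve
  on the stored value by completing a cheaper middle.\<close>

definition covers :: "(nat \<Rightarrow> nat \<Rightarrow> nat \<Rightarrow> bool) \<Rightarrow> ram_state \<Rightarrow> bool" where
  "covers D \<tau> \<longleftrightarrow> goodout \<tau> \<and> (\<forall>x e1 e2 C. D x e1 e2 \<longrightarrow> completes x e1 e2 C \<longrightarrow> nmem \<tau> 3 0 \<noteq> 0 \<and> rmem \<tau> 4 0 \<le> C)"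

lemma covers_upn: "a \<notin> {3, 4} \<Longrightarrow> covers D (upn \<tau> a i x) = covers D \<tau>"
  unfolding covers_def by (simp add: goodout_upn)

lemma covers_mono: "covers D \<tau> \<Longrightarrow> (\<And>x e f. D' x e f \<Longrightarrow> D x e f) \<Longrightarrow> covers D' \<tau>"
  unfolding covers_def by blast

definition trip :: "ram_state \<Rightarrow> nat \<Rightarrow> nat \<Rightarrow> nat \<Rightarrow> bool" where
  "trip \<sigma> x e1 e2 \<longleftrightarrow> fwd e1 \<and> fwd e2 \<and> nmem \<sigma> 47 (cell x (he e2) (he e1)) \<noteq> 0"

definition tproc :: "nat \<Rightarrow> nat" where
  "tproc h = (n + 1) * 800 + (h + 1) * ((m + 1) * 400)"

lemma runs_main_inner:
  assumes R: "ready \<sigma>" and x: "nmem \<sigma> 60 0 = x" "x < n" "nmem \<sigma> 41 x \<noteq> 0" and e1: "nmem \<sigma> 61 0 = e1" "fwd e1" and cv: "covers D \<sigma>"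
  shows "runs main_inner \<sigma> (covers (\<lambda>x' e f. D x' e f \<or> (x' = x \<and> e = e1 \<and> trip \<sigma> x e f)))
    ((m + 1) * 60 + card {f. f < m \<and> trip \<sigma> x e1 f} * (tproc (nmem \<sigma> 35 0) + 40))"
  unfolding main_inner_def
proof (rule runs_For[where N = m and T = "\<lambda>f. if trip \<sigma> x e1 f then tproc (nmem \<sigma> 35 0) + 40 else 40" and
      I = "\<lambda>i. covers (\<lambda>x' e f. D x' e f \<or> (x' = x \<and> e = e1 \<and> f < i \<and> trip \<sigma> x e f))"], goal_cases)
  case 6
  show ?case using cv by (rule covers_mono) auto
next
  case (7 i \<tau>)
  have R1: "ready \<tau>" by (rule ready_frame[OF R 7(4)]) auto
  note P1 = readyD(1)[OF R1] and I1 = readyD(2)[OF R1]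
  have f: "nmem \<tau> 60 0 = x" "nmem \<tau> 61 0 = e1" "nmem \<tau> 47 = nmem \<sigma> 47" "nmem \<tau> 41 = nmem \<sigma> 41" "nmem \<tau> 35 = nmem \<sigma> 35"
    using frame_n[OF 7(4)] x e1 by simp_all
  have em: "e1 < m" using e1 by (simp add: fwd_def)
  have c: "nmem \<tau> 44 x + nmem \<tau> 43 (he i) + he e1 = cell x (he i) (he e1)"
    using prepD(9,10)[OF P1] x he_less[OF 7(1)] by (simp add: cell_def)
  have tst: "bval main_test \<tau> \<longleftrightarrow> trip \<sigma> x e1 i"
    using e1 prepD(11)[OF P1 7(1)] by (simp add: main_test_def trip_def f 7(1,2) inpD[OF I1] em c)
  show ?case
  proof (rule runs_When[where k = "if trip \<sigma> x e1 i then tproc (nmem \<sigma> 35 0) else 0"], goal_cases)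
    case 1
    then have tr: "trip \<sigma> x e1 i" using tst by simp
    have "runs process \<tau> (covers (\<lambda>x' e f. D x' e f \<or> (x' = x \<and> e = e1 \<and> f < Suc i \<and> trip \<sigma> x e f))) (tproc (nmem \<sigma> 35 0))"
    proof (rule runs_conseq[OF runs_process[OF R1 f(1) x(2) _ f(2) e1(2) 7(2)]], goal_cases)
      case (5 \<tau>')
      show ?case unfolding covers_def
      proof (intro conjI allI impI)
        fix x' e f C assume D: "D x' e f \<or> (x' = x \<and> e = e1 \<and> f < Suc i \<and> trip \<sigma> x e f)" and C: "completes x' e f C"
        show "nmem \<tau>' 3 0 \<noteq> 0" "rmem \<tau>' 4 0 \<le> C"
        proof -
          have "nmem \<tau>' 3 0 \<noteq> 0 \<and> rmem \<tau>' 4 0 \<le> C"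
          proof (cases "x' = x \<and> e = e1 \<and> f = i")
            case True
            then show ?thesis using 5(1) C by blast
          next
            case False
            then have "nmem \<tau> 3 0 \<noteq> 0 \<and> rmem \<tau> 4 0 \<le> C" using 7(3) D C unfolding covers_def less_Suc_eq by blast
            then show ?thesis using 5(1) by (meson order_trans)
          qed
          then show "nmem \<tau>' 3 0 \<noteq> 0" "rmem \<tau>' 4 0 \<le> C" by auto
        qed
      qed (use 5(1) in blast)
    next
      case 6
      show ?case by (simp add: tproc_def f)
    qed (use tr x f 7(3) in \<open>auto simp: trip_def covers_def\<close>)
    then show ?case using tr by simp
  next
    case 2
    then have "\<not> trip \<sigma> x e1 i" using tst by simp
    then show ?case by (intro covers_mono[OF 7(3)]) (auto simp: less_Suc_eq)
  next
    case 3
    show ?case using main_test_cost by auto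
  qed
next
  case (8 \<tau>)
  show ?case by (rule covers_mono[OF 8(1)]) (auto simp: trip_def fwd_def)
next
  case 9
  have "(\<Sum>i<m. if trip \<sigma> x e1 i then tproc (nmem \<sigma> 35 0) + 40 else 40) \<le>
    m * 40 + card {i. i < m \<and> trip \<sigma> x e1 i} * (tproc (nmem \<sigma> 35 0) + 40)" by (rule sum_if_le)
  then show ?case by simp
qed (auto simp: inpD[OF readyD(2)[OF R]] covers_upn)

definition npairs :: nat where
  "npairs = card {(e, f). fwd e \<and> fwd f \<and> d (ta e) = d (ta f)}"

lemma finite_fwd: "finite {(e, f). fwd e \<and> fwd f \<and> d (ta e) = d (ta f)}"
  by (rule finite_subset[of _ "{..<m} \<times> {..<m}"]) (auto simp: fwd_def)

lemma trip_level:
  assumes R: "ready \<sigma>" and x: "x < n" "nmem \<sigma> 41 x \<noteq> 0" and t: "trip \<sigma> x e f"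
  shows "d (ta e) = d (ta f)"
proof -
  have "tab (nmem \<sigma> 38) he ta (nmem \<sigma> 47) (nmem \<sigma> 48) x" using R x unfolding ready_def by blast
  moreover have "he f < n" "he e < n" using t he_less by (auto simp: trip_def fwd_def)
  ultimately have "d (he f) = d (he e)" using tab_next(2) t unfolding trip_def by blast
  then show ?thesis using fwd_level_ta[of e f] t unfolding trip_def by simp
qed

lemma runs_main_mid:
  assumes R: "ready \<sigma>" and x: "nmem \<sigma> 60 0 = x" "x < n" "nmem \<sigma> 41 x \<noteq> 0" and cv: "covers D \<sigma>"
  shows "runs main_mid \<sigma> (covers (\<lambda>x' e f. D x' e f \<or> (x' = x \<and> trip \<sigma> x e f)))
    ((m + 1) * ((m + 1) * 100) + npairs * (tproc (nmem \<sigma> 35 0) + 40))"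
  unfolding main_mid_def
proof (rule runs_For[where N = m and T = "\<lambda>e. (m + 1) * 60 + card {f. f < m \<and> trip \<sigma> x e f} * (tproc (nmem \<sigma> 35 0) + 40) + 10" and
      I = "\<lambda>i. covers (\<lambda>x' e f. D x' e f \<or> (x' = x \<and> e < i \<and> trip \<sigma> x e f))"], goal_cases)
  case 6
  show ?case using cv by (rule covers_mono) auto
next
  case (7 i \<tau>)
  have R1: "ready \<tau>" by (rule ready_frame[OF R 7(4)]) auto
  note P1 = readyD(1)[OF R1] and I1 = readyD(2)[OF R1]
  have f: "nmem \<tau> 60 0 = x" "nmem \<tau> 47 = nmem \<sigma> 47" "nmem \<tau> 41 = nmem \<sigma> 41" "nmem \<tau> 35 = nmem \<sigma> 35"
    using frame_n[OF 7(4)] x by simp_all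
  have tr: "trip \<tau> = trip \<sigma>" unfolding trip_def f ..
  show ?case
  proof (rule runs_When[where k = "(m + 1) * 60 + card {f. f < m \<and> trip \<sigma> x i f} * (tproc (nmem \<sigma> 35 0) + 40)"], goal_cases)
    case 1
    then have fi: "fwd i" using prepD(11)[OF P1 7(1)] 7(2) by simp
    show ?case
    proof (rule runs_conseq[OF runs_main_inner[OF R1 f(1) x(2) _ 7(2) fi 7(3)]], goal_cases)
      case (2 \<tau>')
      show ?case by (rule covers_mono[OF 2(1)[unfolded tr]]) (auto simp: less_Suc_eq)
    qed (use x f tr in auto)
  next
    case 2
    then have "\<not> fwd i" using prepD(11)[OF P1 7(1)] 7(2) by simp
    then show ?case by (intro covers_mono[OF 7(3)]) (auto simp: less_Suc_eq trip_def)
  qed auto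
next
  case (8 \<tau>)
  show ?case by (rule covers_mono[OF 8(1)]) (auto simp: trip_def fwd_def)
next
  case 9
  \<comment> \<open>The costs are charged to the disjoint union over \<open>e1\<close>, because
    bounding each \<open>e1\<close> separately would lose the restriction to pairs on a common
    level.\<close>
  have "(\<Sum>e<m. card {f. f < m \<and> trip \<sigma> x e f}) = card (SIGMA e:{..<m}. {f. f < m \<and> trip \<sigma> x e f})"
    by (simp add: card_SigmaI)
  also have "\<dots> \<le> npairs"
    unfolding npairs_def
    by (rule card_mono[OF finite_fwd]) (use trip_level[OF R x(2,3)] in \<open>auto simp: trip_def\<close>)
  finally have le: "(\<Sum>e<m. card {f. f < m \<and> trip \<sigma> x e f}) * (tproc (nmem \<sigma> 35 0) + 40) \<le> npairs * (tproc (nmem \<sigma> 35 0) + 40)"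
    by (rule mult_right_mono) simp
  have "(\<Sum>e<m. (m + 1) * 60 + card {f. f < m \<and> trip \<sigma> x e f} * (tproc (nmem \<sigma> 35 0) + 40) + 10) =
    m * ((m + 1) * 60 + 10) + (\<Sum>e<m. card {f. f < m \<and> trip \<sigma> x e f}) * (tproc (nmem \<sigma> 35 0) + 40)"
    by (rule sum_affine)
  moreover have "m * ((m + 1) * 60 + 10) + m * 12 + 12 \<le> (m + 1) * ((m + 1) * 100)" by (simp add: algebra_simps)
  moreover have "m * (ncost (NCell 0 (NConst 1)) + 10) + ncost (NCell 0 (NConst 1)) + 10 = m * 12 + 12" by simp
  ultimately show ?case using le by linarith
qed (auto simp: inpD[OF readyD(2)[OF R]] covers_upn)

lemma runs_main_loop:
  assumes R: "ready \<sigma>" and z: "nmem \<sigma> 3 0 = 0"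
  shows "runs main_loop \<sigma> (covers (\<lambda>x e f. x < n \<and> nmem \<sigma> 41 x \<noteq> 0 \<and> trip \<sigma> x e f))
    ((n + 1) * 40 + card {x. x < n \<and> nmem \<sigma> 41 x \<noteq> 0} * ((m + 1) * ((m + 1) * 100) + npairs * (tproc (nmem \<sigma> 35 0) + 40)))"
  unfolding main_loop_def
proof (rule runs_For[where N = n and T = "\<lambda>x. if nmem \<sigma> 41 x \<noteq> 0 then ((m + 1) * ((m + 1) * 100) + npairs * (tproc (nmem \<sigma> 35 0) + 40)) + 10 else 10" and
      I = "\<lambda>i. covers (\<lambda>x e f. x < i \<and> nmem \<sigma> 41 x \<noteq> 0 \<and> trip \<sigma> x e f)"], goal_cases)
  case 6
  show ?case using z unfolding covers_def goodout_def by simp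
next
  case (7 i \<tau>)
  have R1: "ready \<tau>" by (rule ready_frame[OF R 7(4)]) auto
  have f: "nmem \<tau> 47 = nmem \<sigma> 47" "nmem \<tau> 41 = nmem \<sigma> 41" "nmem \<tau> 35 = nmem \<sigma> 35"
    using frame_n[OF 7(4)] by simp_all
  have tr: "trip \<tau> = trip \<sigma>" unfolding trip_def f ..
  let ?K = "(m + 1) * ((m + 1) * 100) + npairs * (tproc (nmem \<sigma> 35 0) + 40)"
  show ?case
  proof (rule runs_When[where k = "if nmem \<sigma> 41 i \<noteq> 0 then ?K else 0"], goal_cases)
    case 1
    then have x: "nmem \<tau> 41 i \<noteq> 0" using 7(2) by simp
    have "runs main_mid \<tau> (covers (\<lambda>x e fa. x < Suc i \<and> nmem \<sigma> 41 x \<noteq> 0 \<and> trip \<sigma> x e fa)) ?K"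
    proof (rule runs_conseq[OF runs_main_mid[OF R1 7(2,1) x 7(3)]], goal_cases)
      case (1 \<tau>')
      show ?case by (rule covers_mono[OF 1(1)[unfolded tr]]) (auto simp: less_Suc_eq)
    qed (use f in simp)
    then show ?case using x f by simp
  next
    case 2
    then have "nmem \<sigma> 41 i = 0" using 7(2) f by simp
    then show ?case by (intro covers_mono[OF 7(3)]) (auto simp: less_Suc_eq)
  qed auto
next
  case 9
  let ?K = "(m + 1) * ((m + 1) * 100) + npairs * (tproc (nmem \<sigma> 35 0) + 40)"
  have "(\<Sum>i<n. if nmem \<sigma> 41 i \<noteq> 0 then ?K + 10 else 10) \<le> n * 10 + card {i. i < n \<and> nmem \<sigma> 41 i \<noteq> 0} * (?K + 10)"
    by (rule sum_if_le)
  moreover have "card {i. i < n \<and> nmem \<sigma> 41 i \<noteq> 0} \<le> n"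
    using card_mono[of "{..<n}" "{i. i < n \<and> nmem \<sigma> 41 i \<noteq> 0}"] by auto
  ultimately have "(\<Sum>i<n. if nmem \<sigma> 41 i \<noteq> 0 then ?K + 10 else 10) \<le> n * 20 + card {i. i < n \<and> nmem \<sigma> 41 i \<noteq> 0} * ?K"
    by (simp add: add_mult_distrib2)
  then show ?case by simp
qed (auto simp: inpD[OF readyD(2)[OF R]] covers_upn)

text \<open>The first arc has finitely many choices and the rest uses one vertex less. Finiteness
  makes the minimum in \<open>nsp_min\<close> available.\<close>

lemma finite_WP: "finite S \<Longrightarrow> finite {k. WP a S b k}"
proof (induction "card S" arbitrary: S a rule: less_induct)
  case less
  have "{k. WP a S b k} \<subseteq> {0} \<union> (\<Union>e\<in>{..<m}. (+) (exc e) ` {k. a \<in> S \<and> WP (he e) (S - {a}) b k})"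
  proof
    fix k assume "k \<in> {k. WP a S b k}"
    then have "WP a S b k" by simp
    then show "k \<in> {0} \<union> (\<Union>e\<in>{..<m}. (+) (exc e) ` {k. a \<in> S \<and> WP (he e) (S - {a}) b k})"
      by (cases rule: WP.cases) auto
  qed
  moreover have "finite {k. a \<in> S \<and> WP (he e) (S - {a}) b k}" for e
  proof (cases "a \<in> S")
    case True
    then have "card (S - {a}) < card S" using less.prems by (intro card_Diff1_less)
    then show ?thesis using less.hyps less.prems by simp
  qed simp
  then have "finite ({0} \<union> (\<Union>e\<in>{..<m}. (+) (exc e) ` {k. a \<in> S \<and> WP (he e) (S - {a}) b k}))"
    by (intro finite_UnI finite_UN_I finite_imageI) auto
  ultimately show ?case by (rule finite_subset)
qed

lemma nsp_min:
  assumes "nsp P0 k0"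
  obtains P C where "nsp P C" "\<And>S l. nsp S l \<Longrightarrow> C \<le> l"
proof -
  let ?K = "{k. \<exists>S. nsp S k}"
  have "?K \<subseteq> (\<Union>S\<in>Pow {..<n}. {k. WP s S t k})"
  proof
    fix k assume "k \<in> ?K"
    then obtain S where "WP s S t k" by (auto simp: nsp_def)
    then show "k \<in> (\<Union>S\<in>Pow {..<n}. {k. WP s S t k})" using WP_V[of s S t k] by blast
  qed
  moreover have "finite (\<Union>S\<in>Pow {..<n}. {k. WP s S t k})"
    by (rule finite_UN_I) (auto intro: finite_WP finite_subset)
  ultimately have fin: "finite ?K" by (rule finite_subset)
  moreover have "?K \<noteq> {}" using assms by blast
  ultimately have "Min ?K \<in> ?K" by (rule Min_in)
  then obtain P where "nsp P (Min ?K)" by blast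
  moreover have "Min ?K \<le> l" if "nsp S l" for S l using Min_le[OF fin] that by blast
  ultimately show ?thesis using that by blast
qed

definition result :: "ram_state \<Rightarrow> bool" where
  "result \<tau> \<longleftrightarrow> (if nmem \<tau> 3 0 = 0 then \<forall>P k. \<not> nsp P k else
     \<exists>k. spath (map (nmem \<tau> 4) [0..<nmem \<tau> 3 1]) k \<and> 0 < k \<and> (\<forall>P k'. nsp P k' \<longrightarrow> k \<le> k'))"

text \<open>The triple from \<open>complete\<close> is among those treated, so the stored value is
  at most the optimum; this discharges the condition in \<open>goodout\<close>. Without a
  competitor, \<open>goodout\<close> rules out that anything was stored.\<close>

lemma covers_result:
  assumes R: "ready \<sigma>" and cv: "covers (\<lambda>x e f. x < n \<and> nmem \<sigma> 41 x \<noteq> 0 \<and> trip \<sigma> x e f) \<tau>"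
  shows "result \<tau>"
proof (cases "\<exists>P k. nsp P k")
  case True
  then obtain P0 k0 where "nsp P0 k0" by blast
  then obtain P C where P: "nsp P C" and opt: "\<And>S l. nsp S l \<Longrightarrow> C \<le> l" using nsp_min by blast
  show ?thesis
  proof (rule complete[OF P opt])
    fix x N k el eb f1 f2 Al Bl assume c:
      "eb < m" "\<not> fwd eb" "ta eb = x" "WP x N (ta el) k" "el < m" "\<not> fwd el" "C = k + exc el"
      "fwd f1" "fwd f2" "d (ta f1) = d (ta f2)" "FP s Al (ta f1)" "FP (he el) Bl (ta f2)" "Al \<inter> Bl = {}"
      "\<exists>Ah Bh. FP (he f1) Ah x \<and> FP (he f2) Bh t \<and> Ah \<inter> Bh = {}"
      "\<And>u S. u \<in> N - {x} \<Longrightarrow> \<not> FP u S (ta f1)" "he f1 \<notin> N - {x}"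
      "\<And>Ah Bh. FP (he f1) Ah x \<Longrightarrow> FP (he f2) Bh t \<Longrightarrow> Ah \<inter> Bh = {} \<Longrightarrow> Bh \<inter> (N - {x}) = {}"
    have comp: "completes x f1 f2 C" unfolding completes_def
      by (rule exI[of _ N], rule exI[of _ k], rule exI[of _ el], rule exI[of _ Al], rule exI[of _ Bl])
        (intro conjI allI impI; (rule c | (erule (1) c(17), assumption) | (erule c(15))))
    have x: "x < n" "nmem \<sigma> 41 x \<noteq> 0"
      using c(1-3) ta_less prepD(3)[OF readyD(1)[OF R]] unfolding classified_def by blast+
    obtain Ah Bh where h: "FP (he f1) Ah x" "FP (he f2) Bh t" "Ah \<inter> Bh = {}" using c(14) by blast
    have "tab (nmem \<sigma> 38) he ta (nmem \<sigma> 47) (nmem \<sigma> 48) x" using R x unfolding ready_def by blast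
    moreover have "PW (nmem \<sigma> 38) he ta x m (he f2) (he f1)"
      by (rule high_complete[OF prepD(7)[OF readyD(1)[OF R]] h fwd_level[OF c(8-10)]]) (auto simp: fwd_def)
    ultimately have "trip \<sigma> x f1 f2" unfolding trip_def tab_def using c(8,9) by blast
    then have b: "nmem \<tau> 3 0 \<noteq> 0" "rmem \<tau> 4 0 \<le> C" using cv x comp unfolding covers_def by blast+
    then have "\<forall>P k. nsp P k \<longrightarrow> rmem \<tau> 4 0 \<le> k" using opt by (meson order_trans)
    then obtain k' where "spath (map (nmem \<tau> 4) [0..<nmem \<tau> 3 1]) k'" "0 < k'" "k' \<le> rmem \<tau> 4 0"
      using cv b(1) unfolding covers_def goodout_def by blast
    moreover have "k' \<le> l" if "nsp S l" for S l using opt[OF that] b(2) \<open>k' \<le> rmem \<tau> 4 0\<close> by linarith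
    ultimately show ?thesis unfolding result_def using b(1) by auto
  qed
next
  case False
  then have "nmem \<tau> 3 0 = 0" using cv unfolding covers_def goodout_def by blast
  then show ?thesis using False unfolding result_def by simp
qed

section \<open>Total running time of the program\<close>

definition heads :: "nat set" where "heads = {v. v < n \<and> (\<exists>e<m. \<not> fwd e \<and> he e = v)}"
definition tails :: "nat set" where "tails = {v. v < n \<and> (\<exists>e<m. \<not> fwd e \<and> ta e = v)}"

definition tmain :: nat where
  "tmain = (m + 1) * ((n + m + 1) * 1000) + ((n + 1) * 40 + card heads * ((n + 1) * 60 + (m + 1) * ((m + 1) * 200))) +
    ((n + 1) * 40 + card tails * ((n + 1) * 60 + (m + 1) * ((m + 1) * 200))) +
    ((n + 1) * 40 + card tails * ((m + 1) * ((m + 1) * 100) + npairs * (tproc (Suc (card heads)) + 40)))"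

lemma runs_nsp_prog:
  assumes inp: "inp \<sigma>" and z: "\<And>a. 3 \<le> a \<Longrightarrow> nmem \<sigma> a = (\<lambda>_. 0)" "\<And>a. 1 \<le> a \<Longrightarrow> rmem \<sigma> a = (\<lambda>_. 0)" and s: "d s = 0"
  shows "runs nsp_prog \<sigma> result ((n + m + 2) * 240 + 10 + (if \<forall>e<m. fwd e then 0 else tmain))"
  unfolding nsp_prog_def
proof (rule runs_Seq[OF runs_precheck[OF inp], where ?k2.0 = "10 + (if \<forall>e<m. fwd e then 0 else tmain)"], goal_cases)
  case (3 \<tau>1)
  note f1 = frame_n[OF 3(2)] frame_r[OF 3(2)] and pc = 3(1)
  have inp1: "inp \<tau>1" by (rule inp_frame[OF inp 3(2)]) auto
  show ?case
  proof (rule runs_When[where k = "if \<forall>e<m. fwd e then 0 else tmain"], goal_cases)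
    case 1
    then have nf: "\<not> (\<forall>e<m. fwd e)" using pc s by auto
    have "runs (Seq prepare (Seq (pair_table 1 2 30 42 45 46) (Seq (pair_table 2 1 38 41 47 48) main_loop))) \<tau>1 result tmain"
    proof (rule runs_Seq[OF runs_prepare[OF inp1 _ s], where ?k2.0 = "((n + 1) * 40 + card heads * ((n + 1) * 60 + (m + 1) * ((m + 1) * 200))) +
        (((n + 1) * 40 + card tails * ((n + 1) * 60 + (m + 1) * ((m + 1) * 200))) +
        ((n + 1) * 40 + card tails * ((m + 1) * ((m + 1) * 100) + npairs * (tproc (Suc (card heads)) + 40))))"], goal_cases)
      case (2 \<tau>2)
      note f2 = frame_n[OF 2(2)] and P2 = 2(1)
      have I2: "inp \<tau>2" using prepD(1)[OF P2] .
      have hd: "{z. z < n \<and> nmem \<tau>2 42 z \<noteq> 0} = heads" "{z. z < n \<and> nmem \<tau>2 41 z \<noteq> 0} = tails"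
        using prepD(3)[OF P2] unfolding classified_def heads_def tails_def by blast+
      have r2: "nmem \<tau>2 35 0 = Suc (card heads)" using prepD(8)[OF P2] unfolding hd .
      have th: "nmem \<tau>2 1 e = ta e" "nmem \<tau>2 2 e = he e" "ta e < n \<and> he e < n" if "e < m" for e
        using inpD[OF I2] he_less ta_less that by simp_all
      have z2: "nmem \<tau>2 45 = (\<lambda>_. 0)" using f2 f1 z(1) by simp
      show ?case
      proof (rule runs_Seq[OF runs_pair_table[OF P2 _ _ _ _ _ _ _ th fwd_level z2],
            where ?k2.0 = "((n + 1) * 40 + card tails * ((n + 1) * 60 + (m + 1) * ((m + 1) * 200))) +
          ((n + 1) * 40 + card tails * ((m + 1) * ((m + 1) * 100) + npairs * (tproc (Suc (card heads)) + 40)))"], goal_cases)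
        case (14 \<tau>3)
        note f3 = frame_n[OF 14(2)]
        have P3: "prep \<tau>3" by (rule prep_frame[OF P2 14(2)]) auto
        have I3: "inp \<tau>3" using prepD(1)[OF P3] .
        have t3: "\<forall>z<n. nmem \<tau>3 42 z \<noteq> 0 \<longrightarrow> tab (nmem \<tau>3 30) ta he (nmem \<tau>3 45) (nmem \<tau>3 46) z"
          using 14(1) f3 by simp
        have e3: "nmem \<tau>3 41 = nmem \<tau>2 41" "nmem \<tau>3 35 = nmem \<tau>2 35" using f3 by simp_all
        have th: "nmem \<tau>3 2 e = he e" "nmem \<tau>3 1 e = ta e" "he e < n \<and> ta e < n" if "e < m" for e
          using inpD[OF I3] he_less ta_less that by simp_all
        have z3: "nmem \<tau>3 47 = (\<lambda>_. 0)" using f3 f2 f1 z(1) by simp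
        show ?case
        proof (rule runs_Seq[OF runs_pair_table[OF P3 _ _ _ _ _ _ _ th fwd_level_ta z3],
              where ?k2.0 = "(n + 1) * 40 + card tails * ((m + 1) * ((m + 1) * 100) + npairs * (tproc (Suc (card heads)) + 40))"], goal_cases)
          case (14 \<tau>4)
          note f4 = frame_n[OF 14(2)]
          have P4: "prep \<tau>4" by (rule prep_frame[OF P3 14(2)]) auto
          have R4: "ready \<tau>4" unfolding ready_def using P4 t3 14(1) f4 by simp
          have e4: "nmem \<tau>4 41 = nmem \<tau>2 41" "nmem \<tau>4 35 = nmem \<tau>2 35" "nmem \<tau>4 3 0 = 0" using f4 e3 f3 f2 f1 z by simp_all
          show ?case
          proof (rule runs_conseq[OF runs_main_loop[OF R4 e4(3)]], goal_cases)
            case (1 \<tau>5)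
            show ?case by (rule covers_result[OF R4 1(1)])
          next
            case 2
            show ?case unfolding e4 hd r2 ..
          qed
        next
          case 15
          show ?case unfolding e3 hd by simp
        qed auto
      next
        case 15
        show ?case unfolding hd by simp
      qed auto
    next
      case 3
      show ?case unfolding tmain_def by simp
    qed (use f1 z in auto)
    then show ?case unfolding if_not_P[OF nf] .
  next
    case 2
    then have "\<forall>e<m. rmem \<tau>1 1 (ta e) + w e = rmem \<tau>1 1 (he e)" using pc by simp
    then have "\<not> nsp P k" for P k by (rule potential_no_nsp)
    moreover have "nmem \<tau>1 3 0 = 0" using f1 z by simp
    ultimately show ?case unfolding result_def by simp
  qed auto
qed (use z in auto)

end

section \<open>Layered graphs\<close>

context st_layered begin

definition sdist :: "'a \<Rightarrow> real" where "sdist v = real_of_ereal (\<mu> w s v)"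

lemma w_nonneg: "e \<in> arcs G \<Longrightarrow> 0 \<le> w e"
  using weight_pos[of e] by simp

lemma mu_finite: "v \<in> verts G \<Longrightarrow> \<mu> w s v < \<infinity> \<and> \<mu> w v t < \<infinity>"
  using on_shortest_path[of v] dist_finite by auto

lemma shortest_walk:
  assumes "\<mu> w u v < \<infinity>"
  shows "\<exists>p. apath u p v \<and> \<mu> w u v = ereal (awalk_cost w p)"
  using min_cost_awalk[of u v w] \<mu>_reach_conv assms w_nonneg by blast

lemma mu_dist: "v \<in> verts G \<Longrightarrow> \<mu> w s v = ereal (sdist v)"
  using shortest_walk[of s v] mu_finite[of v] unfolding sdist_def by auto

lemma dist_s: "sdist s = 0"
proof -
  have "\<mu> w s s \<le> 0" using min_cost_le_walk_cost[of s "[]" s w] s_in_verts by (simp add: awalk_Nil_iff zero_ereal_def)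
  moreover obtain p where p: "apath s p s" "\<mu> w s s = ereal (awalk_cost w p)"
    using shortest_walk[of s s] mu_finite[OF s_in_verts] by blast
  moreover have "0 \<le> awalk_cost w p" using pos_cost_pos_awalk_cost p(1) w_nonneg by (auto simp: apath_def)
  ultimately show ?thesis by (simp add: sdist_def)
qed

lemma dist_arc: "e \<in> arcs G \<Longrightarrow> sdist (head G e) \<le> sdist (tail G e) + w e"
  using pos_cost_mu_triangle[of w e "tail G e" "head G e" s] w_nonneg mu_dist by (simp add: arc_to_ends_def)

lemma dist_walk: "awalk u p v \<Longrightarrow> sdist v \<le> sdist u + awalk_cost w p"
proof (induction p arbitrary: u)
  case (Cons e p)
  then have "e \<in> arcs G" "u = tail G e" "awalk (head G e) p v" by (auto simp: awalk_Cons_iff)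
  then show ?case using Cons.IH[of "head G e"] dist_arc[of e] by simp
qed (simp add: awalk_Nil_iff)

text \<open>No arc raises the distance by more than its weight, so equality for the walk forces
  equality for each arc, and positive weights then make each arc ascend.\<close>

lemma tight_walk:
  "awalk u p v \<Longrightarrow> sdist u + awalk_cost w p = sdist v \<Longrightarrow>
   (u, v) \<in> {(tail G e, head G e) | e. e \<in> arcs G \<and> sdist (tail G e) < sdist (head G e)}\<^sup>*"
proof (induction p arbitrary: u)
  case (Cons e p)
  then have e: "e \<in> arcs G" "u = tail G e" "awalk (head G e) p v" by (auto simp: awalk_Cons_iff)
  have eq: "sdist (head G e) = sdist u + w e" "sdist (head G e) + awalk_cost w p = sdist v"
    using Cons.prems(2) dist_arc[OF e(1)] dist_walk[OF e(3)] e(2) by auto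
  have "(u, head G e) \<in> {(tail G e, head G e) | e. e \<in> arcs G \<and> sdist (tail G e) < sdist (head G e)}"
    using e(1,2) eq(1) weight_pos[OF e(1)] by auto
  then show ?case using Cons.IH[OF e(3) eq(2)] by (rule converse_rtrancl_into_rtrancl)
qed (simp add: awalk_Nil_iff)

lemma dist_from_s:
  assumes "v \<in> verts G"
  shows "(s, v) \<in> {(tail G e, head G e) | e. e \<in> arcs G \<and> sdist (tail G e) < sdist (head G e)}\<^sup>*"
proof -
  obtain p where p: "apath s p v" "\<mu> w s v = ereal (awalk_cost w p)" using shortest_walk mu_finite assms by blast
  then show ?thesis using tight_walk[of s p v] dist_s mu_dist[OF assms] by (simp add: apath_def)
qed

text \<open>Every vertex lies on a shortest path to \<open>t\<close>, so a shortest walk from it to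
  \<open>t\<close> uses up exactly the remaining distance.\<close>

lemma dist_to_t:
  assumes "v \<in> verts G"
  shows "(v, t) \<in> {(tail G e, head G e) | e. e \<in> arcs G \<and> sdist (tail G e) < sdist (head G e)}\<^sup>*"
proof -
  obtain p where p: "apath v p t" "\<mu> w v t = ereal (awalk_cost w p)" using shortest_walk mu_finite assms by blast
  then show ?thesis
    using tight_walk[of v p t] mu_dist[OF assms] mu_dist[OF t_in_verts] on_shortest_path[OF assms] by (simp add: apath_def)
qed

lemma dist_between:
  assumes "e \<in> arcs G" "sdist (tail G e) < sdist (head G e)" "x \<in> verts G"
  shows "sdist x \<le> sdist (tail G e) \<or> sdist (tail G e) + w e \<le> sdist x"
  using no_vertex_between[of e x] assms by (simp add: mu_dist)

lemma dist_tight: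
  assumes "e \<in> arcs G" "sdist (tail G e) < sdist (head G e)"
  shows "sdist (head G e) = sdist (tail G e) + w e"
  using dist_between[OF assms, of "head G e"] dist_arc[OF assms(1)] assms by auto

end

lemma layered_arcs_sdist:
  assumes "st_layered G w s t" "numbered G"
  shows "layered_arcs (card (verts G)) (card (arcs G)) (tail G) (head G) w s t (st_layered.sdist G w s)"
proof -
  interpret st_layered G w s t by fact
  have V: "v < card (verts G) \<longleftrightarrow> v \<in> verts G" for v using assms(2) unfolding numbered_def by blast
  have A: "e < card (arcs G) \<longleftrightarrow> e \<in> arcs G" for e using assms(2) unfolding numbered_def by blast
  show ?thesis
  proof (unfold_locales, unfold V A)
    show "sdist (tail G e) \<noteq> sdist (head G e)" if "e \<in> arcs G" for e
      using dist_ends_neq[OF that] that by (simp add: mu_dist)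
    show "sdist x \<le> sdist (tail G e) \<or> sdist (head G e) \<le> sdist x"
      if "e \<in> arcs G" "sdist (tail G e) < sdist (head G e)" "x \<in> verts G" for e x
      using dist_between[OF that] dist_tight[OF that(1,2)] by simp
  qed (use weight_pos s_in_verts t_in_verts dist_tight dist_from_s dist_to_t in auto)
qed

section \<open>Translation to arc lists and counting bounds\<close>

context layered_arcs begin

lemma chain_WP:
  "chain a l b \<Longrightarrow> distinct (a # map he l) \<Longrightarrow> a < n \<Longrightarrow> WP a (set (a # map he l)) b (sum_list (map exc l))"
proof (induction l arbitrary: a)
  case (Cons e l)
  then have e: "e < m" "ta e = a" "chain (he e) l b" "distinct (he e # map he l)" "a \<notin> set (he e # map he l)" by auto
  have "WP (he e) (set (he e # map he l)) b (sum_list (map exc l))" using Cons.IH[OF e(3,4)] he_less e by blast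
  then show ?case using WP_step[OF e(1), of _ b] e by fastforce
qed (auto intro: WP_refl)

lemma chain_exc: "chain a l b \<Longrightarrow> sum_list (map exc l) = sum_list (map w l) + d a - d b"
  by (induction l arbitrary: a) (auto simp: exc_def)

lemma fwd_into: "v < n \<Longrightarrow> v \<noteq> s \<Longrightarrow> \<exists>e. fwd e \<and> he e = v"
  using ex_FP_s[of v] FP_pred FP_V by blast

text \<open>Each vertex other than \<open>s\<close> is entered by a forward arc.\<close>

lemma card_fwd_ge: "n - 1 \<le> card {e. fwd e}"
proof -
  have fin: "finite {e. fwd e}" by (rule finite_subset[of _ "{..<m}"]) (auto simp: fwd_def)
  have "{..<n} - {s} \<subseteq> he ` {e. fwd e}" using fwd_into by blast
  then have "card ({..<n} - {s}) \<le> card (he ` {e. fwd e})" using fin by (intro card_mono) auto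
  also have "\<dots> \<le> card {e. fwd e}" using fin by (rule card_image_le)
  finally show ?thesis using s_less by simp
qed

text \<open>The diagonal pairs already account for all forward arcs.\<close>

lemma card_fwd_le: "card {e. fwd e} \<le> npairs"
proof -
  have "card ((\<lambda>e. (e, e)) ` {e. fwd e}) \<le> npairs"
    unfolding npairs_def by (rule card_mono[OF finite_fwd]) auto
  then show ?thesis by (simp add: card_image inj_on_def)
qed

text \<open>Since there are no parallel arcs, there are at most \<open>V (V - 1) \<le> V E\<close> back arcs.\<close>

lemma size_bounds:
  assumes inj: "\<And>e f. e < m \<Longrightarrow> f < m \<Longrightarrow> ta e = ta f \<Longrightarrow> he e = he f \<Longrightarrow> e = f" and ex_back: "\<exists>e<m. \<not> fwd e"
    and V: "card (heads \<union> tails) = V"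
  shows "2 \<le> V" "1 \<le> npairs" "n \<le> m" "m \<le> 2 * (V * npairs)"
proof -
  let ?F = "{e. fwd e}" and ?B = "{e. e < m \<and> \<not> fwd e}"
  have fin: "finite (heads \<union> tails)" unfolding heads_def tails_def by simp
  have sub: "heads \<union> tails \<subseteq> {..<n}" unfolding heads_def tails_def by auto
  obtain eb where eb: "eb < m" "\<not> fwd eb" using ex_back by blast
  have "{ta eb, he eb} \<subseteq> heads \<union> tails" using eb ta_less he_less unfolding heads_def tails_def by blast
  moreover have "ta eb \<noteq> he eb" using d_neq[OF eb(1)] by auto
  ultimately show V2: "2 \<le> V" using card_mono[OF fin, of "{ta eb, he eb}"] V by simp
  have Vn: "V \<le> n" using card_mono[OF _ sub] V by simp
  have nE: "n - 1 \<le> npairs" using card_fwd_ge card_fwd_le by linarith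
  then show E1: "1 \<le> npairs" using V2 Vn by linarith
  have "{..<m} = ?F \<union> ?B" by (auto simp: fwd_def)
  moreover have "?F \<inter> ?B = {}" by blast
  moreover have "finite ?F" "finite ?B" by (rule finite_subset[of _ "{..<m}"], auto simp: fwd_def)+
  ultimately have m: "m = card ?F + card ?B" using card_Un_disjoint[of ?F ?B] by (metis card_lessThan)
  \<comment> \<open>At least \<open>n - 1\<close> forward arcs and one back arc give
    \<open>n\<close> arcs.\<close>
  have "card ?B \<noteq> 0" using eb by auto
  then show "n \<le> m" using m card_fwd_ge by linarith
  let ?X = "heads \<union> tails"
  let ?D = "?X \<times> ?X - (\<lambda>v. (v, v)) ` ?X"
  have "inj_on (\<lambda>e. (ta e, he e)) ?B" using inj by (auto simp: inj_on_def)
  then have "card ?B = card ((\<lambda>e. (ta e, he e)) ` ?B)" by (simp add: card_image)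
  also have "\<dots> \<le> card ?D"
  proof (rule card_mono)
    show "finite ?D" using fin by simp
    have "(ta e, he e) \<in> ?D" if "e < m" "\<not> fwd e" for e
      using that d_neq[of e] ta_less[of e] he_less[of e] unfolding heads_def tails_def by auto
    then show "(\<lambda>e. (ta e, he e)) ` ?B \<subseteq> ?D" by blast
  qed
  also have "\<dots> = V * V - V"
    using fin V by (subst card_Diff_subset) (auto simp: card_image inj_on_def card_cartesian_product)
  also have "\<dots> = V * (V - 1)" by (simp add: diff_mult_distrib2)
  \<comment> \<open>Here \<open>V - 1\<close> is at most \<open>n - 1\<close>, hence at most the
    number of forward arcs.\<close>
  also have "\<dots> \<le> V * npairs" using Vn nE by (intro mult_le_mono2) linarith
  finally have "card ?B \<le> V * npairs" .
  moreover have "card ?F \<le> V * npairs"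
  proof -
    have "1 * npairs \<le> V * npairs" using V2 by (intro mult_le_mono1) simp
    then show ?thesis using card_fwd_le by linarith
  qed
  ultimately show "m \<le> 2 * (V * npairs)" using m by linarith
qed

text \<open>\<open>Q\<close> is the claimed bound without the logarithmic term. The parts sum to
  21340 times \<open>Q\<close> at most, rounded up to 30000. For the quadratic parts one factor
  \<open>m\<close> is traded for \<open>2 * V * npairs\<close>; in the main loop the two factors
  \<open>V\<close> come from the choice of \<open>x\<close> and from the number of rounds.\<close>

lemma tmain_bound:
  assumes V: "card heads \<le> V" "card tails \<le> V" and b: "2 \<le> V" "1 \<le> npairs" "n \<le> m" "m \<le> 2 * (V * npairs)"
  shows "(n + m + 2) * 240 + 10 + tmain \<le> 30000 * (V * V * npairs * m)"
proof -
  define E Q where "E = npairs" and "Q = V * V * E * m"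
  have m1: "1 \<le> m" using s_less b(3) by linarith
  have one: "1 \<le> V * E" "1 \<le> V * V * E" using b by (simp_all add: E_def)
  have mQ: "m \<le> Q" using mult_le_mono1[OF one(2), of m] by (simp add: Q_def)
  have "V * (m * m) \<le> V * (m * (2 * (V * E)))" using b(4) unfolding E_def by (intro mult_le_mono order_refl)
  then have VmQ: "V * (m * m) \<le> 2 * Q" by (simp add: Q_def algebra_simps)
  have "m * m \<le> V * (m * m)" using b(1) by simp
  then have mmQ: "m * m \<le> 2 * Q" using VmQ by linarith
  have sq: "(m + 1) * (m + 1) \<le> 4 * (m * m)"
  proof -
    have "(m + 1) * (m + 1) \<le> (2 * m) * (2 * m)" using m1 by (intro mult_le_mono) auto
    then show ?thesis by simp
  qed
  have sq': "(m + 1) * ((m + 1) * c) \<le> 4 * c * (m * m)" for c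
    using mult_le_mono2[OF sq, of c] by (simp only: mult_ac)
  have t1: "(m + 1) * ((n + m + 1) * 1000) \<le> 12000 * Q"
  proof -
    have "(m + 1) * ((n + m + 1) * 1000) \<le> (2 * m) * ((3 * m) * 1000)" using m1 b(3) by (intro mult_le_mono) auto
    then show ?thesis using mmQ by simp
  qed
  have inner: "(n + 1) * 60 + (m + 1) * ((m + 1) * 200) \<le> 1000 * (m * m)"
  proof -
    have "m \<le> m * m" using m1 by simp
    then have "n + 1 \<le> 2 * (m * m)" using b(3) m1 by linarith
    then have "(n + 1) * 60 \<le> 120 * (m * m)" by simp
    then show ?thesis using sq'[of 200] by linarith
  qed
  have t2: "c * ((n + 1) * 60 + (m + 1) * ((m + 1) * 200)) \<le> 2000 * Q" if "c \<le> V" for c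
  proof -
    have "c * ((n + 1) * 60 + (m + 1) * ((m + 1) * 200)) \<le> V * (1000 * (m * m))" using that inner by (rule mult_le_mono)
    then show ?thesis using VmQ by simp
  qed
  have t3: "card tails * ((m + 1) * ((m + 1) * 100)) \<le> 800 * Q"
  proof -
    have "card tails * ((m + 1) * ((m + 1) * 100)) \<le> V * (400 * (m * m))" using mult_le_mono[OF V(2) sq'[of 100]] by simp
    then show ?thesis using VmQ by simp
  qed
  have tp: "tproc (Suc (card heads)) + 40 \<le> 3300 * (V * m)"
  proof -
    define Y where "Y = (Suc (card heads) + 1) * ((m + 1) * 400)"
    have "Y \<le> (2 * V) * ((2 * m) * 400)" unfolding Y_def using V(1) b(1) m1 by (intro mult_le_mono) auto
    then have "Y \<le> 1600 * (V * m)" by simp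
    moreover have "m \<le> V * m" using b(1) by simp
    moreover have "(n + 1) * 800 \<le> 1600 * m" using b(3) m1 by simp
    ultimately show ?thesis using m1 unfolding tproc_def Y_def[symmetric] by linarith
  qed
  have t4: "card tails * (npairs * (tproc (Suc (card heads)) + 40)) \<le> 3300 * Q"
  proof -
    have "card tails * (npairs * (tproc (Suc (card heads)) + 40)) \<le> V * (E * (3300 * (V * m)))"
      using V(2) tp unfolding E_def by (intro mult_le_mono order_refl)
    then show ?thesis by (simp add: Q_def algebra_simps)
  qed
  have "(n + m + 2) * 240 + 10 \<le> 1000 * Q" using b(3) m1 mQ by simp
  moreover have "(n + 1) * 40 \<le> 80 * Q" using b(3) m1 mQ by simp
  ultimately show ?thesis using t1 t2[OF V(1)] t2[OF V(2)] t3 t4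
    unfolding tmain_def Q_def[unfolded E_def, symmetric] add_mult_distrib2 by linarith
qed

end

theorem theorem5p4:
  shows "\<exists>(prog :: com) (C :: real).
    \<forall>(G :: (nat, nat) pre_digraph) (w :: nat weight_fun) (s :: nat) (t :: nat).
      st_layered G w s t \<and> numbered G \<longrightarrow>
      (\<exists>k \<sigma>. exec prog (input_state G w s t) k \<sigma> \<and>
             correct_output G w s t (ram_output \<sigma>) \<and>
             real k \<le> C * time_bound G w s)"
proof (intro exI[of _ nsp_prog] exI[of _ "30000 :: real"] allI impI)
  fix G :: "(nat, nat) pre_digraph" and w s t assume "st_layered G w s t \<and> numbered G"
  then interpret S: st_layered G w s t by blast
  interpret L: layered_arcs "card (verts G)" "card (arcs G)" "tail G" "head G" w s t "S.sdist"
    using layered_arcs_sdist \<open>st_layered G w s t \<and> numbered G\<close> by blast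
  have num: "numbered G" using \<open>st_layered G w s t \<and> numbered G\<close> by blast
  have V: "v < card (verts G) \<longleftrightarrow> v \<in> verts G" for v using num unfolding numbered_def by blast
  have A: "e < card (arcs G) \<longleftrightarrow> e \<in> arcs G" for e using num unfolding numbered_def by blast
  let ?\<sigma> = "input_state G w s t"
  have inp: "L.inp ?\<sigma>" unfolding L.inp_def input_state_def by simp
  have z: "nmem ?\<sigma> a = (\<lambda>_. 0)" if "3 \<le> a" for a using that unfolding input_state_def by simp
  have rz: "rmem ?\<sigma> a = (\<lambda>_. 0)" if "1 \<le> a" for a using that unfolding input_state_def by simp
  obtain k \<tau> where ex: "exec nsp_prog ?\<sigma> k \<tau>" "L.result \<tau>"
    and k: "k \<le> (card (verts G) + card (arcs G) + 2) * 240 + 10 + (if \<forall>e<card (arcs G). L.fwd e then 0 else L.tmain)"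
    using L.runs_nsp_prog[OF inp z rz S.dist_s] unfolding runs_def by blast
  have ch: "L.chain a p b \<longleftrightarrow> S.awalk a p b" if "a \<in> verts G" for a p b
    using that
  proof (induction p arbitrary: a)
    case (Cons e p)
    then show ?case using A S.wellformed by (auto simp: S.awalk_Cons_iff)
  qed (auto simp: S.awalk_Nil_iff)
  have vs: "S.awalk_verts a p = a # map (head G) p" if "S.awalk a p b" for a p b
    using S.awalk_verts_conv'[of a p b] that by (cases p) (auto simp: S.awalk_def)
  have ap: "S.apath s p t \<longleftrightarrow> L.chain s p t \<and> distinct (s # map (head G) p)" for p
    unfolding S.apath_def using ch[OF S.s_in_verts] vs by auto
  \<comment> \<open>Since \<open>s\<close> has distance 0, excess is weight minus a constant, so
    positive excess means not shortest and the two orders agree.\<close>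
  have cost: "sum_list (map L.exc p) = S.awalk_cost w p - S.sdist t" if "L.chain s p t" for p
    using L.chain_exc[OF that] S.dist_s by (simp add: S.awalk_cost_def)
  have ns: "S.not_shortest w s t p \<longleftrightarrow> L.chain s p t \<and> distinct (s # map (head G) p) \<and> 0 < sum_list (map L.exc p)" for p
    unfolding S.not_shortest_def ap S.mu_dist[OF S.t_in_verts] using cost by auto
  have nsp: "L.nsp (set (s # map (head G) p)) (S.awalk_cost w p - S.sdist t)" if "S.not_shortest w s t p" for p
    using that ns[of p] L.chain_WP[of s p t] cost[of p] L.s_less unfolding L.nsp_def by auto
  have "correct_output G w s t (ram_output \<tau>)"
  proof (cases "nmem \<tau> 3 0 = 0")
    case True
    then have "\<not> S.not_shortest w s t p" for p using ex(2) nsp[of p] unfolding L.result_def by auto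
    then show ?thesis using True unfolding correct_output_def ram_output_def S.next_to_shortest_def by simp
  next
    case False
    let ?p = "map (nmem \<tau> 4) [0..<nmem \<tau> 3 1]"
    obtain c where c: "L.spath ?p c" "0 < c" "\<And>P k'. L.nsp P k' \<Longrightarrow> c \<le> k'"
      using ex(2) False unfolding L.result_def by auto
    have cp: "c = S.awalk_cost w ?p - S.sdist t" using c(1) cost[of ?p] unfolding L.spath_def by simp
    have "S.not_shortest w s t ?p" using c(1,2) unfolding ns L.spath_def by blast
    moreover have "S.awalk_cost w ?p \<le> S.awalk_cost w q" if "S.not_shortest w s t q" for q
      using c(3)[OF nsp[OF that]] cp by simp
    ultimately show ?thesis using False unfolding correct_output_def ram_output_def S.next_to_shortest_def by simp
  qed
  moreover have "real k \<le> 30000 * time_bound G w s"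
  proof -
    \<comment> \<open>The definition of a back-edge says that the excess is positive, and this
      separates the two kinds of arcs.\<close>
    have bck: "S.back_edge w s e \<longleftrightarrow> e \<in> arcs G \<and> \<not> L.fwd e" for e
      using L.exc_back[of e] L.exc_fwd[of e] unfolding S.back_edge_def L.exc_def by (auto simp: S.mu_dist A)
    have forw: "S.forward_edge w s e \<longleftrightarrow> L.fwd e" for e
      using L.exc_back[of e] L.exc_fwd[of e] S.weight_pos[of e] unfolding S.forward_edge_def L.exc_def by (auto simp: S.mu_dist A L.fwd_def)
    have VB: "S.V_B w s = L.heads \<union> L.tails"
      unfolding S.V_B_def bck L.heads_def L.tails_def V A by blast
    have "S.E_FP w s = {(e, f). L.fwd e \<and> L.fwd f \<and> S.sdist (tail G e) = S.sdist (tail G f)}"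
      unfolding S.E_FP_def forw using S.mu_dist A by (auto simp: L.fwd_def)
    then have EF: "card (S.E_FP w s) = L.npairs" unfolding L.npairs_def by simp
    show ?thesis
    proof (cases "S.V_B w s = {}")
      case True
      then have "L.heads = {}" unfolding VB by simp
      then have "\<forall>e<card (arcs G). L.fwd e" using L.he_less unfolding L.heads_def by blast
      then have "k \<le> (card (verts G) + card (arcs G) + 2) * 240 + 10" using k by simp
      \<comment> \<open>The additive constants are absorbed because a graph containing
        \<open>s\<close> is not empty.\<close>
      moreover have "1 \<le> card (verts G)" using L.s_less by linarith
      ultimately have "k \<le> 30000 * (card (verts G) + card (arcs G))" by simp
      then have "real k \<le> real (30000 * (card (verts G) + card (arcs G)))" by (rule of_nat_mono)
      then show ?thesis using True unfolding time_bound_def Let_def by simp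
    next
      case False
      then have bk: "\<exists>e<card (arcs G). \<not> L.fwd e" unfolding VB L.heads_def L.tails_def by blast
      have inj: "e = f" if "e < card (arcs G)" "f < card (arcs G)" "tail G e = tail G f" "head G e = head G f" for e f
        using S.no_multi_arcs[of e f] that A by (simp add: arc_to_ends_def)
      define W where "W = card (L.heads \<union> L.tails)"
      note sz = L.size_bounds[OF inj bk W_def[symmetric]]
      have fin: "finite (L.heads \<union> L.tails)" unfolding L.heads_def L.tails_def by simp
      have "card L.heads \<le> W" "card L.tails \<le> W" unfolding W_def using fin by (auto intro: card_mono)
      note le = L.tmain_bound[OF this sz]
      have nf: "\<not> (\<forall>e<card (arcs G). L.fwd e)" using bk by blast
      have "k \<le> 30000 * (W * W * L.npairs * card (arcs G))" using order_trans[OF k[unfolded if_not_P[OF nf]] le] .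
      then have "real k \<le> real (30000 * (W * W * L.npairs * card (arcs G)))" by (rule of_nat_mono)
      also have "\<dots> = 30000 * (real W ^ 2 * real L.npairs * real (card (arcs G)))" by (simp add: power2_eq_square)
      \<comment> \<open>The logarithmic term is merely added; it is nonnegative because there is at
        least one vertex.\<close>
      also have "\<dots> \<le> 30000 * (real W ^ 2 * real L.npairs * (real (card (arcs G)) + real (card (verts G)) * log 2 (real (card (verts G)))))"
      proof -
        have "1 \<le> card (verts G)" using L.s_less by linarith
        then have "0 \<le> real (card (verts G)) * log 2 (real (card (verts G)))" by simp
        then show ?thesis by (intro mult_left_mono) auto
      qed
      also have "\<dots> = 30000 * time_bound G w s"
      proof -
        have "time_bound G w s = real (card (S.V_B w s)) ^ 2 * real (card (S.E_FP w s)) *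
          (real (card (arcs G)) + real (card (verts G)) * log 2 (real (card (verts G))))"
          using False unfolding time_bound_def Let_def by simp
        then show ?thesis unfolding EF VB W_def by simp
      qed
      finally show ?thesis .
    qed
  qed
  ultimately show "\<exists>k \<sigma>. exec nsp_prog ?\<sigma> k \<sigma> \<and> correct_output G w s t (ram_output \<sigma>) \<and> real k \<le> 30000 * time_bound G w s"
    using ex(1) by blast
qed

end
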